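(* Let $\mathscr{Q}_c=\mathrm{Funct}(\mathbb{N},\mathrm{Sets})$, regarded as the category of presheaves of sets on $\mathbb{N}^{op}$, with the tensor product extending disjoint union on $\mathbb{N}^{op}$ cocontinuously in each variable. Let $X_c=h_{\mathbf{1}}=\mathrm{Hom}_{\mathbb{N}}(\mathbf{1},-)$, with comultiplication $\Delta_c=u^*:h_{\mathbf{1}}\to h_{\mathbf{2}}=X_c\otimes X_c$ and counit $\eta_c=v^*:h_{\mathbf{1}}\to h_{\mathbf{0}}$ (the unit object), where $u:\mathbf{2}\to\mathbf{1}$ and $v:\mathbf{0}\to\mathbf{1}$ are the unique maps. Then $\mathscr{Q}_c$ is a vectoid, $X_c=(X_c,\Delta_c,\eta_c)$ is a cocommutative coalgebra in $\mathscr{Q}_c$, and $(\mathscr{Q}_c,X_c)$ is the cocommutative coalgebra classifier: for every vectoid $\mathscr{A}$ the functor $$f\mapsto f^*(X_c),$$ from $\mathrm{Hom}(\mathscr{A},\mathscr{Q}_c)$ to the category of cocommutative (coassociative, counital) coalgebras in $(\mathscr{A},\otimes)$, is an equivalence of categories.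
   Context: A (commutative $\otimes$-)vectoid is a category $\mathscr{A}$ with a symmetric monoidal structure $\otimes$ (associative, commutative, with unit) such that: (V1) all small colimits exist; (V2) $\otimes$ preserves small colimits in each argument; (V3) finite limits exist; (V4) epimorphisms are universally effective (they and all their pullbacks are cokernels of their kernel pairs) and every equivalence relation $R\subset X\times X$ is effective, i.e. $R=X\times_{X/R}X$; (V5) there is a small system of generators; (V6) every presheaf of sets $F:\mathscr{A}^{op}\to\mathrm{Sets}$ that transforms small colimits of $\mathscr{A}$ into limits of sets is representable. A morphism of vectoids $f:\mathscr{A}\to\mathscr{B}$ is an adjoint pair $(f^*,f_* )$, $f^*:\mathscr{B}\to\mathscr{A}$ left adjoint to $f_*:\mathscr{A}\to\mathscr{B}$, with $f^*$ a $\otimes$-functor (strong symmetric monoidal); $f^*$ therefore carries coalgebras to coalgebras. The morphisms $\mathscr{A}\to\mathscr{B}$ form a category $\mathrm{Hom}(\mathscr{A},\mathscr{B})$, where a morphism $f\to g$ is a natural transformation of $\otimes$-functors (i.e. a monoidal natural transformation) $f^*\to g^*$. $\mathbb{N}$ is the category with objects the finite sets $\mathbf{n}=\{1,\dots,n\}$, $n\ge0$, and all maps of sets as morphisms. Disjoint union ($\mathbf{n}\sqcup\mathbf{m}\cong\mathbf{n+m}$) makes $\mathbb{N}$, hence $\mathbb{N}^{op}$, a symmetric monoidal category. For a map $\varphi:\mathbf{m}\to\mathbf{n}$, $\varphi^*:h_{\mathbf{n}}\to h_{\mathbf{m}}$ denotes the induced morphism of functors $h_{\mathbf{n}}=\mathrm{Hom}_{\mathbb{N}}(\mathbf{n},-)$.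 *)

theory Defs
  imports Main "HOL-Library.FuncSet"
begin

unbundle cardinal_syntax

section \<open>Universe and smallness\<close>

text \<open>
  The type \<open>'u\<close> plays the role of a universe: a set (of any type) is small if its cardinality is
  strictly below that of \<open>'u\<close>.  The predicate \<open>universe\<close> says that this cardinality is
  strongly inaccessible (uncountable, strong limit, regular), so that the small subsets of \<open>'u\<close>
  represent all small sets up to bijection.
\<close>

definition small :: "'u itself \<Rightarrow> 'b set \<Rightarrow> bool" where
  "small U S \<longleftrightarrow> |S| <o |UNIV :: 'u set|"

definition universe :: "'u itself \<Rightarrow> bool" where
  "universe U \<longleftrightarrow>
     small U (UNIV :: nat set) \<and>
     (\<forall>S :: 'u set. small U S \<longrightarrow> small U (Pow S)) \<and>
     (\<forall>(S :: 'u set) (f :: 'u \<Rightarrow> 'u set).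
        small U S \<and> (\<forall>x\<in>S. small U (f x)) \<longrightarrow> small U (\<Union>x\<in>S. f x))"

section \<open>Categories, functors, natural transformations\<close>

text \<open>\<open>Comp C g f\<close> is the composite ``\<open>g\<close> after \<open>f\<close>''.\<close>

record ('o, 'a) cat =
  Obj :: "'o set"
  Arr :: "'a set"
  Dom :: "'a \<Rightarrow> 'o"
  Cod :: "'a \<Rightarrow> 'o"
  Id :: "'o \<Rightarrow> 'a"
  Comp :: "'a \<Rightarrow> 'a \<Rightarrow> 'a"

definition Hom :: "('o, 'a) cat \<Rightarrow> 'o \<Rightarrow> 'o \<Rightarrow> 'a set" where
  "Hom C X Y = {f \<in> Arr C. Dom C f = X \<and> Cod C f = Y}"

locale category =
  fixes C :: "('o, 'a) cat"
  assumes dom_obj: "f \<in> Arr C \<Longrightarrow> Dom C f \<in> Obj C"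
    and cod_obj: "f \<in> Arr C \<Longrightarrow> Cod C f \<in> Obj C"
    and id_hom: "X \<in> Obj C \<Longrightarrow> Id C X \<in> Hom C X X"
    and comp_hom: "f \<in> Hom C X Y \<Longrightarrow> g \<in> Hom C Y Z \<Longrightarrow> Comp C g f \<in> Hom C X Z"
    and comp_id_right: "f \<in> Hom C X Y \<Longrightarrow> Comp C f (Id C X) = f"
    and comp_id_left: "f \<in> Hom C X Y \<Longrightarrow> Comp C (Id C Y) f = f"
    and comp_assoc: "f \<in> Hom C W X \<Longrightarrow> g \<in> Hom C X Y \<Longrightarrow> h \<in> Hom C Y Z \<Longrightarrow>
      Comp C h (Comp C g f) = Comp C (Comp C h g) f"

definition op :: "('o, 'a) cat \<Rightarrow> ('o, 'a) cat" where
  "op C = C\<lparr>Dom := Cod C, Cod := Dom C, Comp := (\<lambda>g f. Comp C f g)\<rparr>"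

definition inverse_arrows :: "('o, 'a) cat \<Rightarrow> 'a \<Rightarrow> 'a \<Rightarrow> bool" where
  "inverse_arrows C f g \<longleftrightarrow> f \<in> Arr C \<and> g \<in> Hom C (Cod C f) (Dom C f) \<and>
     Comp C g f = Id C (Dom C f) \<and> Comp C f g = Id C (Cod C f)"

definition iso_arr :: "('o, 'a) cat \<Rightarrow> 'a \<Rightarrow> bool" where
  "iso_arr C f \<longleftrightarrow> (\<exists>g. inverse_arrows C f g)"

definition inv_arr :: "('o, 'a) cat \<Rightarrow> 'a \<Rightarrow> 'a" where
  "inv_arr C f = (THE g. inverse_arrows C f g)"

text \<open>
  Functors and natural transformations are extensional functions on objects and arrows, so that
  HOL equality is equality of functors and of natural transformations.  The data of a functor
  \<open>C \<Rightarrow> D\<close> is literally the data of a functor \<open>op C \<Rightarrow> op D\<close>.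
\<close>

record ('o, 'a, 'p, 'b) cfun =
  FO :: "'o \<Rightarrow> 'p"
  FA :: "'a \<Rightarrow> 'b"

locale cfunctor = S: category C + T: category D
  for C :: "('o, 'a) cat" and D :: "('p, 'b) cat" +
  fixes F :: "('o, 'a, 'p, 'b) cfun"
  assumes FO_ext: "FO F \<in> extensional (Obj C)"
    and FA_ext: "FA F \<in> extensional (Arr C)"
    and FO_obj: "X \<in> Obj C \<Longrightarrow> FO F X \<in> Obj D"
    and FA_hom: "f \<in> Hom C X Y \<Longrightarrow> FA F f \<in> Hom D (FO F X) (FO F Y)"
    and FA_id: "X \<in> Obj C \<Longrightarrow> FA F (Id C X) = Id D (FO F X)"
    and FA_comp: "f \<in> Hom C X Y \<Longrightarrow> g \<in> Hom C Y Z \<Longrightarrow>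
      FA F (Comp C g f) = Comp D (FA F g) (FA F f)"

definition idf :: "('o, 'a) cat \<Rightarrow> ('o, 'a, 'o, 'a) cfun" where
  "idf C = \<lparr>FO = (\<lambda>X\<in>Obj C. X), FA = (\<lambda>f\<in>Arr C. f)\<rparr>"

text \<open>\<open>compf C F G\<close> is ``\<open>G\<close> after \<open>F\<close>'' for a functor \<open>F\<close> with source \<open>C\<close>.\<close>

definition compf ::
  "('o, 'a) cat \<Rightarrow> ('o, 'a, 'p, 'b) cfun \<Rightarrow> ('p, 'b, 'q, 'c) cfun \<Rightarrow> ('o, 'a, 'q, 'c) cfun" where
  "compf C F G = \<lparr>FO = (\<lambda>X\<in>Obj C. FO G (FO F X)), FA = (\<lambda>f\<in>Arr C. FA G (FA F f))\<rparr>"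

locale nat_trans = F: cfunctor C D F + G: cfunctor C D G
  for C :: "('o, 'a) cat" and D :: "('p, 'b) cat" and F and G +
  fixes \<alpha> :: "'o \<Rightarrow> 'b"
  assumes ext: "\<alpha> \<in> extensional (Obj C)"
    and hom: "X \<in> Obj C \<Longrightarrow> \<alpha> X \<in> Hom D (FO F X) (FO G X)"
    and natural: "f \<in> Hom C X Y \<Longrightarrow> Comp D (\<alpha> Y) (FA F f) = Comp D (FA G f) (\<alpha> X)"

definition nat_iso where
  "nat_iso C D F G \<alpha> \<longleftrightarrow> nat_trans C D F G \<alpha> \<and> (\<forall>X\<in>Obj C. iso_arr D (\<alpha> X))"

definition is_equivalence ::
  "('o, 'a) cat \<Rightarrow> ('p, 'b) cat \<Rightarrow> ('o, 'a, 'p, 'b) cfun \<Rightarrow> bool" where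
  "is_equivalence C D F \<longleftrightarrow> cfunctor C D F \<and>
     (\<exists>G. cfunctor D C G \<and>
        (\<exists>\<alpha>. nat_iso C C (idf C) (compf C F G) \<alpha>) \<and>
        (\<exists>\<beta>. nat_iso D D (compf D G F) (idf D) \<beta>))"

definition Funct :: "('o, 'a) cat \<Rightarrow> ('p, 'b) cat \<Rightarrow>
  (('o, 'a, 'p, 'b) cfun,
   ('o, 'a, 'p, 'b) cfun \<times> ('o \<Rightarrow> 'b) \<times> ('o, 'a, 'p, 'b) cfun) cat" where
  "Funct C D =
    \<lparr>Obj = {F. cfunctor C D F},
     Arr = {(F, \<alpha>, G). nat_trans C D F G \<alpha>},
     Dom = (\<lambda>(F, \<alpha>, G). F),
     Cod = (\<lambda>(F, \<alpha>, G). G),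
     Id = (\<lambda>F. (F, (\<lambda>X\<in>Obj C. Id D (FO F X)), F)),
     Comp = (\<lambda>(G, \<beta>, H) (F, \<alpha>, G'). (F, (\<lambda>X\<in>Obj C. Comp D (\<beta> X) (\<alpha> X)), H))\<rparr>"

text \<open>The category of small sets; an arrow is a triple (source, function, target).\<close>

definition SET :: "('u set, 'u set \<times> ('u \<Rightarrow> 'u) \<times> 'u set) cat" where
  "SET =
    \<lparr>Obj = {S. small TYPE('u) S},
     Arr = {(S, f, T). small TYPE('u) S \<and> small TYPE('u) T \<and> f \<in> S \<rightarrow>\<^sub>E T},
     Dom = (\<lambda>(S, f, T). S),
     Cod = (\<lambda>(S, f, T). T),
     Id = (\<lambda>S. (S, (\<lambda>x\<in>S. x), S)),
     Comp = (\<lambda>(T, g, U) (S, f, T'). (S, (\<lambda>x\<in>S. g (f x)), U))\<rparr>"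

definition set_app :: "'u set \<times> ('u \<Rightarrow> 'u) \<times> 'u set \<Rightarrow> 'u \<Rightarrow> 'u" where
  "set_app f = fst (snd f)"

section \<open>Limits and colimits\<close>

definition is_cocone ::
  "('i, 'j) cat \<Rightarrow> ('o, 'a) cat \<Rightarrow> ('i, 'j, 'o, 'a) cfun \<Rightarrow> 'o \<Rightarrow> ('i \<Rightarrow> 'a) \<Rightarrow> bool" where
  "is_cocone J C D L \<iota> \<longleftrightarrow> L \<in> Obj C \<and>
     (\<forall>j\<in>Obj J. \<iota> j \<in> Hom C (FO D j) L) \<and>
     (\<forall>f\<in>Arr J. Comp C (\<iota> (Cod J f)) (FA D f) = \<iota> (Dom J f))"

definition is_colimit ::
  "('i, 'j) cat \<Rightarrow> ('o, 'a) cat \<Rightarrow> ('i, 'j, 'o, 'a) cfun \<Rightarrow> 'o \<Rightarrow> ('i \<Rightarrow> 'a) \<Rightarrow> bool" where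
  "is_colimit J C D L \<iota> \<longleftrightarrow> is_cocone J C D L \<iota> \<and>
     (\<forall>L' \<iota>'. is_cocone J C D L' \<iota>' \<longrightarrow>
        (\<exists>!h. h \<in> Hom C L L' \<and> (\<forall>j\<in>Obj J. Comp C h (\<iota> j) = \<iota>' j)))"

definition is_limit ::
  "('i, 'j) cat \<Rightarrow> ('o, 'a) cat \<Rightarrow> ('i, 'j, 'o, 'a) cfun \<Rightarrow> 'o \<Rightarrow> ('i \<Rightarrow> 'a) \<Rightarrow> bool" where
  "is_limit J C D L \<pi> \<longleftrightarrow> is_colimit (op J) (op C) D L \<pi>"

text \<open>
  Every small category is isomorphic to one whose objects and arrows are elements of \<open>'u\<close>, and
  every finite one to one whose objects and arrows are natural numbers; hence the index types.
\<close>

definition small_category :: "('u, 'u) cat \<Rightarrow> bool" where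
  "small_category J \<longleftrightarrow> category J \<and> small TYPE('u) (Obj J) \<and> small TYPE('u) (Arr J)"

definition has_small_colimits :: "'u itself \<Rightarrow> ('o, 'a) cat \<Rightarrow> bool" where
  "has_small_colimits U C \<longleftrightarrow>
     (\<forall>(J :: ('u, 'u) cat) D. small_category J \<and> cfunctor J C D \<longrightarrow>
        (\<exists>L \<iota>. is_colimit J C D L \<iota>))"

definition has_finite_limits :: "('o, 'a) cat \<Rightarrow> bool" where
  "has_finite_limits C \<longleftrightarrow>
     (\<forall>(J :: (nat, nat) cat) D. category J \<and> finite (Obj J) \<and> finite (Arr J) \<and> cfunctor J C D \<longrightarrow>
        (\<exists>L \<pi>. is_limit J C D L \<pi>))"

definition preserves_small_colimits ::
  "'u itself \<Rightarrow> ('o, 'a) cat \<Rightarrow> ('p, 'b) cat \<Rightarrow> ('o, 'a, 'p, 'b) cfun \<Rightarrow> bool" where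
  "preserves_small_colimits U C D F \<longleftrightarrow>
     (\<forall>(J :: ('u, 'u) cat) G L \<iota>.
        small_category J \<and> cfunctor J C G \<and> is_colimit J C G L \<iota> \<longrightarrow>
        is_colimit J D (compf J G F) (FO F L) (\<lambda>j. FA F (\<iota> j)))"

section \<open>Epimorphisms, equivalence relations, generators, representability\<close>

definition is_epi :: "('o, 'a) cat \<Rightarrow> 'a \<Rightarrow> bool" where
  "is_epi C e \<longleftrightarrow> e \<in> Arr C \<and>
     (\<forall>Z. \<forall>g\<in>Hom C (Cod C e) Z. \<forall>h\<in>Hom C (Cod C e) Z. Comp C g e = Comp C h e \<longrightarrow> g = h)"

text \<open>\<open>is_pullback C f g p q\<close>: the square with \<open>f \<circ> p = g \<circ> q\<close> is cartesian.\<close>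

definition is_pullback :: "('o, 'a) cat \<Rightarrow> 'a \<Rightarrow> 'a \<Rightarrow> 'a \<Rightarrow> 'a \<Rightarrow> bool" where
  "is_pullback C f g p q \<longleftrightarrow>
     {f, g, p, q} \<subseteq> Arr C \<and> Cod C f = Cod C g \<and> Dom C p = Dom C q \<and>
     Cod C p = Dom C f \<and> Cod C q = Dom C g \<and> Comp C f p = Comp C g q \<and>
     (\<forall>Z. \<forall>a\<in>Hom C Z (Dom C f). \<forall>b\<in>Hom C Z (Dom C g). Comp C f a = Comp C g b \<longrightarrow>
        (\<exists>!h. h \<in> Hom C Z (Dom C p) \<and> Comp C p h = a \<and> Comp C q h = b))"

definition is_coequalizer :: "('o, 'a) cat \<Rightarrow> 'a \<Rightarrow> 'a \<Rightarrow> 'a \<Rightarrow> bool" where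
  "is_coequalizer C r s q \<longleftrightarrow>
     {r, s, q} \<subseteq> Arr C \<and> Dom C r = Dom C s \<and> Cod C r = Cod C s \<and> Dom C q = Cod C r \<and>
     Comp C q r = Comp C q s \<and>
     (\<forall>Z. \<forall>a\<in>Hom C (Dom C q) Z. Comp C a r = Comp C a s \<longrightarrow>
        (\<exists>!h. h \<in> Hom C (Cod C q) Z \<and> Comp C h q = a))"

definition effective_arr :: "('o, 'a) cat \<Rightarrow> 'a \<Rightarrow> bool" where
  "effective_arr C e \<longleftrightarrow> (\<exists>p q. is_pullback C e e p q \<and> is_coequalizer C p q e)"

definition epis_universally_effective :: "('o, 'a) cat \<Rightarrow> bool" where
  "epis_universally_effective C \<longleftrightarrow>
     (\<forall>e. is_epi C e \<longrightarrow> effective_arr C e \<and>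
        (\<forall>g p q. is_pullback C e g p q \<longrightarrow> effective_arr C q))"

text \<open>
  A relation \<open>R \<subseteq> X \<times> X\<close> is given by its two projections \<open>r, s : R \<rightarrow> X\<close>, which have to be
  jointly monic; it is an equivalence relation if it induces one on \<open>Z\<close>-valued points for all \<open>Z\<close>.
\<close>

definition equivalence_relation :: "('o, 'a) cat \<Rightarrow> 'a \<Rightarrow> 'a \<Rightarrow> bool" where
  "equivalence_relation C r s \<longleftrightarrow>
     {r, s} \<subseteq> Arr C \<and> Dom C r = Dom C s \<and> Cod C r = Cod C s \<and>
     (\<forall>Z\<in>Obj C.
        inj_on (\<lambda>t. (Comp C r t, Comp C s t)) (Hom C Z (Dom C r)) \<and>
        equiv (Hom C Z (Cod C r)) ((\<lambda>t. (Comp C r t, Comp C s t)) ` Hom C Z (Dom C r)))"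

definition equivalence_relations_effective :: "('o, 'a) cat \<Rightarrow> bool" where
  "equivalence_relations_effective C \<longleftrightarrow>
     (\<forall>r s. equivalence_relation C r s \<longrightarrow>
        (\<exists>q. is_coequalizer C r s q \<and> is_pullback C q q r s))"

definition has_small_generators :: "'u itself \<Rightarrow> ('o, 'a) cat \<Rightarrow> bool" where
  "has_small_generators U C \<longleftrightarrow>
     (\<exists>G \<subseteq> Obj C. small U G \<and>
        (\<forall>X Y. \<forall>f\<in>Hom C X Y. \<forall>g\<in>Hom C X Y. f \<noteq> g \<longrightarrow>
           (\<exists>Z\<in>G. \<exists>h\<in>Hom C Z X. Comp C f h \<noteq> Comp C g h)))"

definition locally_small :: "'u itself \<Rightarrow> ('o, 'a) cat \<Rightarrow> bool" where
  "locally_small U C \<longleftrightarrow> (\<forall>X\<in>Obj C. \<forall>Y\<in>Obj C. small U (Hom C X Y))"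

text \<open>
  The arrows of \<open>C\<close> need not be elements of \<open>'u\<close>, so a representation of a presheaf is given
  as a natural family of bijections rather than as an isomorphism in a category of presheaves.
\<close>

definition representable ::
  "('o, 'a) cat \<Rightarrow> ('o, 'a, 'u set, 'u set \<times> ('u \<Rightarrow> 'u) \<times> 'u set) cfun \<Rightarrow> bool" where
  "representable C F \<longleftrightarrow>
     (\<exists>X\<in>Obj C. \<exists>\<theta>.
        (\<forall>Y\<in>Obj C. bij_betw (\<theta> Y) (Hom C Y X) (FO F Y)) \<and>
        (\<forall>Y Z. \<forall>f\<in>Hom C Y Z. \<forall>x\<in>Hom C Z X.
           \<theta> Y (Comp C x f) = set_app (FA F f) (\<theta> Z x)))"

definition continuous_presheaves_representable :: "'u itself \<Rightarrow> ('o, 'a) cat \<Rightarrow> bool" where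
  "continuous_presheaves_representable U C \<longleftrightarrow>
     (\<forall>F. cfunctor (op C) (SET :: ('u set, _) cat) F \<and>
        (\<forall>(J :: ('u, 'u) cat) D L \<iota>.
           small_category J \<and> cfunctor J C D \<and> is_colimit J C D L \<iota> \<longrightarrow>
           is_limit (op J) SET (compf J D F) (FO F L) (\<lambda>j. FA F (\<iota> j))) \<longrightarrow>
        representable C F)"

section \<open>Symmetric monoidal categories and functors\<close>

text \<open>
  \<open>Assoc X Y Z : (X \<otimes> Y) \<otimes> Z \<rightarrow> X \<otimes> (Y \<otimes> Z)\<close>, \<open>LUnit X : I \<otimes> X \<rightarrow> X\<close>, \<open>RUnit X : X \<otimes> I \<rightarrow> X\<close>,
  \<open>Braid X Y : X \<otimes> Y \<rightarrow> Y \<otimes> X\<close>.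
\<close>

record ('o, 'a) tensor =
  TO :: "'o \<Rightarrow> 'o \<Rightarrow> 'o"
  TA :: "'a \<Rightarrow> 'a \<Rightarrow> 'a"
  TI :: "'o"
  Assoc :: "'o \<Rightarrow> 'o \<Rightarrow> 'o \<Rightarrow> 'a"
  LUnit :: "'o \<Rightarrow> 'a"
  RUnit :: "'o \<Rightarrow> 'a"
  Braid :: "'o \<Rightarrow> 'o \<Rightarrow> 'a"

locale sym_mon_cat = category C for C :: "('o, 'a) cat" +
  fixes T :: "('o, 'a) tensor"
  assumes TO_obj: "X \<in> Obj C \<Longrightarrow> Y \<in> Obj C \<Longrightarrow> TO T X Y \<in> Obj C"
    and TI_obj: "TI T \<in> Obj C"
    and TA_hom: "f \<in> Hom C X X' \<Longrightarrow> g \<in> Hom C Y Y' \<Longrightarrow> TA T f g \<in> Hom C (TO T X Y) (TO T X' Y')"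
    and TA_id: "X \<in> Obj C \<Longrightarrow> Y \<in> Obj C \<Longrightarrow> TA T (Id C X) (Id C Y) = Id C (TO T X Y)"
    and TA_comp: "f \<in> Hom C X X' \<Longrightarrow> f' \<in> Hom C X' X'' \<Longrightarrow> g \<in> Hom C Y Y' \<Longrightarrow> g' \<in> Hom C Y' Y'' \<Longrightarrow>
      TA T (Comp C f' f) (Comp C g' g) = Comp C (TA T f' g') (TA T f g)"
    and assoc_hom: "X \<in> Obj C \<Longrightarrow> Y \<in> Obj C \<Longrightarrow> Z \<in> Obj C \<Longrightarrow>
      Assoc T X Y Z \<in> Hom C (TO T (TO T X Y) Z) (TO T X (TO T Y Z))"
    and assoc_iso: "X \<in> Obj C \<Longrightarrow> Y \<in> Obj C \<Longrightarrow> Z \<in> Obj C \<Longrightarrow> iso_arr C (Assoc T X Y Z)"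
    and assoc_natural: "f \<in> Hom C X X' \<Longrightarrow> g \<in> Hom C Y Y' \<Longrightarrow> h \<in> Hom C Z Z' \<Longrightarrow>
      Comp C (Assoc T X' Y' Z') (TA T (TA T f g) h) = Comp C (TA T f (TA T g h)) (Assoc T X Y Z)"
    and lunit_hom: "X \<in> Obj C \<Longrightarrow> LUnit T X \<in> Hom C (TO T (TI T) X) X"
    and lunit_iso: "X \<in> Obj C \<Longrightarrow> iso_arr C (LUnit T X)"
    and lunit_natural: "f \<in> Hom C X Y \<Longrightarrow>
      Comp C (LUnit T Y) (TA T (Id C (TI T)) f) = Comp C f (LUnit T X)"
    and runit_hom: "X \<in> Obj C \<Longrightarrow> RUnit T X \<in> Hom C (TO T X (TI T)) X"
    and runit_iso: "X \<in> Obj C \<Longrightarrow> iso_arr C (RUnit T X)"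
    and runit_natural: "f \<in> Hom C X Y \<Longrightarrow>
      Comp C (RUnit T Y) (TA T f (Id C (TI T))) = Comp C f (RUnit T X)"
    and braid_hom: "X \<in> Obj C \<Longrightarrow> Y \<in> Obj C \<Longrightarrow> Braid T X Y \<in> Hom C (TO T X Y) (TO T Y X)"
    and braid_natural: "f \<in> Hom C X X' \<Longrightarrow> g \<in> Hom C Y Y' \<Longrightarrow>
      Comp C (Braid T X' Y') (TA T f g) = Comp C (TA T g f) (Braid T X Y)"
    and braid_sym: "X \<in> Obj C \<Longrightarrow> Y \<in> Obj C \<Longrightarrow>
      Comp C (Braid T Y X) (Braid T X Y) = Id C (TO T X Y)"
    and pentagon: "W \<in> Obj C \<Longrightarrow> X \<in> Obj C \<Longrightarrow> Y \<in> Obj C \<Longrightarrow> Z \<in> Obj C \<Longrightarrow>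
      Comp C (Assoc T W X (TO T Y Z)) (Assoc T (TO T W X) Y Z) =
      Comp C (TA T (Id C W) (Assoc T X Y Z))
        (Comp C (Assoc T W (TO T X Y) Z) (TA T (Assoc T W X Y) (Id C Z)))"
    and triangle: "X \<in> Obj C \<Longrightarrow> Y \<in> Obj C \<Longrightarrow>
      Comp C (TA T (Id C X) (LUnit T Y)) (Assoc T X (TI T) Y) = TA T (RUnit T X) (Id C Y)"
    and hexagon: "X \<in> Obj C \<Longrightarrow> Y \<in> Obj C \<Longrightarrow> Z \<in> Obj C \<Longrightarrow>
      Comp C (Assoc T Y Z X) (Comp C (Braid T X (TO T Y Z)) (Assoc T X Y Z)) =
      Comp C (TA T (Id C Y) (Braid T X Z))
        (Comp C (Assoc T Y X Z) (TA T (Braid T X Y) (Id C Z)))"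

definition op_tensor :: "('o, 'a) cat \<Rightarrow> ('o, 'a) tensor \<Rightarrow> ('o, 'a) tensor" where
  "op_tensor C T = T\<lparr>
     Assoc := (\<lambda>X Y Z. inv_arr C (Assoc T X Y Z)),
     LUnit := (\<lambda>X. inv_arr C (LUnit T X)),
     RUnit := (\<lambda>X. inv_arr C (RUnit T X)),
     Braid := (\<lambda>X Y. inv_arr C (Braid T X Y))\<rparr>"

text \<open>\<open>X \<otimes> -\<close> and \<open>- \<otimes> X\<close>.\<close>

definition tensor_left :: "('o, 'a) cat \<Rightarrow> ('o, 'a) tensor \<Rightarrow> 'o \<Rightarrow> ('o, 'a, 'o, 'a) cfun" where
  "tensor_left C T X = \<lparr>FO = (\<lambda>Y\<in>Obj C. TO T X Y), FA = (\<lambda>f\<in>Arr C. TA T (Id C X) f)\<rparr>"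

definition tensor_right :: "('o, 'a) cat \<Rightarrow> ('o, 'a) tensor \<Rightarrow> 'o \<Rightarrow> ('o, 'a, 'o, 'a) cfun" where
  "tensor_right C T X = \<lparr>FO = (\<lambda>Y\<in>Obj C. TO T Y X), FA = (\<lambda>f\<in>Arr C. TA T f (Id C X))\<rparr>"

definition tensor_cocontinuous :: "'u itself \<Rightarrow> ('o, 'a) cat \<Rightarrow> ('o, 'a) tensor \<Rightarrow> bool" where
  "tensor_cocontinuous U C T \<longleftrightarrow>
     (\<forall>X\<in>Obj C. preserves_small_colimits U C C (tensor_left C T X) \<and>
                preserves_small_colimits U C C (tensor_right C T X))"

text \<open>
  Strong symmetric monoidal functors, with structure isomorphisms
  \<open>\<mu> (X, Y) : F X \<otimes> F Y \<rightarrow> F (X \<otimes> Y)\<close> and \<open>\<epsilon> : I \<rightarrow> F I\<close>.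
\<close>

locale strong_sym_mon_functor =
  S: sym_mon_cat C T + T: sym_mon_cat D T' + cfunctor C D F
  for C :: "('o, 'a) cat" and T and D :: "('p, 'b) cat" and T' and F +
  fixes \<mu> :: "'o \<times> 'o \<Rightarrow> 'b" and \<epsilon> :: 'b
  assumes mu_ext: "\<mu> \<in> extensional (Obj C \<times> Obj C)"
    and mu_hom: "X \<in> Obj C \<Longrightarrow> Y \<in> Obj C \<Longrightarrow>
      \<mu> (X, Y) \<in> Hom D (TO T' (FO F X) (FO F Y)) (FO F (TO T X Y))"
    and mu_iso: "X \<in> Obj C \<Longrightarrow> Y \<in> Obj C \<Longrightarrow> iso_arr D (\<mu> (X, Y))"
    and mu_natural: "f \<in> Hom C X X' \<Longrightarrow> g \<in> Hom C Y Y' \<Longrightarrow>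
      Comp D (\<mu> (X', Y')) (TA T' (FA F f) (FA F g)) = Comp D (FA F (TA T f g)) (\<mu> (X, Y))"
    and eps_hom: "\<epsilon> \<in> Hom D (TI T') (FO F (TI T))"
    and eps_iso: "iso_arr D \<epsilon>"
    and mu_assoc: "X \<in> Obj C \<Longrightarrow> Y \<in> Obj C \<Longrightarrow> Z \<in> Obj C \<Longrightarrow>
      Comp D (FA F (Assoc T X Y Z))
        (Comp D (\<mu> (TO T X Y, Z)) (TA T' (\<mu> (X, Y)) (Id D (FO F Z)))) =
      Comp D (\<mu> (X, TO T Y Z))
        (Comp D (TA T' (Id D (FO F X)) (\<mu> (Y, Z))) (Assoc T' (FO F X) (FO F Y) (FO F Z)))"
    and mu_lunit: "X \<in> Obj C \<Longrightarrow>
      Comp D (FA F (LUnit T X)) (Comp D (\<mu> (TI T, X)) (TA T' \<epsilon> (Id D (FO F X)))) =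
      LUnit T' (FO F X)"
    and mu_runit: "X \<in> Obj C \<Longrightarrow>
      Comp D (FA F (RUnit T X)) (Comp D (\<mu> (X, TI T)) (TA T' (Id D (FO F X)) \<epsilon>)) =
      RUnit T' (FO F X)"
    and mu_braid: "X \<in> Obj C \<Longrightarrow> Y \<in> Obj C \<Longrightarrow>
      Comp D (FA F (Braid T X Y)) (\<mu> (X, Y)) = Comp D (\<mu> (Y, X)) (Braid T' (FO F X) (FO F Y))"

section \<open>Vectoids and their morphisms\<close>

text \<open>
  A vectoid is locally small, as is implicit in speaking of representable presheaves of sets.
\<close>

definition vectoid :: "'u itself \<Rightarrow> ('o, 'a) cat \<Rightarrow> ('o, 'a) tensor \<Rightarrow> bool" where
  "vectoid U C T \<longleftrightarrow>
     sym_mon_cat C T \<and>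
     locally_small U C \<and>
     has_small_colimits U C \<and>
     tensor_cocontinuous U C T \<and>
     has_finite_limits C \<and>
     epis_universally_effective C \<and>
     equivalence_relations_effective C \<and>
     has_small_generators U C \<and>
     continuous_presheaves_representable U C"

text \<open>
  A morphism \<open>f : A \<rightarrow> B\<close>: the functors \<open>Up f = f\<^sup>* : B \<rightarrow> A\<close> and \<open>Low f = f\<^sub>* : A \<rightarrow> B\<close>, the unit
  and counit of the adjunction \<open>f\<^sup>* \<stileturn> f\<^sub>*\<close>, and the monoidal structure of \<open>f\<^sup>*\<close>.
\<close>

record ('o, 'a, 'p, 'b) vmor =
  Up :: "('p, 'b, 'o, 'a) cfun"
  Low :: "('o, 'a, 'p, 'b) cfun"
  AUnit :: "'p \<Rightarrow> 'b"
  ACounit :: "'o \<Rightarrow> 'a"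
  UpMu :: "'p \<times> 'p \<Rightarrow> 'a"
  UpEps :: 'a

definition adjunction ::
  "('p, 'b) cat \<Rightarrow> ('o, 'a) cat \<Rightarrow> ('p, 'b, 'o, 'a) cfun \<Rightarrow> ('o, 'a, 'p, 'b) cfun \<Rightarrow>
   ('p \<Rightarrow> 'b) \<Rightarrow> ('o \<Rightarrow> 'a) \<Rightarrow> bool" where
  "adjunction B A F G \<eta> \<epsilon> \<longleftrightarrow>
     cfunctor B A F \<and> cfunctor A B G \<and>
     nat_trans B B (idf B) (compf B F G) \<eta> \<and>
     nat_trans A A (compf A G F) (idf A) \<epsilon> \<and>
     (\<forall>X\<in>Obj B. Comp A (\<epsilon> (FO F X)) (FA F (\<eta> X)) = Id A (FO F X)) \<and>
     (\<forall>Y\<in>Obj A. Comp B (FA G (\<epsilon> Y)) (\<eta> (FO G Y)) = Id B (FO G Y))"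

definition vectoid_morphism ::
  "('o, 'a) cat \<Rightarrow> ('o, 'a) tensor \<Rightarrow> ('p, 'b) cat \<Rightarrow> ('p, 'b) tensor \<Rightarrow>
   ('o, 'a, 'p, 'b) vmor \<Rightarrow> bool" where
  "vectoid_morphism A S B T f \<longleftrightarrow>
     adjunction B A (Up f) (Low f) (AUnit f) (ACounit f) \<and>
     strong_sym_mon_functor B T A S (Up f) (UpMu f) (UpEps f)"

definition vectoid_2morphism ::
  "('o, 'a) cat \<Rightarrow> ('o, 'a) tensor \<Rightarrow> ('p, 'b) cat \<Rightarrow> ('p, 'b) tensor \<Rightarrow>
   ('o, 'a, 'p, 'b) vmor \<Rightarrow> ('o, 'a, 'p, 'b) vmor \<Rightarrow> ('p \<Rightarrow> 'a) \<Rightarrow> bool" where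
  "vectoid_2morphism A S B T f g \<alpha> \<longleftrightarrow>
     nat_trans B A (Up f) (Up g) \<alpha> \<and>
     (\<forall>X\<in>Obj B. \<forall>Y\<in>Obj B.
        Comp A (\<alpha> (TO T X Y)) (UpMu f (X, Y)) = Comp A (UpMu g (X, Y)) (TA S (\<alpha> X) (\<alpha> Y))) \<and>
     Comp A (\<alpha> (TI T)) (UpEps f) = UpEps g"

definition HomVect ::
  "('o, 'a) cat \<Rightarrow> ('o, 'a) tensor \<Rightarrow> ('p, 'b) cat \<Rightarrow> ('p, 'b) tensor \<Rightarrow>
   (('o, 'a, 'p, 'b) vmor,
    ('o, 'a, 'p, 'b) vmor \<times> ('p \<Rightarrow> 'a) \<times> ('o, 'a, 'p, 'b) vmor) cat" where
  "HomVect A S B T =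
    \<lparr>Obj = {f. vectoid_morphism A S B T f},
     Arr = {(f, \<alpha>, g). vectoid_morphism A S B T f \<and> vectoid_morphism A S B T g \<and>
              vectoid_2morphism A S B T f g \<alpha>},
     Dom = (\<lambda>(f, \<alpha>, g). f),
     Cod = (\<lambda>(f, \<alpha>, g). g),
     Id = (\<lambda>f. (f, (\<lambda>X\<in>Obj B. Id A (FO (Up f) X)), f)),
     Comp = (\<lambda>(g, \<beta>, h) (f, \<alpha>, g'). (f, (\<lambda>X\<in>Obj B. Comp A (\<beta> X) (\<alpha> X)), h))\<rparr>"

section \<open>Cocommutative coalgebras\<close>

definition cocomm_coalgebra ::
  "('o, 'a) cat \<Rightarrow> ('o, 'a) tensor \<Rightarrow> 'o \<times> 'a \<times> 'a \<Rightarrow> bool" where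
  "cocomm_coalgebra C T = (\<lambda>(X, \<Delta>, \<eta>).
     X \<in> Obj C \<and> \<Delta> \<in> Hom C X (TO T X X) \<and> \<eta> \<in> Hom C X (TI T) \<and>
     Comp C (Assoc T X X X) (Comp C (TA T \<Delta> (Id C X)) \<Delta>) = Comp C (TA T (Id C X) \<Delta>) \<Delta> \<and>
     Comp C (LUnit T X) (Comp C (TA T \<eta> (Id C X)) \<Delta>) = Id C X \<and>
     Comp C (RUnit T X) (Comp C (TA T (Id C X) \<eta>) \<Delta>) = Id C X \<and>
     Comp C (Braid T X X) \<Delta> = \<Delta>)"

definition CocommCoalg ::
  "('o, 'a) cat \<Rightarrow> ('o, 'a) tensor \<Rightarrow>
   ('o \<times> 'a \<times> 'a, ('o \<times> 'a \<times> 'a) \<times> 'a \<times> ('o \<times> 'a \<times> 'a)) cat" where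
  "CocommCoalg C T =
    \<lparr>Obj = {c. cocomm_coalgebra C T c},
     Arr = {((X, \<Delta>, \<eta>), h, (X', \<Delta>', \<eta>')).
              cocomm_coalgebra C T (X, \<Delta>, \<eta>) \<and> cocomm_coalgebra C T (X', \<Delta>', \<eta>') \<and>
              h \<in> Hom C X X' \<and> Comp C \<Delta>' h = Comp C (TA T h h) \<Delta> \<and> Comp C \<eta>' h = \<eta>},
     Dom = (\<lambda>(c, h, d). c),
     Cod = (\<lambda>(c, h, d). d),
     Id = (\<lambda>c. (c, Id C (fst c), c)),
     Comp = (\<lambda>(d, k, e) (c, h, d'). (c, Comp C k h, e))\<rparr>"

text \<open>The coalgebra \<open>f\<^sup>* X\<close> for a coalgebra \<open>X\<close>, and the functor \<open>f \<mapsto> f\<^sup>* X\<close>.\<close>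

definition pull_coalg ::
  "('o, 'a) cat \<Rightarrow> ('o, 'a, 'p, 'b) vmor \<Rightarrow> 'p \<times> 'b \<times> 'b \<Rightarrow> 'o \<times> 'a \<times> 'a" where
  "pull_coalg A f = (\<lambda>(X, \<Delta>, \<eta>).
     (FO (Up f) X,
      Comp A (inv_arr A (UpMu f (X, X))) (FA (Up f) \<Delta>),
      Comp A (inv_arr A (UpEps f)) (FA (Up f) \<eta>)))"

definition coalg_eval ::
  "('o, 'a) cat \<Rightarrow> ('o, 'a) tensor \<Rightarrow> ('p, 'b) cat \<Rightarrow> ('p, 'b) tensor \<Rightarrow> 'p \<times> 'b \<times> 'b \<Rightarrow>
   (('o, 'a, 'p, 'b) vmor,
    ('o, 'a, 'p, 'b) vmor \<times> ('p \<Rightarrow> 'a) \<times> ('o, 'a, 'p, 'b) vmor,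
    'o \<times> 'a \<times> 'a,
    ('o \<times> 'a \<times> 'a) \<times> 'a \<times> ('o \<times> 'a \<times> 'a)) cfun" where
  "coalg_eval A S B T c =
    \<lparr>FO = (\<lambda>f\<in>Obj (HomVect A S B T). pull_coalg A f c),
     FA = (\<lambda>(f, \<alpha>, g)\<in>Arr (HomVect A S B T). (pull_coalg A f c, \<alpha> (fst c), pull_coalg A g c))\<rparr>"

section \<open>The category \<open>\<nat>\<close> and the presheaf category \<open>Q\<^sub>c\<close>\<close>

text \<open>The object \<open>n\<close> stands for the set \<open>{1..n}\<close>; an arrow is a triple (source, map, target).\<close>

type_synonym fin_map = "nat \<times> (nat \<Rightarrow> nat) \<times> nat"

definition NCat :: "(nat, fin_map) cat" where
  "NCat =
    \<lparr>Obj = UNIV,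
     Arr = {(m, f, n). f \<in> {1..m} \<rightarrow>\<^sub>E {1..n}},
     Dom = (\<lambda>(m, f, n). m),
     Cod = (\<lambda>(m, f, n). n),
     Id = (\<lambda>n. (n, (\<lambda>i\<in>{1..n}. i), n)),
     Comp = (\<lambda>(n, g, k) (m, f, n'). (m, (\<lambda>i\<in>{1..m}. g (f i)), k))\<rparr>"

text \<open>
  Disjoint union, through the identification of \<open>{1..m} \<squnion> {1..n}\<close> with \<open>{1..m+n}\<close> that keeps
  \<open>{1..m}\<close> and shifts \<open>{1..n}\<close> by \<open>m\<close>; it is strictly associative and unital.
\<close>

definition NTensor :: "(nat, fin_map) tensor" where
  "NTensor =
    \<lparr>TO = (+),
     TA = (\<lambda>(m, f, n) (m', f', n').
             (m + m', (\<lambda>i\<in>{1..m + m'}. if i \<le> m then f i else n + f' (i - m)), n + n')),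
     TI = 0,
     Assoc = (\<lambda>m n k. Id NCat (m + n + k)),
     LUnit = (\<lambda>n. Id NCat n),
     RUnit = (\<lambda>n. Id NCat n),
     Braid = (\<lambda>m n. (m + n, (\<lambda>i\<in>{1..m + n}. if i \<le> m then n + i else i - m), n + m))\<rparr>"

type_synonym 'u q_obj = "(nat, fin_map, 'u set, 'u set \<times> ('u \<Rightarrow> 'u) \<times> 'u set) cfun"
type_synonym 'u q_arr = "'u q_obj \<times> (nat \<Rightarrow> 'u set \<times> ('u \<Rightarrow> 'u) \<times> 'u set) \<times> 'u q_obj"

definition Qc :: "('u q_obj, 'u q_arr) cat" where
  "Qc = Funct NCat SET"

text \<open>
  The values of \<open>h\<^sub>n = Hom(n, -)\<close> must be subsets of \<open>'u\<close>, so the (countably many) arrows of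
  \<open>NCat\<close> are copied into \<open>'u\<close> along a chosen injection.
\<close>

definition enc :: "fin_map \<Rightarrow> 'u" where
  "enc = (SOME e. inj_on e (Arr NCat))"

definition dec :: "'u \<Rightarrow> fin_map" where
  "dec = inv_into (Arr NCat) enc"

definition hrep :: "nat \<Rightarrow> 'u q_obj" where
  "hrep n =
    \<lparr>FO = (\<lambda>k\<in>Obj NCat. enc ` Hom NCat n k),
     FA = (\<lambda>\<phi>\<in>Arr NCat.
       (enc ` Hom NCat n (Dom NCat \<phi>),
        (\<lambda>x\<in>enc ` Hom NCat n (Dom NCat \<phi>). enc (Comp NCat \<phi> (dec x))),
        enc ` Hom NCat n (Cod NCat \<phi>)))\<rparr>"

text \<open>\<open>pre \<phi> = \<phi>\<^sup>* : h\<^sub>n \<rightarrow> h\<^sub>m\<close> is precomposition with \<open>\<phi> : m \<rightarrow> n\<close>.\<close>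

definition pre :: "fin_map \<Rightarrow> 'u q_arr" where
  "pre \<phi> =
    (hrep (Cod NCat \<phi>),
     (\<lambda>k\<in>Obj NCat.
       (enc ` Hom NCat (Cod NCat \<phi>) k,
        (\<lambda>x\<in>enc ` Hom NCat (Cod NCat \<phi>) k. enc (Comp NCat (dec x) \<phi>)),
        enc ` Hom NCat (Dom NCat \<phi>) k)),
     hrep (Dom NCat \<phi>))"

definition yoneda :: "(nat, fin_map, 'u q_obj, 'u q_arr) cfun" where
  "yoneda = \<lparr>FO = (\<lambda>n\<in>Obj NCat. hrep n), FA = (\<lambda>\<phi>\<in>Arr NCat. pre \<phi>)\<rparr>"

text \<open>
  \<open>T\<close> extends disjoint union on the opposite of \<open>NCat\<close> to \<open>Qc\<close> cocontinuously in each variable;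
  \<open>\<mu> (m, n) : h\<^sub>m \<otimes> h\<^sub>n \<rightarrow> h\<^bsub>m+n\<^esub>\<close> and \<open>\<epsilon> : I \<rightarrow> h\<^sub>0\<close> are the identifications that
  make \<open>T\<close> an extension.  (Such a \<open>T\<close> is determined only up to canonical isomorphism.)
\<close>

definition extends_disjoint_union ::
  "('u q_obj, 'u q_arr) tensor \<Rightarrow> (nat \<times> nat \<Rightarrow> 'u q_arr) \<Rightarrow> 'u q_arr \<Rightarrow> bool" where
  "extends_disjoint_union T \<mu> \<epsilon> \<longleftrightarrow>
     strong_sym_mon_functor (op NCat) (op_tensor NCat NTensor) Qc T yoneda \<mu> \<epsilon> \<and>
     tensor_cocontinuous TYPE('u) Qc T"

text \<open>The unique map from \<open>{1..n}\<close> to \<open>{1}\<close>; thus \<open>u = to_one 2\<close> and \<open>v = to_one 0\<close>.\<close>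

definition to_one :: "nat \<Rightarrow> fin_map" where
  "to_one n = (n, (\<lambda>i\<in>{1..n}. 1), 1)"

text \<open>The coalgebra \<open>X\<^sub>c\<close>, with \<open>h\<^sub>2\<close> and \<open>h\<^sub>0\<close> identified with \<open>X\<^sub>c \<otimes> X\<^sub>c\<close> and \<open>I\<close>.\<close>

definition Xc ::
  "(nat \<times> nat \<Rightarrow> 'u q_arr) \<Rightarrow> 'u q_arr \<Rightarrow> 'u q_obj \<times> 'u q_arr \<times> 'u q_arr" where
  "Xc \<mu> \<epsilon> =
    (hrep 1,
     Comp Qc (inv_arr Qc (\<mu> (1, 1))) (pre (to_one 2)),
     Comp Qc (inv_arr Qc \<epsilon>) (pre (to_one 0)))"

end

theory Submission
  imports Defs "HOL-Library.Countable_Set"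
begin

text \<open>
  The category of finite sets with disjoint union is generated, as a symmetric monoidal
  category, by the commutative monoid \<open>1\<close>. Dually, \<open>1\<close> is a cocommutative coalgebra in its
  opposite, and a strong symmetric monoidal functor \<open>K\<close> from there to \<open>A\<close> is the same thing as
  a cocommutative coalgebra \<open>K 1\<close> in \<open>A\<close>. The presheaf category is the free cocompletion, and
  its tensor product is cocontinuous in each variable; so cocontinuous strong monoidal
  functors out of it are again the same thing as cocommutative coalgebras. Cocontinuous
  functors out of a presheaf category are left adjoints, that is, they are the functors \<open>f\<^sup>*\<close>.

  Full faithfulness. A map of coalgebras \<open>h : K 1 \<rightarrow> K' 1\<close> has the tensor powers \<open>h \<otimes> \<dots> \<otimes> h : K
  n \<rightarrow> K' n\<close>. They are natural because every map of finite sets is obtained from \<open>2 \<rightarrow> 1\<close>, \<open>0 \<rightarrow>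
  1\<close> and the swap by composition and disjoint union (\<open>N_generators\<close>), and no other monoidal
  transformation extends \<open>h\<close> (\<open>monoidal_transformation_exists\<close>,
  \<open>monoidal_transformation_unique\<close>). A transformation on finite sets extends uniquely to all
  presheaves, since these are colimits of representables (\<open>elcolimit_yoneda\<close>, \<open>extend_nat\<close>,
  \<open>monoidal_extend\<close>).

  Essential surjectivity. A coalgebra \<open>X\<close> defines the functor \<open>n \<mapsto> X\<^sup>n\<close>, a map \<open>f : m \<rightarrow> n\<close>
  acting by copying the factors \<open>f 1, \<dots>, f m\<close> and discarding the original ones. It is
  constructed with the iterates of the comonad \<open>- \<otimes> X\<close>, where composites are free of
  associativity isomorphisms (\<open>sym_comonad\<close>), and then shown to be strong monoidal
  (\<open>power_strong\<close>). Its left Kan extension to presheaves is adjoint to the nerve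
  (\<open>kan_extension\<close>) and inherits the monoidal structure (\<open>extend_strong\<close>).

  A tensor product exists because disjoint union is the coproduct of finite sets: \<open>h\<^sub>m \<times> h\<^sub>n\<close>
  is \<open>h\<^bsub>m+n\<^esub>\<close>, so the pointwise product, which is closed and hence cocontinuous, extends
  disjoint union (\<open>extends_tensorQ\<close>). The remaining axioms of a vectoid are those of a
  Grothendieck topos and are checked pointwise (\<open>vectoid_Qc\<close>).
\<close>

section \<open>Categories, functors and colimits\<close>

abbreviation Comp_in ("(_ \<cdot>\<^bsub>_\<^esub>/ _)" [56,0,55] 55) where
  "g \<cdot>\<^bsub>C\<^esub> f \<equiv> Comp C g f"

notation (input) Comp_in ("(_ \<cdot>\<^sub>_/ _)" [56,1000,55] 55)

text \<open>
  The arrows of \<open>NCat\<close>, \<open>SET\<close> and \<open>Qc\<close> are triples of source, map and target.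
\<close>

abbreviation tgt :: "'x \<times> 'y \<times> 'z \<Rightarrow> 'z" where "tgt a \<equiv> snd (snd a)"

lemma Hom_iff: "f \<in> Hom C X Y \<longleftrightarrow> f \<in> Arr C \<and> Dom C f = X \<and> Cod C f = Y"
  by (simp add: Hom_def)

context category begin

abbreviation cmp (infixr "\<cdot>" 55) where "g \<cdot> f \<equiv> Comp C g f"

lemma hom_objs: "f \<in> Hom C X Y ==> X \<in> Obj C \<and> Y \<in> Obj C"
  using dom_obj cod_obj by (auto simp: Hom_iff)

lemma arr_simps [simp]:
  "f \<in> Arr C ==> Dom C f \<in> Obj C"
  "f \<in> Arr C ==> Cod C f \<in> Obj C"
  "[|f \<in> Arr C; g \<in> Arr C; Dom C g = Cod C f|] ==> g \<cdot> f \<in> Arr C"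
  "[|f \<in> Arr C; g \<in> Arr C; Dom C g = Cod C f|] ==> Dom C (g \<cdot> f) = Dom C f"
  "[|f \<in> Arr C; g \<in> Arr C; Dom C g = Cod C f|] ==> Cod C (g \<cdot> f) = Cod C g"
  "X \<in> Obj C ==> Id C X \<in> Arr C"
  "X \<in> Obj C ==> Dom C (Id C X) = X"
  "X \<in> Obj C ==> Cod C (Id C X) = X"
  "[|f \<in> Arr C; X = Dom C f|] ==> f \<cdot> Id C X = f"
  "[|f \<in> Arr C; Y = Cod C f|] ==> Id C Y \<cdot> f = f"
  using dom_obj cod_obj comp_hom id_hom comp_id_right comp_id_left by (auto simp: Hom_iff)

lemma assoc_simp [simp]:
  "[|f \<in> Arr C; g \<in> Arr C; h \<in> Arr C; Dom C g = Cod C f; Dom C h = Cod C g|] ==>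
     (h \<cdot> g) \<cdot> f = h \<cdot> g \<cdot> f"
  using comp_assoc[of f "Dom C f" "Cod C f" g "Cod C g" h "Cod C h"] by (auto simp: Hom_iff)

text \<open>Lets the simplifier apply an equation between composites in the middle of a longer one.\<close>

lemma comp_reduce:
  "a \<cdot> b = c ==>
   [|k \<in> Arr C; a \<in> Arr C; b \<in> Arr C; Dom C a = Cod C b; Cod C k = Dom C b|] ==>
   a \<cdot> b \<cdot> k = c \<cdot> k"
  using assoc_simp[of k b a] by simp

lemma inverse_arrows_unique:
  assumes "inverse_arrows C f g" "inverse_arrows C f h" shows "g = h"
proof -
  have "g = g \<cdot> f \<cdot> h" using assms by (simp add: inverse_arrows_def Hom_iff)
  also have "... = (g \<cdot> f) \<cdot> h"
    using assms by (subst assoc_simp) (auto simp: inverse_arrows_def Hom_iff)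
  also have "... = h" using assms by (simp add: inverse_arrows_def Hom_iff)
  finally show ?thesis .
qed

lemma inv_arr_eq: "inverse_arrows C f g ==> inv_arr C f = g"
  unfolding inv_arr_def using inverse_arrows_unique by blast

lemma iso_inverse: "iso_arr C f ==> inverse_arrows C f (inv_arr C f)"
  using inv_arr_eq by (auto simp: iso_arr_def)

lemma iso_simps [simp]:
  assumes "iso_arr C f"
  shows "f \<in> Arr C" "inv_arr C f \<in> Arr C" "Dom C (inv_arr C f) = Cod C f"
    "Cod C (inv_arr C f) = Dom C f" "f \<cdot> inv_arr C f = Id C (Cod C f)"
    "inv_arr C f \<cdot> f = Id C (Dom C f)"
    "[|k \<in> Arr C; Cod C k = Cod C f|] ==> f \<cdot> inv_arr C f \<cdot> k = k"
    "[|k \<in> Arr C; Cod C k = Dom C f|] ==> inv_arr C f \<cdot> f \<cdot> k = k"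
proof -
  note i = iso_inverse[OF assms, unfolded inverse_arrows_def Hom_iff]
  show "f \<in> Arr C" "inv_arr C f \<in> Arr C" "Dom C (inv_arr C f) = Cod C f"
    "Cod C (inv_arr C f) = Dom C f" "f \<cdot> inv_arr C f = Id C (Cod C f)"
    "inv_arr C f \<cdot> f = Id C (Dom C f)" using i by auto
  show "[|k \<in> Arr C; Cod C k = Cod C f|] ==> f \<cdot> inv_arr C f \<cdot> k = k"
    using i by (subst comp_reduce[where c="Id C (Cod C f)"]) auto
  show "[|k \<in> Arr C; Cod C k = Dom C f|] ==> inv_arr C f \<cdot> f \<cdot> k = k"
    using i by (subst comp_reduce[where c="Id C (Dom C f)"]) auto
qed

lemma inverseI:
  "[|f \<in> Hom C X Y; g \<in> Hom C Y X; g \<cdot> f = Id C X; f \<cdot> g = Id C Y|] ==> inverse_arrows C f g"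
  by (auto simp: inverse_arrows_def Hom_iff)

lemma isoI:
  "[|f \<in> Hom C X Y; g \<in> Hom C Y X; g \<cdot> f = Id C X; f \<cdot> g = Id C Y|] ==> iso_arr C f"
  using inverseI unfolding iso_arr_def by blast

lemma iso_inv [simp]: "iso_arr C f ==> iso_arr C (inv_arr C f)"
  by (rule isoI[where g=f]) (auto simp: Hom_iff)

lemma inv_inv [simp]: "iso_arr C f ==> inv_arr C (inv_arr C f) = f"
  by (rule inv_arr_eq, rule inverseI) (auto simp: Hom_iff)

lemma iso_id [simp]: "X \<in> Obj C ==> iso_arr C (Id C X)"
  by (rule isoI[where g="Id C X"]) (auto simp: Hom_iff)

lemma inv_id [simp]: "X \<in> Obj C ==> inv_arr C (Id C X) = Id C X"
  by (rule inv_arr_eq, rule inverseI) (auto simp: Hom_iff)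

lemma inverse_comp:
  "[|iso_arr C f; iso_arr C g; Dom C g = Cod C f|] ==>
     inverse_arrows C (g \<cdot> f) (inv_arr C f \<cdot> inv_arr C g)"
  by (rule inverseI[where X="Dom C f" and Y="Cod C g"]) (auto simp: Hom_iff)

lemma iso_comp [simp]: "[|iso_arr C f; iso_arr C g; Dom C g = Cod C f|] ==> iso_arr C (g \<cdot> f)"
  using inverse_comp unfolding iso_arr_def by blast

lemma inv_comp:
  "[|iso_arr C f; iso_arr C g; Dom C g = Cod C f|] ==>
     inv_arr C (g \<cdot> f) = inv_arr C f \<cdot> inv_arr C g"
  by (rule inv_arr_eq[OF inverse_comp])

lemma iso_cancel_left:
  assumes "iso_arr C f" "a \<in> Arr C" "b \<in> Arr C" "Cod C a = Dom C f" "Cod C b = Dom C f"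
    "f \<cdot> a = f \<cdot> b"
  shows "a = b"
  using iso_simps(8)[OF assms(1,2,4)] iso_simps(8)[OF assms(1,3,5)] assms(6) by metis

lemma iso_cancel_right:
  assumes "iso_arr C f" "a \<in> Arr C" "b \<in> Arr C" "Dom C a = Cod C f" "Dom C b = Cod C f"
    "a \<cdot> f = b \<cdot> f"
  shows "a = b"
proof -
  have "a = (a \<cdot> f) \<cdot> inv_arr C f" using assms(1-5) by simp
  also have "... = (b \<cdot> f) \<cdot> inv_arr C f" using assms(6) by simp
  also have "... = b" using assms(1-5) by simp
  finally show ?thesis .
qed

lemma iso_move_left:
  assumes "iso_arr C f" "a \<in> Arr C" "Cod C a = Dom C f" "f \<cdot> a = b"
  shows "a = inv_arr C f \<cdot> b"
  using assms iso_simps(8)[OF assms(1,2,3)] by simp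

lemma iso_move_right:
  assumes "iso_arr C f" "a \<in> Arr C" "Dom C a = Cod C f" "a \<cdot> f = b"
  shows "a = b \<cdot> inv_arr C f"
  using assms by (auto simp flip: assms(4))

end

subsection \<open>Opposite categories\<close>

lemma op_simps [simp]:
  "Obj (op C) = Obj C" "Arr (op C) = Arr C" "Dom (op C) = Cod C" "Cod (op C) = Dom C"
  "Id (op C) = Id C" "Comp (op C) g f = Comp C f g" "Hom (op C) X Y = Hom C Y X"
  by (auto simp: op_def Hom_def)

lemma op_op [simp]: "op (op C) = C"
  by (simp add: op_def)

lemma category_op: assumes "category C" shows "category (op C)"
proof -
  interpret category C by fact
  show ?thesis by unfold_locales (auto simp: Hom_iff)
qed

lemma iso_op [simp]: "iso_arr (op C) f = iso_arr C f"
  and inv_op [simp]: "inv_arr (op C) f = inv_arr C f"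
  unfolding iso_arr_def inv_arr_def inverse_arrows_def op_simps by (auto intro: arg_cong[where f=The])

subsection \<open>Functors\<close>

context cfunctor begin

lemma functor_simps [simp]:
  "X \<in> Obj C ==> FO F X \<in> Obj D"
  "f \<in> Arr C ==> FA F f \<in> Arr D"
  "f \<in> Arr C ==> Dom D (FA F f) = FO F (Dom C f)"
  "f \<in> Arr C ==> Cod D (FA F f) = FO F (Cod C f)"
  "X \<in> Obj C ==> FA F (Id C X) = Id D (FO F X)"
  using FO_obj FA_hom FA_id by (auto simp: Hom_iff)

lemma FA_comp_simp:
  "[|f \<in> Arr C; g \<in> Arr C; Dom C g = Cod C f|] ==> FA F (g \<cdot>\<^sub>C f) = FA F g \<cdot>\<^sub>D FA F f"
  using FA_comp[of f "Dom C f" "Cod C f" g "Cod C g"] by (auto simp: Hom_iff)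

lemma FA_inverse: "iso_arr C f ==> inverse_arrows D (FA F f) (FA F (inv_arr C f))"
  by (rule T.inverseI[where X="FO F (Dom C f)" and Y="FO F (Cod C f)"])
    (auto simp: Hom_iff FA_comp_simp[symmetric])

lemma FA_iso [simp]: "iso_arr C f ==> iso_arr D (FA F f)"
  using FA_inverse unfolding iso_arr_def by blast

lemma FA_inv: "iso_arr C f ==> FA F (inv_arr C f) = inv_arr D (FA F f)"
  using T.inv_arr_eq[OF FA_inverse] by simp

end

lemma cfunctorI:
  assumes "category C" "category D" "FO F \<in> extensional (Obj C)" "FA F \<in> extensional (Arr C)"
    "\<And>X. X \<in> Obj C ==> FO F X \<in> Obj D"
    "\<And>f. f \<in> Arr C ==> FA F f \<in> Hom D (FO F (Dom C f)) (FO F (Cod C f))"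
    "\<And>X. X \<in> Obj C ==> FA F (Id C X) = Id D (FO F X)"
    "\<And>f g. [|f \<in> Arr C; g \<in> Arr C; Dom C g = Cod C f|] ==>
      FA F (g \<cdot>\<^sub>C f) = FA F g \<cdot>\<^sub>D FA F f"
  shows "cfunctor C D F"
proof -
  interpret C: category C by fact
  interpret D: category D by fact
  show ?thesis by unfold_locales (use assms(3-) in "auto simp: Hom_iff")
qed

lemma compf_simps [simp]:
  "X \<in> Obj C ==> FO (compf C F G) X = FO G (FO F X)"
  "f \<in> Arr C ==> FA (compf C F G) f = FA G (FA F f)"
  by (auto simp: compf_def)

lemma idf_simps [simp]:
  "X \<in> Obj C ==> FO (idf C) X = X" "f \<in> Arr C ==> FA (idf C) f = f"
  by (auto simp: idf_def)

lemma cfunctor_idf: "category C ==> cfunctor C C (idf C)"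
  using category.arr_simps[of C] by (intro cfunctorI) (auto simp: Hom_iff idf_def)

lemma cfunctor_compf:
  assumes "cfunctor C D F" "cfunctor D E G" shows "cfunctor C E (compf C F G)"
proof -
  interpret F: cfunctor C D F by fact
  interpret G: cfunctor D E G by fact
  show ?thesis
    by (rule cfunctorI)
      (auto simp: F.S.category_axioms G.T.category_axioms Hom_iff F.FA_comp_simp G.FA_comp_simp compf_def)
qed

lemma nat_transI:
  assumes "cfunctor C D F" "cfunctor C D G" "\<alpha> \<in> extensional (Obj C)"
    "\<And>X. X \<in> Obj C ==> \<alpha> X \<in> Hom D (FO F X) (FO G X)"
    "\<And>f. f \<in> Arr C ==> \<alpha> (Cod C f) \<cdot>\<^sub>D FA F f = FA G f \<cdot>\<^sub>D \<alpha> (Dom C f)"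
  shows "nat_trans C D F G \<alpha>"
proof -
  interpret F: cfunctor C D F by fact
  interpret G: cfunctor C D G by fact
  show ?thesis by unfold_locales (use assms(3-) in "auto simp: Hom_iff")
qed

context nat_trans begin

lemma nat_simps [simp]:
  "X \<in> Obj C ==> \<alpha> X \<in> Arr D" "X \<in> Obj C ==> Dom D (\<alpha> X) = FO F X"
  "X \<in> Obj C ==> Cod D (\<alpha> X) = FO G X"
  using hom by (auto simp: Hom_iff)

lemma naturality:
  "f \<in> Arr C ==> \<alpha> (Cod C f) \<cdot>\<^sub>D FA F f = FA G f \<cdot>\<^sub>D \<alpha> (Dom C f)"
  using natural[of f "Dom C f" "Cod C f"] by (simp add: Hom_iff)

end

subsection \<open>Equivalences\<close>

text \<open>
  The inverse functor picks an isomorphic image \<open>e Y : F (K Y) \<rightarrow> Y\<close> for every \<open>Y\<close>, and lifts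
  the arrows conjugated by these isomorphisms.
\<close>

lemma equivalenceI:
  assumes F: "cfunctor C D F"
    and ff: "\<And>X Y g. [|X \<in> Obj C; Y \<in> Obj C; g \<in> Hom D (FO F X) (FO F Y)|] ==>
      \<exists>!f. f \<in> Hom C X Y \<and> FA F f = g"
    and es: "\<And>Y. Y \<in> Obj D ==> \<exists>X\<in>Obj C. \<exists>e\<in>Hom D (FO F X) Y. iso_arr D e"
  shows "is_equivalence C D F"
proof -
  interpret cfunctor C D F by fact
  obtain K e where K: "\<And>Y. Y \<in> Obj D ==> K Y \<in> Obj C \<and> e Y \<in> Hom D (FO F (K Y)) Y \<and> iso_arr D (e Y)"
    using es by metis
  note [simp] = K[THEN conjunct1] K[THEN conjunct2, THEN conjunct2]
    K[THEN conjunct2, THEN conjunct1, unfolded Hom_iff, THEN conjunct2, THEN conjunct1]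
    K[THEN conjunct2, THEN conjunct1, unfolded Hom_iff, THEN conjunct2, THEN conjunct2]
  have eq: "f = f'" if "f \<in> Arr C" "f' \<in> Arr C" "Dom C f = Dom C f'" "Cod C f = Cod C f'" "FA F f = FA F f'" for f f'
    using ff[of "Dom C f" "Cod C f" "FA F f"] that by (auto simp: Hom_iff)
  define lift where "lift X Y g = (THE f. f \<in> Hom C X Y \<and> FA F f = g)" for X Y g
  have lift: "lift X Y g \<in> Arr C" "Dom C (lift X Y g) = X" "Cod C (lift X Y g) = Y" "FA F (lift X Y g) = g"
    if "X \<in> Obj C" "Y \<in> Obj C" "g \<in> Arr D" "Dom D g = FO F X" "Cod D g = FO F Y" for X Y g
    using theI'[OF ff[of X Y g]] that by (auto simp: lift_def Hom_iff)
  define GA where "GA g = lift (K (Dom D g)) (K (Cod D g)) (inv_arr D (e (Cod D g)) \<cdot>\<^sub>D g \<cdot>\<^sub>D e (Dom D g))" for g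
  have GA: "GA g \<in> Arr C" "Dom C (GA g) = K (Dom D g)" "Cod C (GA g) = K (Cod D g)"
    "FA F (GA g) = inv_arr D (e (Cod D g)) \<cdot>\<^sub>D g \<cdot>\<^sub>D e (Dom D g)" if "g \<in> Arr D" for g
    unfolding GA_def using lift that by auto
  define G where "G = \<lparr>FO = (\<lambda>Y\<in>Obj D. K Y), FA = (\<lambda>g\<in>Arr D. GA g)\<rparr>"
  have G: "cfunctor D C G"
  proof (rule cfunctorI)
    show "FA G (Id D X) = Id C (FO G X)" if "X \<in> Obj D" for X
      using that by (auto simp: G_def GA intro!: eq)
    show "FA G (g \<cdot>\<^sub>D f) = FA G g \<cdot>\<^sub>C FA G f" if "f \<in> Arr D" "g \<in> Arr D" "Dom D g = Cod D f" for f g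
      using that by (auto simp: G_def GA FA_comp_simp intro!: eq)
  qed (auto simp: G_def S.category_axioms T.category_axioms GA Hom_iff)
  interpret G: cfunctor D C G by fact
  have 1: "nat_iso C C (idf C) (compf C F G) (\<lambda>X\<in>Obj C. lift X (K (FO F X)) (inv_arr D (e (FO F X))))"
    unfolding nat_iso_def
  proof (intro conjI ballI nat_transI)
    show "cfunctor C C (idf C)" by (rule cfunctor_idf[OF S.category_axioms])
    show "cfunctor C C (compf C F G)" by (rule cfunctor_compf[OF F G])
    fix X assume X: "X \<in> Obj C"
    let ?a = "lift X (K (FO F X)) (inv_arr D (e (FO F X)))"
    let ?b = "lift (K (FO F X)) X (e (FO F X))"
    have a: "?a \<in> Hom C X (K (FO F X))" "?b \<in> Hom C (K (FO F X)) X" "FA F ?a = inv_arr D (e (FO F X))" "FA F ?b = e (FO F X)"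
      using X by (auto simp: Hom_iff lift)
    have "iso_arr C ?a"
      by (rule S.isoI[OF a(1,2)]; rule eq) (use a X in "auto simp: Hom_iff FA_comp_simp")
    then show "iso_arr C ((\<lambda>X\<in>Obj C. lift X (K (FO F X)) (inv_arr D (e (FO F X)))) X)" using X by simp
  next
    fix f assume f: "f \<in> Arr C"
    show "(\<lambda>X\<in>Obj C. lift X (K (FO F X)) (inv_arr D (e (FO F X)))) (Cod C f) \<cdot>\<^sub>C FA (idf C) f =
      FA (compf C F G) f \<cdot>\<^sub>C (\<lambda>X\<in>Obj C. lift X (K (FO F X)) (inv_arr D (e (FO F X)))) (Dom C f)"
      using f by (auto simp: lift FA_comp_simp G_def GA intro!: eq)
  qed (auto simp: lift G_def Hom_iff)
  have 2: "nat_iso D D (compf D G F) (idf D) (\<lambda>Y\<in>Obj D. e Y)"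
    unfolding nat_iso_def
  proof (intro conjI ballI nat_transI)
    show "cfunctor D D (idf D)" by (rule cfunctor_idf[OF T.category_axioms])
    show "cfunctor D D (compf D G F)" by (rule cfunctor_compf[OF G F])
  qed (auto simp: G_def GA Hom_iff)
  show ?thesis unfolding is_equivalence_def using F G 1 2 by blast
qed

subsection \<open>Colimits and adjunctions\<close>

text \<open>
  A map \<open>H L \<rightarrow> Z\<close> is a map from \<open>L\<close> to the object \<open>E\<close> representing \<open>Hom(H -, Z)\<close>, hence a cocone.
  Asking for the objects \<open>E\<close> one by one suits internal homs, which are constructed objectwise.
\<close>

lemma preserves_colimit_if_adjoint:
  assumes H: "cfunctor C D H"
    and adj: "\<And>Z. Z \<in> Obj D ==> \<exists>E\<in>Obj C. \<exists>\<theta>.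
      (\<forall>P\<in>Obj C. bij_betw (\<theta> P) (Hom D (FO H P) Z) (Hom C P E)) \<and>
      (\<forall>P P' f a. f \<in> Hom C P' P \<longrightarrow> a \<in> Hom D (FO H P) Z \<longrightarrow>
         \<theta> P' (a \<cdot>\<^sub>D FA H f) = \<theta> P a \<cdot>\<^sub>C f)"
    and G: "cfunctor J C G" and L: "is_colimit J C G L \<iota>"
  shows "is_colimit J D (compf J G H) (FO H L) (\<lambda>j. FA H (\<iota> j))"
proof -
  interpret H: cfunctor C D H by fact
  interpret G: cfunctor J C G by fact
  have c: "L \<in> Obj C" "\<And>j. j \<in> Obj J ==> \<iota> j \<in> Hom C (FO G j) L"
    "\<And>f. f \<in> Arr J ==> \<iota> (Cod J f) \<cdot>\<^sub>C FA G f = \<iota> (Dom J f)"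
    using L by (auto simp: is_colimit_def is_cocone_def)
  show ?thesis unfolding is_colimit_def
  proof (intro conjI allI impI)
    show "is_cocone J D (compf J G H) (FO H L) (\<lambda>j. FA H (\<iota> j))"
      unfolding is_cocone_def
    proof (intro conjI ballI)
      fix f assume f: "f \<in> Arr J"
      then show "FA H (\<iota> (Cod J f)) \<cdot>\<^sub>D FA (compf J G H) f = FA H (\<iota> (Dom J f))"
        using c(2)[of "Cod J f"] c(3)[of f] by (auto simp: H.FA_comp_simp[symmetric] Hom_iff)
    qed (use c in "auto simp: Hom_iff")
  next
    fix Z \<kappa> assume \<kappa>: "is_cocone J D (compf J G H) Z \<kappa>"
    then have Z: "Z \<in> Obj D" by (simp add: is_cocone_def)
    obtain E \<theta> where E: "E \<in> Obj C"
      and bij: "\<And>P. P \<in> Obj C ==> bij_betw (\<theta> P) (Hom D (FO H P) Z) (Hom C P E)"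
      and nat: "\<And>P P' f a. f \<in> Hom C P' P ==> a \<in> Hom D (FO H P) Z ==>
         \<theta> P' (a \<cdot>\<^sub>D FA H f) = \<theta> P a \<cdot>\<^sub>C f" using adj[OF Z] by metis
    have k: "\<And>j. j \<in> Obj J ==> \<kappa> j \<in> Hom D (FO H (FO G j)) Z"
      "\<And>f. f \<in> Arr J ==> \<kappa> (Cod J f) \<cdot>\<^sub>D FA H (FA G f) = \<kappa> (Dom J f)"
      using \<kappa> by (auto simp: is_cocone_def)
    have th: "\<theta> P a \<in> Hom C P E" if "P \<in> Obj C" "a \<in> Hom D (FO H P) Z" for P a
      using bij_betwE[OF bij[OF that(1)]] that(2) by blast
    have inj: "a = b" if "P \<in> Obj C" "a \<in> Hom D (FO H P) Z" "b \<in> Hom D (FO H P) Z" "\<theta> P a = \<theta> P b" for P a b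
      using bij_betw_imp_inj_on[OF bij[OF that(1)]] that by (auto dest: inj_onD)
    have co: "is_cocone J C G E (\<lambda>j. \<theta> (FO G j) (\<kappa> j))"
      unfolding is_cocone_def
    proof (intro conjI ballI)
      fix f assume f: "f \<in> Arr J"
      show "\<theta> (FO G (Cod J f)) (\<kappa> (Cod J f)) \<cdot>\<^sub>C FA G f = \<theta> (FO G (Dom J f)) (\<kappa> (Dom J f))"
        using f nat[of "FA G f" "FO G (Dom J f)" "FO G (Cod J f)" "\<kappa> (Cod J f)"] k by (simp add: Hom_iff)
    qed (use E th k in auto)
    have "\<exists>!h. h \<in> Hom C L E \<and> (\<forall>j\<in>Obj J. h \<cdot>\<^sub>C \<iota> j = \<theta> (FO G j) (\<kappa> j))"
      using L co unfolding is_colimit_def by blast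
    then obtain h where h: "h \<in> Hom C L E" "\<And>j. j \<in> Obj J ==> h \<cdot>\<^sub>C \<iota> j = \<theta> (FO G j) (\<kappa> j)"
      and hu: "\<And>h'. h' \<in> Hom C L E ==> (\<And>j. j \<in> Obj J ==> h' \<cdot>\<^sub>C \<iota> j = \<theta> (FO G j) (\<kappa> j)) ==> h' = h"
      by metis
    obtain a where a: "a \<in> Hom D (FO H L) Z" "\<theta> L a = h"
      using bij_betw_imp_surj_on[OF bij[OF c(1)]] h(1) by (metis imageE)
    have comp: "b \<cdot>\<^sub>D FA H (\<iota> j) \<in> Hom D (FO H (FO G j)) Z" if "b \<in> Hom D (FO H L) Z" "j \<in> Obj J" for b j
      using that c(2)[of j] by (auto simp: Hom_iff)
    show "\<exists>!h. h \<in> Hom D (FO H L) Z \<and> (\<forall>j\<in>Obj J. h \<cdot>\<^sub>D FA H (\<iota> j) = \<kappa> j)"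
    proof (intro ex1I[of _ a] conjI ballI a)
      fix j assume j: "j \<in> Obj J"
      show "a \<cdot>\<^sub>D FA H (\<iota> j) = \<kappa> j"
        by (rule inj[of "FO G j"]) (use j a h c comp k nat[OF c(2)[OF j] a(1)] in auto)
    next
      fix b assume b: "b \<in> Hom D (FO H L) Z \<and> (\<forall>j\<in>Obj J. b \<cdot>\<^sub>D FA H (\<iota> j) = \<kappa> j)"
      have "\<theta> L b = h"
        by (rule hu) (use b th c nat[OF c(2) conjunct1[OF b]] in auto)
      then show "b = a" using inj[of L b a] a b c by auto
    qed
  qed
qed

lemma left_adjoint_preserves_colimit:
  assumes adj: "adjunction B A F G \<eta> \<epsilon>" and D: "cfunctor J B D" and L: "is_colimit J B D L \<iota>"
  shows "is_colimit J A (compf J D F) (FO F L) (\<lambda>j. FA F (\<iota> j))"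
proof -
  have F: "cfunctor B A F" and G: "cfunctor A B G" and n1: "nat_trans B B (idf B) (compf B F G) \<eta>"
    and n2: "nat_trans A A (compf A G F) (idf A) \<epsilon>"
    and t: "\<And>X. X \<in> Obj B ==> \<epsilon> (FO F X) \<cdot>\<^sub>A FA F (\<eta> X) = Id A (FO F X)"
      "\<And>Y. Y \<in> Obj A ==> FA G (\<epsilon> Y) \<cdot>\<^sub>B \<eta> (FO G Y) = Id B (FO G Y)"
    using adj by (auto simp: adjunction_def)
  interpret F: cfunctor B A F by fact
  interpret G: cfunctor A B G by fact
  interpret n1: nat_trans B B "idf B" "compf B F G" \<eta> by fact
  interpret n2: nat_trans A A "compf A G F" "idf A" \<epsilon> by fact
  note nn1 = n1.naturality[simplified] and nn2 = n2.naturality[simplified]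
  show ?thesis
  proof (rule preserves_colimit_if_adjoint[OF F _ D L])
    fix Z assume Z: "Z \<in> Obj A"
    let ?\<theta> = "\<lambda>P a. FA G a \<cdot>\<^sub>B \<eta> P"
    let ?\<theta>' = "\<lambda>b. \<epsilon> Z \<cdot>\<^sub>A FA F b"
    have 1: "bij_betw (?\<theta> P) (Hom A (FO F P) Z) (Hom B P (FO G Z))" if P: "P \<in> Obj B" for P
    proof (rule bij_betwI[where g="?\<theta>'"])
      show "?\<theta> P \<in> Hom A (FO F P) Z \<rightarrow> Hom B P (FO G Z)" using P by (auto simp: Hom_iff)
      show "?\<theta>' \<in> Hom B P (FO G Z) \<rightarrow> Hom A (FO F P) Z" using Z by (auto simp: Hom_iff)
      show "\<epsilon> Z \<cdot>\<^sub>A FA F (FA G a \<cdot>\<^sub>B \<eta> P) = a" if a: "a \<in> Hom A (FO F P) Z" for a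
      proof -
        have "\<epsilon> Z \<cdot>\<^sub>A FA F (FA G a \<cdot>\<^sub>B \<eta> P) = (\<epsilon> Z \<cdot>\<^sub>A FA F (FA G a)) \<cdot>\<^sub>A FA F (\<eta> P)"
          using a P Z by (simp add: Hom_iff F.FA_comp_simp)
        also have "... = (a \<cdot>\<^sub>A \<epsilon> (FO F P)) \<cdot>\<^sub>A FA F (\<eta> P)"
          using nn2[of a] a by (auto simp: Hom_iff)
        also have "... = a" using a P t(1)[OF P] by (simp add: Hom_iff)
        finally show ?thesis .
      qed
      show "FA G (\<epsilon> Z \<cdot>\<^sub>A FA F b) \<cdot>\<^sub>B \<eta> P = b" if b: "b \<in> Hom B P (FO G Z)" for b
      proof -
        have "FA G (\<epsilon> Z \<cdot>\<^sub>A FA F b) \<cdot>\<^sub>B \<eta> P = FA G (\<epsilon> Z) \<cdot>\<^sub>B (FA G (FA F b) \<cdot>\<^sub>B \<eta> P)"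
          using b P Z by (simp add: Hom_iff G.FA_comp_simp)
        also have "... = FA G (\<epsilon> Z) \<cdot>\<^sub>B (\<eta> (FO G Z) \<cdot>\<^sub>B b)"
          using nn1[of b] b by (auto simp: Hom_iff)
        also have "... = (FA G (\<epsilon> Z) \<cdot>\<^sub>B \<eta> (FO G Z)) \<cdot>\<^sub>B b"
          using b Z by (subst F.S.assoc_simp) (auto simp: Hom_iff)
        also have "... = b" using b Z t(2)[OF Z] by (simp add: Hom_iff)
        finally show ?thesis .
      qed
    qed
    have 2: "FA G (a \<cdot>\<^sub>A FA F f) \<cdot>\<^sub>B \<eta> P' = (FA G a \<cdot>\<^sub>B \<eta> P) \<cdot>\<^sub>B f"
      if "f \<in> Hom B P' P" "a \<in> Hom A (FO F P) Z" for P P' f a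
    proof -
      have "P \<in> Obj B" "P' \<in> Obj B" using F.S.hom_objs[OF that(1)] by auto
      then show ?thesis using that nn1[of f] by (simp add: Hom_iff G.FA_comp_simp)
    qed
    show "\<exists>E\<in>Obj B. \<exists>\<theta>.
      (\<forall>P\<in>Obj B. bij_betw (\<theta> P) (Hom A (FO F P) Z) (Hom B P E)) \<and>
      (\<forall>P P' f a. f \<in> Hom B P' P \<longrightarrow> a \<in> Hom A (FO F P) Z \<longrightarrow>
         \<theta> P' (a \<cdot>\<^sub>A FA F f) = \<theta> P a \<cdot>\<^sub>B f)"
      by (rule bexI[of _ "FO G Z"], rule exI[of _ ?\<theta>]) (use 1 2 Z in auto)
  qed
qed

text \<open>
  Here the values \<open>L P\<close> of the left adjoint are prescribed exactly; this is what allows the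
  Kan extension below to extend a functor on the nose.
\<close>

lemma adjunction_from_universal_arrows:
  assumes G: "cfunctor A B G"
    and L: "\<And>P. P \<in> Obj B ==> L P \<in> Obj A \<and> u P \<in> Hom B P (FO G (L P))"
    and un: "\<And>P Y f. [|P \<in> Obj B; Y \<in> Obj A; f \<in> Hom B P (FO G Y)|] ==>
      \<exists>!h. h \<in> Hom A (L P) Y \<and> FA G h \<cdot>\<^sub>B u P = f"
  shows "\<exists>F \<eta> \<epsilon>. adjunction B A F G \<eta> \<epsilon> \<and> (\<forall>P\<in>Obj B. FO F P = L P \<and> \<eta> P = u P)"
proof -
  interpret cfunctor A B G by fact
  note [simp] = L[THEN conjunct1] L[THEN conjunct2, unfolded Hom_iff, THEN conjunct1]
    L[THEN conjunct2, unfolded Hom_iff, THEN conjunct2, THEN conjunct1]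
    L[THEN conjunct2, unfolded Hom_iff, THEN conjunct2, THEN conjunct2]
  define lift where "lift P Y f = (THE h. h \<in> Hom A (L P) Y \<and> FA G h \<cdot>\<^sub>B u P = f)" for P Y f
  have lift: "lift P Y f \<in> Arr A" "Dom A (lift P Y f) = L P" "Cod A (lift P Y f) = Y" "FA G (lift P Y f) \<cdot>\<^sub>B u P = f"
    if "P \<in> Obj B" "Y \<in> Obj A" "f \<in> Arr B" "Dom B f = P" "Cod B f = FO G Y" for P Y f
    using theI'[OF un[of P Y f]] that by (auto simp: lift_def Hom_iff)
  have eq: "h = h'" if "P \<in> Obj B" "h \<in> Arr A" "h' \<in> Arr A" "Dom A h = L P" "Dom A h' = L P" "Cod A h = Cod A h'"
    "FA G h \<cdot>\<^sub>B u P = FA G h' \<cdot>\<^sub>B u P" for P h h'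
    using un[of P "Cod A h" "FA G h \<cdot>\<^sub>B u P"] that by (auto simp: Hom_iff)
  define F where "F = \<lparr>FO = (\<lambda>P\<in>Obj B. L P), FA = (\<lambda>f\<in>Arr B. lift (Dom B f) (L (Cod B f)) (u (Cod B f) \<cdot>\<^sub>B f))\<rparr>"
  have FA: "FA F f \<in> Arr A" "Dom A (FA F f) = L (Dom B f)" "Cod A (FA F f) = L (Cod B f)"
     "FA G (FA F f) \<cdot>\<^sub>B u (Dom B f) = u (Cod B f) \<cdot>\<^sub>B f" if "f \<in> Arr B" for f
    using that by (auto simp: F_def lift)
  have F: "cfunctor B A F"
  proof (rule cfunctorI)
    show "FA F (Id B X) = Id A (FO F X)" if "X \<in> Obj B" for X
      using that by (intro eq[of X]) (auto simp: FA F_def lift)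
    show "FA F (g \<cdot>\<^sub>B f) = FA F g \<cdot>\<^sub>A FA F f" if "f \<in> Arr B" "g \<in> Arr B" "Dom B g = Cod B f" for f g
    proof (rule eq[of "Dom B f"])
      have "FA G (FA F g \<cdot>\<^sub>A FA F f) \<cdot>\<^sub>B u (Dom B f) = FA G (FA F g) \<cdot>\<^sub>B u (Cod B f) \<cdot>\<^sub>B f"
        using that by (simp add: FA_comp_simp FA)
      also have "... = (FA G (FA F g) \<cdot>\<^sub>B u (Dom B g)) \<cdot>\<^sub>B f"
        using that by (simp add: FA(1-3))
      also have "... = (u (Cod B g) \<cdot>\<^sub>B g) \<cdot>\<^sub>B f"
        by (simp only: FA(4)[OF that(2)])
      also have "... = u (Cod B g) \<cdot>\<^sub>B g \<cdot>\<^sub>B f"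
        using that by simp
      finally show "FA G (FA F (g \<cdot>\<^sub>B f)) \<cdot>\<^sub>B u (Dom B f) = FA G (FA F g \<cdot>\<^sub>A FA F f) \<cdot>\<^sub>B u (Dom B f)"
        using that FA(4)[of "g \<cdot>\<^sub>B f"] by simp
    qed (use that in "auto simp: FA")
  qed (use FA in "auto simp: S.category_axioms T.category_axioms Hom_iff F_def")
  have FO: "P \<in> Obj B ==> FO F P = L P" for P by (simp add: F_def)
  define \<eta> where "\<eta> = (\<lambda>P\<in>Obj B. u P)"
  define \<epsilon> where "\<epsilon> = (\<lambda>Y\<in>Obj A. lift (FO G Y) Y (Id B (FO G Y)))"
  have ep: "\<epsilon> Y \<in> Arr A" "Dom A (\<epsilon> Y) = L (FO G Y)" "Cod A (\<epsilon> Y) = Y" "FA G (\<epsilon> Y) \<cdot>\<^sub>B u (FO G Y) = Id B (FO G Y)"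
    if "Y \<in> Obj A" for Y using that by (auto simp: \<epsilon>_def lift)
  have n1: "nat_trans B B (idf B) (compf B F G) \<eta>"
    by (rule nat_transI) (use FA in "auto simp: cfunctor_idf cfunctor_compf[OF F G] T.category_axioms \<eta>_def FO Hom_iff")
  have n2: "nat_trans A A (compf A G F) (idf A) \<epsilon>"
  proof (rule nat_transI)
    fix f assume f: "f \<in> Arr A"
    let ?X = "Dom A f" and ?Y = "Cod A f"
    have "FA G (\<epsilon> ?Y \<cdot>\<^sub>A FA F (FA G f)) \<cdot>\<^sub>B u (FO G ?X) =
      FA G (\<epsilon> ?Y) \<cdot>\<^sub>B FA G (FA F (FA G f)) \<cdot>\<^sub>B u (FO G ?X)"
      using f by (simp add: FA_comp_simp FA ep)
    also have "... = FA G (\<epsilon> ?Y) \<cdot>\<^sub>B u (FO G ?Y) \<cdot>\<^sub>B FA G f" using f FA(4)[of "FA G f"] by simp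
    also have "... = FA G f" using f ep(4)[THEN T.comp_reduce, of ?Y "FA G f"] by (simp add: ep)
    also have "... = FA G (f \<cdot>\<^sub>A \<epsilon> ?X) \<cdot>\<^sub>B u (FO G ?X)"
      using f ep(4)[of ?X] by (simp add: FA_comp_simp ep)
    finally show "\<epsilon> (Cod A f) \<cdot>\<^sub>A FA (compf A G F) f = FA (idf A) f \<cdot>\<^sub>A \<epsilon> (Dom A f)"
      using f by (intro eq[of "FO G ?X"]) (auto simp: FA ep)
  qed (use ep in "auto simp: cfunctor_idf cfunctor_compf[OF G F] S.category_axioms FO Hom_iff \<epsilon>_def")
  have t1: "\<epsilon> (FO F P) \<cdot>\<^sub>A FA F (\<eta> P) = Id A (FO F P)" if P: "P \<in> Obj B" for P
  proof (rule eq[of P])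
    have "FA G (\<epsilon> (L P) \<cdot>\<^sub>A FA F (u P)) \<cdot>\<^sub>B u P = FA G (\<epsilon> (L P)) \<cdot>\<^sub>B FA G (FA F (u P)) \<cdot>\<^sub>B u P"
      using P by (simp add: FA_comp_simp FA ep)
    also have "... = FA G (\<epsilon> (L P)) \<cdot>\<^sub>B u (FO G (L P)) \<cdot>\<^sub>B u P" using P FA(4)[of "u P"] by simp
    also have "... = u P" using P ep(4)[THEN T.comp_reduce, of "L P" "u P"] by (simp add: ep)
    finally show "FA G (\<epsilon> (FO F P) \<cdot>\<^sub>A FA F (\<eta> P)) \<cdot>\<^sub>B u P = FA G (Id A (FO F P)) \<cdot>\<^sub>B u P"
      using P by (simp add: FO \<eta>_def)
  qed (use P in "auto simp: FA FO ep \<eta>_def")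
  have "adjunction B A F G \<eta> \<epsilon>"
    unfolding adjunction_def using F G n1 n2 t1 ep(4) by (auto simp: \<eta>_def)
  then show ?thesis using FO by (auto simp: \<eta>_def intro!: exI[of _ F] exI[of _ \<eta>])
qed

section \<open>Symmetric monoidal categories and strong monoidal functors\<close>

context sym_mon_cat begin

abbreviation ten (infixr "\<otimes>" 70) where "f \<otimes> g \<equiv> TA T f g"
abbreviation tob (infixr "\<boxtimes>" 70) where "X \<boxtimes> Y \<equiv> TO T X Y"
abbreviation one ("\<one>") where "\<one> \<equiv> Id C"
abbreviation unt ("\<I>") where "\<I> \<equiv> TI T"
abbreviation aso ("\<a>") where "\<a> \<equiv> Assoc T"
abbreviation asi ("\<a>''") where "\<a>' X Y Z \<equiv> inv_arr C (Assoc T X Y Z)"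
abbreviation lun ("\<l>") where "\<l> \<equiv> LUnit T"
abbreviation run ("\<r>") where "\<r> \<equiv> RUnit T"
abbreviation brd ("\<c>") where "\<c> \<equiv> Braid T"

lemma tensor_simps [simp]:
  "[|X \<in> Obj C; Y \<in> Obj C|] ==> X \<boxtimes> Y \<in> Obj C" "\<I> \<in> Obj C"
  "[|f \<in> Arr C; g \<in> Arr C|] ==> f \<otimes> g \<in> Arr C"
  "[|f \<in> Arr C; g \<in> Arr C|] ==> Dom C (f \<otimes> g) = Dom C f \<boxtimes> Dom C g"
  "[|f \<in> Arr C; g \<in> Arr C|] ==> Cod C (f \<otimes> g) = Cod C f \<boxtimes> Cod C g"
  "[|X \<in> Obj C; Y \<in> Obj C|] ==> \<one> X \<otimes> \<one> Y = \<one> (X \<boxtimes> Y)"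
  "[|X \<in> Obj C; Y \<in> Obj C; Z \<in> Obj C|] ==> iso_arr C (\<a> X Y Z)"
  "[|X \<in> Obj C; Y \<in> Obj C; Z \<in> Obj C|] ==> Dom C (\<a> X Y Z) = (X \<boxtimes> Y) \<boxtimes> Z"
  "[|X \<in> Obj C; Y \<in> Obj C; Z \<in> Obj C|] ==> Cod C (\<a> X Y Z) = X \<boxtimes> Y \<boxtimes> Z"
  "X \<in> Obj C ==> iso_arr C (\<l> X)" "X \<in> Obj C ==> iso_arr C (\<r> X)"
  "X \<in> Obj C ==> Dom C (\<l> X) = \<I> \<boxtimes> X" "X \<in> Obj C ==> Cod C (\<l> X) = X"
  "X \<in> Obj C ==> Dom C (\<r> X) = X \<boxtimes> \<I>" "X \<in> Obj C ==> Cod C (\<r> X) = X"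
  "[|X \<in> Obj C; Y \<in> Obj C|] ==> Dom C (\<c> X Y) = X \<boxtimes> Y"
  "[|X \<in> Obj C; Y \<in> Obj C|] ==> Cod C (\<c> X Y) = Y \<boxtimes> X"
  using TO_obj TI_obj TA_hom TA_id assoc_hom assoc_iso lunit_hom lunit_iso runit_hom runit_iso braid_hom
  by (auto simp: Hom_iff)

lemma braid_inverse: "[|X \<in> Obj C; Y \<in> Obj C|] ==> inverse_arrows C (\<c> X Y) (\<c> Y X)"
  using braid_hom braid_sym by (intro inverseI) auto

lemma braid_iso [simp]: "[|X \<in> Obj C; Y \<in> Obj C|] ==> iso_arr C (\<c> X Y)"
  using braid_inverse unfolding iso_arr_def by blast

lemma inv_braid [simp]: "[|X \<in> Obj C; Y \<in> Obj C|] ==> inv_arr C (\<c> X Y) = \<c> Y X"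
  using inv_arr_eq[OF braid_inverse] .

lemma struct_arr [simp]:
  "[|X \<in> Obj C; Y \<in> Obj C; Z \<in> Obj C|] ==> \<a> X Y Z \<in> Arr C"
  "X \<in> Obj C ==> \<l> X \<in> Arr C" "X \<in> Obj C ==> \<r> X \<in> Arr C"
  "[|X \<in> Obj C; Y \<in> Obj C|] ==> \<c> X Y \<in> Arr C"
  by auto

lemma interchange:
  "[|f \<in> Arr C; f' \<in> Arr C; g \<in> Arr C; g' \<in> Arr C; Dom C f' = Cod C f; Dom C g' = Cod C g|] ==>
    (f' \<otimes> g') \<cdot> (f \<otimes> g) = (f' \<cdot> f) \<otimes> (g' \<cdot> g)"
  using TA_comp[of f "Dom C f" "Cod C f" f' "Cod C f'" g "Dom C g" "Cod C g" g' "Cod C g'"]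
  by (auto simp: Hom_iff)

lemma interchange_re:
  "[|f \<in> Arr C; f' \<in> Arr C; g \<in> Arr C; g' \<in> Arr C; Dom C f' = Cod C f; Dom C g' = Cod C g;
    k \<in> Arr C; Cod C k = Dom C f \<boxtimes> Dom C g|] ==>
    (f' \<otimes> g') \<cdot> (f \<otimes> g) \<cdot> k = ((f' \<cdot> f) \<otimes> (g' \<cdot> g)) \<cdot> k"
  by (subst comp_reduce[OF interchange]) auto

lemma inverse_tensor:
  "[|iso_arr C f; iso_arr C g|] ==> inverse_arrows C (f \<otimes> g) (inv_arr C f \<otimes> inv_arr C g)"
  by (rule inverseI) (auto simp: Hom_iff interchange)

lemma iso_tensor [simp]: "[|iso_arr C f; iso_arr C g|] ==> iso_arr C (f \<otimes> g)"
  using inverse_tensor unfolding iso_arr_def by blast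

lemma inv_tensor: "[|iso_arr C f; iso_arr C g|] ==> inv_arr C (f \<otimes> g) = inv_arr C f \<otimes> inv_arr C g"
  by (rule inv_arr_eq[OF inverse_tensor])

lemma assoc_nat:
  "[|f \<in> Arr C; g \<in> Arr C; h \<in> Arr C; X = Cod C f; Y = Cod C g; Z = Cod C h|] ==>
    \<a> X Y Z \<cdot> ((f \<otimes> g) \<otimes> h) = (f \<otimes> g \<otimes> h) \<cdot> \<a> (Dom C f) (Dom C g) (Dom C h)"
  using assoc_natural by (auto simp: Hom_iff)

lemma assoc_inv_nat:
  assumes [simp]: "f \<in> Arr C" "g \<in> Arr C" "h \<in> Arr C" "X = Cod C f" "Y = Cod C g" "Z = Cod C h"
  shows "\<a>' X Y Z \<cdot> (f \<otimes> g \<otimes> h) = ((f \<otimes> g) \<otimes> h) \<cdot> \<a>' (Dom C f) (Dom C g) (Dom C h)"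
  by (rule iso_cancel_right[of "\<a> (Dom C f) (Dom C g) (Dom C h)"])
    (simp_all add: assoc_nat[symmetric])

lemma lunit_nat: "f \<in> Arr C ==> \<l> (Cod C f) \<cdot> (\<one> \<I> \<otimes> f) = f \<cdot> \<l> (Dom C f)"
  using lunit_natural by (auto simp: Hom_iff)

lemma runit_nat: "f \<in> Arr C ==> \<r> (Cod C f) \<cdot> (f \<otimes> \<one> \<I>) = f \<cdot> \<r> (Dom C f)"
  using runit_natural by (auto simp: Hom_iff)

lemma braid_nat:
  "[|f \<in> Arr C; g \<in> Arr C; X = Cod C f; Y = Cod C g|] ==>
    \<c> X Y \<cdot> (f \<otimes> g) = (g \<otimes> f) \<cdot> \<c> (Dom C f) (Dom C g)"
  using braid_natural by (auto simp: Hom_iff)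

lemma unit_left_faithful:
  assumes "f \<in> Arr C" "g \<in> Arr C" "Dom C f = Dom C g" "Cod C f = Cod C g" "\<one> \<I> \<otimes> f = \<one> \<I> \<otimes> g"
  shows "f = g"
  by (rule iso_cancel_right[of "\<l> (Dom C f)"])
    (use assms lunit_nat[of f] lunit_nat[of g] in auto)

lemma unit_right_faithful:
  assumes "f \<in> Arr C" "g \<in> Arr C" "Dom C f = Dom C g" "Cod C f = Cod C g" "f \<otimes> \<one> \<I> = g \<otimes> \<one> \<I>"
  shows "f = g"
  by (rule iso_cancel_right[of "\<r> (Dom C f)"])
    (use assms runit_nat[of f] runit_nat[of g] in auto)

lemma left_comp: "[|f \<in> Arr C; g \<in> Arr C; Dom C g = Cod C f; M \<in> Obj C|] ==>
    \<one> M \<otimes> (g \<cdot> f) = (\<one> M \<otimes> g) \<cdot> (\<one> M \<otimes> f)"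
  by (simp add: interchange)

lemma right_comp: "[|f \<in> Arr C; g \<in> Arr C; Dom C g = Cod C f; M \<in> Obj C|] ==>
    (g \<cdot> f) \<otimes> \<one> M = (g \<otimes> \<one> M) \<cdot> (f \<otimes> \<one> M)"
  by (simp add: interchange)

text \<open>The unit laws of Kelly, which the pentagon and the triangle imply.\<close>

lemma lunit_tensor:
  assumes [simp]: "X \<in> Obj C" "Y \<in> Obj C"
  shows "\<l> (X \<boxtimes> Y) \<cdot> \<a> \<I> X Y = \<l> X \<otimes> \<one> Y"
proof (rule unit_left_faithful)
  show "\<one> \<I> \<otimes> (\<l> (X \<boxtimes> Y) \<cdot> \<a> \<I> X Y) = \<one> \<I> \<otimes> (\<l> X \<otimes> \<one> Y)"
  proof (rule iso_cancel_right[of "\<a> \<I> (\<I> \<boxtimes> X) Y \<cdot> (\<a> \<I> \<I> X \<otimes> \<one> Y)"])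
    have "(\<one> \<I> \<otimes> (\<l> (X \<boxtimes> Y) \<cdot> \<a> \<I> X Y)) \<cdot> \<a> \<I> (\<I> \<boxtimes> X) Y \<cdot> (\<a> \<I> \<I> X \<otimes> \<one> Y) =
      (\<one> \<I> \<otimes> \<l> (X \<boxtimes> Y)) \<cdot> (\<one> \<I> \<otimes> \<a> \<I> X Y) \<cdot> \<a> \<I> (\<I> \<boxtimes> X) Y \<cdot> (\<a> \<I> \<I> X \<otimes> \<one> Y)"
      by (simp add: left_comp)
    also have "... = (\<one> \<I> \<otimes> \<l> (X \<boxtimes> Y)) \<cdot> \<a> \<I> \<I> (X \<boxtimes> Y) \<cdot> \<a> (\<I> \<boxtimes> \<I>) X Y"
      by (simp add: pentagon)
    also have "... = (\<r> \<I> \<otimes> \<one> X \<otimes> \<one> Y) \<cdot> \<a> (\<I> \<boxtimes> \<I>) X Y"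
      by (subst comp_reduce[OF triangle]) auto
    also have "... = \<a> \<I> X Y \<cdot> (((\<one> \<I> \<otimes> \<l> X) \<cdot> \<a> \<I> \<I> X) \<otimes> \<one> Y)"
      using assoc_nat[of "\<r> \<I>" "\<one> X" "\<one> Y" \<I> X Y] by (simp add: triangle)
    also have "... = \<a> \<I> X Y \<cdot> ((\<one> \<I> \<otimes> \<l> X) \<otimes> \<one> Y) \<cdot> (\<a> \<I> \<I> X \<otimes> \<one> Y)"
      by (simp add: right_comp)
    also have "... = (\<one> \<I> \<otimes> \<l> X \<otimes> \<one> Y) \<cdot> \<a> \<I> (\<I> \<boxtimes> X) Y \<cdot> (\<a> \<I> \<I> X \<otimes> \<one> Y)"
      by (subst comp_reduce[OF assoc_nat]) auto
    finally show "(\<one> \<I> \<otimes> (\<l> (X \<boxtimes> Y) \<cdot> \<a> \<I> X Y)) \<cdot> \<a> \<I> (\<I> \<boxtimes> X) Y \<cdot> (\<a> \<I> \<I> X \<otimes> \<one> Y) =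
      (\<one> \<I> \<otimes> \<l> X \<otimes> \<one> Y) \<cdot> \<a> \<I> (\<I> \<boxtimes> X) Y \<cdot> (\<a> \<I> \<I> X \<otimes> \<one> Y)" .
  qed auto
qed auto

lemma runit_tensor:
  assumes [simp]: "X \<in> Obj C" "Y \<in> Obj C"
  shows "(\<one> X \<otimes> \<r> Y) \<cdot> \<a> X Y \<I> = \<r> (X \<boxtimes> Y)"
proof (rule unit_right_faithful)
  show "((\<one> X \<otimes> \<r> Y) \<cdot> \<a> X Y \<I>) \<otimes> \<one> \<I> = \<r> (X \<boxtimes> Y) \<otimes> \<one> \<I>"
  proof (rule iso_cancel_left[of "\<a> X Y \<I>"])
    have "\<a> X Y \<I> \<cdot> (\<r> (X \<boxtimes> Y) \<otimes> \<one> \<I>) = \<a> X Y \<I> \<cdot> ((\<one> X \<otimes> \<one> Y) \<otimes> \<l> \<I>) \<cdot> \<a> (X \<boxtimes> Y) \<I> \<I>"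
      by (simp add: triangle)
    also have "... = (\<one> X \<otimes> \<one> Y \<otimes> \<l> \<I>) \<cdot> \<a> X Y (\<I> \<boxtimes> \<I>) \<cdot> \<a> (X \<boxtimes> Y) \<I> \<I>"
      by (subst comp_reduce[OF assoc_nat]) auto
    also have "... = (\<one> X \<otimes> \<one> Y \<otimes> \<l> \<I>) \<cdot> (\<one> X \<otimes> \<a> Y \<I> \<I>) \<cdot> \<a> X (Y \<boxtimes> \<I>) \<I> \<cdot> (\<a> X Y \<I> \<otimes> \<one> \<I>)"
      by (simp add: pentagon)
    also have "... = (\<one> X \<otimes> \<r> Y \<otimes> \<one> \<I>) \<cdot> \<a> X (Y \<boxtimes> \<I>) \<I> \<cdot> (\<a> X Y \<I> \<otimes> \<one> \<I>)"
      by (subst interchange_re) (simp_all add: triangle)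
    also have "... = \<a> X Y \<I> \<cdot> ((\<one> X \<otimes> \<r> Y) \<otimes> \<one> \<I>) \<cdot> (\<a> X Y \<I> \<otimes> \<one> \<I>)"
      by (subst comp_reduce[OF assoc_nat]) auto
    finally show "\<a> X Y \<I> \<cdot> (((\<one> X \<otimes> \<r> Y) \<cdot> \<a> X Y \<I>) \<otimes> \<one> \<I>) = \<a> X Y \<I> \<cdot> (\<r> (X \<boxtimes> Y) \<otimes> \<one> \<I>)"
      by (simp add: right_comp)
  qed auto
qed auto

lemma lunit_braid:
  assumes [simp]: "X \<in> Obj C" shows "\<l> X \<cdot> \<c> X \<I> = \<r> X"
proof (rule unit_right_faithful)
  show "(\<l> X \<cdot> \<c> X \<I>) \<otimes> \<one> \<I> = \<r> X \<otimes> \<one> \<I>"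
  proof (rule iso_cancel_left[of "\<c> X \<I>"])
    have "\<c> X \<I> \<cdot> ((\<l> X \<cdot> \<c> X \<I>) \<otimes> \<one> \<I>) = \<c> X \<I> \<cdot> (\<l> X \<otimes> \<one> \<I>) \<cdot> (\<c> X \<I> \<otimes> \<one> \<I>)"
      by (simp add: right_comp)
    also have "... = (\<c> X \<I> \<cdot> \<l> (X \<boxtimes> \<I>)) \<cdot> \<a> \<I> X \<I> \<cdot> (\<c> X \<I> \<otimes> \<one> \<I>)"
      by (simp add: comp_reduce[OF lunit_tensor])
    also have "... = (\<l> (\<I> \<boxtimes> X) \<cdot> (\<one> \<I> \<otimes> \<c> X \<I>)) \<cdot> \<a> \<I> X \<I> \<cdot> (\<c> X \<I> \<otimes> \<one> \<I>)"
      using lunit_nat[of "\<c> X \<I>"] by simp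
    also have "... = \<l> (\<I> \<boxtimes> X) \<cdot> \<a> \<I> \<I> X \<cdot> \<c> X (\<I> \<boxtimes> \<I>) \<cdot> \<a> X \<I> \<I>"
      using hexagon[of X \<I> \<I>] by simp
    also have "... = (\<l> \<I> \<otimes> \<one> X) \<cdot> \<c> X (\<I> \<boxtimes> \<I>) \<cdot> \<a> X \<I> \<I>"
      by (simp add: comp_reduce[OF lunit_tensor])
    also have "... = \<c> X \<I> \<cdot> (\<one> X \<otimes> \<l> \<I>) \<cdot> \<a> X \<I> \<I>"
      by (subst comp_reduce[OF braid_nat]) auto
    finally show "\<c> X \<I> \<cdot> ((\<l> X \<cdot> \<c> X \<I>) \<otimes> \<one> \<I>) = \<c> X \<I> \<cdot> (\<r> X \<otimes> \<one> \<I>)"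
      by (simp add: triangle)
  qed auto
qed auto

lemma runit_braid:
  assumes [simp]: "X \<in> Obj C" shows "\<r> X \<cdot> \<c> \<I> X = \<l> X"
  using iso_move_right[OF _ _ _ lunit_braid[of X]] by simp

lemma lunit_unit: "\<l> \<I> = \<r> \<I>"
proof (rule unit_right_faithful)
  have "\<l> \<I> \<cdot> (\<one> \<I> \<otimes> \<l> \<I>) = \<l> \<I> \<cdot> \<l> (\<I> \<boxtimes> \<I>)" using lunit_nat[of "\<l> \<I>"] by simp
  then have "\<one> \<I> \<otimes> \<l> \<I> = \<l> (\<I> \<boxtimes> \<I>)" by (rule iso_cancel_left[rotated -1]) simp_all
  then show "\<l> \<I> \<otimes> \<one> \<I> = \<r> \<I> \<otimes> \<one> \<I>" using lunit_tensor[of \<I> \<I>] triangle[of \<I> \<I>] by simp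
qed auto

end

lemma cocomm_coalgebra_iff:
  "cocomm_coalgebra C T (X, \<Delta>, \<eta>) \<longleftrightarrow>
     X \<in> Obj C \<and> \<Delta> \<in> Hom C X (TO T X X) \<and> \<eta> \<in> Hom C X (TI T) \<and>
     Comp C (Assoc T X X X) (Comp C (TA T \<Delta> (Id C X)) \<Delta>) = Comp C (TA T (Id C X) \<Delta>) \<Delta> \<and>
     Comp C (LUnit T X) (Comp C (TA T \<eta> (Id C X)) \<Delta>) = Id C X \<and>
     Comp C (RUnit T X) (Comp C (TA T (Id C X) \<eta>) \<Delta>) = Id C X \<and>
     Comp C (Braid T X X) \<Delta> = \<Delta>"
  by (simp add: cocomm_coalgebra_def)

text \<open>The right counit law is the left one composed with the braiding.\<close>

lemma (in sym_mon_cat) cocomm_coalgebraI: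
  assumes "X \<in> Obj C" "\<Delta> \<in> Hom C X (X \<boxtimes> X)" "\<eta> \<in> Hom C X \<I>" "\<a> X X X \<cdot> (\<Delta> \<otimes> \<one> X) \<cdot> \<Delta> = (\<one> X \<otimes> \<Delta>) \<cdot> \<Delta>"
    "\<l> X \<cdot> (\<eta> \<otimes> \<one> X) \<cdot> \<Delta> = \<one> X" "\<c> X X \<cdot> \<Delta> = \<Delta>"
  shows "cocomm_coalgebra C T (X, \<Delta>, \<eta>)"
proof -
  have "\<r> X \<cdot> (\<one> X \<otimes> \<eta>) \<cdot> \<Delta> = \<r> X \<cdot> ((\<one> X \<otimes> \<eta>) \<cdot> \<c> X X) \<cdot> \<Delta>"
    using assms by (simp add: Hom_iff)
  also have "(\<one> X \<otimes> \<eta>) \<cdot> \<c> X X = \<c> \<I> X \<cdot> (\<eta> \<otimes> \<one> X)" using assms by (simp add: Hom_iff braid_nat)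
  also have "\<r> X \<cdot> (\<c> \<I> X \<cdot> (\<eta> \<otimes> \<one> X)) \<cdot> \<Delta> = \<one> X"
    using assms comp_reduce[OF runit_braid[of X], of "(\<eta> \<otimes> \<one> X) \<cdot> \<Delta>"] by (simp add: Hom_iff)
  finally show ?thesis using assms by (simp add: cocomm_coalgebra_iff)
qed

text \<open>The right unit law is the left one composed with the braiding.\<close>

lemma strong_sym_mon_functorI:
  assumes "sym_mon_cat C T" "sym_mon_cat D T'" "cfunctor C D F" "\<mu> \<in> extensional (Obj C \<times> Obj C)"
    and hom: "\<And>X Y. X \<in> Obj C ==> Y \<in> Obj C ==>
      \<mu> (X, Y) \<in> Hom D (TO T' (FO F X) (FO F Y)) (FO F (TO T X Y)) \<and> iso_arr D (\<mu> (X, Y))"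
    and nat: "\<And>f g. f \<in> Arr C ==> g \<in> Arr C ==>
      \<mu> (Cod C f, Cod C g) \<cdot>\<^sub>D TA T' (FA F f) (FA F g) = FA F (TA T f g) \<cdot>\<^sub>D \<mu> (Dom C f, Dom C g)"
    and eps: "\<epsilon> \<in> Hom D (TI T') (FO F (TI T))" "iso_arr D \<epsilon>"
    and assoc: "\<And>X Y Z. [|X \<in> Obj C; Y \<in> Obj C; Z \<in> Obj C|] ==>
      FA F (Assoc T X Y Z) \<cdot>\<^sub>D \<mu> (TO T X Y, Z) \<cdot>\<^sub>D TA T' (\<mu> (X, Y)) (Id D (FO F Z)) =
      \<mu> (X, TO T Y Z) \<cdot>\<^sub>D TA T' (Id D (FO F X)) (\<mu> (Y, Z)) \<cdot>\<^sub>D Assoc T' (FO F X) (FO F Y) (FO F Z)"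
    and lunit: "\<And>X. X \<in> Obj C ==>
      FA F (LUnit T X) \<cdot>\<^sub>D \<mu> (TI T, X) \<cdot>\<^sub>D TA T' \<epsilon> (Id D (FO F X)) = LUnit T' (FO F X)"
    and braid: "\<And>X Y. X \<in> Obj C ==> Y \<in> Obj C ==>
      FA F (Braid T X Y) \<cdot>\<^sub>D \<mu> (X, Y) = \<mu> (Y, X) \<cdot>\<^sub>D Braid T' (FO F X) (FO F Y)"
  shows "strong_sym_mon_functor C T D T' F \<mu> \<epsilon>"
proof -
  interpret S: sym_mon_cat C T by fact
  interpret T: sym_mon_cat D T' by fact
  interpret cfunctor C D F by fact
  show ?thesis
  proof (unfold_locales, goal_cases)
    case (9 X)
    let ?X = "FO F X" and ?i = "Id D (FO F X)"
    have [simp]: "X \<in> Obj C" by fact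
    have e [simp]: "\<epsilon> \<in> Arr D" "Dom D \<epsilon> = TI T'" "Cod D \<epsilon> = FO F (TI T)" using eps by (auto simp: Hom_iff)
    have m [simp]: "\<mu> (Y, Z) \<in> Arr D" "Dom D (\<mu> (Y, Z)) = TO T' (FO F Y) (FO F Z)" "Cod D (\<mu> (Y, Z)) = FO F (TO T Y Z)"
      if "Y \<in> Obj C" "Z \<in> Obj C" for Y Z using hom[OF that] by (auto simp: Hom_iff)
    have "FA F (RUnit T X) \<cdot>\<^sub>D \<mu> (X, TI T) \<cdot>\<^sub>D TA T' ?i \<epsilon> =
      FA F (LUnit T X) \<cdot>\<^sub>D (FA F (Braid T X (TI T)) \<cdot>\<^sub>D \<mu> (X, TI T)) \<cdot>\<^sub>D TA T' ?i \<epsilon>"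
      by (simp add: FA_comp_simp flip: S.lunit_braid)
    also have "... = FA F (LUnit T X) \<cdot>\<^sub>D \<mu> (TI T, X) \<cdot>\<^sub>D TA T' \<epsilon> ?i \<cdot>\<^sub>D Braid T' ?X (TI T')"
      by (simp add: braid T.braid_nat)
    also have "... = (FA F (LUnit T X) \<cdot>\<^sub>D \<mu> (TI T, X) \<cdot>\<^sub>D TA T' \<epsilon> ?i) \<cdot>\<^sub>D Braid T' ?X (TI T')" by simp
    also have "... = RUnit T' ?X" by (simp only: lunit[OF 9] T.lunit_braid functor_simps 9)
    finally show ?case .
  qed (use assms in "auto simp: Hom_iff")
qed

context strong_sym_mon_functor begin

lemma mu_simps [simp]:
  "[|X \<in> Obj C; Y \<in> Obj C|] ==> iso_arr D (\<mu> (X, Y))"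
  "[|X \<in> Obj C; Y \<in> Obj C|] ==> Dom D (\<mu> (X, Y)) = TO T' (FO F X) (FO F Y)"
  "[|X \<in> Obj C; Y \<in> Obj C|] ==> Cod D (\<mu> (X, Y)) = FO F (TO T X Y)"
  "iso_arr D \<epsilon>" "Dom D \<epsilon> = TI T'" "Cod D \<epsilon> = FO F (TI T)"
  using mu_hom mu_iso eps_hom eps_iso by (auto simp: Hom_iff)

lemma mu_arr [simp]: "[|X \<in> Obj C; Y \<in> Obj C|] ==> \<mu> (X, Y) \<in> Arr D" "\<epsilon> \<in> Arr D"
  by auto

lemma mu_nat:
  "[|f \<in> Arr C; g \<in> Arr C; X = Cod C f; Y = Cod C g|] ==>
    \<mu> (X, Y) \<cdot>\<^sub>D TA T' (FA F f) (FA F g) = FA F (TA T f g) \<cdot>\<^sub>D \<mu> (Dom C f, Dom C g)"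
  using mu_natural by (auto simp: Hom_iff)

lemma mu_inv_nat:
  assumes [simp]: "f \<in> Arr C" "g \<in> Arr C" "X = Cod C f" "Y = Cod C g"
  shows "inv_arr D (\<mu> (X, Y)) \<cdot>\<^sub>D FA F (TA T f g) = TA T' (FA F f) (FA F g) \<cdot>\<^sub>D inv_arr D (\<mu> (Dom C f, Dom C g))"
  by (rule T.iso_cancel_right[of "\<mu> (Dom C f, Dom C g)"]) (simp_all flip: mu_nat)

lemma image_coalgebra:
  assumes "cocomm_coalgebra C T (X, \<Delta>, \<eta>)"
  shows "cocomm_coalgebra D T' (FO F X, inv_arr D (\<mu> (X, X)) \<cdot>\<^sub>D FA F \<Delta>, inv_arr D \<epsilon> \<cdot>\<^sub>D FA F \<eta>)"
proof -
  note c = assms[unfolded cocomm_coalgebra_iff Hom_iff]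
  have [simp]: "X \<in> Obj C" "\<Delta> \<in> Arr C" "Dom C \<Delta> = X" "Cod C \<Delta> = TO T X X"
    "\<eta> \<in> Arr C" "Dom C \<eta> = X" "Cod C \<eta> = TI T" using c by auto
  let ?\<mu> = "\<mu> (X, X)" and ?F = "FA F" and ?X = "FO F X" and ?i = "Id D (FO F X)"
  let ?D = "inv_arr D ?\<mu> \<cdot>\<^sub>D ?F \<Delta>" and ?e = "inv_arr D \<epsilon> \<cdot>\<^sub>D ?F \<eta>"
  note simps = T.right_comp T.left_comp FA_comp_simp[symmetric] T.inv_tensor
  have \<mu>D: "?\<mu> \<cdot>\<^sub>D ?D = ?F \<Delta>" by simp
  have ee: "\<epsilon> \<cdot>\<^sub>D ?e = ?F \<eta>" by simp
  have 1: "\<mu> (TO T X X, X) \<cdot>\<^sub>D TA T' ?\<mu> ?i \<cdot>\<^sub>D TA T' ?D ?i \<cdot>\<^sub>D ?D = ?F (TA T \<Delta> (Id C X) \<cdot>\<^sub>C \<Delta>)"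
  proof -
    have "TA T' ?\<mu> ?i \<cdot>\<^sub>D TA T' ?D ?i \<cdot>\<^sub>D ?D = TA T' (?F \<Delta>) (?F (Id C X)) \<cdot>\<^sub>D ?D"
      by (subst T.interchange_re) simp_all
    then show ?thesis using T.comp_reduce[OF mu_nat[of \<Delta> "Id C X" "TO T X X" X], of ?D]
      by (simp add: FA_comp_simp)
  qed
  have 2: "\<mu> (X, TO T X X) \<cdot>\<^sub>D TA T' ?i ?\<mu> \<cdot>\<^sub>D TA T' ?i ?D \<cdot>\<^sub>D ?D = ?F (TA T (Id C X) \<Delta> \<cdot>\<^sub>C \<Delta>)"
  proof -
    have "TA T' ?i ?\<mu> \<cdot>\<^sub>D TA T' ?i ?D \<cdot>\<^sub>D ?D = TA T' (?F (Id C X)) (?F \<Delta>) \<cdot>\<^sub>D ?D"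
      by (subst T.interchange_re) simp_all
    then show ?thesis using T.comp_reduce[OF mu_nat[of "Id C X" \<Delta> X "TO T X X"], of ?D]
      by (simp add: FA_comp_simp)
  qed
  have as: "Assoc T' ?X ?X ?X \<cdot>\<^sub>D TA T' ?D ?i \<cdot>\<^sub>D ?D = TA T' ?i ?D \<cdot>\<^sub>D ?D"
  proof (rule T.iso_cancel_left[of "\<mu> (X, TO T X X) \<cdot>\<^sub>D TA T' ?i ?\<mu>"])
    have "(\<mu> (X, TO T X X) \<cdot>\<^sub>D TA T' ?i ?\<mu>) \<cdot>\<^sub>D Assoc T' ?X ?X ?X \<cdot>\<^sub>D TA T' ?D ?i \<cdot>\<^sub>D ?D =
      (\<mu> (X, TO T X X) \<cdot>\<^sub>D TA T' ?i ?\<mu> \<cdot>\<^sub>D Assoc T' ?X ?X ?X) \<cdot>\<^sub>D TA T' ?D ?i \<cdot>\<^sub>D ?D" by simp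
    also have "... = ?F (Assoc T X X X) \<cdot>\<^sub>D \<mu> (TO T X X, X) \<cdot>\<^sub>D TA T' ?\<mu> ?i \<cdot>\<^sub>D TA T' ?D ?i \<cdot>\<^sub>D ?D"
      by (subst mu_assoc[symmetric]) simp_all
    also have "... = ?F (Assoc T X X X) \<cdot>\<^sub>D ?F (TA T \<Delta> (Id C X) \<cdot>\<^sub>C \<Delta>)" by (simp only: 1)
    also have "... = ?F (TA T (Id C X) \<Delta> \<cdot>\<^sub>C \<Delta>)" using c by (simp flip: FA_comp_simp)
    finally show "(\<mu> (X, TO T X X) \<cdot>\<^sub>D TA T' ?i ?\<mu>) \<cdot>\<^sub>D Assoc T' ?X ?X ?X \<cdot>\<^sub>D TA T' ?D ?i \<cdot>\<^sub>D ?D =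
       (\<mu> (X, TO T X X) \<cdot>\<^sub>D TA T' ?i ?\<mu>) \<cdot>\<^sub>D TA T' ?i ?D \<cdot>\<^sub>D ?D"
      using 2 by simp
  qed simp_all
  have lu: "LUnit T' ?X \<cdot>\<^sub>D TA T' ?e ?i \<cdot>\<^sub>D ?D = ?i"
  proof -
    have "LUnit T' ?X \<cdot>\<^sub>D TA T' ?e ?i \<cdot>\<^sub>D ?D =
      ?F (LUnit T X) \<cdot>\<^sub>D \<mu> (TI T, X) \<cdot>\<^sub>D TA T' \<epsilon> ?i \<cdot>\<^sub>D TA T' ?e ?i \<cdot>\<^sub>D ?D"
      by (subst mu_lunit[symmetric]) simp_all
    also have "TA T' \<epsilon> ?i \<cdot>\<^sub>D TA T' ?e ?i \<cdot>\<^sub>D ?D = TA T' (?F \<eta>) (?F (Id C X)) \<cdot>\<^sub>D ?D"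
      by (subst T.interchange_re) simp_all
    also have "?F (LUnit T X) \<cdot>\<^sub>D \<mu> (TI T, X) \<cdot>\<^sub>D TA T' (?F \<eta>) (?F (Id C X)) \<cdot>\<^sub>D ?D =
      ?F (LUnit T X \<cdot>\<^sub>C TA T \<eta> (Id C X) \<cdot>\<^sub>C \<Delta>)"
      using T.comp_reduce[OF mu_nat[of \<eta> "Id C X" "TI T" X], of ?D] by (simp add: FA_comp_simp)
    finally show ?thesis using c by simp
  qed
  have br: "Braid T' ?X ?X \<cdot>\<^sub>D ?D = ?D"
  proof (rule T.iso_cancel_left[of ?\<mu>])
    have "?\<mu> \<cdot>\<^sub>D Braid T' ?X ?X \<cdot>\<^sub>D ?D = ?F (Braid T X X) \<cdot>\<^sub>D ?F \<Delta>"
      using T.comp_reduce[OF mu_braid[symmetric], of X X ?D] by simp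
    then show "?\<mu> \<cdot>\<^sub>D Braid T' ?X ?X \<cdot>\<^sub>D ?D = ?\<mu> \<cdot>\<^sub>D ?D"
      using c by (simp flip: FA_comp_simp)
  qed simp_all
  show ?thesis by (rule T.cocomm_coalgebraI) (use as lu br in "simp_all add: Hom_iff")
qed

end

lemma strong_sym_mon_functor_comp:
  assumes F: "strong_sym_mon_functor C T D T' F \<mu> \<epsilon>" and G: "strong_sym_mon_functor D T' E T'' G \<nu> \<zeta>"
  shows "strong_sym_mon_functor C T E T'' (compf C F G)
    (\<lambda>(X, Y)\<in>Obj C \<times> Obj C. FA G (\<mu> (X, Y)) \<cdot>\<^sub>E \<nu> (FO F X, FO F Y)) (FA G \<epsilon> \<cdot>\<^sub>E \<zeta>)"
proof -
  interpret F: strong_sym_mon_functor C T D T' F \<mu> \<epsilon> by fact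
  interpret G: strong_sym_mon_functor D T' E T'' G \<nu> \<zeta> by fact
  interpret GF: cfunctor C E "compf C F G" by (rule cfunctor_compf) unfold_locales
  show ?thesis
  proof (rule strong_sym_mon_functorI, goal_cases)
    case (6 f g)
    note [simp] = this
    let ?X = "Dom C f" and ?Y = "Dom C g" and ?X' = "Cod C f" and ?Y' = "Cod C g"
    have "FA G (\<mu> (?X', ?Y')) \<cdot>\<^sub>E \<nu> (FO F ?X', FO F ?Y') \<cdot>\<^sub>E TA T'' (FA G (FA F f)) (FA G (FA F g)) =
      FA G (\<mu> (?X', ?Y') \<cdot>\<^sub>D TA T' (FA F f) (FA F g)) \<cdot>\<^sub>E \<nu> (FO F ?X, FO F ?Y)"
      using G.mu_nat[of "FA F f" "FA F g" "FO F ?X'" "FO F ?Y'"] by (simp add: G.FA_comp_simp)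
    also have "... = FA G (FA F (TA T f g)) \<cdot>\<^sub>E FA G (\<mu> (?X, ?Y)) \<cdot>\<^sub>E \<nu> (FO F ?X, FO F ?Y)"
      by (simp add: F.mu_nat G.FA_comp_simp)
    finally show ?case by simp
  next
    case (9 X Y Z)
    note [simp] = this
    let ?X = "FO F X" and ?Y = "FO F Y" and ?Z = "FO F Z"
    have "FA G (FA F (Assoc T X Y Z)) \<cdot>\<^sub>E (FA G (\<mu> (TO T X Y, Z)) \<cdot>\<^sub>E \<nu> (FO F (TO T X Y), ?Z)) \<cdot>\<^sub>E
        TA T'' (FA G (\<mu> (X, Y)) \<cdot>\<^sub>E \<nu> (?X, ?Y)) (Id E (FO G ?Z)) =
      FA G (FA F (Assoc T X Y Z) \<cdot>\<^sub>D \<mu> (TO T X Y, Z)) \<cdot>\<^sub>E (\<nu> (FO F (TO T X Y), ?Z) \<cdot>\<^sub>E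
        TA T'' (FA G (\<mu> (X, Y))) (FA G (Id D ?Z))) \<cdot>\<^sub>E TA T'' (\<nu> (?X, ?Y)) (Id E (FO G ?Z))"
      by (simp add: G.T.right_comp G.FA_comp_simp)
    also have "... = FA G (FA F (Assoc T X Y Z) \<cdot>\<^sub>D \<mu> (TO T X Y, Z) \<cdot>\<^sub>D TA T' (\<mu> (X, Y)) (Id D ?Z)) \<cdot>\<^sub>E
        \<nu> (TO T' ?X ?Y, ?Z) \<cdot>\<^sub>E TA T'' (\<nu> (?X, ?Y)) (Id E (FO G ?Z))"
      by (subst G.mu_nat) (simp_all add: G.FA_comp_simp)
    also have "... = FA G (\<mu> (X, TO T Y Z) \<cdot>\<^sub>D TA T' (Id D ?X) (\<mu> (Y, Z))) \<cdot>\<^sub>E FA G (Assoc T' ?X ?Y ?Z) \<cdot>\<^sub>E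
        \<nu> (TO T' ?X ?Y, ?Z) \<cdot>\<^sub>E TA T'' (\<nu> (?X, ?Y)) (Id E (FO G ?Z))"
      by (subst F.mu_assoc) (simp_all add: G.FA_comp_simp)
    also have "... = FA G (\<mu> (X, TO T Y Z)) \<cdot>\<^sub>E (FA G (TA T' (Id D ?X) (\<mu> (Y, Z))) \<cdot>\<^sub>E
        \<nu> (?X, TO T' ?Y ?Z)) \<cdot>\<^sub>E TA T'' (Id E (FO G ?X)) (\<nu> (?Y, ?Z)) \<cdot>\<^sub>E Assoc T'' (FO G ?X) (FO G ?Y) (FO G ?Z)"
      by (subst G.mu_assoc) (simp_all add: G.FA_comp_simp)
    also have "... = FA G (\<mu> (X, TO T Y Z)) \<cdot>\<^sub>E (\<nu> (?X, FO F (TO T Y Z)) \<cdot>\<^sub>E TA T'' (FA G (Id D ?X)) (FA G (\<mu> (Y, Z)))) \<cdot>\<^sub>E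
        TA T'' (Id E (FO G ?X)) (\<nu> (?Y, ?Z)) \<cdot>\<^sub>E Assoc T'' (FO G ?X) (FO G ?Y) (FO G ?Z)"
      by (subst G.mu_nat) simp_all
    finally show ?case by (simp add: G.T.left_comp)
  next
    case (10 X)
    note [simp] = this
    let ?X = "FO F X"
    have "FA G (FA F (LUnit T X)) \<cdot>\<^sub>E (FA G (\<mu> (TI T, X)) \<cdot>\<^sub>E \<nu> (FO F (TI T), ?X)) \<cdot>\<^sub>E
        TA T'' (FA G \<epsilon> \<cdot>\<^sub>E \<zeta>) (Id E (FO G ?X)) =
      FA G (FA F (LUnit T X) \<cdot>\<^sub>D \<mu> (TI T, X)) \<cdot>\<^sub>E (\<nu> (FO F (TI T), ?X) \<cdot>\<^sub>E
        TA T'' (FA G \<epsilon>) (FA G (Id D ?X))) \<cdot>\<^sub>E TA T'' \<zeta> (Id E (FO G ?X))"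
      by (simp add: G.T.right_comp G.FA_comp_simp)
    also have "... = FA G (FA F (LUnit T X) \<cdot>\<^sub>D \<mu> (TI T, X) \<cdot>\<^sub>D TA T' \<epsilon> (Id D ?X)) \<cdot>\<^sub>E
        \<nu> (TI T', ?X) \<cdot>\<^sub>E TA T'' \<zeta> (Id E (FO G ?X))"
      by (subst G.mu_nat) (simp_all add: G.FA_comp_simp)
    finally show ?case by (simp add: F.mu_lunit G.mu_lunit)
  next
    case (11 X Y)
    note [simp] = this
    have "FA G (FA F (Braid T X Y)) \<cdot>\<^sub>E FA G (\<mu> (X, Y)) \<cdot>\<^sub>E \<nu> (FO F X, FO F Y) =
      FA G (FA F (Braid T X Y) \<cdot>\<^sub>D \<mu> (X, Y)) \<cdot>\<^sub>E \<nu> (FO F X, FO F Y)"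
      by (simp add: G.FA_comp_simp)
    also have "... = (FA G (\<mu> (Y, X)) \<cdot>\<^sub>E \<nu> (FO F Y, FO F X)) \<cdot>\<^sub>E Braid T'' (FO G (FO F X)) (FO G (FO F Y))"
      by (simp add: F.mu_braid G.mu_braid G.FA_comp_simp)
    finally show ?case by simp
  qed (auto simp: Hom_iff G.FA_comp_simp F.S.sym_mon_cat_axioms G.T.sym_mon_cat_axioms GF.cfunctor_axioms)
qed

section \<open>Small sets\<close>

text \<open>
  A chosen injection into the universe, which copies a small set of any type to a subset of
  \<open>'u\<close>.
\<close>

definition code_of :: "'b set \<Rightarrow> 'b \<Rightarrow> 'u" where
  "code_of S = (SOME e. inj_on e S)"

definition decode :: "'b set \<Rightarrow> 'u \<Rightarrow> 'b" where
  "decode S = inv_into S (code_of S)"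

locale small_universe =
  fixes U :: "'u itself"
  assumes universe: "universe TYPE('u)"
begin

lemma small_leq: "|B| \<le>o |A| ==> small TYPE('u) A ==> small TYPE('u) B"
  unfolding small_def by (rule ordLeq_ordLess_trans)

lemma small_image: "small TYPE('u) A ==> small TYPE('u) (f ` A)"
  by (rule small_leq[OF card_of_image])

lemma small_subset: "B \<subseteq> A ==> small TYPE('u) A ==> small TYPE('u) B"
  by (rule small_leq[OF card_of_mono1])

lemma small_if_inj: "[|inj_on f A; f ` A \<subseteq> B; small TYPE('u) B|] ==> small TYPE('u) A"
  by (rule small_leq) (auto simp flip: card_of_ordLeq)

lemma inj_code: assumes "small TYPE('u) S" shows "inj_on (code_of S :: _ \<Rightarrow> 'u) S"
proof -
  have "\<exists>e :: _ \<Rightarrow> 'u. inj_on e S"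
    using ordLess_imp_ordLeq[OF assms[unfolded small_def]] by (auto simp flip: card_of_ordLeq)
  then show ?thesis unfolding code_of_def by (rule someI_ex)
qed

lemma decode_code [simp]: "small TYPE('u) S ==> x \<in> S ==> decode S (code_of S x :: 'u) = x"
  unfolding decode_def by (simp add: inj_code inv_into_f_f)

lemma code_eq_iff: "[|small TYPE('u) S; x \<in> S; y \<in> S|] ==> (code_of S x :: 'u) = code_of S y \<longleftrightarrow> x = y"
  by (metis decode_code)

lemma small_nat: "small TYPE('u) (UNIV :: nat set)"
  using universe by (simp add: universe_def)

lemma small_countable: "countable S ==> small TYPE('u) S"
  by (erule countableE) (rule small_if_inj[OF _ _ small_nat], auto)

lemma small_finite: "finite S ==> small TYPE('u) S"
  by (simp add: small_countable countable_finite)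

lemma infinite_u: "infinite (UNIV :: 'u set)"
  using small_nat unfolding small_def
  by (metis card_of_ordLeq_finite infinite_UNIV_nat ordLess_imp_ordLeq)

definition pr :: "'u \<times> 'u \<Rightarrow> 'u" where "pr = (SOME p. inj p)"

lemma inj_pr: "inj pr"
proof -
  have "|UNIV \<times> UNIV :: ('u \<times> 'u) set| \<le>o |UNIV :: 'u set|"
    using card_of_Times_same_infinite[OF infinite_u] ordIso_imp_ordLeq by blast
  then have "\<exists>p :: 'u \<times> 'u \<Rightarrow> 'u. inj p" by (auto simp flip: card_of_ordLeq)
  then show ?thesis unfolding pr_def by (rule someI_ex)
qed

lemma pr_eq [simp]: "pr p = pr q \<longleftrightarrow> p = q"
  using inj_pr by (auto dest: injD)

text \<open>
  The closure properties of a universe speak of its own subsets; they pass to all small sets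
  along \<open>code_of\<close>.
\<close>

lemma small_Pow: assumes "small TYPE('u) S" shows "small TYPE('u) (Pow S)"
proof -
  let ?e = "code_of S :: _ \<Rightarrow> 'u"
  have "small TYPE('u) (Pow (?e ` S))" using universe small_image[OF assms] by (auto simp: universe_def)
  moreover have "Pow S = (\<lambda>A. {x\<in>S. ?e x \<in> A}) ` Pow (?e ` S)"
  proof (intro equalityI subsetI)
    fix A assume A: "A \<in> Pow S"
    then have "A = {x\<in>S. ?e x \<in> ?e ` A}" using inj_code[OF assms] by (auto dest: inj_onD)
    then show "A \<in> (\<lambda>A. {x\<in>S. ?e x \<in> A}) ` Pow (?e ` S)" using A by blast
  qed auto
  ultimately show ?thesis using small_image[of "Pow (?e ` S)"] by simp
qed

lemma small_UN:
  assumes S: "small TYPE('u) S" and f: "\<And>x. x \<in> S ==> small TYPE('u) (f x)"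
  shows "small TYPE('u) (\<Union>x\<in>S. f x)"
proof -
  let ?e = "code_of S :: _ \<Rightarrow> 'u" and ?d = "decode S :: 'u \<Rightarrow> _"
  let ?A = "\<lambda>u. (\<lambda>y. pr (u, code_of (f (?d u)) y)) ` f (?d u)"
  have "small TYPE('u) (\<Union>u\<in>?e ` S. ?A u)"
  proof -
    have un: "small TYPE('u) (\<Union>x\<in>A. g x)" if "small TYPE('u) A" "\<forall>x\<in>A. small TYPE('u) (g x)" for A and g :: "'u \<Rightarrow> 'u set"
      using universe that by (simp add: universe_def)
    show ?thesis by (rule un) (use S f in "auto intro: small_image")
  qed
  moreover have "(\<Union>x\<in>S. f x) \<subseteq> (\<lambda>w. case inv pr w of (u, v) \<Rightarrow> decode (f (?d u)) v) ` (\<Union>u\<in>?e ` S. ?A u)"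
  proof
    fix y assume "y \<in> (\<Union>x\<in>S. f x)"
    then obtain x where x: "x \<in> S" "y \<in> f x" by blast
    have "y = (case inv pr (pr (?e x, code_of (f x) y)) of (u, v) \<Rightarrow> decode (f (?d u)) v)"
      using x S f by (simp add: inv_f_f inj_pr)
    moreover have "pr (?e x, code_of (f x) y) \<in> (\<Union>u\<in>?e ` S. ?A u)" using x S by auto
    ultimately show "y \<in> (\<lambda>w. case inv pr w of (u, v) \<Rightarrow> decode (f (?d u)) v) ` (\<Union>u\<in>?e ` S. ?A u)"
      by (rule image_eqI)
  qed
  ultimately show ?thesis by (rule small_subset[OF _ small_image, rotated])
qed

lemma small_Sigma: "small TYPE('u) S ==> (\<And>x. x \<in> S ==> small TYPE('u) (f x)) ==> small TYPE('u) (Sigma S f)"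
proof -
  assume "small TYPE('u) S" "\<And>x. x \<in> S ==> small TYPE('u) (f x)"
  moreover have "Sigma S f = (\<Union>x\<in>S. Pair x ` f x)" by auto
  ultimately show ?thesis by (simp add: small_UN small_image)
qed

lemma small_PiE:
  assumes "small TYPE('u) S" "\<And>x. x \<in> S ==> small TYPE('u) (f x)" shows "small TYPE('u) (PiE S f)"
proof (rule small_if_inj[of "\<lambda>g. (\<lambda>x. (x, g x)) ` S"])
  show "inj_on (\<lambda>g. (\<lambda>x. (x, g x)) ` S) (PiE S f)"
  proof (rule inj_onI)
    fix g h assume g: "g \<in> PiE S f" and h: "h \<in> PiE S f" and eq: "(\<lambda>x. (x, g x)) ` S = (\<lambda>x. (x, h x)) ` S"
    have "g x = h x" if "x \<in> S" for x
    proof -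
      have "(x, g x) \<in> (\<lambda>x. (x, h x)) ` S" using eq that by blast
      then show ?thesis by auto
    qed
    then show "g = h" using g h by (auto intro: PiE_ext)
  qed
  show "(\<lambda>g. (\<lambda>x. (x, g x)) ` S) ` PiE S f \<subseteq> Pow (Sigma S f)" by auto
  show "small TYPE('u) (Pow (Sigma S f))" using assms by (intro small_Pow small_Sigma) auto
qed

end

section \<open>The category of finite sets\<close>

definition nv :: "fin_map \<Rightarrow> nat \<Rightarrow> nat" where "nv \<phi> = fst (snd \<phi>)"

definition mkn :: "nat \<Rightarrow> (nat \<Rightarrow> nat) \<Rightarrow> nat \<Rightarrow> fin_map" where
  "mkn m f n = (m, restrict f {1..m}, n)"

lemma N_simps [simp]: "Obj NCat = UNIV" "Dom NCat \<phi> = fst \<phi>" "Cod NCat \<phi> = tgt \<phi>"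
  by (auto simp: NCat_def split: prod.splits)

lemma N_arr: "\<phi> \<in> Arr NCat \<longleftrightarrow> nv \<phi> \<in> {1..fst \<phi>} \<rightarrow>\<^sub>E {1..tgt \<phi>}"
  by (auto simp: NCat_def nv_def split: prod.splits)

lemma nv_range: "[|\<phi> \<in> Arr NCat; 1 \<le> i; i \<le> fst \<phi>|] ==> 1 \<le> nv \<phi> i \<and> nv \<phi> i \<le> tgt \<phi>"
  by (fastforce simp: N_arr dest: PiE_mem)

lemma N_ext:
  assumes "\<phi> \<in> Arr NCat" "\<psi> \<in> Arr NCat" "fst \<phi> = fst \<psi>" "tgt \<phi> = tgt \<psi>"
    "\<And>i. 1 \<le> i ==> i \<le> fst \<phi> ==> nv \<phi> i = nv \<psi> i"
  shows "\<phi> = \<psi>"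
proof -
  have "nv \<phi> = nv \<psi>"
    by (rule PiE_ext[of _ "{1..fst \<phi>}" "\<lambda>_. {1..tgt \<phi>}"]) (use assms in "auto simp: N_arr")
  then show ?thesis using assms(3,4) by (simp add: nv_def prod_eq_iff)
qed

lemma mkn_simps [simp]:
  "fst (mkn m f n) = m" "tgt (mkn m f n) = n" "1 \<le> i ==> i \<le> m ==> nv (mkn m f n) i = f i"
  by (auto simp: mkn_def nv_def)

lemma mkn_arr: "(\<And>i. 1 \<le> i ==> i \<le> m ==> 1 \<le> f i \<and> f i \<le> n) ==> mkn m f n \<in> Arr NCat"
  by (auto simp: N_arr mkn_def nv_def)

lemma N_id: "Id NCat n = mkn n (\<lambda>i. i) n"
  and N_comp: "Comp NCat \<psi> \<phi> = mkn (fst \<phi>) (\<lambda>i. nv \<psi> (nv \<phi> i)) (tgt \<psi>)"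
  by (auto simp: NCat_def mkn_def nv_def split: prod.splits)

lemma category_N: "category NCat"
proof unfold_locales
  show "Comp NCat h (Comp NCat g f) = Comp NCat (Comp NCat h g) f"
    if "f \<in> Hom NCat W X" "g \<in> Hom NCat X Y" "h \<in> Hom NCat Y Z" for f g h W X Y Z
    using that by (auto simp: Hom_iff N_comp nv_range mkn_def nv_def restrict_def fun_eq_iff)
       (use nv_range[of f] in "auto simp: nv_def")
  show "Comp NCat g f \<in> Hom NCat X Z" if "f \<in> Hom NCat X Y" "g \<in> Hom NCat Y Z" for f g X Y Z
    using that by (auto simp: Hom_iff N_comp nv_range intro!: mkn_arr)
       (use nv_range[of f] nv_range[of g] in "auto")
  show "Comp NCat f (Id NCat X) = f" if "f \<in> Hom NCat X Y" for f X Y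
    using that by (auto simp: Hom_iff N_comp N_id intro!: N_ext mkn_arr) (use nv_range[of f] in auto)
  show "Comp NCat (Id NCat Y) f = f" if "f \<in> Hom NCat X Y" for f X Y
    using that by (auto simp: Hom_iff N_comp N_id intro!: N_ext mkn_arr) (use nv_range[of f] in auto)
qed (auto simp: Hom_iff N_id intro!: mkn_arr)

interpretation N: category NCat by (rule category_N)

lemma nv_comp [simp]:
  "[|\<phi> \<in> Arr NCat; 1 \<le> i; i \<le> fst \<phi>|] ==> nv (Comp NCat \<psi> \<phi>) i = nv \<psi> (nv \<phi> i)"
  by (simp add: N_comp)

lemma nv_id [simp]: "1 \<le> i ==> i \<le> n ==> nv (Id NCat n) i = i"
  by (simp add: N_id)

lemma N_comp_simps [simp]: "fst (Comp NCat \<psi> \<phi>) = fst \<phi>" "tgt (Comp NCat \<psi> \<phi>) = tgt \<psi>"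
  "fst (Id NCat n) = n" "tgt (Id NCat n) = n"
  by (simp_all add: N_comp N_id)

lemma N_comp_arr [simp]: "[|\<phi> \<in> Arr NCat; \<psi> \<in> Arr NCat; fst \<psi> = tgt \<phi>|] ==> Comp NCat \<psi> \<phi> \<in> Arr NCat"
  "Id NCat n \<in> Arr NCat"
  by simp_all

lemma countable_N: "countable (Arr NCat)"
proof -
  have eq: "Arr NCat = (\<Union>m n. (\<lambda>f. (m, f, n)) ` ({1..m} \<rightarrow>\<^sub>E {1..n}))"
    by (auto simp: NCat_def)
  have "countable ((\<lambda>f. (m, f, n)) ` ({1..m} \<rightarrow>\<^sub>E {1..n}))" for m n :: nat
    by (intro countable_finite finite_imageI finite_PiE) auto
  then show ?thesis unfolding eq by (intro countable_UN) auto
qed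

section \<open>Functors from finite sets to small sets, elementwise\<close>

lemma set_app_simp [simp]: "set_app (S, f, T) = f"
  by (simp add: set_app_def)

lemma SET_simps [simp]: "Obj (SET :: ('u set, 'u set \<times> ('u \<Rightarrow> 'u) \<times> 'u set) cat) = {S. small TYPE('u) S}"
  "Dom SET a = fst a" "Cod SET a = tgt (a :: 'u set \<times> ('u \<Rightarrow> 'u) \<times> 'u set)"
  by (auto simp: SET_def split: prod.splits)

lemma SET_arr: "(a :: 'u set \<times> ('u \<Rightarrow> 'u) \<times> 'u set) \<in> Arr SET \<longleftrightarrow>
   small TYPE('u) (fst a) \<and> small TYPE('u) (tgt a) \<and> set_app a \<in> fst a \<rightarrow>\<^sub>E tgt a"
  by (auto simp: SET_def set_app_def split: prod.splits)

lemma SET_comp: "Comp SET b a = (fst a, (\<lambda>x\<in>fst a. set_app b (set_app a x)), tgt b)"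
  by (auto simp: SET_def set_app_def split: prod.splits)

lemma SET_id: "Id SET S = (S, (\<lambda>x\<in>S. x), S)"
  by (simp add: SET_def)

lemma SET_ext:
  assumes "a \<in> Arr SET" "b \<in> Arr SET" "fst a = fst b" "tgt a = tgt b"
    "\<And>x. x \<in> fst a ==> set_app a x = set_app b x"
  shows "a = b"
proof -
  have "set_app a = set_app b"
    by (rule PiE_ext[of _ "fst a" "\<lambda>_. tgt a"]) (use assms in "auto simp: SET_arr")
  then show ?thesis using assms(3,4) by (simp add: set_app_def prod_eq_iff)
qed

lemma set_app_mem: "a \<in> Arr SET ==> x \<in> fst a ==> set_app a x \<in> tgt a"
  by (auto simp: SET_arr dest: PiE_mem)

lemma category_SET: "category SET"
proof unfold_locales
  show "Comp SET g f \<in> Hom SET X Z" if "f \<in> Hom SET X Y" "g \<in> Hom SET Y Z" for f g X Y Z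
    using that set_app_mem[of f] set_app_mem[of g] by (auto simp: Hom_iff SET_comp SET_arr)
  show "Comp SET f (Id SET X) = f" if "f \<in> Hom SET X Y" for f X Y
    using that set_app_mem[of f] by (auto simp: Hom_iff SET_comp SET_id SET_arr intro!: SET_ext)
  show "Comp SET (Id SET Y) f = f" if "f \<in> Hom SET X Y" for f X Y
    using that set_app_mem[of f] by (auto simp: Hom_iff SET_comp SET_id SET_arr dest: PiE_mem intro!: SET_ext)
  show "Comp SET h (Comp SET g f) = Comp SET (Comp SET h g) f"
    if "f \<in> Hom SET W X" "g \<in> Hom SET X Y" "h \<in> Hom SET Y Z" for f g h W X Y Z
    using that set_app_mem[of f] by (auto simp: Hom_iff SET_comp)
qed (auto simp: Hom_iff SET_arr SET_id)

lemma nat_trans_comp: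
  assumes a: "nat_trans C D F G \<alpha>" and b: "nat_trans C D G H \<beta>"
  shows "nat_trans C D F H (\<lambda>X\<in>Obj C. \<beta> X \<cdot>\<^sub>D \<alpha> X)"
proof -
  interpret a: nat_trans C D F G \<alpha> by fact
  interpret b: nat_trans C D G H \<beta> by fact
  show ?thesis
  proof (rule nat_transI)
    fix f assume f: "f \<in> Arr C"
    have "(\<beta> (Cod C f) \<cdot>\<^sub>D \<alpha> (Cod C f)) \<cdot>\<^sub>D FA F f = \<beta> (Cod C f) \<cdot>\<^sub>D FA G f \<cdot>\<^sub>D \<alpha> (Dom C f)"
      using f a.naturality[OF f] by simp
    also have "... = FA H f \<cdot>\<^sub>D \<beta> (Dom C f) \<cdot>\<^sub>D \<alpha> (Dom C f)"
      using f by (simp add: a.F.T.comp_reduce[OF b.naturality])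
    finally show "(\<lambda>X\<in>Obj C. \<beta> X \<cdot>\<^sub>D \<alpha> X) (Cod C f) \<cdot>\<^sub>D FA F f = FA H f \<cdot>\<^sub>D (\<lambda>X\<in>Obj C. \<beta> X \<cdot>\<^sub>D \<alpha> X) (Dom C f)"
      using f by simp
  qed (auto simp: a.F.cfunctor_axioms b.G.cfunctor_axioms Hom_iff)
qed

lemma nat_trans_id:
  assumes "cfunctor C D F" shows "nat_trans C D F F (\<lambda>X\<in>Obj C. Id D (FO F X))"
proof -
  interpret cfunctor C D F by fact
  show ?thesis by (rule nat_transI) (auto simp: cfunctor_axioms Hom_iff)
qed

lemma category_Funct: assumes "category C" "category D" shows "category (Funct C D)"
proof -
  interpret C: category C by fact
  interpret D: category D by fact
  have e: "\<alpha> X \<in> Hom D (FO F X) (FO G X)" "\<alpha> \<in> extensional (Obj C)"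
    if "nat_trans C D F G \<alpha>" "X \<in> Obj C" for F G \<alpha> X
    using that nat_trans.hom nat_trans.ext by metis+
  show ?thesis
  proof unfold_locales
    show "Comp (Funct C D) f (Id (Funct C D) X) = f" if hom: "f \<in> Hom (Funct C D) X Y" for f X Y
    proof -
      obtain \<alpha> where f: "f = (X, \<alpha>, Y)" and n: "nat_trans C D X Y \<alpha>"
        by (cases f) (use hom in "auto simp: Hom_iff Funct_def")
      interpret n: nat_trans C D X Y \<alpha> by fact
      show ?thesis using n.ext by (auto simp: f Funct_def restrict_def extensional_def fun_eq_iff)
    qed
    show "Comp (Funct C D) (Id (Funct C D) Y) f = f" if hom: "f \<in> Hom (Funct C D) X Y" for f X Y
    proof -
      obtain \<alpha> where f: "f = (X, \<alpha>, Y)" and n: "nat_trans C D X Y \<alpha>"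
        by (cases f) (use hom in "auto simp: Hom_iff Funct_def")
      interpret n: nat_trans C D X Y \<alpha> by fact
      show ?thesis using n.ext by (auto simp: f Funct_def restrict_def extensional_def fun_eq_iff)
    qed
    show "Comp (Funct C D) h (Comp (Funct C D) g f) = Comp (Funct C D) (Comp (Funct C D) h g) f"
      if hom: "f \<in> Hom (Funct C D) W X" "g \<in> Hom (Funct C D) X Y" "h \<in> Hom (Funct C D) Y Z" for f g h W X Y Z
    proof -
      obtain \<alpha> \<beta> \<gamma> where f: "f = (W, \<alpha>, X)" "g = (X, \<beta>, Y)" "h = (Y, \<gamma>, Z)"
        and n: "nat_trans C D W X \<alpha>" "nat_trans C D X Y \<beta>" "nat_trans C D Y Z \<gamma>"
        by (cases f, cases g, cases h) (use hom in "auto simp: Hom_iff Funct_def")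
      interpret n1: nat_trans C D W X \<alpha> by fact
      interpret n2: nat_trans C D X Y \<beta> by fact
      interpret n3: nat_trans C D Y Z \<gamma> by fact
      show ?thesis by (auto simp: f Funct_def restrict_def fun_eq_iff)
    qed
    show "Comp (Funct C D) g f \<in> Hom (Funct C D) X Z"
      if hom: "f \<in> Hom (Funct C D) X Y" "g \<in> Hom (Funct C D) Y Z" for f g X Y Z
    proof -
      obtain \<alpha> \<beta> where f: "f = (X, \<alpha>, Y)" "g = (Y, \<beta>, Z)" and n: "nat_trans C D X Y \<alpha>" "nat_trans C D Y Z \<beta>"
        by (cases f, cases g) (use hom in "auto simp: Hom_iff Funct_def")
      then show ?thesis using nat_trans_comp[OF n] by (simp add: f Funct_def Hom_iff)
    qed
    show "Id (Funct C D) X \<in> Hom (Funct C D) X X" if "X \<in> Obj (Funct C D)" for X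
      using that nat_trans_id[of C D X] by (simp add: Funct_def Hom_iff)
  qed (auto simp: Funct_def Hom_iff nat_trans_def)
qed

lemma category_Qc: "category Qc"
  unfolding Qc_def by (rule category_Funct[OF category_N category_SET])

text \<open>
  An object \<open>P\<close> of \<open>Qc\<close> is handled as the family of the sets \<open>FO P n\<close> with the action \<open>act P\<close>,
  an arrow \<open>a\<close> as the family of the maps \<open>ap a n\<close>; \<open>mkob\<close> and \<open>mkar\<close> go back.
\<close>

definition act :: "'u q_obj \<Rightarrow> fin_map \<Rightarrow> 'u \<Rightarrow> 'u" where
  "act P \<phi> = set_app (FA P \<phi>)"

definition ap :: "'u q_arr \<Rightarrow> nat \<Rightarrow> 'u \<Rightarrow> 'u" where
  "ap a n = set_app (fst (snd a) n)"

definition mkob :: "(nat \<Rightarrow> 'u set) \<Rightarrow> (fin_map \<Rightarrow> 'u \<Rightarrow> 'u) \<Rightarrow> 'u q_obj" where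
  "mkob S f = \<lparr>FO = (\<lambda>n\<in>Obj NCat. S n),
     FA = (\<lambda>\<phi>\<in>Arr NCat. (S (fst \<phi>), restrict (f \<phi>) (S (fst \<phi>)), S (tgt \<phi>)))\<rparr>"

definition mkar :: "'u q_obj \<Rightarrow> (nat \<Rightarrow> 'u \<Rightarrow> 'u) \<Rightarrow> 'u q_obj \<Rightarrow> 'u q_arr" where
  "mkar P g Q = (P, (\<lambda>n\<in>Obj NCat. (FO P n, restrict (g n) (FO P n), FO Q n)), Q)"

lemma Q_simps [simp]: "Dom Qc a = fst a" "Cod Qc a = tgt a"
  by (auto simp: Qc_def Funct_def split: prod.splits)

lemma Q_obj: "P \<in> Obj Qc \<longleftrightarrow> cfunctor NCat SET P"
  by (simp add: Qc_def Funct_def)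

lemma Q_arr: "a \<in> Arr Qc \<longleftrightarrow> nat_trans NCat SET (fst a) (tgt a) (fst (snd a))"
  by (auto simp: Qc_def Funct_def)

interpretation Q: category Qc by (rule category_Qc)

lemma Qob:
  assumes "P \<in> Obj Qc"
  shows Qob_small: "small TYPE('u) (FO (P :: 'u q_obj) n)"
    and Qob_mem: "\<phi> \<in> Arr NCat ==> x \<in> FO P (fst \<phi>) ==> act P \<phi> x \<in> FO P (tgt \<phi>)"
    and Qob_id [simp]: "x \<in> FO P n ==> act P (Id NCat n) x = x"
    and Qob_comp: "[|\<phi> \<in> Arr NCat; \<psi> \<in> Arr NCat; fst \<psi> = tgt \<phi>; x \<in> FO P (fst \<phi>)|] ==>
      act P (Comp NCat \<psi> \<phi>) x = act P \<psi> (act P \<phi> x)"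
proof -
  interpret cfunctor NCat SET P using assms by (simp add: Q_obj)
  have d: "fst (FA P \<phi>) = FO P (fst \<phi>)" "tgt (FA P \<phi>) = FO P (tgt \<phi>)"
    if "\<phi> \<in> Arr NCat" for \<phi> using functor_simps(3,4)[OF that] by simp_all
  show "small TYPE('u) (FO P n)" using FO_obj[of n] by simp
  show "act P \<phi> x \<in> FO P (tgt \<phi>)" if "\<phi> \<in> Arr NCat" "x \<in> FO P (fst \<phi>)"
    using set_app_mem[of "FA P \<phi>" x] that by (simp add: act_def d)
  show "act P (Id NCat n) x = x" if "x \<in> FO P n"
    using that FA_id[of n] by (simp add: act_def SET_id)
  show "act P (Comp NCat \<psi> \<phi>) x = act P \<psi> (act P \<phi> x)"
    if "\<phi> \<in> Arr NCat" "\<psi> \<in> Arr NCat" "fst \<psi> = tgt \<phi>" "x \<in> FO P (fst \<phi>)"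
    using that by (simp add: act_def FA_comp_simp SET_comp d)
qed

lemma Qob_mem2:
  "[|P \<in> Obj Qc; \<phi> \<in> Arr NCat; tgt \<phi> = n; x \<in> FO P (fst \<phi>)|] ==> act P \<phi> x \<in> FO P n"
  using Qob_mem[of P \<phi> x] by simp

lemma mkob_simps [simp]:
  "FO (mkob S f) n = S n" "\<phi> \<in> Arr NCat ==> x \<in> S (fst \<phi>) ==> act (mkob S f) \<phi> x = f \<phi> x"
  by (auto simp: mkob_def act_def)

lemma mkob_obj:
  fixes S :: "nat \<Rightarrow> 'u set"
  assumes "\<And>n. small TYPE('u) (S n)"
    "\<And>\<phi> x. \<phi> \<in> Arr NCat ==> x \<in> S (fst \<phi>) ==> f \<phi> x \<in> S (tgt \<phi>)"
    "\<And>n x. x \<in> S n ==> f (Id NCat n) x = x"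
    "\<And>\<phi> \<psi> x. [|\<phi> \<in> Arr NCat; \<psi> \<in> Arr NCat; fst \<psi> = tgt \<phi>; x \<in> S (fst \<phi>)|] ==>
      f (Comp NCat \<psi> \<phi>) x = f \<psi> (f \<phi> x)"
  shows "mkob S f \<in> Obj Qc"
  unfolding Q_obj
proof (rule cfunctorI[OF category_N category_SET])
  show "FA (mkob S f) \<phi> \<in> Hom SET (FO (mkob S f) (Dom NCat \<phi>)) (FO (mkob S f) (Cod NCat \<phi>))" if "\<phi> \<in> Arr NCat" for \<phi>
    using that assms(1,2) by (auto simp: Hom_iff SET_arr mkob_def)
  show "FA (mkob S f) (Comp NCat \<psi> \<phi>) = Comp SET (FA (mkob S f) \<psi>) (FA (mkob S f) \<phi>)"
    if "\<phi> \<in> Arr NCat" "\<psi> \<in> Arr NCat" "Dom NCat \<psi> = Cod NCat \<phi>" for \<phi> \<psi>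
    using that assms(2,4) by (auto simp: mkob_def SET_comp fun_eq_iff restrict_def)
  show "FA (mkob S f) (Id NCat X) = Id SET (FO (mkob S f) X)" for X
    using assms(3) by (auto simp: mkob_def SET_id restrict_def fun_eq_iff)
qed (use assms(1) in "auto simp: mkob_def")

lemma mkar_simps [simp]:
  "fst (mkar P g Q) = P" "tgt (mkar P g Q) = Q" "x \<in> FO P n ==> ap (mkar P g Q) n x = g n x"
  by (auto simp: mkar_def ap_def)

lemma FA_eq:
  assumes "P \<in> Obj Qc" "\<phi> \<in> Arr NCat"
  shows "FA P \<phi> \<in> Arr SET" "fst (FA P \<phi>) = FO P (fst \<phi>)" "tgt (FA P \<phi>) = FO P (tgt \<phi>)"
    "set_app (FA P \<phi>) = act P \<phi>"
proof -
  interpret cfunctor NCat SET P using assms by (simp add: Q_obj)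
  show "FA P \<phi> \<in> Arr SET" "fst (FA P \<phi>) = FO P (fst \<phi>)" "tgt (FA P \<phi>) = FO P (tgt \<phi>)"
    using functor_simps(2-4)[OF assms(2)] by simp_all
qed (simp add: act_def)

lemma mkar_arr:
  assumes "P \<in> Obj Qc" "Q \<in> Obj Qc" "\<And>n x. x \<in> FO P n ==> g n x \<in> FO Q n"
    "\<And>\<phi> x. \<phi> \<in> Arr NCat ==> x \<in> FO P (fst \<phi>) ==> g (tgt \<phi>) (act P \<phi> x) = act Q \<phi> (g (fst \<phi>) x)"
  shows "mkar P g Q \<in> Arr Qc"
  unfolding Q_arr
proof (rule nat_transI)
  show "cfunctor NCat SET (fst (mkar P g Q))" "cfunctor NCat SET (tgt (mkar P g Q))"
    using assms(1,2) by (simp_all add: Q_obj)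
  show "fst (snd (mkar P g Q)) X \<in> Hom SET (FO (fst (mkar P g Q)) X) (FO (tgt (mkar P g Q)) X)" for X
    using assms(1-3) by (auto simp: Hom_iff mkar_def SET_arr Qob_small)
  show "Comp SET (fst (snd (mkar P g Q)) (Cod NCat \<phi>)) (FA (fst (mkar P g Q)) \<phi>) =
    Comp SET (FA (tgt (mkar P g Q)) \<phi>) (fst (snd (mkar P g Q)) (Dom NCat \<phi>))" if "\<phi> \<in> Arr NCat" for \<phi>
    using that assms(1-4) FA_eq[OF assms(1) that] FA_eq[OF assms(2) that]
    by (auto simp: mkar_def SET_comp Qob_mem restrict_def fun_eq_iff)
qed (auto simp: mkar_def)

lemma Q_ap_mem: "a \<in> Arr Qc ==> x \<in> FO (fst a) n ==> ap a n x \<in> FO (tgt a) n"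
  using nat_trans.hom[of NCat SET "fst a" "tgt a" "fst (snd a)" n]
    set_app_mem[of "fst (snd a) n" x] by (auto simp: Q_arr ap_def Hom_iff)

lemma Q_ap_nat:
  assumes "a \<in> Arr Qc" "\<phi> \<in> Arr NCat" "x \<in> FO (fst a) (fst \<phi>)"
  shows "ap a (tgt \<phi>) (act (fst a) \<phi> x) = act (tgt a) \<phi> (ap a (fst \<phi>) x)"
proof -
  interpret nat_trans NCat SET "fst a" "tgt a" "fst (snd a)" using assms by (simp add: Q_arr)
  have "fst (fst (snd a) (fst \<phi>)) = FO (fst a) (fst \<phi>)" "fst (FA (fst a) \<phi>) = FO (fst a) (fst \<phi>)"
    using nat_simps(2)[of "fst \<phi>"] F.functor_simps(3)[OF assms(2)] by auto
  moreover have "set_app (Comp SET (fst (snd a) (tgt \<phi>)) (FA (fst a) \<phi>)) x =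
     set_app (Comp SET (FA (tgt a) \<phi>) (fst (snd a) (fst \<phi>))) x"
    using naturality[OF assms(2)] by simp
  ultimately show ?thesis using assms(3) by (simp add: SET_comp ap_def act_def)
qed

lemma Q_ext:
  assumes "a \<in> Arr Qc" "b \<in> Arr Qc" "fst a = fst b" "tgt a = tgt b"
    "\<And>n x. x \<in> FO (fst a) n ==> ap a n x = ap b n x"
  shows "a = b"
proof -
  interpret a: nat_trans NCat SET "fst a" "tgt a" "fst (snd a)" using assms by (simp add: Q_arr)
  interpret b: nat_trans NCat SET "fst b" "tgt b" "fst (snd b)" using assms by (simp add: Q_arr)
  have "fst (snd a) n = fst (snd b) n" for n
    by (rule SET_ext) (use a.hom[of n] b.hom[of n] assms(3-5) in "auto simp: Hom_iff ap_def")
  then show ?thesis using assms(3,4) by (simp add: prod_eq_iff fun_eq_iff)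
qed

lemma Q_comp_simps [simp]: "fst (Comp Qc b a) = fst a" "tgt (Comp Qc b a) = tgt b"
  by (auto simp: Qc_def Funct_def split: prod.splits)

lemma ap_comp [simp]:
  "a \<in> Arr Qc ==> x \<in> FO (fst a) n ==> ap (Comp Qc b a) n x = ap b n (ap a n x)"
proof -
  assume a: "a \<in> Arr Qc" "x \<in> FO (fst a) n"
  interpret nat_trans NCat SET "fst a" "tgt a" "fst (snd a)" using a by (simp add: Q_arr)
  have "fst (fst (snd a) n) = FO (fst a) n" using nat_simps(2)[of n] by simp
  then show ?thesis using a(2)
    by (auto simp: Qc_def Funct_def ap_def SET_comp split: prod.splits)
qed

lemma Q_id_simps [simp]: "fst (Id Qc P) = P" "tgt (Id Qc P) = P" "x \<in> FO P n ==> ap (Id Qc P) n x = x"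
  by (auto simp: Qc_def Funct_def ap_def SET_id)

lemma Q_comp_arr [simp]: "[|a \<in> Arr Qc; b \<in> Arr Qc; fst b = tgt a|] ==> Comp Qc b a \<in> Arr Qc"
  "P \<in> Obj Qc ==> Id Qc P \<in> Arr Qc" "a \<in> Arr Qc ==> fst a \<in> Obj Qc" "a \<in> Arr Qc ==> tgt a \<in> Obj Qc"
  using Q.arr_simps(1,2)[of a] by simp_all

lemma Q_inverseI:
  assumes "a \<in> Arr Qc" "b \<in> Arr Qc" "fst b = tgt a" "tgt b = fst a"
    "\<And>n x. x \<in> FO (fst a) n ==> ap b n (ap a n x) = x" "\<And>n x. x \<in> FO (fst b) n ==> ap a n (ap b n x) = x"
  shows "inverse_arrows Qc a b"
  by (rule Q.inverseI[of _ "fst a" "tgt a"]; (rule Q_ext)?) (use assms in "auto simp: Hom_iff")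

lemma Q_isoI:
  assumes a: "a \<in> Arr Qc" and bij: "\<And>n. bij_betw (ap a n) (FO (fst a) n) (FO (tgt a) n)"
  shows "iso_arr Qc a"
proof -
  let ?g = "\<lambda>n. inv_into (FO (fst a) n) (ap a n)"
  let ?b = "mkar (tgt a) ?g (fst a)"
  have ob: "fst a \<in> Obj Qc" "tgt a \<in> Obj Qc" using a by auto
  have g: "?g n (ap a n x) = x" if "x \<in> FO (fst a) n" for n x
    using bij[of n] that by (simp add: bij_betw_def)
  have g': "?g n y \<in> FO (fst a) n" "ap a n (?g n y) = y" if "y \<in> FO (tgt a) n" for n y
    using bij[of n] that by (auto simp: bij_betw_def inv_into_into f_inv_into_f)
  have "?b \<in> Arr Qc"
  proof (rule mkar_arr)
    fix \<phi> y assume \<phi>: "\<phi> \<in> Arr NCat" and y: "y \<in> FO (tgt a) (fst \<phi>)"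
    have "act (tgt a) \<phi> y = ap a (tgt \<phi>) (act (fst a) \<phi> (?g (fst \<phi>) y))"
      using Q_ap_nat[OF a \<phi> g'(1)[OF y]] g'(2)[OF y] by simp
    then show "?g (tgt \<phi>) (act (tgt a) \<phi> y) = act (fst a) \<phi> (?g (fst \<phi>) y)"
      using g[OF Qob_mem[OF ob(1) \<phi> g'(1)[OF y]]] by simp
  qed (use ob g' in auto)
  then have "inverse_arrows Qc a ?b"
    by (intro Q_inverseI) (use a g g' Q_ap_mem[OF a] in auto)
  then show ?thesis unfolding iso_arr_def by blast
qed

subsection \<open>Representable functors and the Yoneda lemma\<close>

context small_universe begin

lemma dec_enc [simp]: "\<phi> \<in> Arr NCat ==> dec (enc \<phi> :: 'u) = \<phi>"
proof -
  have "inj_on (enc :: fin_map \<Rightarrow> 'u) (Arr NCat)"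
    using inj_code[OF small_countable[OF countable_N]] by (simp add: enc_def code_of_def)
  then show "\<phi> \<in> Arr NCat ==> dec (enc \<phi> :: 'u) = \<phi>" by (simp add: dec_def inv_into_f_f)
qed

lemma hrep_eq: "hrep n = mkob (\<lambda>k. enc ` Hom NCat n k) (\<lambda>\<phi> x. enc (Comp NCat \<phi> (dec x)) :: 'u)"
  by (simp add: hrep_def mkob_def)

lemma pre_eq: "\<phi> \<in> Arr NCat ==>
    (pre \<phi> :: 'u q_arr) = mkar (hrep (tgt \<phi>)) (\<lambda>k x. enc (Comp NCat (dec x) \<phi>)) (hrep (fst \<phi>))"
  by (simp add: pre_def mkar_def hrep_eq)

lemma hrep_simps: "FO (hrep n) k = (enc ` Hom NCat n k :: 'u set)"
  by (simp add: hrep_eq)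

lemma hrep_mem: "z \<in> FO (hrep n :: 'u q_obj) k \<longleftrightarrow> (\<exists>\<psi>\<in>Arr NCat. fst \<psi> = n \<and> tgt \<psi> = k \<and> z = enc \<psi>)"
  unfolding hrep_simps image_iff Hom_def N_simps by blast

lemma hrepE:
  assumes "z \<in> FO (hrep n :: 'u q_obj) k"
  obtains \<psi> where "\<psi> \<in> Arr NCat" "fst \<psi> = n" "tgt \<psi> = k" "z = enc \<psi>"
  using assms unfolding hrep_mem by blast

lemma enc_hrep [simp]: "[|\<psi> \<in> Arr NCat; fst \<psi> = n; tgt \<psi> = k|] ==> (enc \<psi> :: 'u) \<in> FO (hrep n) k"
  unfolding hrep_mem by blast

lemma act_hrep [simp]:
  "[|\<psi> \<in> Arr NCat; \<phi> \<in> Arr NCat; fst \<psi> = n; fst \<phi> = tgt \<psi>|] ==>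
     act (hrep n) \<phi> (enc \<psi> :: 'u) = enc (Comp NCat \<phi> \<psi>)"
  by (simp add: hrep_eq Hom_iff)

lemma hrep_obj [simp]: "(hrep n :: 'u q_obj) \<in> Obj Qc"
  unfolding hrep_eq
proof (rule mkob_obj)
  show "small TYPE('u) (enc ` Hom NCat n k :: 'u set)" for k
    by (rule small_image[OF small_countable[OF countable_subset[OF _ countable_N]]]) (auto simp: Hom_iff)
qed (auto simp: Hom_iff)

text \<open>
  The arrow \<open>h\<^sub>n \<rightarrow> P\<close> that the Yoneda lemma attaches to \<open>x \<in> P n\<close>.
\<close>

definition ya :: "'u q_obj \<Rightarrow> nat \<Rightarrow> 'u \<Rightarrow> 'u q_arr" where
  "ya P n x = mkar (hrep n) (\<lambda>k z. act P (dec z) x) P"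

lemma ya_simps [simp]:
  "fst (ya P n x) = hrep n" "tgt (ya P n x) = P"
  "[|\<psi> \<in> Arr NCat; fst \<psi> = n; tgt \<psi> = k|] ==> ap (ya P n x) k (enc \<psi>) = act P \<psi> x"
  by (simp_all add: ya_def enc_hrep)

lemma ya_arr [simp]: "P \<in> Obj Qc ==> x \<in> FO P n ==> ya P n x \<in> Arr Qc"
  unfolding ya_def by (rule mkar_arr) (auto elim!: hrepE simp: Qob_comp Qob_mem2)

lemma yoneda_unique:
  assumes "a \<in> Arr Qc" "fst a = hrep n" "tgt a = P"
  shows "a = ya P n (ap a n (enc (Id NCat n)))" "ap a n (enc (Id NCat n)) \<in> FO P n"
proof -
  show m: "ap a n (enc (Id NCat n)) \<in> FO P n"
    using Q_ap_mem[OF assms(1), of "enc (Id NCat n)" n] assms by (simp add: enc_hrep)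
  show "a = ya P n (ap a n (enc (Id NCat n)))"
  proof (rule Q_ext)
    fix k z assume "z \<in> FO (fst a) k"
    then obtain \<psi> where \<psi>: "\<psi> \<in> Arr NCat" "fst \<psi> = n" "tgt \<psi> = k" "z = enc \<psi>"
      using assms by (auto elim!: hrepE)
    have "ap a k (enc \<psi>) = act P \<psi> (ap a n (enc (Id NCat n)))"
      using Q_ap_nat[OF assms(1) \<psi>(1), of "enc (Id NCat n)"] \<psi> assms by (simp add: enc_hrep)
    then show "ap a k z = ap (ya P n (ap a n (enc (Id NCat n)))) k z" using \<psi> by simp
  qed (use assms m Q.arr_simps(2)[OF assms(1)] in auto)
qed

lemma ya_id [simp]: "P \<in> Obj Qc ==> x \<in> FO P n ==> ap (ya P n x) n (enc (Id NCat n)) = x"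
  by simp

lemma ya_comp:
  assumes "a \<in> Arr Qc" "x \<in> FO (fst a) n"
  shows "Comp Qc a (ya (fst a) n x) = ya (tgt a) n (ap a n x)"
  using yoneda_unique(1)[of "Comp Qc a (ya (fst a) n x)" n "tgt a"] assms
  by (simp add: enc_hrep)

lemma pre_simps [simp]:
  assumes "\<phi> \<in> Arr NCat"
  shows "fst (pre \<phi> :: 'u q_arr) = hrep (tgt \<phi>)" "tgt (pre \<phi> :: 'u q_arr) = hrep (fst \<phi>)"
    "(pre \<phi> :: 'u q_arr) \<in> Arr Qc"
    "[|\<psi> \<in> Arr NCat; fst \<psi> = tgt \<phi>; tgt \<psi> = k|] ==>
      ap (pre \<phi>) k (enc \<psi> :: 'u) = enc (Comp NCat \<psi> \<phi>)"
proof -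
  show "(pre \<phi> :: 'u q_arr) \<in> Arr Qc"
    unfolding pre_eq[OF assms]
    by (rule mkar_arr) (use assms in "auto elim!: hrepE")
qed (use assms in "simp_all add: pre_eq enc_hrep")

lemma pre_ya:
  assumes "P \<in> Obj Qc" "\<phi> \<in> Arr NCat" "x \<in> FO P (fst \<phi>)"
  shows "Comp Qc (ya P (fst \<phi>) x) (pre \<phi>) = ya P (tgt \<phi>) (act P \<phi> x)"
  using yoneda_unique(1)[of "Comp Qc (ya P (fst \<phi>) x) (pre \<phi>)" "tgt \<phi>" P] assms
  by (simp add: enc_hrep)

lemma ya_hrep_id: "ya (hrep n) n (enc (Id NCat n)) = Id Qc (hrep n)"
  using yoneda_unique(1)[of "Id Qc (hrep n)" n "hrep n"] by (simp add: enc_hrep)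

lemma pre_id [simp]: "(pre (Id NCat n) :: 'u q_arr) = Id Qc (hrep n)"
  using yoneda_unique(1)[of "pre (Id NCat n)" n "hrep n"] by (simp add: enc_hrep ya_hrep_id)

lemma pre_comp:
  assumes "\<phi> \<in> Arr NCat" "\<psi> \<in> Arr NCat" "fst \<psi> = tgt \<phi>"
  shows "(pre (Comp NCat \<psi> \<phi>) :: 'u q_arr) = Comp Qc (pre \<phi>) (pre \<psi>)"
  by (rule Q_ext) (use assms in "auto elim!: hrepE")

lemma yoneda_functor: "cfunctor (op NCat) Qc (yoneda :: (nat, fin_map, 'u q_obj, 'u q_arr) cfun)"
  by (rule cfunctorI[OF category_op[OF category_N] category_Qc])
    (auto simp: yoneda_def Hom_iff pre_comp)

lemma yoneda_simps [simp]:
  "FO yoneda n = (hrep n :: 'u q_obj)" "\<phi> \<in> Arr NCat ==> FA yoneda \<phi> = (pre \<phi> :: 'u q_arr)"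
  by (simp_all add: yoneda_def)

end

subsection \<open>Presheaves as colimits of representables\<close>

text \<open>
  For a contravariant functor \<open>F\<close> on finite sets, a cocone \<open>c\<close> under the diagram \<open>(n, x) \<mapsto> F n\<close> on
  the category of elements of \<open>P\<close>, and the statement that it is universal.
\<close>

definition elcocone ::
  "('o, 'a) cat \<Rightarrow> (nat, fin_map, 'o, 'a) cfun \<Rightarrow> 'u q_obj \<Rightarrow> 'o \<Rightarrow> (nat \<Rightarrow> 'u \<Rightarrow> 'a) \<Rightarrow> bool" where
  "elcocone C F P Y c \<longleftrightarrow> Y \<in> Obj C \<and> (\<forall>n. \<forall>x\<in>FO P n. c n x \<in> Hom C (FO F n) Y) \<and>
     (\<forall>\<phi>\<in>Arr NCat. \<forall>x\<in>FO P (fst \<phi>). c (tgt \<phi>) (act P \<phi> x) = c (fst \<phi>) x \<cdot>\<^sub>C FA F \<phi>)"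

definition elcolimit ::
  "('o, 'a) cat \<Rightarrow> (nat, fin_map, 'o, 'a) cfun \<Rightarrow> 'u q_obj \<Rightarrow> 'o \<Rightarrow> (nat \<Rightarrow> 'u \<Rightarrow> 'a) \<Rightarrow> bool" where
  "elcolimit C F P L c \<longleftrightarrow> elcocone C F P L c \<and>
     (\<forall>Y d. elcocone C F P Y d \<longrightarrow> (\<exists>!h. h \<in> Hom C L Y \<and> (\<forall>n. \<forall>x\<in>FO P n. h \<cdot>\<^sub>C c n x = d n x)))"

definition elset :: "'u q_obj \<Rightarrow> (fin_map \<times> 'u) set" where
  "elset P = {(\<phi>, x). \<phi> \<in> Arr NCat \<and> x \<in> FO P (fst \<phi>)}"

text \<open>
  The category of elements, with arrows \<open>(\<phi>, x) : (cod \<phi>, P \<phi> x) \<rightarrow> (dom \<phi>, x)\<close> and the object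
  \<open>(n, x)\<close> represented by its identity, copied into the universe.
\<close>

definition el :: "'u q_obj \<Rightarrow> fin_map \<Rightarrow> 'u \<Rightarrow> 'u" where
  "el P \<phi> x = code_of (elset P) (\<phi>, x)"

definition elcat :: "'u q_obj \<Rightarrow> ('u, 'u) cat" where
  "elcat P = (let d = decode (elset P) in
    \<lparr>Obj = {el P (Id NCat n) x | n x. x \<in> FO P n},
     Arr = {el P \<phi> x | \<phi> x. (\<phi>, x) \<in> elset P},
     Dom = (\<lambda>a. el P (Id NCat (tgt (fst (d a)))) (act P (fst (d a)) (snd (d a)))),
     Cod = (\<lambda>a. el P (Id NCat (fst (fst (d a)))) (snd (d a))),
     Id = (\<lambda>X. X),
     Comp = (\<lambda>b a. el P (Comp NCat (fst (d a)) (fst (d b))) (snd (d b)))\<rparr>)"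

definition eldiag :: "'u q_obj \<Rightarrow> (nat, fin_map, 'o, 'a) cfun \<Rightarrow> ('u, 'u, 'o, 'a) cfun" where
  "eldiag P F = \<lparr>FO = (\<lambda>j\<in>Obj (elcat P). FO F (fst (fst (decode (elset P) j)))),
     FA = (\<lambda>a\<in>Arr (elcat P). FA F (fst (decode (elset P) a)))\<rparr>"

definition elfam :: "'u q_obj \<Rightarrow> (nat \<Rightarrow> 'u \<Rightarrow> 'a) \<Rightarrow> 'u \<Rightarrow> 'a" where
  "elfam P c j = c (fst (fst (decode (elset P) j))) (snd (decode (elset P) j))"

context small_universe begin

lemma elset_small: "P \<in> Obj Qc ==> small TYPE('u) (elset (P :: 'u q_obj))"
proof -
  assume P: "P \<in> Obj Qc"
  have "elset P = Sigma (Arr NCat) (\<lambda>\<phi>. FO P (fst \<phi>))" by (auto simp: elset_def)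
  then show ?thesis using small_Sigma[OF small_countable[OF countable_N] Qob_small[OF P]] by simp
qed

lemma elset_mem [simp]: "(\<phi>, x) \<in> elset P \<longleftrightarrow> \<phi> \<in> Arr NCat \<and> x \<in> FO P (fst \<phi>)"
  by (simp add: elset_def)

lemma el_simps [simp]:
  assumes "P \<in> Obj Qc" "\<phi> \<in> Arr NCat" "x \<in> FO (P :: 'u q_obj) (fst \<phi>)"
  shows "decode (elset P) (el P \<phi> x) = (\<phi>, x)"
    "\<psi> \<in> Arr NCat ==> y \<in> FO P (fst \<psi>) ==> el P \<phi> x = el P \<psi> y \<longleftrightarrow> \<phi> = \<psi> \<and> x = y"
  using assms decode_code[OF elset_small[OF assms(1)]] code_eq_iff[OF elset_small[OF assms(1)]]
  by (simp_all add: el_def elset_def)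

lemma elcat_simps [simp]:
  assumes "P \<in> Obj Qc" "\<phi> \<in> Arr NCat" "x \<in> FO (P :: 'u q_obj) (fst \<phi>)"
  shows "Dom (elcat P) (el P \<phi> x) = el P (Id NCat (tgt \<phi>)) (act P \<phi> x)"
    "Cod (elcat P) (el P \<phi> x) = el P (Id NCat (fst \<phi>)) x"
    "\<psi> \<in> Arr NCat ==> y \<in> FO P (fst \<psi>) ==> Comp (elcat P) (el P \<psi> y) (el P \<phi> x) = el P (Comp NCat \<phi> \<psi>) y"
    "el P \<phi> x \<in> Arr (elcat P)"
  using assms by (auto simp: elcat_def Let_def simp del: split_paired_Ex)

lemma el_obj [simp]: "x \<in> FO P n ==> el P (Id NCat n) x \<in> Obj (elcat P)"
  by (auto simp: elcat_def Let_def)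

lemma elcat_id [simp]: "Id (elcat P) X = X"
  by (simp add: elcat_def Let_def)

lemma el_objE:
  assumes "j \<in> Obj (elcat P)" obtains n x where "x \<in> FO P n" "j = el P (Id NCat n) x"
  using assms by (auto simp: elcat_def Let_def)

lemma el_arrE:
  assumes "a \<in> Arr (elcat P)" obtains \<phi> x where "\<phi> \<in> Arr NCat" "x \<in> FO P (fst \<phi>)" "a = el P \<phi> x"
  using assms unfolding elcat_def Let_def elset_def by auto

lemma N_id_eq [simp]: "Id NCat m = Id NCat n \<longleftrightarrow> m = n"
  by (auto simp: N_id mkn_def)

lemma elcat_small:
  assumes P: "P \<in> Obj Qc" shows "small_category (elcat (P :: 'u q_obj))"
  unfolding small_category_def
proof (intro conjI)
  have "Obj (elcat P) \<subseteq> code_of (elset P) ` elset P" "Arr (elcat P) \<subseteq> code_of (elset P) ` elset P"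
    by (auto simp: elcat_def Let_def el_def elset_def image_iff)
  then show "small TYPE('u) (Obj (elcat P))" "small TYPE('u) (Arr (elcat P))"
    by (auto intro: small_subset small_image[OF elset_small[OF P]])
  note m = Qob_mem[OF P] Qob_mem2[OF P] Qob_comp[OF P]
  show "category (elcat P)"
  proof unfold_locales
    show "Comp (elcat P) g f \<in> Hom (elcat P) X Z" if "f \<in> Hom (elcat P) X Y" "g \<in> Hom (elcat P) Y Z" for f g X Y Z
      using that P unfolding Hom_iff by (elim conjE el_arrE) (auto simp: m)
    show "Comp (elcat P) f (Id (elcat P) X) = f" "Comp (elcat P) (Id (elcat P) Y) f = f"
      if "f \<in> Hom (elcat P) X Y" for f X Y
      using that P unfolding Hom_iff by (elim conjE el_arrE; auto simp: m)+
    show "Comp (elcat P) h (Comp (elcat P) g f) = Comp (elcat P) (Comp (elcat P) h g) f"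
      if "f \<in> Hom (elcat P) W X" "g \<in> Hom (elcat P) X Y" "h \<in> Hom (elcat P) Y Z" for f g h W X Y Z
      using that P unfolding Hom_iff by (elim conjE el_arrE) (auto simp: m)
  qed (use P in "auto simp: Hom_iff m elim!: el_arrE el_objE")
qed

lemma eldiag_simps [simp]:
  assumes "P \<in> Obj Qc"
  shows "x \<in> FO (P :: 'u q_obj) n ==> FO (eldiag P F) (el P (Id NCat n) x) = FO F n"
    "\<phi> \<in> Arr NCat ==> x \<in> FO (P :: 'u q_obj) (fst \<phi>) ==> FA (eldiag P F) (el P \<phi> x) = FA F \<phi>"
    "x \<in> FO (P :: 'u q_obj) n ==> elfam P c (el P (Id NCat n) x) = c n x"
  using assms by (auto simp: eldiag_def elfam_def)

lemma eldiag_functor: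
  assumes P: "P \<in> Obj Qc" and F: "cfunctor (op NCat) C F" shows "cfunctor (elcat (P :: 'u q_obj)) C (eldiag P F)"
proof -
  interpret cfunctor "op NCat" C F by fact
  have cat: "category (elcat P)" using elcat_small[OF P] by (simp add: small_category_def)
  note m = Qob_mem[OF P] Qob_mem2[OF P] Qob_comp[OF P]
  show ?thesis
  proof (rule cfunctorI[OF cat T.category_axioms])
    show "FA (eldiag P F) (Comp (elcat P) g f) = FA (eldiag P F) g \<cdot>\<^sub>C FA (eldiag P F) f"
      if "f \<in> Arr (elcat P)" "g \<in> Arr (elcat P)" "Dom (elcat P) g = Cod (elcat P) f" for f g
      using that
    proof (elim el_arrE)
      fix \<phi> x \<psi> y assume a: "\<phi> \<in> Arr NCat" "x \<in> FO P (fst \<phi>)" "f = el P \<phi> x" "\<psi> \<in> Arr NCat" "y \<in> FO P (fst \<psi>)" "g = el P \<psi> y"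
      then have "tgt \<psi> = fst \<phi>" using that P by (auto simp: m)
      then show ?thesis using a P FA_comp_simp[of \<phi> \<psi>] by simp
    qed
    show "FA (eldiag P F) (Id (elcat P) X) = Id C (FO (eldiag P F) X)" if "X \<in> Obj (elcat P)" for X
      using that P FA_id[simplified] by (auto elim!: el_objE)
    show "FO (eldiag P F) X \<in> Obj C" if "X \<in> Obj (elcat P)" for X
      using that P by (auto elim!: el_objE)
    show "FA (eldiag P F) f \<in> Hom C (FO (eldiag P F) (Dom (elcat P) f)) (FO (eldiag P F) (Cod (elcat P) f))"
      if "f \<in> Arr (elcat P)" for f
      using that P by (auto simp: Hom_iff m elim!: el_arrE)
  qed (simp_all add: eldiag_def)
qed

lemma el_ball_obj: "(\<forall>j\<in>Obj (elcat P). Q j) \<longleftrightarrow> (\<forall>n. \<forall>x\<in>FO P n. Q (el P (Id NCat n) x))"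
  by (auto elim!: el_objE)

lemma elcocone_iff:
  assumes P: "P \<in> Obj Qc"
  shows "is_cocone (elcat (P :: 'u q_obj)) C (eldiag P F) Y (elfam P c) \<longleftrightarrow> elcocone C F P Y c"
proof -
  have a: "(\<forall>f\<in>Arr (elcat P). Q f) \<longleftrightarrow> (\<forall>\<phi>\<in>Arr NCat. \<forall>x\<in>FO P (fst \<phi>). Q (el P \<phi> x))" for Q
    using elcat_simps(4)[OF P] by (metis el_arrE)
  show ?thesis unfolding is_cocone_def elcocone_def el_ball_obj a
    using P Qob_mem[OF P] by auto
qed

lemma elcocone_of_cocone:
  assumes P: "P \<in> Obj Qc" and i: "is_cocone (elcat (P :: 'u q_obj)) C (eldiag P F) Y i"
  shows "elcocone C F P Y (\<lambda>n x. i (el P (Id NCat n) x))"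
proof -
  interpret category "elcat P" using elcat_small[OF P] by (simp add: small_category_def)
  have "elfam P (\<lambda>n x. i (el P (Id NCat n) x)) j = i j" if "j \<in> Obj (elcat P)" for j
    using that P by (auto elim!: el_objE)
  then have "is_cocone (elcat P) C (eldiag P F) Y (elfam P (\<lambda>n x. i (el P (Id NCat n) x)))"
    using i by (simp add: is_cocone_def)
  then show ?thesis by (simp only: elcocone_iff[OF P])
qed

lemma elcolimit_iff:
  assumes P: "P \<in> Obj Qc"
  shows "is_colimit (elcat (P :: 'u q_obj)) C (eldiag P F) L (elfam P c) \<longleftrightarrow> elcolimit C F P L c"
  unfolding is_colimit_def elcolimit_def elcocone_iff[OF P]
proof (intro conj_cong refl iffI allI impI)
  fix Y d
  assume *: "\<forall>L' \<iota>'. is_cocone (elcat P) C (eldiag P F) L' \<iota>' \<longrightarrow>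
    (\<exists>!h. h \<in> Hom C L L' \<and> (\<forall>j\<in>Obj (elcat P). h \<cdot>\<^sub>C elfam P c j = \<iota>' j))"
    and "elcocone C F P Y d"
  then have "is_cocone (elcat P) C (eldiag P F) Y (elfam P d)" by (simp only: elcocone_iff[OF P])
  then have "\<exists>!h. h \<in> Hom C L Y \<and> (\<forall>j\<in>Obj (elcat P). h \<cdot>\<^sub>C elfam P c j = elfam P d j)"
    using *[rule_format] by simp
  then show "\<exists>!h. h \<in> Hom C L Y \<and> (\<forall>n. \<forall>x\<in>FO P n. h \<cdot>\<^sub>C c n x = d n x)"
    unfolding el_ball_obj using P by simp
next
  fix Y i
  assume *: "\<forall>Y d. elcocone C F P Y d \<longrightarrow> (\<exists>!h. h \<in> Hom C L Y \<and> (\<forall>n. \<forall>x\<in>FO P n. h \<cdot>\<^sub>C c n x = d n x))"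
    and i: "is_cocone (elcat P) C (eldiag P F) Y i"
  have "\<exists>!h. h \<in> Hom C L Y \<and> (\<forall>n. \<forall>x\<in>FO P n. h \<cdot>\<^sub>C c n x = i (el P (Id NCat n) x))"
    using *[rule_format, OF elcocone_of_cocone[OF P i]] .
  then show "\<exists>!h. h \<in> Hom C L Y \<and> (\<forall>j\<in>Obj (elcat P). h \<cdot>\<^sub>C elfam P c j = i j)"
    unfolding el_ball_obj using P by simp
qed

lemma elcolimit_of_colimit:
  assumes P: "P \<in> Obj Qc" and i: "is_colimit (elcat (P :: 'u q_obj)) C (eldiag P F) L i"
  shows "elcolimit C F P L (\<lambda>n x. i (el P (Id NCat n) x))"
proof -
  interpret category "elcat P" using elcat_small[OF P] by (simp add: small_category_def)
  have e: "elfam P (\<lambda>n x. i (el P (Id NCat n) x)) j = i j" if "j \<in> Obj (elcat P)" for j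
    using that P by (auto elim!: el_objE)
  have "is_colimit (elcat P) C (eldiag P F) L (elfam P (\<lambda>n x. i (el P (Id NCat n) x)))"
    using i by (simp add: is_colimit_def is_cocone_def e)
  then show ?thesis by (simp only: elcolimit_iff[OF P])
qed

lemma elcolimit_exists:
  assumes "has_small_colimits TYPE('u) C" "P \<in> Obj Qc" "cfunctor (op NCat) C F"
  shows "\<exists>L c. elcolimit C F (P :: 'u q_obj) L c"
proof -
  obtain L i where "is_colimit (elcat P) C (eldiag P F) L i"
    using assms(1) elcat_small[OF assms(2)] eldiag_functor[OF assms(2,3)]
    unfolding has_small_colimits_def by blast
  from elcolimit_of_colimit[OF assms(2) this] show ?thesis by blast
qed

lemma elcolimit_preserved:
  assumes pr: "preserves_small_colimits TYPE('u) C D H" and H: "cfunctor C D H" and P: "P \<in> Obj Qc"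
    and F: "cfunctor (op NCat) C F" and L: "elcolimit C F (P :: 'u q_obj) L c"
  shows "elcolimit D (compf (op NCat) F H) P (FO H L) (\<lambda>n x. FA H (c n x))"
proof -
  have "is_colimit (elcat P) C (eldiag P F) L (elfam P c)" using L by (simp only: elcolimit_iff[OF P])
  then have "is_colimit (elcat P) D (compf (elcat P) (eldiag P F) H) (FO H L) (\<lambda>j. FA H (elfam P c j))"
    using pr elcat_small[OF P] eldiag_functor[OF P F] unfolding preserves_small_colimits_def by blast
  moreover have "compf (elcat P) (eldiag P F) H = eldiag P (compf (op NCat) F H)"
    using P by (auto simp: compf_def eldiag_def fun_eq_iff restrict_def elim!: el_arrE el_objE)
  moreover have "(\<lambda>j. FA H (elfam P c j)) = elfam P (\<lambda>n x. FA H (c n x))" by (simp add: elfam_def fun_eq_iff)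
  ultimately show ?thesis by (simp only: elcolimit_iff[OF P, symmetric])
qed

text \<open>
  By the Yoneda lemma, a cocone under the representables over the elements of \<open>P\<close> is a
  compatible choice of elements, that is, an arrow out of \<open>P\<close>.
\<close>

lemma elcolimit_yoneda:
  assumes P: "P \<in> Obj Qc" shows "elcolimit Qc yoneda P P (ya (P :: 'u q_obj))"
  unfolding elcolimit_def
proof (intro conjI allI impI)
  show "elcocone Qc yoneda P P (ya P)" using P by (auto simp: elcocone_def Hom_iff pre_ya)
next
  fix Y :: "'u q_obj" and d :: "nat \<Rightarrow> 'u \<Rightarrow> 'u q_arr"
  assume d: "elcocone Qc yoneda P Y d"
  then have Y: "Y \<in> Obj Qc" by (simp add: elcocone_def)
  have dd: "d n x \<in> Arr Qc" "fst (d n x) = hrep n" "tgt (d n x) = Y" if "x \<in> FO P n" for n x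
    using d that by (auto simp: elcocone_def Hom_iff)
  have dn: "d (tgt \<phi>) (act P \<phi> x) = Comp Qc (d (fst \<phi>) x) (pre \<phi>)"
    if "\<phi> \<in> Arr NCat" "x \<in> FO P (fst \<phi>)" for \<phi> x
    using d that by (simp add: elcocone_def)
  let ?g = "\<lambda>n x. ap (d n x) n (enc (Id NCat n))"
  have g: "d n x = ya Y n (?g n x)" "?g n x \<in> FO Y n" if "x \<in> FO P n" for n x
    using yoneda_unique[OF dd[OF that]] .
  let ?h = "mkar P ?g Y"
  have h: "?h \<in> Arr Qc"
  proof (rule mkar_arr[OF P Y])
    fix \<phi> x assume \<phi>: "\<phi> \<in> Arr NCat" "x \<in> FO P (fst \<phi>)"
    show "?g (tgt \<phi>) (act P \<phi> x) = act Y \<phi> (?g (fst \<phi>) x)"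
      using \<phi> g[OF \<phi>(2)] Y by (metis dn pre_ya Qob_mem ya_id)
  qed (use g in auto)
  show "\<exists>!h. h \<in> Hom Qc P Y \<and> (\<forall>n. \<forall>x\<in>FO P n. Comp Qc h (ya P n x) = d n x)"
  proof (intro ex1I[of _ ?h] conjI allI ballI)
    show "?h \<in> Hom Qc P Y" using h by (simp add: Hom_iff)
    show "Comp Qc ?h (ya P n x) = d n x" if "x \<in> FO P n" for n x
      using ya_comp[OF h, of x n] that g(1)[OF that] by simp
    fix k assume k: "k \<in> Hom Qc P Y \<and> (\<forall>n. \<forall>x\<in>FO P n. Comp Qc k (ya P n x) = d n x)"
    show "k = ?h"
    proof (rule Q_ext)
      fix n x assume x: "x \<in> FO (fst k) n"
      then have x': "x \<in> FO P n" using k by (simp add: Hom_iff)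
      then have "ya Y n (ap k n x) = d n x" using k ya_comp[of k x n] by (auto simp: Hom_iff)
      moreover have "ap k n x \<in> FO Y n" using Q_ap_mem[of k x n] x k by (auto simp: Hom_iff)
      ultimately have "ap k n x = ?g n x" using Y ya_id by metis
      then show "ap k n x = ap ?h n x" using x' by simp
    qed (use h k in "auto simp: Hom_iff")
  qed
qed

end

section \<open>The functor category is a Grothendieck topos\<close>

context small_universe begin

text \<open>
  Limits and colimits are formed in sets of families or of pairs, possibly modulo a relation.  This
  copies the result into the universe, a class being coded as a subset.
\<close>

lemma quotient_functor:
  fixes D :: "nat \<Rightarrow> 'b set"
  assumes sm: "\<And>n. small TYPE('u) (D n)"
    and A: "\<And>\<phi> p. \<phi> \<in> Arr NCat ==> p \<in> D (fst \<phi>) ==> A \<phi> p \<in> D (tgt \<phi>)"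
      "\<And>n p. p \<in> D n ==> A (Id NCat n) p = p"
      "\<And>\<phi> \<psi> p. [|\<phi> \<in> Arr NCat; \<psi> \<in> Arr NCat; fst \<psi> = tgt \<phi>; p \<in> D (fst \<phi>)|] ==>
        A (Comp NCat \<psi> \<phi>) p = A \<psi> (A \<phi> p)"
    and R: "\<And>n. R n \<subseteq> D n \<times> D n"
      "\<And>\<phi> p p'. \<phi> \<in> Arr NCat ==> (p, p') \<in> R (fst \<phi>) ==> (A \<phi> p, A \<phi> p') \<in> R (tgt \<phi>)"
  obtains L :: "'u q_obj" and q where "L \<in> Obj Qc" "\<And>n. q n ` D n = FO L n"
    "\<And>\<phi> p. \<phi> \<in> Arr NCat ==> p \<in> D (fst \<phi>) ==> q (tgt \<phi>) (A \<phi> p) = act L \<phi> (q (fst \<phi>) p)"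
    "\<And>n p p'. p \<in> D n ==> p' \<in> D n ==> q n p = q n p' \<longleftrightarrow> (p, p') \<in> (R n \<union> (R n)\<inverse>)\<^sup>*"
proof -
  define E where "E n = (R n \<union> (R n)\<inverse>)\<^sup>*" for n
  have sE: "(p', p) \<in> E n" if "(p, p') \<in> E n" for n p p'
    using that sym_rtrancl[OF sym_Un_converse] unfolding E_def by (meson symE)
  have tE: "(p, p'') \<in> E n" if "(p, p') \<in> E n" "(p', p'') \<in> E n" for n p p' p''
    using that unfolding E_def by (rule rtrancl_trans)
  have ED: "p' \<in> D n" if "(p, p') \<in> E n" "p \<in> D n" for n p p'
    using that unfolding E_def by (induction rule: rtrancl_induct) (use R(1) in blast)+
  have EA: "(A \<phi> p, A \<phi> p') \<in> E (tgt \<phi>)" if "\<phi> \<in> Arr NCat" "(p, p') \<in> E (fst \<phi>)" for \<phi> p p'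
    using that(2) unfolding E_def
  proof (induction rule: rtrancl_induct)
    case (step y z)
    then have "(A \<phi> y, A \<phi> z) \<in> R (tgt \<phi>) \<union> (R (tgt \<phi>))\<inverse>" using R(2)[OF that(1)] by auto
    then show ?case using step by (meson rtrancl.rtrancl_into_rtrancl)
  qed auto
  define q :: "nat \<Rightarrow> 'b \<Rightarrow> 'u" where "q n p = code_of (Pow (D n)) {p'. (p, p') \<in> E n}" for n p
  have q: "q n p = q n p' \<longleftrightarrow> (p, p') \<in> E n" if "p \<in> D n" "p' \<in> D n" for n p p'
  proof -
    have "q n p = q n p' \<longleftrightarrow> {r. (p, r) \<in> E n} = {r. (p', r) \<in> E n}"
      unfolding q_def using that ED by (intro code_eq_iff[OF small_Pow[OF sm]]) auto
    also have "... \<longleftrightarrow> (p, p') \<in> E n"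
    proof
      assume "{r. (p, r) \<in> E n} = {r. (p', r) \<in> E n}"
      moreover have "(p', p') \<in> E n" by (simp add: E_def)
      ultimately show "(p, p') \<in> E n" by blast
    qed (auto intro: sE tE)
    finally show ?thesis .
  qed
  define rep where "rep n z = inv_into (D n) (q n) z" for n z
  have rep: "rep n z \<in> D n" "q n (rep n z) = z" if "z \<in> q n ` D n" for n z
    using that by (auto simp: rep_def inv_into_into f_inv_into_f)
  define f where "f \<phi> z = q (tgt \<phi>) (A \<phi> (rep (fst \<phi>) z))" for \<phi> z
  have f: "f \<phi> (q (fst \<phi>) p) = q (tgt \<phi>) (A \<phi> p)" if "\<phi> \<in> Arr NCat" "p \<in> D (fst \<phi>)" for \<phi> p
  proof -
    have "rep (fst \<phi>) (q (fst \<phi>) p) \<in> D (fst \<phi>)" "q (fst \<phi>) (rep (fst \<phi>) (q (fst \<phi>) p)) = q (fst \<phi>) p"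
      using rep that by auto
    then have "(rep (fst \<phi>) (q (fst \<phi>) p), p) \<in> E (fst \<phi>)" using q that by blast
    then show ?thesis unfolding f_def using q A(1) EA that rep by auto
  qed
  have "mkob (\<lambda>n. q n ` D n) f \<in> Obj Qc"
  proof (rule mkob_obj)
    show "small TYPE('u) (q n ` D n)" for n using small_image[OF sm] .
    show "f \<phi> x \<in> q (tgt \<phi>) ` D (tgt \<phi>)" if "\<phi> \<in> Arr NCat" "x \<in> q (fst \<phi>) ` D (fst \<phi>)" for \<phi> x
    proof -
      obtain p where p: "p \<in> D (fst \<phi>)" "x = q (fst \<phi>) p" using \<open>x \<in> _\<close> by blast
      show ?thesis using f[OF \<open>\<phi> \<in> _\<close> p(1)] A(1)[OF \<open>\<phi> \<in> _\<close> p(1)] p(2) by simp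
    qed
    show "f (Id NCat n) x = x" if x: "x \<in> q n ` D n" for n x
    proof -
      obtain p where p: "p \<in> D n" "x = q n p" using x by blast
      show ?thesis using f[of "Id NCat n" p] p A(2)[OF p(1)] by simp
    qed
    show "f (Comp NCat \<psi> \<phi>) x = f \<psi> (f \<phi> x)"
      if h: "\<phi> \<in> Arr NCat" "\<psi> \<in> Arr NCat" "fst \<psi> = tgt \<phi>" "x \<in> q (fst \<phi>) ` D (fst \<phi>)" for \<phi> \<psi> x
    proof -
      obtain p where p: "p \<in> D (fst \<phi>)" "x = q (fst \<phi>) p" using h by blast
      show ?thesis using f[of "Comp NCat \<psi> \<phi>" p] f[of \<phi> p] f[of \<psi> "A \<phi> p"] p h A(1,3) by simp
    qed
  qed
  then show thesis
  proof (rule that)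
    show "q (tgt \<phi>) (A \<phi> p) = act (mkob (\<lambda>n. q n ` D n) f) \<phi> (q (fst \<phi>) p)"
      if "\<phi> \<in> Arr NCat" "p \<in> D (fst \<phi>)" for \<phi> p
      using f[OF that] that by simp
    show "q n p = q n p' \<longleftrightarrow> (p, p') \<in> (R n \<union> (R n)\<inverse>)\<^sup>*" if "p \<in> D n" "p' \<in> D n" for n p p'
      using q[OF that] by (simp only: E_def)
  qed simp
qed

lemma encode_functor:
  fixes D :: "nat \<Rightarrow> 'b set"
  assumes sm: "\<And>n. small TYPE('u) (D n)"
    and A: "\<And>\<phi> p. \<phi> \<in> Arr NCat ==> p \<in> D (fst \<phi>) ==> A \<phi> p \<in> D (tgt \<phi>)"
      "\<And>n p. p \<in> D n ==> A (Id NCat n) p = p"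
      "\<And>\<phi> \<psi> p. [|\<phi> \<in> Arr NCat; \<psi> \<in> Arr NCat; fst \<psi> = tgt \<phi>; p \<in> D (fst \<phi>)|] ==>
        A (Comp NCat \<psi> \<phi>) p = A \<psi> (A \<phi> p)"
  obtains L :: "'u q_obj" and q where "L \<in> Obj Qc" "\<And>n. bij_betw (q n) (D n) (FO L n)"
    "\<And>\<phi> p. \<phi> \<in> Arr NCat ==> p \<in> D (fst \<phi>) ==> q (tgt \<phi>) (A \<phi> p) = act L \<phi> (q (fst \<phi>) p)"
proof -
  obtain L :: "'u q_obj" and q where L: "L \<in> Obj Qc" "\<And>n. q n ` D n = FO L n"
    "\<And>\<phi> p. \<phi> \<in> Arr NCat ==> p \<in> D (fst \<phi>) ==> q (tgt \<phi>) (A \<phi> p) = act L \<phi> (q (fst \<phi>) p)"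
    "\<And>n p p'. p \<in> D n ==> p' \<in> D n ==> q n p = q n p' \<longleftrightarrow> (p, p') \<in> ({} \<union> {}\<inverse>)\<^sup>*"
    using quotient_functor[of D A "\<lambda>_. {}"] assms by auto
  have "bij_betw (q n) (D n) (FO L n)" for n
    using L(2)[of n] L(4)[of _ n] by (auto simp: bij_betw_def inj_on_def)
  then show thesis using that L(1,3) by blast
qed

lemma surj_factor:
  assumes q: "q \<in> Arr Qc" "\<And>n. ap q n ` FO (fst q) n = FO (tgt q) n"
    and a: "a \<in> Arr Qc" "fst a = fst q"
    and eq: "\<And>n x y. [|x \<in> FO (fst q) n; y \<in> FO (fst q) n; ap q n x = ap q n y|] ==> ap a n x = ap a n y"
  shows "\<exists>!h. h \<in> Hom Qc (tgt q) (tgt (a :: 'u q_arr)) \<and> Comp Qc h q = a"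
proof -
  let ?L = "tgt q" and ?Z = "tgt a"
  let ?r = "\<lambda>n. inv_into (FO (fst q) n) (ap q n)"
  let ?h = "mkar ?L (\<lambda>n z. ap a n (?r n z)) ?Z"
  have r: "?r n z \<in> FO (fst q) n" "ap q n (?r n z) = z" if "z \<in> FO ?L n" for n z
    using that q(2)[of n] by (auto simp: inv_into_into f_inv_into_f)
  have hq: "ap a n (?r n (ap q n x)) = ap a n x" if "x \<in> FO (fst q) n" for n x
    using that r[of "ap q n x" n] Q_ap_mem[OF q(1) that] by (intro eq) auto
  have h: "?h \<in> Arr Qc"
  proof (rule mkar_arr)
    fix \<phi> z assume \<phi>: "\<phi> \<in> Arr NCat" and z: "z \<in> FO ?L (fst \<phi>)"
    let ?x = "?r (fst \<phi>) z"
    have x: "?x \<in> FO (fst q) (fst \<phi>)" using r z by blast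
    have "act ?L \<phi> z = ap q (tgt \<phi>) (act (fst q) \<phi> ?x)"
      using Q_ap_nat[OF q(1) \<phi> x] r[OF z] by simp
    then have "ap a (tgt \<phi>) (?r (tgt \<phi>) (act ?L \<phi> z)) = ap a (tgt \<phi>) (act (fst q) \<phi> ?x)"
      using hq Qob_mem[OF _ \<phi> x] q by simp
    then show "ap a (tgt \<phi>) (?r (tgt \<phi>) (act ?L \<phi> z)) = act ?Z \<phi> (ap a (fst \<phi>) ?x)"
      using Q_ap_nat[OF a(1) \<phi>, of ?x] x a(2) by simp
  next
    show "ap a n (?r n z) \<in> FO ?Z n" if "z \<in> FO ?L n" for n z
      using Q_ap_mem[OF a(1), of "?r n z" n] r[OF that] a(2) by simp
  qed (use q a in auto)
  show ?thesis
  proof (intro ex1I[of _ ?h] conjI)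
    show "Comp Qc ?h q = a"
      by (rule Q_ext) (use q(1) h a hq Q_ap_mem[OF q(1)] in auto)
    fix k assume k: "k \<in> Hom Qc ?L ?Z \<and> Comp Qc k q = a"
    show "k = ?h"
    proof (rule Q_ext)
      fix n z assume "z \<in> FO (fst k) n"
      then have z: "z \<in> FO ?L n" using k by (simp add: Hom_iff)
      have "ap k n (ap q n (?r n z)) = ap a n (?r n z)"
        using k ap_comp[OF q(1), of "?r n z" n k] r[OF z] by simp
      then show "ap k n z = ap ?h n z" using z r by simp
    qed (use k h in "auto simp: Hom_iff")
  qed (use h in "auto simp: Hom_iff")
qed

lemma Q_coequalizerI:
  assumes q: "q \<in> Arr Qc" "\<And>n. ap q n ` FO (fst q) n = FO (tgt q) n"
    and rs: "r \<in> Arr Qc" "s \<in> Arr Qc" "fst s = fst r" "tgt r = fst q" "tgt s = fst q" "Comp Qc q r = Comp Qc q s"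
    and ex: "\<And>n x y. [|x \<in> FO (fst q) n; y \<in> FO (fst q) n; ap q n x = ap q n y|] ==>
      \<exists>t. t \<in> FO (fst r) n \<and> ap r n t = x \<and> ap s n t = y"
  shows "is_coequalizer Qc r s (q :: 'u q_arr)"
  unfolding is_coequalizer_def
proof (intro conjI allI ballI impI)
  fix Z a assume a: "a \<in> Hom Qc (Dom Qc q) Z" and ars: "Comp Qc a r = Comp Qc a s"
  have a': "a \<in> Arr Qc" "fst a = fst q" "tgt a = Z" using a by (auto simp: Hom_iff)
  have eq: "ap a n x = ap a n y" if xy: "x \<in> FO (fst q) n" "y \<in> FO (fst q) n" "ap q n x = ap q n y" for n x y
  proof -
    obtain t where t: "t \<in> FO (fst r) n" "ap r n t = x" "ap s n t = y" using ex[OF xy] by blast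
    have "ap (Comp Qc a r) n t = ap (Comp Qc a s) n t" using ars by simp
    then show ?thesis using t rs by simp
  qed
  have "\<exists>!h. h \<in> Hom Qc (tgt q) (tgt a) \<and> Comp Qc h q = a" by (rule surj_factor[OF q a'(1,2)]) (rule eq)
  then show "\<exists>!h. h \<in> Hom Qc (Cod Qc q) Z \<and> Comp Qc h q = a" by (simp only: a'(3) Q_simps)
qed (use q rs in auto)

text \<open>
  Pullbacks are pointwise; the lifts are natural because the two projections are jointly
  injective.
\<close>

lemma Q_pullbackI:
  assumes e: "e \<in> Arr Qc" and p: "p \<in> Arr Qc" "p' \<in> Arr Qc" "fst p' = fst p" "tgt p = fst e" "tgt p' = fst e"
      "Comp Qc e p = Comp Qc e p'"
    and ex: "\<And>n x y. [|x \<in> FO (fst e) n; y \<in> FO (fst e) n; ap e n x = ap e n y|] ==>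
      \<exists>t. t \<in> FO (fst p) n \<and> ap p n t = x \<and> ap p' n t = y"
    and inj: "\<And>n t t'. [|t \<in> FO (fst p) n; t' \<in> FO (fst p) n; ap p n t = ap p n t'; ap p' n t = ap p' n t'|] ==> t = t'"
  shows "is_pullback Qc e e p (p' :: 'u q_arr)"
  unfolding is_pullback_def
proof (intro conjI allI ballI impI)
  fix Z a b assume a: "a \<in> Hom Qc Z (Dom Qc e)" and b: "b \<in> Hom Qc Z (Dom Qc e)" and ab: "Comp Qc e a = Comp Qc e b"
  let ?K = "fst p"
  have Z: "Z \<in> Obj Qc" and K: "?K \<in> Obj Qc" using Q.hom_objs[OF a] p by auto
  have a': "a \<in> Arr Qc" "fst a = Z" "tgt a = fst e" and b': "b \<in> Arr Qc" "fst b = Z" "tgt b = fst e"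
    using a b by (auto simp: Hom_iff)
  define t where "t n z = (SOME t. t \<in> FO ?K n \<and> ap p n t = ap a n z \<and> ap p' n t = ap b n z)" for n z
  have t: "t n z \<in> FO ?K n \<and> ap p n (t n z) = ap a n z \<and> ap p' n (t n z) = ap b n z" if z: "z \<in> FO Z n" for n z
  proof -
    have "ap (Comp Qc e a) n z = ap (Comp Qc e b) n z" using ab by simp
    then have "\<exists>t. t \<in> FO ?K n \<and> ap p n t = ap a n z \<and> ap p' n t = ap b n z"
      using a' b' z Q_ap_mem[OF a'(1), of z n] Q_ap_mem[OF b'(1), of z n] by (intro ex) auto
    from someI_ex[OF this] show ?thesis by (simp add: t_def)
  qed
  let ?h = "mkar Z t ?K"
  have h: "?h \<in> Arr Qc"
  proof (rule mkar_arr[OF Z K])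
    fix \<phi> z assume \<phi>: "\<phi> \<in> Arr NCat" "z \<in> FO Z (fst \<phi>)"
    have z': "act Z \<phi> z \<in> FO Z (tgt \<phi>)" using Qob_mem[OF Z \<phi>] .
    show "t (tgt \<phi>) (act Z \<phi> z) = act ?K \<phi> (t (fst \<phi>) z)"
    proof (rule inj)
      show "act ?K \<phi> (t (fst \<phi>) z) \<in> FO ?K (tgt \<phi>)" using Qob_mem[OF K \<phi>(1)] t[OF \<phi>(2)] by blast
    qed (use t[OF z'] t[OF \<phi>(2)] Q_ap_nat[OF a'(1) \<phi>(1)] Q_ap_nat[OF b'(1) \<phi>(1)] Q_ap_nat[OF p(1) \<phi>(1)]
      Q_ap_nat[OF p(2) \<phi>(1)] \<phi> a' b' p in auto)
  qed (use t in auto)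
  show "\<exists>!h. h \<in> Hom Qc Z (Dom Qc p) \<and> Comp Qc p h = a \<and> Comp Qc p' h = b"
  proof (intro ex1I[of _ ?h] conjI)
    show "Comp Qc p ?h = a" by (rule Q_ext) (use p a' h t in auto)
    show "Comp Qc p' ?h = b" by (rule Q_ext) (use p b' h t in auto)
    fix k assume k: "k \<in> Hom Qc Z (Dom Qc p) \<and> Comp Qc p k = a \<and> Comp Qc p' k = b"
    show "k = ?h"
    proof (rule Q_ext)
      fix n z assume "z \<in> FO (fst k) n"
      then have z: "z \<in> FO Z n" and ka: "k \<in> Arr Qc" "fst k = Z" "tgt k = ?K" using k by (auto simp: Hom_iff)
      have "ap (Comp Qc p k) n z = ap a n z" "ap (Comp Qc p' k) n z = ap b n z" using k by auto
      then show "ap k n z = ap ?h n z"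
        using inj[of "ap k n z" n "t n z"] t[OF z] z ka Q_ap_mem[OF ka(1), of z n] by simp
    qed (use k h in "auto simp: Hom_iff")
  qed (use h in "auto simp: Hom_iff")
qed (use e p in auto)

lemma locally_small_Qc: "locally_small TYPE('u) (Qc :: ('u q_obj, 'u q_arr) cat)"
  unfolding locally_small_def
proof (intro ballI)
  fix P Q :: "'u q_obj" assume P: "P \<in> Obj Qc" and Q: "Q \<in> Obj Qc"
  let ?G = "\<lambda>a. {(n, x, ap a n x) | n x. x \<in> FO P n}"
  show "small TYPE('u) (Hom Qc P Q)"
  proof (rule small_if_inj)
    show "inj_on ?G (Hom Qc P Q)"
    proof (rule inj_onI)
      fix a b assume ab: "a \<in> Hom Qc P Q" "b \<in> Hom Qc P Q" and eq: "?G a = ?G b"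
      have "ap a n x = ap b n x" if "x \<in> FO P n" for n x
      proof -
        have "(n, x, ap a n x) \<in> ?G b" using that unfolding eq[symmetric] by blast
        then show ?thesis by blast
      qed
      then show "a = b" using ab by (intro Q_ext) (auto simp: Hom_iff)
    qed
    have "ap a n x \<in> FO Q n" if "a \<in> Hom Qc P Q" "x \<in> FO P n" for a n x
      using Q_ap_mem[of a x n] that by (simp add: Hom_iff)
    then show "?G ` Hom Qc P Q \<subseteq> Pow (SIGMA n:UNIV. FO P n \<times> FO Q n)" by blast
    show "small TYPE('u) (Pow (SIGMA n:(UNIV :: nat set). FO P n \<times> FO Q n))"
      by (intro small_Pow small_Sigma small_nat Qob_small P Q)
  qed
qed

text \<open>
  The pointwise colimit: the disjoint union of the sets \<open>G j n\<close>, modulo the relation generated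
  by the transition maps.
\<close>

lemma has_small_colimits_Qc: "has_small_colimits TYPE('u) (Qc :: ('u q_obj, 'u q_arr) cat)"
  unfolding has_small_colimits_def
proof (intro allI impI)
  fix J :: "('u, 'u) cat" and G :: "('u, 'u, 'u q_obj, 'u q_arr) cfun"
  assume JG: "small_category J \<and> cfunctor J Qc G"
  then interpret G: cfunctor J Qc G by simp
  note G = G.functor_simps[simplified]
  define D where "D n = Sigma (Obj J) (\<lambda>j. FO (FO G j) n)" for n
  define A where "A \<phi> = (\<lambda>(j, x). (j, act (FO G j) \<phi> x))" for \<phi>
  define R where "R n = {((Dom J f, x), (Cod J f, ap (FA G f) n x)) | f x. f \<in> Arr J \<and> x \<in> FO (FO G (Dom J f)) n}" for n
  have mem: "ap (FA G f) n x \<in> FO (FO G (Cod J f)) n" if "f \<in> Arr J" "x \<in> FO (FO G (Dom J f)) n" for f n x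
    using Q_ap_mem[of "FA G f" x n] that G by simp
  have RD: "R n \<subseteq> D n \<times> D n" for n using mem by (auto simp: R_def D_def)
  have Rn: "(A \<phi> p, A \<phi> p') \<in> R (tgt \<phi>)" if hyp: "\<phi> \<in> Arr NCat" "(p, p') \<in> R (fst \<phi>)" for \<phi> p p'
  proof -
    obtain f x where f: "f \<in> Arr J" "x \<in> FO (FO G (Dom J f)) (fst \<phi>)" "p = (Dom J f, x)" "p' = (Cod J f, ap (FA G f) (fst \<phi>) x)"
      using hyp(2) by (auto simp: R_def)
    have "act (FO G (Cod J f)) \<phi> (ap (FA G f) (fst \<phi>) x) = ap (FA G f) (tgt \<phi>) (act (FO G (Dom J f)) \<phi> x)"
      using Q_ap_nat[of "FA G f" \<phi> x] f G hyp(1) by simp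
    then show ?thesis unfolding R_def A_def f using f G hyp(1) by (auto simp: Qob_mem)
  qed
  obtain L :: "'u q_obj" and q where L: "L \<in> Obj Qc" and qs: "\<And>n. q n ` D n = FO L n"
    and qn: "\<And>\<phi> p. \<phi> \<in> Arr NCat ==> p \<in> D (fst \<phi>) ==> q (tgt \<phi>) (A \<phi> p) = act L \<phi> (q (fst \<phi>) p)"
    and qe: "\<And>n p p'. p \<in> D n ==> p' \<in> D n ==> q n p = q n p' \<longleftrightarrow> (p, p') \<in> (R n \<union> (R n)\<inverse>)\<^sup>*"
  proof (rule quotient_functor[of D A R])
    show "small TYPE('u) (D n)" for n
      unfolding D_def using JG G(1) by (intro small_Sigma Qob_small) (auto simp: small_category_def)
  qed (use RD Rn G(1) in "auto simp: D_def A_def Qob_mem2 Qob_comp")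
  let ?i = "\<lambda>j. mkar (FO G j) (\<lambda>n x. q n (j, x)) L"
  have i: "?i j \<in> Arr Qc" if "j \<in> Obj J" for j
  proof (rule mkar_arr)
    show "q n (j, x) \<in> FO L n" if "x \<in> FO (FO G j) n" for n x
      using that \<open>j \<in> Obj J\<close> qs[of n] by (auto simp: D_def)
    show "q (tgt \<phi>) (j, act (FO G j) \<phi> x) = act L \<phi> (q (fst \<phi>) (j, x))"
      if "\<phi> \<in> Arr NCat" "x \<in> FO (FO G j) (fst \<phi>)" for \<phi> x
      using qn[of \<phi> "(j, x)"] that \<open>j \<in> Obj J\<close> by (simp add: D_def A_def)
  qed (use that G L in auto)
  have "is_colimit J Qc G L ?i"
    unfolding is_colimit_def
  proof (intro conjI allI impI)
    show "is_cocone J Qc G L ?i"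
      unfolding is_cocone_def
    proof (intro conjI ballI)
      fix f assume f: "f \<in> Arr J"
      show "Comp Qc (?i (Cod J f)) (FA G f) = ?i (Dom J f)"
      proof (rule Q_ext)
        fix n x assume "x \<in> FO (fst (Comp Qc (?i (Cod J f)) (FA G f))) n"
        then have x: "x \<in> FO (FO G (Dom J f)) n" using f G by simp
        then have "((Dom J f, x), (Cod J f, ap (FA G f) n x)) \<in> R n" using f by (auto simp: R_def)
        then have "q n (Dom J f, x) = q n (Cod J f, ap (FA G f) n x)"
          using qe[of "(Dom J f, x)" n "(Cod J f, ap (FA G f) n x)"] f x mem[OF f x] by (auto simp: D_def)
        then show "ap (Comp Qc (?i (Cod J f)) (FA G f)) n x = ap (?i (Dom J f)) n x"
          using f x G mem[OF f x] by simp
      qed (use f G i in auto)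
    qed (use L i in "auto simp: Hom_iff")
  next
    fix Z k assume k: "is_cocone J Qc G Z k"
    then have Z: "Z \<in> Obj Qc" by (simp add: is_cocone_def)
    have kk: "k j \<in> Arr Qc" "fst (k j) = FO G j" "tgt (k j) = Z" if "j \<in> Obj J" for j
      using k that by (auto simp: is_cocone_def Hom_iff)
    define g where "g n = (\<lambda>(j, x). ap (k j) n x)" for n
    have gR: "g n p = g n p'" if "(p, p') \<in> R n" for n p p'
    proof -
      obtain f x where f: "f \<in> Arr J" "x \<in> FO (FO G (Dom J f)) n" "p = (Dom J f, x)" "p' = (Cod J f, ap (FA G f) n x)"
        using \<open>(p, p') \<in> R n\<close> by (auto simp: R_def)
      have "ap (Comp Qc (k (Cod J f)) (FA G f)) n x = ap (k (Dom J f)) n x"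
        using k f by (simp add: is_cocone_def)
      then show ?thesis using f G by (simp add: g_def)
    qed
    have gE: "g n p = g n p'" if "(p, p') \<in> (R n \<union> (R n)\<inverse>)\<^sup>*" for n p p'
      using that by (induction rule: rtrancl_induct) (auto dest: gR)
    define r where "r n = inv_into (D n) (q n)" for n
    have r: "r n z \<in> D n" "q n (r n z) = z" if "z \<in> FO L n" for n z
      using that qs[of n] by (auto simp: r_def inv_into_into f_inv_into_f)
    have gr: "g n (r n (q n p)) = g n p" if "p \<in> D n" for n p
    proof -
      have "q n p \<in> FO L n" using that qs[of n] by blast
      then show ?thesis using r[of "q n p" n] qe[of "r n (q n p)" n p] that gE by blast
    qed
    have gZ: "g n p \<in> FO Z n" if "p \<in> D n" for n p
      using that kk Q_ap_mem[of "k (fst p)" "snd p" n] by (auto simp: g_def D_def)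
    let ?h = "mkar L (\<lambda>n z. g n (r n z)) Z"
    have h: "?h \<in> Arr Qc"
    proof (rule mkar_arr[OF L Z])
      fix \<phi> z assume \<phi>: "\<phi> \<in> Arr NCat" and z: "z \<in> FO L (fst \<phi>)"
      let ?p = "r (fst \<phi>) z"
      have p: "?p \<in> D (fst \<phi>)" using r z by blast
      have "g (tgt \<phi>) (A \<phi> ?p) = act Z \<phi> (g (fst \<phi>) ?p)"
        using p kk Q_ap_nat[of "k (fst ?p)" \<phi> "snd ?p"] \<phi> by (auto simp: g_def A_def D_def split: prod.splits)
      moreover have "act L \<phi> z = q (tgt \<phi>) (A \<phi> ?p)" using qn[OF \<phi> p] r(2)[OF z] by simp
      moreover have "A \<phi> ?p \<in> D (tgt \<phi>)" using p \<phi> G(1) by (auto simp: A_def D_def Qob_mem)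
      ultimately show "g (tgt \<phi>) (r (tgt \<phi>) (act L \<phi> z)) = act Z \<phi> (g (fst \<phi>) ?p)"
        using gr by simp
    qed (use r gZ in auto)
    show "\<exists>!h. h \<in> Hom Qc L Z \<and> (\<forall>j\<in>Obj J. Comp Qc h (?i j) = k j)"
    proof (intro ex1I[of _ ?h] conjI ballI)
      fix j assume j: "j \<in> Obj J"
      show "Comp Qc ?h (?i j) = k j"
      proof (rule Q_ext)
        fix n x assume "x \<in> FO (fst (Comp Qc ?h (?i j))) n"
        then have x: "(j, x) \<in> D n" using j by (simp add: D_def)
        moreover have "q n (j, x) \<in> FO L n" using qs[of n] x by blast
        ultimately show "ap (Comp Qc ?h (?i j)) n x = ap (k j) n x"
          using ap_comp[OF i[OF j], of x n ?h] gr[OF x] by (simp add: D_def g_def)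
      qed (use j i kk h in auto)
    next
      fix h' assume h': "h' \<in> Hom Qc L Z \<and> (\<forall>j\<in>Obj J. Comp Qc h' (?i j) = k j)"
      show "h' = ?h"
      proof (rule Q_ext)
        fix n z assume "z \<in> FO (fst h') n"
        then have z: "z \<in> FO L n" using h' by (simp add: Hom_iff)
        obtain j x where p: "r n z = (j, x)" "j \<in> Obj J" "x \<in> FO (FO G j) n"
          using r(1)[OF z] by (auto simp: D_def)
        have "ap h' n z = ap (Comp Qc h' (?i j)) n x"
          using ap_comp[OF i[OF p(2)], of x n h'] p r(2)[OF z] by simp
        then show "ap h' n z = ap ?h n z" using h' p z by (simp add: g_def)
      qed (use h h' in "auto simp: Hom_iff")
    qed (use h in "auto simp: Hom_iff")
  qed
  then show "\<exists>L \<iota>. is_colimit J Qc G L \<iota>" by blast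
qed

text \<open>The pointwise limit: the set of compatible families.\<close>

lemma has_finite_limits_Qc: "has_finite_limits (Qc :: ('u q_obj, 'u q_arr) cat)"
  unfolding has_finite_limits_def
proof (intro allI impI)
  fix J :: "(nat, nat) cat" and G :: "(nat, nat, 'u q_obj, 'u q_arr) cfun"
  assume JG: "category J \<and> finite (Obj J) \<and> finite (Arr J) \<and> cfunctor J Qc G"
  then interpret G: cfunctor J Qc G by simp
  note G = G.functor_simps[simplified]
  define D where "D n = {t \<in> PiE (Obj J) (\<lambda>j. FO (FO G j) n). \<forall>f\<in>Arr J. ap (FA G f) n (t (Dom J f)) = t (Cod J f)}" for n
  define A where "A \<phi> t = (\<lambda>j\<in>Obj J. act (FO G j) \<phi> (t j))" for \<phi> t
  have Dm: "t j \<in> FO (FO G j) n" if "t \<in> D n" "j \<in> Obj J" for t j n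
    using that by (auto simp: D_def)
  have AD: "A \<phi> t \<in> D (tgt \<phi>)" if "\<phi> \<in> Arr NCat" "t \<in> D (fst \<phi>)" for \<phi> t
  proof -
    have "ap (FA G f) (tgt \<phi>) (act (FO G (Dom J f)) \<phi> (t (Dom J f))) = act (FO G (Cod J f)) \<phi> (t (Cod J f))"
      if "f \<in> Arr J" for f
      using Q_ap_nat[of "FA G f" \<phi> "t (Dom J f)"] that \<open>\<phi> \<in> Arr NCat\<close> \<open>t \<in> D (fst \<phi>)\<close> Dm G by (simp add: D_def)
    then show ?thesis using that Dm[OF that(2)] G(1) by (auto simp: D_def A_def Qob_mem)
  qed
  obtain L :: "'u q_obj" and q where L: "L \<in> Obj Qc" and qb: "\<And>n. bij_betw (q n) (D n) (FO L n)"
    and qn: "\<And>\<phi> p. \<phi> \<in> Arr NCat ==> p \<in> D (fst \<phi>) ==> q (tgt \<phi>) (A \<phi> p) = act L \<phi> (q (fst \<phi>) p)"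
  proof (rule encode_functor[of D A])
    show "small TYPE('u) (D n)" for n
    proof (rule small_subset)
      show "D n \<subseteq> PiE (Obj J) (\<lambda>j. FO (FO G j) n)" by (auto simp: D_def)
      show "small TYPE('u) (PiE (Obj J) (\<lambda>j. FO (FO G j) n))"
        using JG G(1) by (intro small_PiE Qob_small small_finite) auto
    qed
    show "A \<phi> t \<in> D (tgt \<phi>)" if "\<phi> \<in> Arr NCat" "t \<in> D (fst \<phi>)" for \<phi> t by (rule AD[OF that])
    show "A (Id NCat n) t = t" if "t \<in> D n" for n t
      using that Dm[OF that] G(1) by (auto simp: A_def D_def fun_eq_iff restrict_def dest: PiE_arb)
    show "A (Comp NCat \<psi> \<phi>) t = A \<psi> (A \<phi> t)"
      if "\<phi> \<in> Arr NCat" "\<psi> \<in> Arr NCat" "fst \<psi> = tgt \<phi>" "t \<in> D (fst \<phi>)" for \<phi> \<psi> t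
      using that Dm[OF that(4)] G(1) by (auto simp: A_def fun_eq_iff restrict_def Qob_comp)
  qed blast
  define r where "r n = inv_into (D n) (q n)" for n
  have r: "r n z \<in> D n" "q n (r n z) = z" if "z \<in> FO L n" for n z
    using that qb[of n] by (auto simp: r_def bij_betw_def inv_into_into f_inv_into_f)
  have rq: "r n (q n t) = t" "q n t \<in> FO L n" if "t \<in> D n" for n t
    using that qb[of n] by (auto simp: r_def bij_betw_def)
  let ?p = "\<lambda>j. mkar L (\<lambda>n z. r n z j) (FO G j)"
  have ra: "r (tgt \<phi>) (act L \<phi> z) = A \<phi> (r (fst \<phi>) z)" if "\<phi> \<in> Arr NCat" "z \<in> FO L (fst \<phi>)" for \<phi> z
    using qn[OF that(1) r(1)[OF that(2)]] r(2)[OF that(2)] rq(1)[OF AD[OF that(1) r(1)[OF that(2)]]] by simp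
  have p: "?p j \<in> Arr Qc" if "j \<in> Obj J" for j
    by (rule mkar_arr) (use that L G(1) r(1) Dm ra in "auto simp: A_def")
  have "is_colimit (op J) (op Qc) G L ?p"
    unfolding is_colimit_def
  proof (intro conjI allI impI)
    show "is_cocone (op J) (op Qc) G L ?p"
      unfolding is_cocone_def op_simps
    proof (intro conjI ballI)
      fix f assume f: "f \<in> Arr J"
      show "Comp Qc (FA G f) (?p (Dom J f)) = ?p (Cod J f)"
        by (rule Q_ext) (use f G p r in "auto simp: D_def")
    qed (use L p in "auto simp: Hom_iff")
  next
    fix Z k assume "is_cocone (op J) (op Qc) G Z k"
    then have Z: "Z \<in> Obj Qc" and kk: "\<And>j. j \<in> Obj J ==> k j \<in> Arr Qc \<and> fst (k j) = Z \<and> tgt (k j) = FO G j"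
      and kf: "\<And>f. f \<in> Arr J ==> Comp Qc (FA G f) (k (Dom J f)) = k (Cod J f)"
      by (auto simp: is_cocone_def Hom_iff)
    define t where "t n z = (\<lambda>j\<in>Obj J. ap (k j) n z)" for n z
    have t: "t n z \<in> D n" if "z \<in> FO Z n" for n z
    proof -
      have "ap (k j) n z \<in> FO (FO G j) n" if "j \<in> Obj J" for j
        using Q_ap_mem[of "k j" z n] kk[OF that] \<open>z \<in> _\<close> by simp
      moreover have "ap (FA G f) n (ap (k (Dom J f)) n z) = ap (k (Cod J f)) n z" if "f \<in> Arr J" for f
        using ap_comp[of "k (Dom J f)" z n "FA G f"] kk[of "Dom J f"] kf[OF that] that \<open>z \<in> _\<close> by simp
      ultimately show ?thesis by (auto simp: t_def D_def)
    qed
    let ?h = "mkar Z (\<lambda>n z. q n (t n z)) L"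
    have h: "?h \<in> Arr Qc"
    proof (rule mkar_arr[OF Z L])
      fix \<phi> z assume \<phi>: "\<phi> \<in> Arr NCat" and z: "z \<in> FO Z (fst \<phi>)"
      have "t (tgt \<phi>) (act Z \<phi> z) = A \<phi> (t (fst \<phi>) z)"
      proof -
        have "ap (k j) (tgt \<phi>) (act Z \<phi> z) = act (FO G j) \<phi> (ap (k j) (fst \<phi>) z)" if "j \<in> Obj J" for j
          using Q_ap_nat[of "k j" \<phi> z] kk[OF that] \<phi> z by simp
        then show ?thesis by (auto simp: t_def A_def fun_eq_iff)
      qed
      then show "q (tgt \<phi>) (t (tgt \<phi>) (act Z \<phi> z)) = act L \<phi> (q (fst \<phi>) (t (fst \<phi>) z))"
        using qn[OF \<phi> t[OF z]] by simp
    qed (use t rq in auto)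
    show "\<exists>!h. h \<in> Hom (op Qc) L Z \<and> (\<forall>j\<in>Obj (op J). Comp (op Qc) h (?p j) = k j)"
      unfolding op_simps
    proof (intro ex1I[of _ ?h] conjI ballI)
      fix j assume j: "j \<in> Obj J"
      show "Comp Qc (?p j) ?h = k j"
        by (rule Q_ext) (use j h p kk rq t in "auto simp: t_def")
    next
      fix h' assume h': "h' \<in> Hom Qc Z L \<and> (\<forall>j\<in>Obj J. Comp Qc (?p j) h' = k j)"
      show "h' = ?h"
      proof (rule Q_ext)
        fix n z assume "z \<in> FO (fst h') n"
        then have z: "z \<in> FO Z n" using h' by (simp add: Hom_iff)
        have hz: "ap h' n z \<in> FO L n" using Q_ap_mem[of h' z n] h' z by (auto simp: Hom_iff)
        have "r n (ap h' n z) j = ap (k j) n z" if "j \<in> Obj J" for j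
        proof -
          have "ap (Comp Qc (?p j) h') n z = ap (k j) n z" using h' that by auto
          then show ?thesis using h' z hz by (simp add: Hom_iff)
        qed
        then have "r n (ap h' n z) = t n z"
          using r(1)[OF hz] t[OF z] by (intro PiE_ext[of _ "Obj J" "\<lambda>j. FO (FO G j) n"]) (auto simp: D_def t_def)
        then show "ap h' n z = ap ?h n z" using r(2)[OF hz] z by simp
      qed (use h h' in "auto simp: Hom_iff")
    qed (use h in "auto simp: Hom_iff")
  qed
  then show "\<exists>L \<pi>. is_limit J Qc G L \<pi>" unfolding is_limit_def by blast
qed

text \<open>
  An epimorphism is pointwise surjective: otherwise it does not distinguish the two maps to the
  target with the complement of the image doubled.
\<close>

lemma epi_surj:
  assumes e: "is_epi Qc (e :: 'u q_arr)" shows "ap e n ` FO (fst e) n = FO (tgt e) n"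
proof -
  have ea: "e \<in> Arr Qc" using e by (simp add: is_epi_def)
  let ?P = "fst e" and ?Q = "tgt e"
  have ob: "?P \<in> Obj Qc" "?Q \<in> Obj Qc" using ea by auto
  define I where "I n = ap e n ` FO ?P n" for n
  have IQ: "I n \<subseteq> FO ?Q n" for n using Q_ap_mem[OF ea] by (auto simp: I_def)
  have Ia: "act ?Q \<phi> y \<in> I (tgt \<phi>)" if "\<phi> \<in> Arr NCat" "y \<in> I (fst \<phi>)" for \<phi> y
    using that Q_ap_nat[OF ea that(1)] Qob_mem[OF ob(1) that(1)] by (force simp: I_def)
  define D where "D n = {(y, b). y \<in> FO ?Q n \<and> (b \<longrightarrow> y \<notin> I n)}" for n
  define A where "A \<phi> = (\<lambda>(y, b). (act ?Q \<phi> y, b \<and> act ?Q \<phi> y \<notin> I (tgt \<phi>)))" for \<phi>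
  obtain W :: "'u q_obj" and q where W: "W \<in> Obj Qc" and qb: "\<And>n. bij_betw (q n) (D n) (FO W n)"
    and qn: "\<And>\<phi> p. \<phi> \<in> Arr NCat ==> p \<in> D (fst \<phi>) ==> q (tgt \<phi>) (A \<phi> p) = act W \<phi> (q (fst \<phi>) p)"
  proof (rule encode_functor[of D A])
    show "small TYPE('u) (D n)" for n
    proof (rule small_subset)
      show "D n \<subseteq> FO ?Q n \<times> UNIV" by (auto simp: D_def)
      show "small TYPE('u) (FO ?Q n \<times> (UNIV :: bool set))"
        by (intro small_Sigma Qob_small ob small_finite) auto
    qed
    show "A (Comp NCat \<psi> \<phi>) t = A \<psi> (A \<phi> t)"
      if "\<phi> \<in> Arr NCat" "\<psi> \<in> Arr NCat" "fst \<psi> = tgt \<phi>" "t \<in> D (fst \<phi>)" for \<phi> \<psi> t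
      using that Ia[OF that(2)] ob by (auto simp: A_def D_def Qob_comp)
  qed (use ob in "auto simp: A_def D_def Qob_mem2")
  have qm: "q n p \<in> FO W n" if "p \<in> D n" for n p using qb[of n] that by (auto simp: bij_betw_def)
  let ?g = "mkar ?Q (\<lambda>n y. q n (y, False)) W" and ?h = "mkar ?Q (\<lambda>n y. q n (y, y \<notin> I n)) W"
  have g: "?g \<in> Arr Qc"
  proof (rule mkar_arr)
    fix \<phi> y assume "\<phi> \<in> Arr NCat" "y \<in> FO ?Q (fst \<phi>)"
    then show "q (tgt \<phi>) (act ?Q \<phi> y, False) = act W \<phi> (q (fst \<phi>) (y, False))"
      using qn[of \<phi> "(y, False)"] by (simp add: A_def D_def)
  qed (use ob W qm in "auto simp: D_def")
  have h: "?h \<in> Arr Qc"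
  proof (rule mkar_arr)
    fix \<phi> y assume \<phi>: "\<phi> \<in> Arr NCat" "y \<in> FO ?Q (fst \<phi>)"
    have "A \<phi> (y, y \<notin> I (fst \<phi>)) = (act ?Q \<phi> y, act ?Q \<phi> y \<notin> I (tgt \<phi>))"
      using Ia[OF \<phi>(1)] by (auto simp: A_def)
    then show "q (tgt \<phi>) (act ?Q \<phi> y, act ?Q \<phi> y \<notin> I (tgt \<phi>)) = act W \<phi> (q (fst \<phi>) (y, y \<notin> I (fst \<phi>)))"
      using qn[of \<phi> "(y, y \<notin> I (fst \<phi>))"] \<phi> by (simp add: D_def)
  qed (use ob W qm in "auto simp: D_def")
  have "Comp Qc ?g e = Comp Qc ?h e"
    by (rule Q_ext) (use ea g h Q_ap_mem[OF ea] in "auto simp: I_def")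
  then have "?g = ?h" using e g h unfolding is_epi_def by (auto simp: Hom_iff)
  have "FO ?Q n \<subseteq> I n"
  proof
    fix y assume y: "y \<in> FO ?Q n"
    have "ap ?g n y = ap ?h n y" by (simp only: \<open>?g = ?h\<close>)
    then have "q n (y, False) = q n (y, y \<notin> I n)" using y by simp
    then have "(y, False) = (y, y \<notin> I n)"
      using qb[of n] y by (auto simp: bij_betw_def D_def dest!: inj_onD)
    then show "y \<in> I n" by simp
  qed
  then show ?thesis using IQ[of n] by (auto simp: I_def)
qed

text \<open>\<open>D\<close> is the kernel pair, whose quotient is the image.\<close>

lemma surj_effective:
  assumes e: "e \<in> Arr Qc" and s: "\<And>n. ap e n ` FO (fst e) n = FO (tgt e) n"
  shows "effective_arr Qc (e :: 'u q_arr)"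
proof -
  let ?P = "fst e"
  have P: "?P \<in> Obj Qc" using e by simp
  define D where "D n = {(x, y). x \<in> FO ?P n \<and> y \<in> FO ?P n \<and> ap e n x = ap e n y}" for n
  define A where "A \<phi> = (\<lambda>(x, y). (act ?P \<phi> x, act ?P \<phi> y))" for \<phi>
  have AD: "A \<phi> t \<in> D (tgt \<phi>)" if "\<phi> \<in> Arr NCat" "t \<in> D (fst \<phi>)" for \<phi> t
    using that P Q_ap_nat[OF e that(1)] by (auto simp: A_def D_def Qob_mem)
  obtain K :: "'u q_obj" and q where K: "K \<in> Obj Qc" and qb: "\<And>n. bij_betw (q n) (D n) (FO K n)"
    and qn: "\<And>\<phi> p. \<phi> \<in> Arr NCat ==> p \<in> D (fst \<phi>) ==> q (tgt \<phi>) (A \<phi> p) = act K \<phi> (q (fst \<phi>) p)"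
  proof (rule encode_functor[of D A])
    show "small TYPE('u) (D n)" for n
    proof (rule small_subset)
      show "D n \<subseteq> FO ?P n \<times> FO ?P n" by (auto simp: D_def)
      show "small TYPE('u) (FO ?P n \<times> FO ?P n)" by (intro small_Sigma Qob_small P)
    qed
  qed (use P AD in "auto simp: A_def D_def Qob_comp")
  define r where "r n = inv_into (D n) (q n)" for n
  have r: "r n z \<in> D n" "q n (r n z) = z" if "z \<in> FO K n" for n z
    using that qb[of n] by (auto simp: r_def bij_betw_def inv_into_into f_inv_into_f)
  have rq: "r n (q n t) = t" "q n t \<in> FO K n" if "t \<in> D n" for n t
    using that qb[of n] by (auto simp: r_def bij_betw_def)
  have ra: "r (tgt \<phi>) (act K \<phi> z) = A \<phi> (r (fst \<phi>) z)" if "\<phi> \<in> Arr NCat" "z \<in> FO K (fst \<phi>)" for \<phi> z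
    using qn[OF that(1) r(1)[OF that(2)]] r(2)[OF that(2)] rq(1)[OF AD[OF that(1) r(1)[OF that(2)]]] by simp
  let ?p = "mkar K (\<lambda>n z. fst (r n z)) ?P" and ?p' = "mkar K (\<lambda>n z. snd (r n z)) ?P"
  have rD: "fst (r n z) \<in> FO ?P n" "snd (r n z) \<in> FO ?P n" "ap e n (fst (r n z)) = ap e n (snd (r n z))"
    if "z \<in> FO K n" for n z
    using r(1)[OF that] by (auto simp: D_def)
  have p: "?p \<in> Arr Qc" "?p' \<in> Arr Qc"
    by (rule mkar_arr; use K P rD ra in "auto simp: A_def split: prod.splits")+
  have epp: "Comp Qc e ?p = Comp Qc e ?p'"
    by (rule Q_ext) (use e p rD in auto)
  have ex: "\<exists>t. t \<in> FO (fst ?p) n \<and> ap ?p n t = x \<and> ap ?p' n t = y"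
    if xy: "x \<in> FO ?P n" "y \<in> FO ?P n" "ap e n x = ap e n y" for n x y
  proof -
    have "(x, y) \<in> D n" using xy by (simp add: D_def)
    then show ?thesis using rq[of "(x, y)" n] by (intro exI[of _ "q n (x, y)"]) simp
  qed
  have "is_pullback Qc e e ?p ?p'"
  proof (rule Q_pullbackI[OF e p _ _ _ epp ex])
    fix n t t' assume "t \<in> FO (fst ?p) n" "t' \<in> FO (fst ?p) n" "ap ?p n t = ap ?p n t'" "ap ?p' n t = ap ?p' n t'"
    then have "t \<in> FO K n" "t' \<in> FO K n" "r n t = r n t'" by (simp_all add: prod_eq_iff)
    then show "t = t'" using r(2) by metis
  qed simp_all
  moreover have "is_coequalizer Qc ?p ?p' e"
    by (rule Q_coequalizerI[OF e s p _ _ _ epp ex]) simp_all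
  ultimately show ?thesis unfolding effective_arr_def by blast
qed

lemma epis_effective_Qc: "epis_universally_effective (Qc :: ('u q_obj, 'u q_arr) cat)"
  unfolding epis_universally_effective_def
proof (intro allI impI conjI)
  fix e :: "'u q_arr" assume e: "is_epi Qc e"
  then have ea: "e \<in> Arr Qc" by (simp add: is_epi_def)
  show "effective_arr Qc e" using surj_effective[OF ea epi_surj[OF e]] .
  fix g p q assume pb: "is_pullback Qc e g p q"
  then have a: "g \<in> Arr Qc" "p \<in> Arr Qc" "q \<in> Arr Qc" "tgt q = fst g" "tgt p = fst e" "tgt e = tgt g" "fst p = fst q"
    by (auto simp: is_pullback_def)
  show "effective_arr Qc q"
  proof (rule surj_effective[OF a(3)])
    fix n
    have "y \<in> ap q n ` FO (fst q) n" if y: "y \<in> FO (tgt q) n" for y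
    proof -
      have gy: "ap g n y \<in> FO (tgt e) n" using Q_ap_mem[OF a(1), of y n] a y by simp
      then obtain x where x: "x \<in> FO (fst e) n" "ap e n x = ap g n y" 
        unfolding epi_surj[OF e, symmetric] by (auto simp: image_iff)
      have "Comp Qc e (ya (fst e) n x) = Comp Qc g (ya (fst g) n y)"
        using ya_comp[OF ea x(1)] ya_comp[OF a(1), of y n] a y x by simp
      moreover have "ya (fst e) n x \<in> Hom Qc (hrep n) (Dom Qc e)" "ya (fst g) n y \<in> Hom Qc (hrep n) (Dom Qc g)"
        using ea a x y by (auto simp: Hom_iff)
      ultimately obtain h where h: "h \<in> Hom Qc (hrep n) (Dom Qc p)" "Comp Qc q h = ya (fst g) n y"
        using pb unfolding is_pullback_def by metis
      have "h \<in> Arr Qc" "fst h = hrep n" "tgt h = fst q" using h(1) a by (auto simp: Hom_iff)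
      note hh = this yoneda_unique(2)[OF this]
      have "ap (Comp Qc q h) n (enc (Id NCat n)) = y"
        using h(2) ya_id[of "fst g" y n] a y by simp
      then have "ap q n (ap h n (enc (Id NCat n))) = y" using hh a by simp
      then show ?thesis using hh(4) by blast
    qed
    then show "ap q n ` FO (fst q) n = FO (tgt q) n" using Q_ap_mem[OF a(3)] by blast
  qed
qed

text \<open>
  The \<open>h\<^sub>n\<close>-valued points of \<open>X\<close> are the elements of \<open>X n\<close>, so \<open>R n\<close> is an equivalence
  relation on each of these sets.
\<close>

lemma equivalence_relations_effective_Qc: "equivalence_relations_effective (Qc :: ('u q_obj, 'u q_arr) cat)"
  unfolding equivalence_relations_effective_def
proof (intro allI impI)
  fix r s :: "'u q_arr" assume rs: "equivalence_relation Qc r s"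
  then have a: "r \<in> Arr Qc" "s \<in> Arr Qc" "fst s = fst r" "tgt s = tgt r"
    by (auto simp: equivalence_relation_def)
  let ?R = "fst r" and ?X = "tgt r"
  have ob: "?R \<in> Obj Qc" "?X \<in> Obj Qc" using a by auto
  define R where "R n = (\<lambda>t. (ap r n t, ap s n t)) ` FO ?R n" for n
  have RX: "R n \<subseteq> FO ?X n \<times> FO ?X n" for n
    using Q_ap_mem[OF a(1)] Q_ap_mem[OF a(2)] a by (auto simp: R_def)
  have cr: "Comp Qc r (ya ?R n t) = ya ?X n (ap r n t)" "Comp Qc s (ya ?R n t) = ya ?X n (ap s n t)"
    if "t \<in> FO ?R n" for n t
    using ya_comp[OF a(1), of t n] ya_comp[OF a(2), of t n] that a by auto
  have yX: "ya ?X n x = ya ?X n y \<longleftrightarrow> x = y" if "x \<in> FO ?X n" "y \<in> FO ?X n" for n x y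
    using ya_id[OF ob(2) that(1)] ya_id[OF ob(2) that(2)] by metis
  have inj: "t = t'" if "t \<in> FO ?R n" "t' \<in> FO ?R n" "ap r n t = ap r n t'" "ap s n t = ap s n t'" for n t t'
  proof -
    have i: "inj_on (\<lambda>t. (Comp Qc r t, Comp Qc s t)) (Hom Qc (hrep n) ?R)"
      using rs[unfolded equivalence_relation_def Q_simps, THEN conjunct2, THEN conjunct2, THEN conjunct2,
        THEN bspec, OF hrep_obj[of n], THEN conjunct1] .
    have "ya ?R n t = ya ?R n t'"
      by (rule inj_onD[OF i]) (use that cr[OF that(1)] cr[OF that(2)] ob in "simp_all add: Hom_iff")
    then show ?thesis using ya_id[OF ob(1) that(1)] ya_id[OF ob(1) that(2)] by metis
  qed
  have eqv: "equiv (FO ?X n) (R n)" for n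
  proof -
    let ?H = "Hom Qc (hrep n) ?X" and ?E = "(\<lambda>t. (Comp Qc r t, Comp Qc s t)) ` Hom Qc (hrep n) ?R"
    have E: "equiv ?H ?E" 
      using rs[unfolded equivalence_relation_def Q_simps, THEN conjunct2, THEN conjunct2, THEN conjunct2,
        THEN bspec, OF hrep_obj[of n], THEN conjunct2] .
    have YE: "(ya ?X n x, ya ?X n y) \<in> ?E \<longleftrightarrow> (x, y) \<in> R n" if "x \<in> FO ?X n" "y \<in> FO ?X n" for x y
    proof
      assume "(ya ?X n x, ya ?X n y) \<in> ?E"
      then obtain t where t: "t \<in> Hom Qc (hrep n) ?R" "ya ?X n x = Comp Qc r t" "ya ?X n y = Comp Qc s t" by auto
      obtain u where u: "u \<in> FO ?R n" "t = ya ?R n u" using yoneda_unique[of t n ?R] t(1) by (auto simp: Hom_iff)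
      have "x = ap r n u" "y = ap s n u"
        using t u cr[OF u(1)] yX that Q_ap_mem[OF a(1)] Q_ap_mem[OF a(2)] a by auto
      then show "(x, y) \<in> R n" using u by (auto simp: R_def)
    next
      assume "(x, y) \<in> R n"
      then obtain t where "t \<in> FO ?R n" "x = ap r n t" "y = ap s n t" by (auto simp: R_def)
      then show "(ya ?X n x, ya ?X n y) \<in> ?E"
        using cr[of t n] ob by (auto simp: image_iff Hom_iff intro!: bexI[of _ "ya ?R n t"])
    qed
    have yH: "ya ?X n x \<in> ?H" if "x \<in> FO ?X n" for x using that ob by (simp add: Hom_iff)
    show ?thesis
    proof (rule equivI)
      show "R n \<subseteq> FO ?X n \<times> FO ?X n" by (rule RX)
      show "refl_on (FO ?X n) (R n)"
        using E YE yH unfolding refl_on_def equiv_def by blast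
      show "sym (R n)"
      proof (rule symI)
        fix x y assume xy: "(x, y) \<in> R n"
        then have "x \<in> FO ?X n" "y \<in> FO ?X n" using RX by auto
        then show "(y, x) \<in> R n" using E YE xy unfolding equiv_def by (meson symE)
      qed
      show "trans (R n)"
      proof (rule transI)
        fix x y z assume xy: "(x, y) \<in> R n" "(y, z) \<in> R n"
        then have "x \<in> FO ?X n" "y \<in> FO ?X n" "z \<in> FO ?X n" using RX by auto
        then show "(x, z) \<in> R n" using E YE xy unfolding equiv_def by (meson transE)
      qed
    qed
  qed
  have cl: "(R n \<union> (R n)\<inverse>)\<^sup>* \<inter> FO ?X n \<times> FO ?X n = R n" for n
  proof -
    have "(x, y) \<in> R n" if "(x, y) \<in> (R n \<union> (R n)\<inverse>)\<^sup>*" "x \<in> FO ?X n" for x y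
      using that
    proof (induction rule: rtrancl_induct)
      case base then show ?case using eqv[of n] by (auto simp: equiv_def refl_on_def)
    next
      case (step y z)
      then have "(y, z) \<in> R n" using eqv[of n] by (auto simp: equiv_def dest: symD)
      then show ?case using step eqv[of n] by (auto simp: equiv_def dest: transD)
    qed
    then show ?thesis using RX by blast
  qed
  obtain L :: "'u q_obj" and q where L: "L \<in> Obj Qc" and qs: "\<And>n. q n ` FO ?X n = FO L n"
    and qn: "\<And>\<phi> p. \<phi> \<in> Arr NCat ==> p \<in> FO ?X (fst \<phi>) ==> q (tgt \<phi>) (act ?X \<phi> p) = act L \<phi> (q (fst \<phi>) p)"
    and qe: "\<And>n p p'. p \<in> FO ?X n ==> p' \<in> FO ?X n ==> q n p = q n p' \<longleftrightarrow> (p, p') \<in> (R n \<union> (R n)\<inverse>)\<^sup>*"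
  proof (rule quotient_functor[of "FO ?X" "act ?X" R])
    show "(act ?X \<phi> p, act ?X \<phi> p') \<in> R (tgt \<phi>)" if "\<phi> \<in> Arr NCat" "(p, p') \<in> R (fst \<phi>)" for \<phi> p p'
      using that Q_ap_nat[OF a(1) that(1)] Q_ap_nat[OF a(2) that(1)] Qob_mem[OF ob(1) that(1)] a
      by (force simp: R_def)
  qed (use ob RX in "auto simp: Qob_small Qob_mem Qob_comp")
  have qR: "q n x = q n y \<longleftrightarrow> (x, y) \<in> R n" if "x \<in> FO ?X n" "y \<in> FO ?X n" for n x y
    using qe[OF that] cl[of n] that by blast
  let ?q = "mkar ?X q L"
  have q: "?q \<in> Arr Qc" by (rule mkar_arr) (use ob L qs qn in auto)
  have rm: "ap r n t \<in> FO ?X n" "ap s n t \<in> FO ?X n" if "t \<in> FO ?R n" for n t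
    using Q_ap_mem[OF a(1)] Q_ap_mem[OF a(2)] a that by auto
  have qrs: "Comp Qc ?q r = Comp Qc ?q s"
    by (rule Q_ext) (use a q qR rm in "auto simp: R_def")
  have ex: "\<exists>t. t \<in> FO ?R n \<and> ap r n t = x \<and> ap s n t = y"
    if "x \<in> FO (fst ?q) n" "y \<in> FO (fst ?q) n" "ap ?q n x = ap ?q n y" for n x y
    using that qR[of x n y] by (auto simp: R_def)
  have "is_coequalizer Qc r s ?q"
    by (rule Q_coequalizerI[OF q _ a(1-3) _ _ qrs ex]) (use qs a in auto)
  moreover have "is_pullback Qc ?q ?q r s"
    by (rule Q_pullbackI[OF q a(1-3) _ _ qrs ex inj]) (use a in auto)
  ultimately show "\<exists>q. is_coequalizer Qc r s q \<and> is_pullback Qc q q r s" by blast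
qed

lemma has_small_generators_Qc: "has_small_generators TYPE('u) (Qc :: ('u q_obj, 'u q_arr) cat)"
  unfolding has_small_generators_def
proof (intro exI[of _ "range hrep"] conjI allI ballI impI)
  show "small TYPE('u) (range hrep :: 'u q_obj set)" by (rule small_image[OF small_nat])
  fix X Y :: "'u q_obj" and f g assume f: "f \<in> Hom Qc X Y" and g: "g \<in> Hom Qc X Y" and "f \<noteq> g"
  then obtain n x where x: "x \<in> FO X n" "ap f n x \<noteq> ap g n x"
    using Q_ext[of f g] by (auto simp: Hom_iff)
  have X: "X \<in> Obj Qc" and Y: "Y \<in> Obj Qc" using Q.hom_objs[OF f] by auto
  have m: "ap f n x \<in> FO Y n" "ap g n x \<in> FO Y n"
    using Q_ap_mem[of f x n] Q_ap_mem[of g x n] f g x by (auto simp: Hom_iff)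
  have "Comp Qc f (ya X n x) = ya Y n (ap f n x)" "Comp Qc g (ya X n x) = ya Y n (ap g n x)"
    using ya_comp[of f x n] ya_comp[of g x n] f g x by (auto simp: Hom_iff)
  then have "Comp Qc f (ya X n x) \<noteq> Comp Qc g (ya X n x)" using x(2) ya_id[OF Y m(1)] ya_id[OF Y m(2)] by metis
  moreover have "ya X n x \<in> Hom Qc (hrep n) X" using X x by (simp add: Hom_iff)
  ultimately show "\<exists>Z\<in>range hrep. \<exists>h\<in>Hom Qc Z X. Comp Qc f h \<noteq> Comp Qc g h" by blast
qed auto

text \<open>
  A continuous presheaf \<open>F\<close> is represented by its restriction \<open>X\<close> to the representables: an element
  of \<open>F P\<close> is a compatible family of elements of the \<open>F (h n) = X n\<close>, one for each element of \<open>P\<close>,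
  that is, a map \<open>P \<rightarrow> X\<close>.
\<close>

lemma continuous_presheaves_representable_Qc:
  "continuous_presheaves_representable TYPE('u) (Qc :: ('u q_obj, 'u q_arr) cat)"
  unfolding continuous_presheaves_representable_def
proof (intro allI impI)
  fix F :: "('u q_obj, 'u q_arr, 'u set, 'u set \<times> ('u \<Rightarrow> 'u) \<times> 'u set) cfun"
  assume F: "cfunctor (op Qc) SET F \<and> (\<forall>(J :: ('u, 'u) cat) D L \<iota>.
     small_category J \<and> cfunctor J Qc D \<and> is_colimit J Qc D L \<iota> \<longrightarrow>
     is_limit (op J) SET (compf J D F) (FO F L) (\<lambda>j. FA F (\<iota> j)))"
  then interpret F: cfunctor "op Qc" SET F by simp
  interpret S: category SET by (rule category_SET)
  note FF = F.functor_simps[simplified]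
  let ?F = "\<lambda>a. set_app (FA F a)"
  have Fm: "?F a y \<in> FO F (fst a)" if "a \<in> Arr Qc" "y \<in> FO F (tgt a)" for a y
    using set_app_mem[of "FA F a" y] FF that by simp
  have Fc: "?F (Comp Qc b a) y = ?F a (?F b y)" if "a \<in> Arr Qc" "b \<in> Arr Qc" "fst b = tgt a" "y \<in> FO F (tgt b)" for a b y
    using F.FA_comp_simp[of b a] that FF by (simp add: SET_comp)
  have Fi: "?F (Id Qc P) y = y" if "P \<in> Obj Qc" "y \<in> FO F P" for P y
    using FF(5)[OF that(1)] that by (simp add: SET_id)
  define X :: "'u q_obj" where "X = mkob (\<lambda>n. FO F (hrep n)) (\<lambda>\<phi>. ?F (pre \<phi>))"
  have X: "X \<in> Obj Qc" unfolding X_def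
  proof (rule mkob_obj)
    show "small TYPE('u) (FO F (hrep n))" for n using FF(1)[OF hrep_obj] .
    show "?F (pre \<phi>) x \<in> FO F (hrep (tgt \<phi>))" if "\<phi> \<in> Arr NCat" "x \<in> FO F (hrep (fst \<phi>))" for \<phi> x
      using Fm[of "pre \<phi>" x] that by simp
    show "?F (pre (Comp NCat \<psi> \<phi>)) x = ?F (pre \<psi>) (?F (pre \<phi>) x)"
      if "\<phi> \<in> Arr NCat" "\<psi> \<in> Arr NCat" "fst \<psi> = tgt \<phi>" "x \<in> FO F (hrep (fst \<phi>))" for \<phi> \<psi> x
      using Fc[of "pre \<psi>" "pre \<phi>" x] that by (simp add: pre_comp)
  qed (use Fi in auto)
  have XF: "FO X n = FO F (hrep n)" for n by (simp add: X_def)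
  have Xa: "act X \<phi> y = ?F (pre \<phi>) y" if "\<phi> \<in> Arr NCat" "y \<in> FO F (hrep (fst \<phi>))" for \<phi> y
    using that by (simp add: X_def)
  have lim: "\<exists>!a. a \<in> FO F P \<and> (\<forall>n. \<forall>x\<in>FO P n. ?F (ya P n x) a = ap b n x)"
    if P: "P \<in> Obj Qc" and b: "b \<in> Hom Qc P X" for P b
  proof -
    let ?J = "elcat P"
    have b': "b \<in> Arr Qc" "fst b = P" "tgt b = X" using b by (auto simp: Hom_iff)
    have "is_colimit ?J Qc (eldiag P yoneda) P (elfam P (ya P))"
      by (simp only: elcolimit_iff[OF P] elcolimit_yoneda[OF P])
    then have "is_limit (op ?J) SET (compf ?J (eldiag P yoneda) F) (FO F P) (\<lambda>j. FA F (elfam P (ya P) j))"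
      using F elcat_small[OF P] eldiag_functor[OF P yoneda_functor] by blast
    then have lim: "is_colimit ?J (op SET) (compf ?J (eldiag P yoneda) F) (FO F P) (\<lambda>j. FA F (elfam P (ya P) j))"
      by (simp add: is_limit_def)
    define u where "u = (undefined :: 'u)"
    define k where "k n x = ({u}, (\<lambda>_\<in>{u}. ap b n x), FO F (hrep n))" for n x
    have cone: "is_cocone ?J (op SET) (compf ?J (eldiag P yoneda) F) {u} (elfam P k)"
      unfolding is_cocone_def el_ball_obj
    proof (intro conjI ballI allI)
      show "{u} \<in> Obj (op SET)" by (simp add: small_finite)
      fix n x assume x: "x \<in> FO P n"
      have "ap b n x \<in> FO F (hrep n)" using Q_ap_mem[OF b'(1), of x n] b' x by (simp add: XF)
      then show "elfam P k (el P (Id NCat n) x) \<in> Hom (op SET) (FO (compf ?J (eldiag P yoneda) F) (el P (Id NCat n) x)) {u}"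
        using x P FF(1) by (auto simp: Hom_iff k_def SET_arr small_finite)
    next
      fix f assume "f \<in> Arr ?J"
      then obtain \<phi> x where f: "\<phi> \<in> Arr NCat" "x \<in> FO P (fst \<phi>)" "f = el P \<phi> x" by (rule el_arrE)
      have m: "ap b (fst \<phi>) x \<in> FO F (hrep (fst \<phi>))" using Q_ap_mem[OF b'(1), of x "fst \<phi>"] b' f by (simp add: XF)
      have "?F (pre \<phi>) (ap b (fst \<phi>) x) = ap b (tgt \<phi>) (act P \<phi> x)"
        using Q_ap_nat[OF b'(1) f(1), of x] f b' Xa[OF f(1) m] by simp
      then show "Comp (op SET) (elfam P k (Cod ?J f)) (FA (compf ?J (eldiag P yoneda) F) f) = elfam P k (Dom ?J f)"
        using f P m FF(4)[OF pre_simps(3)[OF f(1)]] by (simp add: k_def SET_comp Qob_mem restrict_def fun_eq_iff)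
    qed
    then have ex: "\<exists>!h. h \<in> Hom SET {u} (FO F P) \<and> (\<forall>n. \<forall>x\<in>FO P n. Comp SET (FA F (ya P n x)) h = k n x)"
      using lim[unfolded is_colimit_def, THEN conjunct2, rule_format, OF cone] P unfolding el_ball_obj by simp
    have kk: "Comp SET (FA F (ya P n x)) ({u}, \<lambda>_\<in>{u}. a, FO F P) = k n x \<longleftrightarrow> ?F (ya P n x) a = ap b n x"
      if "x \<in> FO P n" for n x a
      using that P FF(4)[of "ya P n x"] by (auto simp: k_def SET_comp restrict_def fun_eq_iff)
    have hom: "({u}, \<lambda>_\<in>{u}. a, FO F P) \<in> Hom SET {u} (FO F P)" if "a \<in> FO F P" for a
      using that FF(1)[OF P] by (auto simp: Hom_iff SET_arr small_finite)
    obtain h where h: "h \<in> Hom SET {u} (FO F P)" "\<forall>n. \<forall>x\<in>FO P n. Comp SET (FA F (ya P n x)) h = k n x"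
      using ex by blast
    have hu: "set_app h u \<in> FO F P" using h(1) by (auto simp: Hom_iff SET_arr dest: PiE_mem)
    have heq: "h = ({u}, \<lambda>_\<in>{u}. set_app h u, FO F P)"
      by (rule SET_ext) (use h(1) hom[OF hu] in "auto simp: Hom_iff")
    show ?thesis
    proof (intro ex1I[of _ "set_app h u"] conjI allI ballI)
      show "?F (ya P n x) (set_app h u) = ap b n x" if "x \<in> FO P n" for n x
        using h(2) kk[OF that, of "set_app h u"] that heq by metis
      fix a assume a: "a \<in> FO F P \<and> (\<forall>n. \<forall>x\<in>FO P n. ?F (ya P n x) a = ap b n x)"
      then have "({u}, \<lambda>_\<in>{u}. a, FO F P) \<in> Hom SET {u} (FO F P) \<and>
         (\<forall>n. \<forall>x\<in>FO P n. Comp SET (FA F (ya P n x)) ({u}, \<lambda>_\<in>{u}. a, FO F P) = k n x)"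
        using hom kk by simp
      then have "({u}, \<lambda>_\<in>{u}. a, FO F P) = h"
        using the1_equality[OF ex] h by (metis (no_types, lifting))
      then show "a = set_app h u" by auto
    qed (rule hu)
  qed
  define \<theta> where "\<theta> P b = (THE a. a \<in> FO F P \<and> (\<forall>n. \<forall>x\<in>FO P n. ?F (ya P n x) a = ap b n x))" for P b
  have th: "\<theta> P b \<in> FO F P" "\<And>n x. x \<in> FO P n ==> ?F (ya P n x) (\<theta> P b) = ap b n x"
    if "P \<in> Obj Qc" "b \<in> Hom Qc P X" for P b
    using theI'[OF lim[OF that]] by (auto simp: \<theta>_def)
  have thu: "\<theta> P b = a" if "P \<in> Obj Qc" "b \<in> Hom Qc P X" "a \<in> FO F P" "\<And>n x. x \<in> FO P n ==> ?F (ya P n x) a = ap b n x" for P b a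
    unfolding \<theta>_def by (rule the1_equality[OF lim[OF that(1,2)]]) (use that in auto)
  show "representable Qc F"
    unfolding representable_def
  proof (intro bexI[OF _ X] exI[of _ \<theta>] conjI ballI allI)
    fix P :: "'u q_obj" assume P: "P \<in> Obj Qc"
    show "bij_betw (\<theta> P) (Hom Qc P X) (FO F P)"
    proof (rule bij_betwI')
      fix b b' assume b: "b \<in> Hom Qc P X" and b': "b' \<in> Hom Qc P X"
      have "b = b'" if "\<theta> P b = \<theta> P b'"
      proof (rule Q_ext)
        fix n x assume "x \<in> FO (fst b) n"
        then have "x \<in> FO P n" using b by (auto simp: Hom_iff)
        then show "ap b n x = ap b' n x" using th(2)[OF P b] th(2)[OF P b'] that by metis
      qed (use b b' in "auto simp: Hom_iff")
      then show "\<theta> P b = \<theta> P b' \<longleftrightarrow> b = b'" by blast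
    next
      fix a assume a: "a \<in> FO F P"
      let ?b = "mkar P (\<lambda>n x. ?F (ya P n x) a) X"
      have "?b \<in> Arr Qc"
      proof (rule mkar_arr[OF P X])
        show m: "?F (ya P n x) a \<in> FO X n" if "x \<in> FO P n" for n x
          using Fm[of "ya P n x" a] a P that by (simp add: XF)
        fix \<phi> x assume \<phi>: "\<phi> \<in> Arr NCat" "x \<in> FO P (fst \<phi>)"
        show "?F (ya P (tgt \<phi>) (act P \<phi> x)) a = act X \<phi> (?F (ya P (fst \<phi>) x) a)"
          using Fc[of "pre \<phi>" "ya P (fst \<phi>) x" a] \<phi> a P m[OF \<phi>(2)] by (simp add: pre_ya Xa XF)
      qed
      then have b: "?b \<in> Hom Qc P X" by (simp add: Hom_iff)
      have "\<theta> P ?b = a" by (rule thu[OF P b a]) simp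
      from this[symmetric] b show "\<exists>b\<in>Hom Qc P X. a = \<theta> P b" by blast
    qed (use th P in auto)
  next
    fix P Z f b assume f: "f \<in> Hom Qc P Z" and b: "b \<in> Hom Qc Z X"
    have P: "P \<in> Obj Qc" and Z: "Z \<in> Obj Qc" using Q.hom_objs[OF f] by auto
    have f': "f \<in> Arr Qc" "fst f = P" "tgt f = Z" using f by (auto simp: Hom_iff)
    have b': "b \<in> Arr Qc" "fst b = Z" "tgt b = X" using b by (auto simp: Hom_iff)
    show "\<theta> P (Comp Qc b f) = ?F f (\<theta> Z b)"
    proof (rule thu[OF P])
      show "?F f (\<theta> Z b) \<in> FO F P" using Fm[of f "\<theta> Z b"] f' th(1)[OF Z b] by simp
      fix n x assume x: "x \<in> FO P n"
      have "?F (ya P n x) (?F f (\<theta> Z b)) = ?F (ya Z n (ap f n x)) (\<theta> Z b)"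
        using Fc[of "ya P n x" f "\<theta> Z b"] f' P x th(1)[OF Z b] ya_comp[of f x n] by simp
      then show "?F (ya P n x) (?F f (\<theta> Z b)) = ap (Comp Qc b f) n x"
        using th(2)[OF Z b] Q_ap_mem[of f x n] f' x by simp
    qed (use f' b' in "simp add: Hom_iff")
  qed
qed

lemma vectoid_Qc:
  assumes "sym_mon_cat Qc T" "tensor_cocontinuous TYPE('u) (Qc :: ('u q_obj, 'u q_arr) cat) T"
  shows "vectoid TYPE('u) Qc T"
  unfolding vectoid_def
  using assms locally_small_Qc has_small_colimits_Qc has_finite_limits_Qc epis_effective_Qc
    equivalence_relations_effective_Qc has_small_generators_Qc continuous_presheaves_representable_Qc by simp

end

section \<open>Existence of the tensor product\<close>

context sym_mon_cat begin

lemma tensor_left_functor: "X \<in> Obj C ==> cfunctor C C (tensor_left C T X)"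
  by (rule cfunctorI) (auto simp: category_axioms tensor_left_def Hom_iff interchange)

lemma tensor_right_functor: "X \<in> Obj C ==> cfunctor C C (tensor_right C T X)"
  by (rule cfunctorI) (auto simp: category_axioms tensor_right_def Hom_iff interchange)

lemma tensor_left_simps [simp]:
  "Y \<in> Obj C ==> FO (tensor_left C T X) Y = X \<boxtimes> Y" "f \<in> Arr C ==> FA (tensor_left C T X) f = \<one> X \<otimes> f"
  by (auto simp: tensor_left_def)

lemma tensor_right_simps [simp]:
  "Y \<in> Obj C ==> FO (tensor_right C T X) Y = Y \<boxtimes> X" "f \<in> Arr C ==> FA (tensor_right C T X) f = f \<otimes> \<one> X"
  by (auto simp: tensor_right_def)

text \<open>A right adjoint in one variable gives one in the other through the braiding.\<close>

lemma tensor_cocontinuous_if_closed: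
  assumes adj: "\<And>X Z. X \<in> Obj C ==> Z \<in> Obj C ==> \<exists>E\<in>Obj C. \<exists>\<theta>.
      (\<forall>P\<in>Obj C. bij_betw (\<theta> P) (Hom C (X \<boxtimes> P) Z) (Hom C P E)) \<and>
      (\<forall>P P' f a. f \<in> Hom C P' P \<longrightarrow> a \<in> Hom C (X \<boxtimes> P) Z \<longrightarrow> \<theta> P' (a \<cdot> (\<one> X \<otimes> f)) = \<theta> P a \<cdot> f)"
  shows "tensor_cocontinuous U C T"
  unfolding tensor_cocontinuous_def preserves_small_colimits_def
proof (intro ballI conjI allI impI)
  fix X and J :: "('u, 'u) cat" and G L \<iota>
  assume X: "X \<in> Obj C" and "small_category J \<and> cfunctor J C G \<and> is_colimit J C G L \<iota>"
  then have G: "cfunctor J C G" and L: "is_colimit J C G L \<iota>" by auto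
  show "is_colimit J C (compf J G (tensor_left C T X)) (FO (tensor_left C T X) L) (\<lambda>j. FA (tensor_left C T X) (\<iota> j))"
  proof (rule preserves_colimit_if_adjoint[OF tensor_left_functor[OF X] _ G L])
    fix Z assume Z: "Z \<in> Obj C"
    from adj[OF X Z] obtain E \<theta> where E: "E \<in> Obj C" "\<forall>P\<in>Obj C. bij_betw (\<theta> P) (Hom C (X \<boxtimes> P) Z) (Hom C P E)"
      "\<forall>P P' f a. f \<in> Hom C P' P \<longrightarrow> a \<in> Hom C (X \<boxtimes> P) Z \<longrightarrow> \<theta> P' (a \<cdot> (\<one> X \<otimes> f)) = \<theta> P a \<cdot> f"
      by (elim bexE exE conjE) (rule that)
    show "\<exists>E\<in>Obj C. \<exists>\<theta>. (\<forall>P\<in>Obj C. bij_betw (\<theta> P) (Hom C (FO (tensor_left C T X) P) Z) (Hom C P E)) \<and>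
      (\<forall>P P' f a. f \<in> Hom C P' P \<longrightarrow> a \<in> Hom C (FO (tensor_left C T X) P) Z \<longrightarrow>
        \<theta> P' (a \<cdot> FA (tensor_left C T X) f) = \<theta> P a \<cdot> f)"
    proof (intro bexI[OF _ E(1)] exI[of _ \<theta>] conjI ballI allI impI)
      fix P P' f a assume f: "f \<in> Hom C P' P" and a: "a \<in> Hom C (FO (tensor_left C T X) P) Z"
      then show "\<theta> P' (a \<cdot> FA (tensor_left C T X) f) = \<theta> P a \<cdot> f"
        using E(3)[rule_format, OF f, of a] hom_objs[OF f] by (simp add: Hom_iff)
    qed (use E(2) in simp)
  qed
  show "is_colimit J C (compf J G (tensor_right C T X)) (FO (tensor_right C T X) L) (\<lambda>j. FA (tensor_right C T X) (\<iota> j))"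
  proof (rule preserves_colimit_if_adjoint[OF tensor_right_functor[OF X] _ G L])
    fix Z assume Z: "Z \<in> Obj C"
    from adj[OF X Z] obtain E \<theta> where E: "E \<in> Obj C" "\<forall>P\<in>Obj C. bij_betw (\<theta> P) (Hom C (X \<boxtimes> P) Z) (Hom C P E)"
      "\<forall>P P' f a. f \<in> Hom C P' P \<longrightarrow> a \<in> Hom C (X \<boxtimes> P) Z \<longrightarrow> \<theta> P' (a \<cdot> (\<one> X \<otimes> f)) = \<theta> P a \<cdot> f"
      by (elim bexE exE conjE) (rule that)
    show "\<exists>E\<in>Obj C. \<exists>\<theta>. (\<forall>P\<in>Obj C. bij_betw (\<theta> P) (Hom C (FO (tensor_right C T X) P) Z) (Hom C P E)) \<and>
      (\<forall>P P' f a. f \<in> Hom C P' P \<longrightarrow> a \<in> Hom C (FO (tensor_right C T X) P) Z \<longrightarrow>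
        \<theta> P' (a \<cdot> FA (tensor_right C T X) f) = \<theta> P a \<cdot> f)"
    proof (intro bexI[OF _ E(1)] exI[of _ "\<lambda>P a. \<theta> P (a \<cdot> \<c> X P)"] conjI ballI allI impI)
      fix P assume P: "P \<in> Obj C"
      have "bij_betw (\<lambda>a. a \<cdot> \<c> X P) (Hom C (P \<boxtimes> X) Z) (Hom C (X \<boxtimes> P) Z)"
        by (rule bij_betwI[where g="\<lambda>a. a \<cdot> \<c> P X"]) (use X P in "auto simp: Hom_iff braid_sym")
      from bij_betw_trans[OF this E(2)[rule_format, OF P]]
      show "bij_betw (\<lambda>a. \<theta> P (a \<cdot> \<c> X P)) (Hom C (FO (tensor_right C T X) P) Z) (Hom C P E)"
        using P by (simp add: comp_def)
    next
      fix P P' f a assume f: "f \<in> Hom C P' P" and a: "a \<in> Hom C (FO (tensor_right C T X) P) Z"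
      have P: "P \<in> Obj C" "P' \<in> Obj C" using hom_objs[OF f] by auto
      have "(a \<cdot> (f \<otimes> \<one> X)) \<cdot> \<c> X P' = (a \<cdot> \<c> X P) \<cdot> (\<one> X \<otimes> f)"
        using a f P X braid_nat[of "\<one> X" f X P] by (simp add: Hom_iff)
      then show "\<theta> P' ((a \<cdot> FA (tensor_right C T X) f) \<cdot> \<c> X P') = \<theta> P (a \<cdot> \<c> X P) \<cdot> f"
        using E(3)[rule_format, OF f, of "a \<cdot> \<c> X P"] f a P X by (simp add: Hom_iff)
    qed
  qed
qed

end

subsection \<open>Disjoint union of finite sets\<close>

definition nsum :: "fin_map \<Rightarrow> fin_map \<Rightarrow> fin_map" where
  "nsum \<phi> \<psi> = mkn (fst \<phi> + fst \<psi>) (\<lambda>i. if i \<le> fst \<phi> then nv \<phi> i else tgt \<phi> + nv \<psi> (i - fst \<phi>))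
     (tgt \<phi> + tgt \<psi>)"

definition swp :: "nat \<Rightarrow> nat \<Rightarrow> fin_map" where
  "swp m n = mkn (m + n) (\<lambda>i. if i \<le> m then n + i else i - m) (n + m)"

lemma nsum_simps [simp]: "fst (nsum \<phi> \<psi>) = fst \<phi> + fst \<psi>" "tgt (nsum \<phi> \<psi>) = tgt \<phi> + tgt \<psi>"
  "1 \<le> i ==> i \<le> fst \<phi> + fst \<psi> ==> nv (nsum \<phi> \<psi>) i = (if i \<le> fst \<phi> then nv \<phi> i else tgt \<phi> + nv \<psi> (i - fst \<phi>))"
  by (auto simp: nsum_def)

lemma nv_range_shift: "[|\<phi> \<in> Arr NCat; \<not> i \<le> m; i \<le> m + fst \<phi>|] ==> 1 \<le> nv \<phi> (i - m) \<and> nv \<phi> (i - m) \<le> tgt \<phi>"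
  by (rule nv_range) auto

lemma nsum_arr [simp]: "\<phi> \<in> Arr NCat ==> \<psi> \<in> Arr NCat ==> nsum \<phi> \<psi> \<in> Arr NCat"
  unfolding nsum_def
proof (rule mkn_arr)
  fix i assume a: "\<phi> \<in> Arr NCat" "\<psi> \<in> Arr NCat" and i: "1 \<le> i" "i \<le> fst \<phi> + fst \<psi>"
  show "1 \<le> (if i \<le> fst \<phi> then nv \<phi> i else tgt \<phi> + nv \<psi> (i - fst \<phi>)) \<and>
    (if i \<le> fst \<phi> then nv \<phi> i else tgt \<phi> + nv \<psi> (i - fst \<phi>)) \<le> tgt \<phi> + tgt \<psi>"
    using nv_range[OF a(1) i(1)] nv_range_shift[OF a(2), of i "fst \<phi>"] i by auto
qed

lemma swp_simps [simp]: "fst (swp m n) = m + n" "tgt (swp m n) = n + m"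
  "1 \<le> i ==> i \<le> m + n ==> nv (swp m n) i = (if i \<le> m then n + i else i - m)" "swp m n \<in> Arr NCat"
  by (auto simp: swp_def intro!: mkn_arr)

lemma NTensor_TA: "\<phi> \<in> Arr NCat ==> \<psi> \<in> Arr NCat ==> TA NTensor \<phi> \<psi> = nsum \<phi> \<psi>"
  by (auto simp: NTensor_def nsum_def mkn_def nv_def split: prod.splits)

lemma swp_inverse: "inverse_arrows NCat (swp m n) (swp n m)"
  by (rule N.inverseI[of _ "m + n" "n + m"]; (rule N_ext)?) (auto simp: Hom_iff)

lemma op_N_simps [simp]:
  "TO (op_tensor NCat NTensor) m n = m + n" "TI (op_tensor NCat NTensor) = 0"
  "\<phi> \<in> Arr NCat ==> \<psi> \<in> Arr NCat ==> TA (op_tensor NCat NTensor) \<phi> \<psi> = nsum \<phi> \<psi>"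
  "Assoc (op_tensor NCat NTensor) m n k = Id NCat (m + n + k)"
  "LUnit (op_tensor NCat NTensor) m = Id NCat m"
  "RUnit (op_tensor NCat NTensor) m = Id NCat m"
  "Braid (op_tensor NCat NTensor) m n = swp n m"
proof -
  have "Braid NTensor m n = swp m n" by (simp add: NTensor_def swp_def mkn_def)
  then show "Braid (op_tensor NCat NTensor) m n = swp n m"
    using N.inv_arr_eq[OF swp_inverse] by (simp add: op_tensor_def)
  show "\<phi> \<in> Arr NCat ==> \<psi> \<in> Arr NCat ==> TA (op_tensor NCat NTensor) \<phi> \<psi> = nsum \<phi> \<psi>"
    using NTensor_TA[of \<phi> \<psi>] by (simp add: op_tensor_def)
qed (simp_all add: op_tensor_def NTensor_def)

lemma nsum_id [simp]: "nsum (Id NCat m) (Id NCat n) = Id NCat (m + n)"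
  by (rule N_ext) auto

lemma nsum_comp:
  assumes "\<phi> \<in> Arr NCat" "\<phi>' \<in> Arr NCat" "\<psi> \<in> Arr NCat" "\<psi>' \<in> Arr NCat" "fst \<phi>' = tgt \<phi>" "fst \<psi>' = tgt \<psi>"
  shows "nsum (Comp NCat \<phi>' \<phi>) (Comp NCat \<psi>' \<psi>) = Comp NCat (nsum \<phi>' \<psi>') (nsum \<phi> \<psi>)"
proof (rule N_ext)
  fix i assume i: "1 \<le> i" "i \<le> fst (nsum (Comp NCat \<phi>' \<phi>) (Comp NCat \<psi>' \<psi>))"
  show "nv (nsum (Comp NCat \<phi>' \<phi>) (Comp NCat \<psi>' \<psi>)) i = nv (Comp NCat (nsum \<phi>' \<psi>') (nsum \<phi> \<psi>)) i"
    using assms i nv_range[OF assms(1) i(1)] nv_range_shift[OF assms(3), of i "fst \<phi>"]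
    by (cases "i \<le> fst \<phi>") auto
qed (use assms in auto)

lemma sym_mon_cat_N: "sym_mon_cat (op NCat) (op_tensor NCat NTensor)"
proof -
  interpret O: category "op NCat" by (rule category_op[OF category_N])
  show ?thesis
  proof (unfold_locales, goal_cases)
    case (5 f X X' f' X'' g Y Y' g' Y'')
    then show ?case by (simp add: Hom_iff nsum_comp)
  next
    case (8 f X X' g Y Y' h Z Z')
    then have a: "f \<in> Arr NCat" "g \<in> Arr NCat" "h \<in> Arr NCat" by (auto simp: Hom_iff)
    have "nsum (nsum f g) h = nsum f (nsum g h)"
      by (rule N_ext) (use a in "auto simp: add.assoc")
    then show ?case using 8 by (auto simp: Hom_iff add.assoc)
  next
    case (11 f X Y)
    then have a: "f \<in> Arr NCat" "X = tgt f" "Y = fst f" by (auto simp: Hom_iff)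
    have "nsum (Id NCat 0) f = f" by (rule N_ext) (use a in auto)
    then show ?case using a by simp
  next
    case (14 f X Y)
    then have a: "f \<in> Arr NCat" "X = tgt f" "Y = fst f" by (auto simp: Hom_iff)
    have "nsum f (Id NCat 0) = f" by (rule N_ext) (use a in auto)
    then show ?case using a by simp
  next
    case (16 f X X' g Y Y')
    then have a: "f \<in> Arr NCat" "X = tgt f" "X' = fst f" "g \<in> Arr NCat" "Y = tgt g" "Y' = fst g" by (auto simp: Hom_iff)
    have "Comp NCat (nsum f g) (swp Y' X') = Comp NCat (swp Y X) (nsum g f)"
    proof (rule N_ext)
      fix i assume i: "1 \<le> i" "i \<le> fst (Comp NCat (nsum f g) (swp Y' X'))"
      then show "nv (Comp NCat (nsum f g) (swp Y' X')) i = nv (Comp NCat (swp Y X) (nsum g f)) i"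
        using a nv_range[OF a(4) i(1)] nv_range_shift[OF a(1), of i Y']
        by (cases "i \<le> Y'") auto
    qed (use a in auto)
    then show ?case using a by simp
  next
    case (17 X Y)
    show ?case using N.inverse_comp swp_inverse[of X Y] by (auto simp: inverse_arrows_def Hom_iff)
  next
    case (20 X Y Z)
    have "Comp NCat (swp (Y + Z) X) (Id NCat (Y + Z + X)) = Comp NCat (nsum (swp Y X) (Id NCat Z)) (nsum (Id NCat Y) (swp Z X))"
      by (rule N_ext) auto
    then show ?case by (simp add: add_ac)
  qed (auto simp: Hom_iff add_ac)
qed

lemma mkn_0: "mkn 0 f k = mkn 0 g k" "mkn 0 f k \<in> Arr NCat"
  by (auto simp: mkn_def N_arr nv_def)

lemma N_from_0: "\<phi> \<in> Arr NCat ==> fst \<phi> = 0 ==> \<phi> = mkn 0 (\<lambda>i. i) (tgt \<phi>)"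
  by (rule N_ext) (auto simp: mkn_0)

lemma swp_0 [simp]: "swp 0 m = Id NCat m" "swp m 0 = Id NCat m"
  by (rule N_ext; simp)+

lemma to_one_simps [simp]: "to_one n \<in> Arr NCat" "fst (to_one n) = n" "tgt (to_one n) = 1"
  "1 \<le> i ==> i \<le> n ==> nv (to_one n) i = 1"
  by (auto simp: to_one_def N_arr nv_def)

subsection \<open>The pointwise product\<close>

context small_universe begin

definition pi1 :: "'u \<Rightarrow> 'u" where "pi1 z = fst (inv pr z)"
definition pi2 :: "'u \<Rightarrow> 'u" where "pi2 z = snd (inv pr z)"

lemma pi_simps [simp]: "pi1 (pr (x, y)) = x" "pi2 (pr (x, y)) = y"
  by (simp_all add: pi1_def pi2_def inv_f_f inj_pr)

text \<open>
  The cocontinuous extension of disjoint union is in general a convolution. Disjoint union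
  being a coproduct, \<open>h\<^sub>m \<times> h\<^sub>n \<cong> h\<^bsub>m+n\<^esub>\<close>, and the convolution is the pointwise product.
\<close>

definition prodQ :: "'u q_obj \<Rightarrow> 'u q_obj \<Rightarrow> 'u q_obj" where
  "prodQ P Q = mkob (\<lambda>n. pr ` (FO P n \<times> FO Q n)) (\<lambda>\<phi> z. pr (act P \<phi> (pi1 z), act Q \<phi> (pi2 z)))"

text \<open>The terminal functor, with \<open>undefined\<close> for the point of each value.\<close>

definition unitQ :: "'u q_obj" where
  "unitQ = mkob (\<lambda>n. {undefined}) (\<lambda>\<phi> z. undefined)"

definition tensorQ :: "('u q_obj, 'u q_arr) tensor" where
  "tensorQ =
    \<lparr>TO = prodQ,
     TA = (\<lambda>a b. mkar (prodQ (fst a) (fst b)) (\<lambda>n z. pr (ap a n (pi1 z), ap b n (pi2 z)))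
       (prodQ (tgt a) (tgt b))),
     TI = unitQ,
     Assoc = (\<lambda>P Q R. mkar (prodQ (prodQ P Q) R) (\<lambda>n z. pr (pi1 (pi1 z), pr (pi2 (pi1 z), pi2 z))) (prodQ P (prodQ Q R))),
     LUnit = (\<lambda>P. mkar (prodQ unitQ P) (\<lambda>n. pi2) P),
     RUnit = (\<lambda>P. mkar (prodQ P unitQ) (\<lambda>n. pi1) P),
     Braid = (\<lambda>P Q. mkar (prodQ P Q) (\<lambda>n z. pr (pi2 z, pi1 z)) (prodQ Q P))\<rparr>"

lemma prodQ_FO [simp]: "FO (prodQ P Q) n = pr ` (FO P n \<times> FO Q n)"
  by (simp add: prodQ_def)

lemma prodQ_mem [simp]: "x \<in> FO P n ==> y \<in> FO Q n ==> pr (x, y) \<in> FO (prodQ P Q) n"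
  by simp

lemma prodQ_act [simp]:
  "[|\<phi> \<in> Arr NCat; x \<in> FO P (fst \<phi>); y \<in> FO Q (fst \<phi>)|] ==> act (prodQ P Q) \<phi> (pr (x, y)) = pr (act P \<phi> x, act Q \<phi> y)"
  by (simp add: prodQ_def)

lemma prodQ_obj [simp]: "P \<in> Obj Qc ==> Q \<in> Obj Qc ==> prodQ P Q \<in> Obj Qc"
  unfolding prodQ_def
  by (rule mkob_obj) (auto simp: Qob_mem2 Qob_comp intro!: small_image small_Sigma Qob_small)

lemma unitQ_simps [simp]: "FO unitQ n = {undefined}" "\<phi> \<in> Arr NCat ==> act unitQ \<phi> undefined = undefined"
  "unitQ \<in> Obj Qc"
proof -
  show "unitQ \<in> Obj Qc" unfolding unitQ_def by (rule mkob_obj) (auto simp: small_finite)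
qed (auto simp: unitQ_def)

lemma tensorQ_simps [simp]: "TO tensorQ = prodQ" "TI tensorQ = unitQ"
  "fst (TA tensorQ a b) = prodQ (fst a) (fst b)" "tgt (TA tensorQ a b) = prodQ (tgt a) (tgt b)"
  "fst (Assoc tensorQ P Q R) = prodQ (prodQ P Q) R" "tgt (Assoc tensorQ P Q R) = prodQ P (prodQ Q R)"
  "fst (LUnit tensorQ P) = prodQ unitQ P" "tgt (LUnit tensorQ P) = P"
  "fst (RUnit tensorQ P) = prodQ P unitQ" "tgt (RUnit tensorQ P) = P"
  "fst (Braid tensorQ P Q) = prodQ P Q" "tgt (Braid tensorQ P Q) = prodQ Q P"
  "x \<in> FO (fst a) n ==> y \<in> FO (fst b) n ==> ap (TA tensorQ a b) n (pr (x, y)) = pr (ap a n x, ap b n y)"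
  "[|x \<in> FO P n; y \<in> FO Q n; z \<in> FO R n|] ==>
    ap (Assoc tensorQ P Q R) n (pr (pr (x, y), z)) = pr (x, pr (y, z))"
  "x \<in> FO P n ==> ap (LUnit tensorQ P) n (pr (undefined, x)) = x"
  "x \<in> FO P n ==> ap (RUnit tensorQ P) n (pr (x, undefined)) = x"
  "x \<in> FO P n ==> y \<in> FO Q n ==> ap (Braid tensorQ P Q) n (pr (x, y)) = pr (y, x)"
  by (simp_all add: tensorQ_def)

lemma tensorQ_arr [simp]:
  "a \<in> Arr Qc ==> b \<in> Arr Qc ==> TA tensorQ a b \<in> Arr Qc"
  "[|P \<in> Obj Qc; Q \<in> Obj Qc; R \<in> Obj Qc|] ==> Assoc tensorQ P Q R \<in> Arr Qc"
  "P \<in> Obj Qc ==> LUnit tensorQ P \<in> Arr Qc"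
  "P \<in> Obj Qc ==> RUnit tensorQ P \<in> Arr Qc"
  "P \<in> Obj Qc ==> Q \<in> Obj Qc ==> Braid tensorQ P Q \<in> Arr Qc"
proof -
  show "TA tensorQ a b \<in> Arr Qc" if ab: "a \<in> Arr Qc" "b \<in> Arr Qc"
  proof -
    have o: "fst a \<in> Obj Qc" "fst b \<in> Obj Qc" using ab by auto
    have m: "ap a n x \<in> FO (tgt a) n" if "x \<in> FO (fst a) n" for n x using Q_ap_mem[OF ab(1)] that by blast
    have m': "ap b n x \<in> FO (tgt b) n" if "x \<in> FO (fst b) n" for n x using Q_ap_mem[OF ab(2)] that by blast
    have "mkar (prodQ (fst a) (fst b)) (\<lambda>n z. pr (ap a n (pi1 z), ap b n (pi2 z))) (prodQ (tgt a) (tgt b)) \<in> Arr Qc"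
    proof (rule mkar_arr)
      fix \<phi> z assume \<phi>: "\<phi> \<in> Arr NCat" "z \<in> FO (prodQ (fst a) (fst b)) (fst \<phi>)"
      then obtain x y where z: "x \<in> FO (fst a) (fst \<phi>)" "y \<in> FO (fst b) (fst \<phi>)" "z = pr (x, y)" by auto
      show "pr (ap a (tgt \<phi>) (pi1 (act (prodQ (fst a) (fst b)) \<phi> z)), ap b (tgt \<phi>) (pi2 (act (prodQ (fst a) (fst b)) \<phi> z))) =
         act (prodQ (tgt a) (tgt b)) \<phi> (pr (ap a (fst \<phi>) (pi1 z), ap b (fst \<phi>) (pi2 z)))"
        using \<phi>(1) z Q_ap_nat[OF ab(1) \<phi>(1) z(1)] Q_ap_nat[OF ab(2) \<phi>(1) z(2)] m[OF z(1)] m'[OF z(2)] by simp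
    qed (use ab m m' in auto)
    then show ?thesis by (simp add: tensorQ_def)
  qed
  show "[|P \<in> Obj Qc; Q \<in> Obj Qc; R \<in> Obj Qc|] ==> Assoc tensorQ P Q R \<in> Arr Qc"
    unfolding tensorQ_def tensor.simps by (rule mkar_arr) (auto simp: Qob_mem2)
  show "P \<in> Obj Qc ==> LUnit tensorQ P \<in> Arr Qc"
    unfolding tensorQ_def tensor.simps by (rule mkar_arr) (auto simp: Qob_mem2)
  show "P \<in> Obj Qc ==> RUnit tensorQ P \<in> Arr Qc"
    unfolding tensorQ_def tensor.simps by (rule mkar_arr) (auto simp: Qob_mem2)
  show "P \<in> Obj Qc ==> Q \<in> Obj Qc ==> Braid tensorQ P Q \<in> Arr Qc"
    unfolding tensorQ_def tensor.simps by (rule mkar_arr) (auto simp: Qob_mem2)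
qed

lemma tensorQ_iso:
  "[|P \<in> Obj Qc; Q \<in> Obj Qc; R \<in> Obj Qc|] ==> iso_arr Qc (Assoc tensorQ P Q R)"
  "P \<in> Obj Qc ==> iso_arr Qc (LUnit tensorQ P)"
  "P \<in> Obj Qc ==> iso_arr Qc (RUnit tensorQ P)"
proof -
  show "iso_arr Qc (Assoc tensorQ P Q R)" if "P \<in> Obj Qc" "Q \<in> Obj Qc" "R \<in> Obj Qc"
  proof (rule Q_isoI)
    show "bij_betw (ap (Assoc tensorQ P Q R) n) (FO (fst (Assoc tensorQ P Q R)) n) (FO (tgt (Assoc tensorQ P Q R)) n)" for n
      by (rule bij_betwI[where g="\<lambda>z. pr (pr (pi1 z, pi1 (pi2 z)), pi2 (pi2 z))"]) auto
  qed (use that in auto)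
  show "iso_arr Qc (LUnit tensorQ P)" if "P \<in> Obj Qc"
  proof (rule Q_isoI)
    show "bij_betw (ap (LUnit tensorQ P) n) (FO (fst (LUnit tensorQ P)) n) (FO (tgt (LUnit tensorQ P)) n)" for n
      by (rule bij_betwI[where g="\<lambda>z. pr (undefined, z)"]) auto
  qed (use that in auto)
  show "iso_arr Qc (RUnit tensorQ P)" if "P \<in> Obj Qc"
  proof (rule Q_isoI)
    show "bij_betw (ap (RUnit tensorQ P) n) (FO (fst (RUnit tensorQ P)) n) (FO (tgt (RUnit tensorQ P)) n)" for n
      by (rule bij_betwI[where g="\<lambda>z. pr (z, undefined)"]) auto
  qed (use that in auto)
qed

lemma sym_mon_cat_Qc: "sym_mon_cat Qc tensorQ"
proof -
  note m = Q_ap_mem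
  show ?thesis
  proof (unfold_locales, goal_cases)
    case (4 X Y) then show ?case by (intro Q_ext) auto
  next
    case (5 f X X' f' X'' g Y Y' g' Y'') then show ?case
      by (intro Q_ext) (auto simp: Hom_iff m)
  next
    case (8 f X X' g Y Y' h Z Z') then show ?case by (intro Q_ext) (auto simp: Hom_iff m)
  next
    case (11 f X Y) then show ?case by (intro Q_ext) (auto simp: Hom_iff m)
  next
    case (14 f X Y) then show ?case by (intro Q_ext) (auto simp: Hom_iff m)
  next
    case (16 f X X' g Y Y') then show ?case by (intro Q_ext) (auto simp: Hom_iff m)
  next
    case (17 X Y) then show ?case by (intro Q_ext) auto
  next
    case (18 W X Y Z) then show ?case by (intro Q_ext) auto
  next
    case (19 X Y) then show ?case by (intro Q_ext) auto
  next
    case (20 X Y Z) then show ?case by (intro Q_ext) auto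
  qed (auto simp: Hom_iff tensorQ_iso)
qed

interpretation QT: sym_mon_cat Qc tensorQ by (rule sym_mon_cat_Qc)

text \<open>
  The pointwise product is closed: the exponential has the value \<open>Hom(X \<times> h n, Z)\<close> at \<open>n\<close>.
\<close>

lemma tensorQ_closed:
  assumes X: "X \<in> Obj Qc" and Z: "Z \<in> Obj Qc"
  shows "\<exists>E\<in>Obj Qc. \<exists>\<theta>.
      (\<forall>P\<in>Obj Qc. bij_betw (\<theta> P) (Hom Qc (TO tensorQ X P) Z) (Hom Qc P E)) \<and>
      (\<forall>P P' f a. f \<in> Hom Qc P' P \<longrightarrow> a \<in> Hom Qc (TO tensorQ X P) Z \<longrightarrow>
        \<theta> P' (Comp Qc a (TA tensorQ (Id Qc X) f)) = Comp Qc (\<theta> P a) f)"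
proof -
  let ?X = "Id Qc X"
  define D where "D n = Hom Qc (prodQ X (hrep n)) Z" for n
  define A where "A \<phi> t = Comp Qc t (TA tensorQ ?X (pre \<phi>))" for \<phi> t
  have AD: "A \<phi> t \<in> D (tgt \<phi>)" if "\<phi> \<in> Arr NCat" "t \<in> D (fst \<phi>)" for \<phi> t
    using that X by (auto simp: A_def D_def Hom_iff)
  obtain E :: "'u q_obj" and q where E: "E \<in> Obj Qc" and qb: "\<And>n. bij_betw (q n) (D n) (FO E n)"
    and qn: "\<And>\<phi> p. \<phi> \<in> Arr NCat ==> p \<in> D (fst \<phi>) ==> q (tgt \<phi>) (A \<phi> p) = act E \<phi> (q (fst \<phi>) p)"
  proof (rule encode_functor[of D A])
    show "small TYPE('u) (D n)" for n
      using locally_small_Qc X Z unfolding D_def locally_small_def by simp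
    show "A (Id NCat n) t = t" if "t \<in> D n" for n t
      using that X by (auto simp: A_def D_def Hom_iff)
    show "A (Comp NCat \<psi> \<phi>) t = A \<psi> (A \<phi> t)"
      if "\<phi> \<in> Arr NCat" "\<psi> \<in> Arr NCat" "fst \<psi> = tgt \<phi>" "t \<in> D (fst \<phi>)" for \<phi> \<psi> t
      using that X by (auto simp: A_def D_def Hom_iff pre_comp QT.left_comp)
  qed (use AD in auto)
  define r where "r n = inv_into (D n) (q n)" for n
  have r: "r n z \<in> D n" "q n (r n z) = z" if "z \<in> FO E n" for n z
    using that qb[of n] by (auto simp: r_def bij_betw_def inv_into_into f_inv_into_f)
  have rq: "r n (q n t) = t" "q n t \<in> FO E n" if "t \<in> D n" for n t
    using that qb[of n] by (auto simp: r_def bij_betw_def)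
  have ra: "r (tgt \<phi>) (act E \<phi> z) = A \<phi> (r (fst \<phi>) z)" if "\<phi> \<in> Arr NCat" "z \<in> FO E (fst \<phi>)" for \<phi> z
    using qn[OF that(1) r(1)[OF that(2)]] r(2)[OF that(2)] rq(1)[OF AD[OF that(1) r(1)[OF that(2)]]] by simp
  define \<theta> where "\<theta> P a = mkar P (\<lambda>n x. q n (Comp Qc a (TA tensorQ ?X (ya P n x)))) E" for P a
  have aD: "Comp Qc a (TA tensorQ ?X (ya P n x)) \<in> D n" if "P \<in> Obj Qc" "a \<in> Hom Qc (prodQ X P) Z" "x \<in> FO P n" for P a n x
    using that X by (auto simp: D_def Hom_iff)
  have th: "\<theta> P a \<in> Hom Qc P E" if P: "P \<in> Obj Qc" and a: "a \<in> Hom Qc (prodQ X P) Z" for P a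
  proof -
    have "\<theta> P a \<in> Arr Qc" unfolding \<theta>_def
    proof (rule mkar_arr[OF P E])
      fix \<phi> x assume \<phi>: "\<phi> \<in> Arr NCat" "x \<in> FO P (fst \<phi>)"
      have "Comp Qc a (TA tensorQ ?X (ya P (tgt \<phi>) (act P \<phi> x))) = A \<phi> (Comp Qc a (TA tensorQ ?X (ya P (fst \<phi>) x)))"
        using \<phi> P X a by (simp add: A_def Hom_iff pre_ya[symmetric] QT.left_comp)
      then show "q (tgt \<phi>) (Comp Qc a (TA tensorQ ?X (ya P (tgt \<phi>) (act P \<phi> x)))) =
        act E \<phi> (q (fst \<phi>) (Comp Qc a (TA tensorQ ?X (ya P (fst \<phi>) x))))"
        using qn[OF \<phi>(1) aD[OF P a \<phi>(2)]] by simp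
    qed (use rq aD[OF P a] in auto)
    then show ?thesis by (simp add: Hom_iff \<theta>_def)
  qed
  have ev: "ap (Comp Qc a (TA tensorQ ?X (ya P n x))) n (pr (w, enc (Id NCat n))) = ap a n (pr (w, x))"
    if "P \<in> Obj Qc" "x \<in> FO P n" "w \<in> FO X n" for P a n x w
    using that X by simp
  show ?thesis
  proof (intro bexI[OF _ E] exI[of _ \<theta>] conjI ballI allI impI)
    fix P :: "'u q_obj" assume P: "P \<in> Obj Qc"
    show "bij_betw (\<theta> P) (Hom Qc (TO tensorQ X P) Z) (Hom Qc P E)"
      unfolding tensorQ_simps
    proof (rule bij_betwI')
      fix a b assume a: "a \<in> Hom Qc (prodQ X P) Z" and b: "b \<in> Hom Qc (prodQ X P) Z"
      have "a = b" if eq: "\<theta> P a = \<theta> P b"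
      proof (rule Q_ext)
        fix n z assume "z \<in> FO (fst a) n"
        then obtain w x where z: "w \<in> FO X n" "x \<in> FO P n" "z = pr (w, x)" using a by (auto simp: Hom_iff)
        have "ap (\<theta> P a) n x = ap (\<theta> P b) n x" using eq by simp
        then have "q n (Comp Qc a (TA tensorQ ?X (ya P n x))) = q n (Comp Qc b (TA tensorQ ?X (ya P n x)))"
          using z by (simp add: \<theta>_def)
        then have "Comp Qc a (TA tensorQ ?X (ya P n x)) = Comp Qc b (TA tensorQ ?X (ya P n x))"
          using rq(1)[OF aD[OF P a z(2)]] rq(1)[OF aD[OF P b z(2)]] by metis
        then show "ap a n z = ap b n z" using ev[OF P z(2,1)] z(3) by metis
      qed (use a b in "auto simp: Hom_iff")
      then show "\<theta> P a = \<theta> P b \<longleftrightarrow> a = b" by blast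
    next
      fix b assume b: "b \<in> Hom Qc P E"
      have b': "b \<in> Arr Qc" "fst b = P" "tgt b = E" using b by (auto simp: Hom_iff)
      define t where "t n x = r n (ap b n x)" for n x
      have tD: "t n x \<in> D n" if "x \<in> FO P n" for n x
        using Q_ap_mem[OF b'(1), of x n] b' that r by (simp add: t_def)
      have ta: "t (tgt \<phi>) (act P \<phi> x) = A \<phi> (t (fst \<phi>) x)" if "\<phi> \<in> Arr NCat" "x \<in> FO P (fst \<phi>)" for \<phi> x
        using Q_ap_nat[OF b'(1) that(1), of x] Q_ap_mem[OF b'(1), of x "fst \<phi>"] b' that ra by (simp add: t_def)
      have t: "t n x \<in> Arr Qc" "fst (t n x) = prodQ X (hrep n)" "tgt (t n x) = Z" if "x \<in> FO P n" for n x
        using tD[OF that] by (auto simp: D_def Hom_iff)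
      have tt: "ap (t (tgt \<phi>) (act P \<phi> x)) (tgt \<phi>) (pr (w, enc (Id NCat (tgt \<phi>)))) =
          ap (t (fst \<phi>) x) (tgt \<phi>) (pr (w, enc \<phi>))"
        if "\<phi> \<in> Arr NCat" "x \<in> FO P (fst \<phi>)" "w \<in> FO X (tgt \<phi>)" for \<phi> x w
        using that X t[OF that(2)] by (simp add: ta A_def)
      define a where "a = mkar (prodQ X P) (\<lambda>n z. ap (t n (pi2 z)) n (pr (pi1 z, enc (Id NCat n)))) Z"
      have aa: "a \<in> Arr Qc" unfolding a_def
      proof (rule mkar_arr)
        fix n z assume "z \<in> FO (prodQ X P) n"
        then obtain w x where z: "w \<in> FO X n" "x \<in> FO P n" "z = pr (w, x)" by auto
        then show "ap (t n (pi2 z)) n (pr (pi1 z, enc (Id NCat n))) \<in> FO Z n"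
          using Q_ap_mem[OF t(1)[OF z(2)], of "pr (w, enc (Id NCat n))" n] t[OF z(2)] by simp
      next
        fix \<phi> z assume \<phi>: "\<phi> \<in> Arr NCat" "z \<in> FO (prodQ X P) (fst \<phi>)"
        then obtain w x where z: "w \<in> FO X (fst \<phi>)" "x \<in> FO P (fst \<phi>)" "z = pr (w, x)" by auto
        have "ap (t (fst \<phi>) x) (tgt \<phi>) (pr (act X \<phi> w, enc \<phi>)) = act Z \<phi> (ap (t (fst \<phi>) x) (fst \<phi>) (pr (w, enc (Id NCat (fst \<phi>)))))"
          using Q_ap_nat[OF t(1)[OF z(2)] \<phi>(1), of "pr (w, enc (Id NCat (fst \<phi>)))"] t[OF z(2)] z \<phi>(1) by simp
        then show "ap (t (tgt \<phi>) (pi2 (act (prodQ X P) \<phi> z))) (tgt \<phi>) (pr (pi1 (act (prodQ X P) \<phi> z), enc (Id NCat (tgt \<phi>)))) =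
          act Z \<phi> (ap (t (fst \<phi>) (pi2 z)) (fst \<phi>) (pr (pi1 z, enc (Id NCat (fst \<phi>)))))"
          using tt[OF \<phi>(1) z(2) Qob_mem[OF X \<phi>(1) z(1)]] z \<phi>(1) by simp
      qed (use X Z P in auto)
      then have a: "a \<in> Hom Qc (prodQ X P) Z" by (simp add: Hom_iff a_def)
      have "\<theta> P a = b"
      proof (rule Q_ext)
        fix n x assume "x \<in> FO (fst (\<theta> P a)) n"
        then have x: "x \<in> FO P n" by (simp add: \<theta>_def)
        have "Comp Qc a (TA tensorQ ?X (ya P n x)) = t n x"
        proof (rule Q_ext)
          fix k z assume "z \<in> FO (fst (Comp Qc a (TA tensorQ ?X (ya P n x)))) k"
          then obtain w \<psi> where z: "w \<in> FO X k" "\<psi> \<in> Arr NCat" "fst \<psi> = n" "tgt \<psi> = k" "z = pr (w, enc \<psi>)"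
            by (auto elim!: hrepE)
          have "ap a k (pr (w, act P \<psi> x)) = ap (t n x) k (pr (w, enc \<psi>))"
            using tt[of \<psi> x w] z x Qob_mem[OF P z(2), of x] by (simp add: a_def)
          then show "ap (Comp Qc a (TA tensorQ ?X (ya P n x))) k z = ap (t n x) k z"
            using z x P X by simp
        qed (use t[OF x] aa P X x in "auto simp: a_def")
        then show "ap (\<theta> P a) n x = ap b n x"
          using x r(2) Q_ap_mem[OF b'(1), of x n] b' by (simp add: \<theta>_def t_def)
      qed (use th[OF P a] b' in "auto simp: Hom_iff")
      then show "\<exists>a\<in>Hom Qc (prodQ X P) Z. b = \<theta> P a" using a by blast
    qed (use th P in auto)
  next
    fix P P' :: "'u q_obj" and f a assume f: "f \<in> Hom Qc P' P" and a: "a \<in> Hom Qc (TO tensorQ X P) Z"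
    have P: "P \<in> Obj Qc" "P' \<in> Obj Qc" using Q.hom_objs[OF f] by auto
    have f': "f \<in> Arr Qc" "fst f = P'" "tgt f = P" using f by (auto simp: Hom_iff)
    have a': "a \<in> Arr Qc" "fst a = prodQ X P" "tgt a = Z" using a by (auto simp: Hom_iff)
    have af: "Comp Qc a (TA tensorQ ?X f) \<in> Hom Qc (prodQ X P') Z" using f' a' X by (simp add: Hom_iff)
    show "\<theta> P' (Comp Qc a (TA tensorQ ?X f)) = Comp Qc (\<theta> P a) f"
    proof (rule Q_ext)
      fix n x assume "x \<in> FO (fst (\<theta> P' (Comp Qc a (TA tensorQ ?X f)))) n"
      then have x: "x \<in> FO P' n" by (simp add: \<theta>_def)
      have "Comp Qc (Comp Qc a (TA tensorQ ?X f)) (TA tensorQ ?X (ya P' n x)) = Comp Qc a (TA tensorQ ?X (ya P n (ap f n x)))"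
        using f' a' X P x ya_comp[of f x n] by (simp add: QT.left_comp[symmetric])
      then show "ap (\<theta> P' (Comp Qc a (TA tensorQ ?X f))) n x = ap (Comp Qc (\<theta> P a) f) n x"
        using f' x Q_ap_mem[of f x n] by (simp add: \<theta>_def)
    qed (use th[OF P(2) af] th[OF P(1), of a] a f' in "auto simp: Hom_iff")
  qed
qed

definition copair :: "fin_map \<Rightarrow> fin_map \<Rightarrow> fin_map" where
  "copair \<phi> \<psi> = mkn (fst \<phi> + fst \<psi>) (\<lambda>i. if i \<le> fst \<phi> then nv \<phi> i else nv \<psi> (i - fst \<phi>)) (tgt \<phi>)"

lemma copair_simps [simp]: "fst (copair \<phi> \<psi>) = fst \<phi> + fst \<psi>" "tgt (copair \<phi> \<psi>) = tgt \<phi>"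
  "1 \<le> i ==> i \<le> fst \<phi> + fst \<psi> ==> nv (copair \<phi> \<psi>) i = (if i \<le> fst \<phi> then nv \<phi> i else nv \<psi> (i - fst \<phi>))"
  by (auto simp: copair_def)

lemma copair_arr [simp]: "[|\<phi> \<in> Arr NCat; \<psi> \<in> Arr NCat; tgt \<phi> = tgt \<psi>|] ==> copair \<phi> \<psi> \<in> Arr NCat"
  unfolding copair_def
proof (rule mkn_arr)
  fix i assume a: "\<phi> \<in> Arr NCat" "\<psi> \<in> Arr NCat" "tgt \<phi> = tgt \<psi>" and i: "1 \<le> i" "i \<le> fst \<phi> + fst \<psi>"
  show "1 \<le> (if i \<le> fst \<phi> then nv \<phi> i else nv \<psi> (i - fst \<phi>)) \<and>
    (if i \<le> fst \<phi> then nv \<phi> i else nv \<psi> (i - fst \<phi>)) \<le> tgt \<phi>"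
    using nv_range[OF a(1) i(1)] nv_range_shift[OF a(2), of i "fst \<phi>"] i a(3) by auto
qed

lemma copair_comp:
  assumes "\<phi> \<in> Arr NCat" "\<psi> \<in> Arr NCat" "tgt \<phi> = tgt \<psi>" "\<omega> \<in> Arr NCat" "fst \<omega> = tgt \<psi>"
  shows "Comp NCat \<omega> (copair \<phi> \<psi>) = copair (Comp NCat \<omega> \<phi>) (Comp NCat \<omega> \<psi>)"
proof (rule N_ext)
  fix i assume "1 \<le> i" "i \<le> fst (Comp NCat \<omega> (copair \<phi> \<psi>))"
  then show "nv (Comp NCat \<omega> (copair \<phi> \<psi>)) i = nv (copair (Comp NCat \<omega> \<phi>) (Comp NCat \<omega> \<psi>)) i"
    using assms by auto
qed (use assms in auto)

lemma copair_nsum: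
  assumes "\<phi> \<in> Arr NCat" "\<psi> \<in> Arr NCat" "f \<in> Arr NCat" "g \<in> Arr NCat" "tgt f = fst \<phi>" "tgt g = fst \<psi>"
    "tgt \<phi> = tgt \<psi>"
  shows "Comp NCat (copair \<phi> \<psi>) (nsum f g) = copair (Comp NCat \<phi> f) (Comp NCat \<psi> g)"
proof (rule N_ext)
  fix i assume i: "1 \<le> i" "i \<le> fst (Comp NCat (copair \<phi> \<psi>) (nsum f g))"
  then show "nv (Comp NCat (copair \<phi> \<psi>) (nsum f g)) i = nv (copair (Comp NCat \<phi> f) (Comp NCat \<psi> g)) i"
    using assms nv_range[OF assms(3) i(1)] nv_range_shift[OF assms(4), of i "fst f"]
    by (cases "i \<le> fst f") auto
qed (use assms in auto)

definition muQ :: "nat \<times> nat \<Rightarrow> 'u q_arr" where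
  "muQ = (\<lambda>(m, n)\<in>UNIV \<times> UNIV. mkar (prodQ (hrep m) (hrep n)) (\<lambda>k z. enc (copair (dec (pi1 z)) (dec (pi2 z)))) (hrep (m + n)))"

definition epsQ :: "'u q_arr" where
  "epsQ = mkar unitQ (\<lambda>k z. enc (mkn 0 (\<lambda>i. i) k)) (hrep 0)"

lemma muQ_simps [simp]: "fst (muQ (m, n)) = prodQ (hrep m) (hrep n)" "tgt (muQ (m, n)) = hrep (m + n)"
  "[|\<phi> \<in> Arr NCat; \<psi> \<in> Arr NCat; fst \<phi> = m; fst \<psi> = n; tgt \<phi> = k; tgt \<psi> = k|] ==>
    ap (muQ (m, n)) k (pr (enc \<phi>, enc \<psi>)) = enc (copair \<phi> \<psi>)"
  by (simp_all add: muQ_def)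

lemma muQ_arr [simp]: "muQ (m, n) \<in> Arr Qc"
proof -
  have "mkar (prodQ (hrep m) (hrep n)) (\<lambda>k z. enc (copair (dec (pi1 z)) (dec (pi2 z)))) (hrep (m + n)) \<in> Arr Qc"
    by (rule mkar_arr) (auto elim!: hrepE simp: copair_comp)
  then show ?thesis by (simp add: muQ_def)
qed

lemma muQ_iso: "iso_arr Qc (muQ (m, n))"
proof (rule Q_isoI)
  fix k
  let ?l = "\<lambda>\<omega>. mkn m (nv \<omega>) k" and ?r = "\<lambda>\<omega>. mkn n (\<lambda>i. nv \<omega> (m + i)) k"
  have lr: "?l \<omega> \<in> Arr NCat" "?r \<omega> \<in> Arr NCat" if "\<omega> \<in> Arr NCat" "fst \<omega> = m + n" "tgt \<omega> = k" for \<omega>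
    using nv_range[OF that(1)] that by (auto intro!: mkn_arr)
  have c: "copair (?l \<omega>) (?r \<omega>) = \<omega>" if "\<omega> \<in> Arr NCat" "fst \<omega> = m + n" "tgt \<omega> = k" for \<omega>
    by (rule N_ext) (use that lr[OF that] in auto)
  have c': "?l (copair \<phi> \<psi>) = \<phi>" "?r (copair \<phi> \<psi>) = \<psi>"
    if "\<phi> \<in> Arr NCat" "\<psi> \<in> Arr NCat" "fst \<phi> = m" "fst \<psi> = n" "tgt \<phi> = k" "tgt \<psi> = k" for \<phi> \<psi>
    by (rule N_ext; use that lr[of "copair \<phi> \<psi>"] in auto)+
  show "bij_betw (ap (muQ (m, n)) k) (FO (fst (muQ (m, n))) k) (FO (tgt (muQ (m, n))) k)"
    by (rule bij_betwI[where g="\<lambda>z. pr (enc (?l (dec z)), enc (?r (dec z)))"])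
      (auto elim!: hrepE simp: c c' lr)
qed simp

lemma epsQ_simps [simp]: "fst epsQ = unitQ" "tgt epsQ = hrep 0" "ap epsQ k undefined = enc (mkn 0 (\<lambda>i. i) k)"
  "epsQ \<in> Arr Qc"
proof -
  show "epsQ \<in> Arr Qc" unfolding epsQ_def
    by (rule mkar_arr) (auto simp: mkn_0 intro!: arg_cong[where f=enc] N_ext)
qed (simp_all add: epsQ_def)

lemma epsQ_iso: "iso_arr Qc epsQ"
proof (rule Q_isoI)
  fix k
  have "z = enc (mkn 0 (\<lambda>i. i) k)" if "z \<in> FO (hrep 0 :: 'u q_obj) k" for z
    using that N_from_0 by (metis hrepE)
  then have "FO (hrep 0 :: 'u q_obj) k = {enc (mkn 0 (\<lambda>i. i) k)}" by (auto simp: mkn_0)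
  then show "bij_betw (ap epsQ k) (FO (fst epsQ) k) (FO (tgt epsQ) k)"
    by (simp add: bij_betw_def)
qed simp

lemma extends_tensorQ: "extends_disjoint_union tensorQ muQ epsQ"
proof -
  interpret ON: sym_mon_cat "op NCat" "op_tensor NCat NTensor" by (rule sym_mon_cat_N)
  interpret Y: cfunctor "op NCat" Qc "yoneda :: (nat, fin_map, 'u q_obj, 'u q_arr) cfun" by (rule yoneda_functor)
  have mu: "strong_sym_mon_functor (op NCat) (op_tensor NCat NTensor) Qc tensorQ yoneda muQ epsQ"
  proof (unfold_locales, goal_cases)
    case 1 then show ?case by (simp add: muQ_def)
  next
    case (4 f X X' g Y Y')
    then have a: "f \<in> Arr NCat" "X = tgt f" "X' = fst f" "g \<in> Arr NCat" "Y = tgt g" "Y' = fst g" by (auto simp: Hom_iff)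
    then show ?case by (intro Q_ext) (auto elim!: hrepE simp: copair_nsum)
  next
    case (7 X Y Z)
    have "copair (copair \<phi> \<psi>) \<omega> = copair \<phi> (copair \<psi> \<omega>)" if "\<phi> \<in> Arr NCat" "\<psi> \<in> Arr NCat" "\<omega> \<in> Arr NCat"
      "tgt \<psi> = tgt \<phi>" "tgt \<omega> = tgt \<phi>" for \<phi> \<psi> \<omega>
      by (rule N_ext) (use that in auto)
    then show ?case by (intro Q_ext) (auto elim!: hrepE simp: add.assoc)
  next
    case (8 X)
    have "copair (mkn 0 (\<lambda>i. i) (tgt \<phi>)) \<phi> = \<phi>" if "\<phi> \<in> Arr NCat" for \<phi>
      by (rule N_ext) (use that in "auto simp: mkn_0")
    then show ?case by (intro Q_ext) (auto elim!: hrepE simp: mkn_0)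
  next
    case (9 X)
    have "copair \<phi> (mkn 0 (\<lambda>i. i) (tgt \<phi>)) = \<phi>" if "\<phi> \<in> Arr NCat" for \<phi>
      by (rule N_ext) (use that in "auto simp: mkn_0")
    then show ?case by (intro Q_ext) (auto elim!: hrepE simp: mkn_0)
  next
    case (10 X Y)
    have "Comp NCat (copair \<phi> \<psi>) (swp (fst \<psi>) (fst \<phi>)) = copair \<psi> \<phi>" if "\<phi> \<in> Arr NCat" "\<psi> \<in> Arr NCat"
      "tgt \<psi> = tgt \<phi>" for \<phi> \<psi>
      by (rule N_ext) (use that in auto)
    then show ?case by (intro Q_ext) (auto elim!: hrepE)
  qed (auto simp: Hom_iff muQ_iso epsQ_iso)
  have "tensor_cocontinuous TYPE('u) Qc tensorQ"
    by (rule QT.tensor_cocontinuous_if_closed[OF tensorQ_closed])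
  with mu show ?thesis by (simp add: extends_disjoint_union_def)
qed

end

section \<open>Powers of a cocommutative coalgebra\<close>

abbreviation maps :: "nat \<Rightarrow> (nat \<Rightarrow> nat) \<Rightarrow> nat \<Rightarrow> bool" where
  "maps m f n \<equiv> \<forall>i. 1 \<le> i \<and> i \<le> m \<longrightarrow> 1 \<le> f i \<and> f i \<le> n"

text \<open>
  Tensoring with a cocommutative coalgebra \<open>X\<close> is a comonad \<open>R = - \<otimes> X\<close> with a symmetry
  \<open>s : R R \<rightarrow> R R\<close>.  Working with the iterates of \<open>R\<close> instead of tensor powers of \<open>X\<close> makes all
  associativity isomorphisms disappear.
\<close>

locale sym_comonad = category C for C :: "('o, 'a) cat" +
  fixes Ro :: "'o \<Rightarrow> 'o" and R :: "'a \<Rightarrow> 'a" and d e s :: "'o \<Rightarrow> 'a"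
  assumes R_simps [simp]:
      "M \<in> Obj C ==> Ro M \<in> Obj C" "f \<in> Arr C ==> R f \<in> Arr C"
      "f \<in> Arr C ==> Dom C (R f) = Ro (Dom C f)" "f \<in> Arr C ==> Cod C (R f) = Ro (Cod C f)"
      "M \<in> Obj C ==> R (Id C M) = Id C (Ro M)"
    and R_comp: "[|f \<in> Arr C; g \<in> Arr C; Dom C g = Cod C f|] ==> R (g \<cdot> f) = R g \<cdot> R f"
    and d_simps [simp]: "M \<in> Obj C ==> d M \<in> Arr C" "M \<in> Obj C ==> Dom C (d M) = Ro M"
      "M \<in> Obj C ==> Cod C (d M) = Ro (Ro M)"
    and e_simps [simp]: "M \<in> Obj C ==> e M \<in> Arr C" "M \<in> Obj C ==> Dom C (e M) = Ro M"
      "M \<in> Obj C ==> Cod C (e M) = M"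
    and s_simps [simp]: "M \<in> Obj C ==> s M \<in> Arr C" "M \<in> Obj C ==> Dom C (s M) = Ro (Ro M)"
      "M \<in> Obj C ==> Cod C (s M) = Ro (Ro M)"
    and d_nat: "f \<in> Arr C ==> d (Cod C f) \<cdot> R f = R (R f) \<cdot> d (Dom C f)"
    and e_nat: "f \<in> Arr C ==> e (Cod C f) \<cdot> R f = f \<cdot> e (Dom C f)"
    and s_nat: "f \<in> Arr C ==> s (Cod C f) \<cdot> R (R f) = R (R f) \<cdot> s (Dom C f)"
    and coassoc: "M \<in> Obj C ==> R (d M) \<cdot> d M = d (Ro M) \<cdot> d M"
    and counit1: "M \<in> Obj C ==> e (Ro M) \<cdot> d M = Id C (Ro M)"
    and counit2: "M \<in> Obj C ==> R (e M) \<cdot> d M = Id C (Ro M)"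
    and cocomm: "M \<in> Obj C ==> s M \<cdot> d M = d M"
    and s_s: "M \<in> Obj C ==> s M \<cdot> s M = Id C (Ro (Ro M))"
    and e_s: "M \<in> Obj C ==> e (Ro M) \<cdot> s M = R (e M)"
    and s_d: "M \<in> Obj C ==> R (s M) \<cdot> s (Ro M) \<cdot> R (d M) = d (Ro M) \<cdot> s M"
    and yang_baxter: "M \<in> Obj C ==>
      R (s M) \<cdot> s (Ro M) \<cdot> R (s M) = s (Ro M) \<cdot> R (s M) \<cdot> s (Ro M)"
begin

primrec Rn :: "nat \<Rightarrow> 'o \<Rightarrow> 'o" where
  "Rn 0 M = M" | "Rn (Suc n) M = Ro (Rn n M)"

primrec Ran :: "nat \<Rightarrow> 'a \<Rightarrow> 'a" where
  "Ran 0 f = f" | "Ran (Suc n) f = R (Ran n f)"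

text \<open>The coaction \<open>R\<^sup>n M \<rightarrow> R\<^sup>n\<^sup>+\<^sup>1 M\<close> that copies the \<open>i\<close>-th factor and moves the copy to the end.\<close>

primrec kap :: "nat \<Rightarrow> 'o \<Rightarrow> nat \<Rightarrow> 'a" where
  "kap 0 M i = undefined"
| "kap (Suc n) M i = (if i = Suc n then d (Rn n M) else s (Rn n M) \<cdot> R (kap n M i))"

primrec ep :: "nat \<Rightarrow> 'o \<Rightarrow> 'a" where
  "ep 0 M = Id C M" | "ep (Suc n) M = ep n M \<cdot> e (Rn n M)"

text \<open>
  The action of a map \<open>f : {1..m} \<rightarrow> {1..n}\<close>: the factors numbered \<open>f 1, \<dots>, f m\<close> are copied to the
  end one after the other, then the original factors are discarded.
\<close>

primrec Fa :: "'o \<Rightarrow> nat \<Rightarrow> (nat \<Rightarrow> nat) \<Rightarrow> nat \<Rightarrow> 'a" where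
  "Fa M n f 0 = ep n M"
| "Fa M n f (Suc m) = R (Fa M n f m) \<cdot> kap n M (f (Suc m))"

lemma Rn_obj [simp]: "M \<in> Obj C ==> Rn n M \<in> Obj C"
  by (induction n) auto

lemma Ran_simps [simp]: "f \<in> Arr C ==> Ran n f \<in> Arr C" "f \<in> Arr C ==> Dom C (Ran n f) = Rn n (Dom C f)"
  "f \<in> Arr C ==> Cod C (Ran n f) = Rn n (Cod C f)" "M \<in> Obj C ==> Ran n (Id C M) = Id C (Rn n M)"
  by (induction n) auto

lemma Rn_add: "Rn n (Rn p M) = Rn (p + n) M"
  by (induction n) auto

lemma kap_simps [simp]:
  assumes "M \<in> Obj C" "1 \<le> i" "i \<le> n"
  shows "kap n M i \<in> Arr C" "Dom C (kap n M i) = Rn n M" "Cod C (kap n M i) = Ro (Rn n M)"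
proof -
  have "kap n M i \<in> Arr C \<and> Dom C (kap n M i) = Rn n M \<and> Cod C (kap n M i) = Ro (Rn n M)"
    using assms(2,3) by (induction n) (use assms(1) in "auto simp: le_Suc_eq")
  then show "kap n M i \<in> Arr C" "Dom C (kap n M i) = Rn n M" "Cod C (kap n M i) = Ro (Rn n M)" by auto
qed

declare kap.simps(2) [simp del]

lemma kap_last: "kap (Suc n) M (Suc n) = d (Rn n M)"
  by (simp add: kap.simps)

lemma kap_prev: "i \<le> n ==> kap (Suc n) M i = s (Rn n M) \<cdot> R (kap n M i)"
  by (simp add: kap.simps)

lemma ep_simps [simp]: "M \<in> Obj C ==> ep n M \<in> Arr C" "M \<in> Obj C ==> Dom C (ep n M) = Rn n M"
  "M \<in> Obj C ==> Cod C (ep n M) = M"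
  by (induction n) auto

lemma Fa_simps [simp]:
  assumes "M \<in> Obj C" "maps m f n"
  shows "Fa M n f m \<in> Arr C" "Dom C (Fa M n f m) = Rn n M" "Cod C (Fa M n f m) = Rn m M"
proof -
  have "Fa M n f m \<in> Arr C \<and> Dom C (Fa M n f m) = Rn n M \<and> Cod C (Fa M n f m) = Rn m M"
    using assms(2) by (induction m) (use assms(1) in auto)
  then show "Fa M n f m \<in> Arr C" "Dom C (Fa M n f m) = Rn n M" "Cod C (Fa M n f m) = Rn m M" by auto
qed

lemma Fa_cong: "(\<And>i. 1 \<le> i ==> i \<le> m ==> f i = g i) ==> Fa M n f m = Fa M n g m"
  by (induction m) auto

lemma R_eq: "[|g \<cdot> f = h; f \<in> Arr C; g \<in> Arr C; Dom C g = Cod C f|] ==> R g \<cdot> R f = R h"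
  using R_comp by metis

lemma d_s: assumes [simp]: "M \<in> Obj C"
  shows "s (Ro M) \<cdot> R (s M) \<cdot> d (Ro M) = R (d M) \<cdot> s M"
proof -
  have "s (Ro M) \<cdot> R (s M) \<cdot> d (Ro M) = s (Ro M) \<cdot> R (s M) \<cdot> (d (Ro M) \<cdot> s M) \<cdot> s M" by (simp add: s_s)
  also have "... = s (Ro M) \<cdot> (R (s M) \<cdot> R (s M)) \<cdot> s (Ro M) \<cdot> R (d M) \<cdot> s M" by (simp flip: s_d)
  also have "... = (s (Ro M) \<cdot> s (Ro M)) \<cdot> R (d M) \<cdot> s M" by (simp add: R_eq[OF s_s])
  also have "... = R (d M) \<cdot> s M" by (simp only: s_s R_simps assms) simp
  finally show ?thesis .
qed

lemma kap_coassoc: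
  assumes [simp]: "M \<in> Obj C" and "1 \<le> i" "i \<le> n"
  shows "R (kap n M i) \<cdot> kap n M i = d (Rn n M) \<cdot> kap n M i"
  using assms(2,3)
proof (induction n)
  case (Suc n)
  let ?M = "Rn n M"
  show ?case
  proof (cases "i = Suc n")
    case True then show ?thesis by (simp add: kap_last coassoc)
  next
    case False
    then have i [simp]: "Suc 0 \<le> i" "i \<le> n" using Suc.prems by auto
    let ?k = "kap n M i"
    have "R (s ?M \<cdot> R ?k) \<cdot> s ?M \<cdot> R ?k = R (s ?M) \<cdot> (R (R ?k) \<cdot> s ?M) \<cdot> R ?k" by (simp add: R_comp)
    also have "... = R (s ?M) \<cdot> s (Ro ?M) \<cdot> R (R ?k) \<cdot> R ?k" using comp_reduce[OF s_nat[of ?k], of "R ?k"] by simp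
    also have "... = R (s ?M) \<cdot> s (Ro ?M) \<cdot> R (d ?M \<cdot> ?k)" using Suc.IH by (simp add: R_comp[symmetric])
    also have "... = (R (s ?M) \<cdot> s (Ro ?M) \<cdot> R (d ?M)) \<cdot> R ?k" by (simp add: R_comp)
    also have "... = d (Ro ?M) \<cdot> s ?M \<cdot> R ?k" by (simp only: s_d Rn_obj assms(1)) simp
    finally show ?thesis by (simp add: kap_prev)
  qed
qed simp

lemma kap_counit:
  assumes [simp]: "M \<in> Obj C" and "1 \<le> i" "i \<le> n"
  shows "e (Rn n M) \<cdot> kap n M i = Id C (Rn n M)"
  using assms(2,3)
proof (induction n)
  case (Suc n)
  show ?case
  proof (cases "i = Suc n")
    case True then show ?thesis by (simp add: kap_last counit1)
  next
    case False
    then have i [simp]: "Suc 0 \<le> i" "i \<le> n" using Suc.prems by auto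
    show ?thesis using Suc.IH by (simp add: kap_prev comp_reduce[OF e_s] R_comp[symmetric])
  qed
qed simp

text \<open>
  Two factors may be copied in either order; the copies then differ by \<open>s\<close>. If neither factor
  is the last one, this is the Yang-Baxter equation.
\<close>

lemma kap_comm:
  assumes [simp]: "M \<in> Obj C" and "1 \<le> i" "i \<le> n" "1 \<le> j" "j \<le> n"
  shows "R (kap n M i) \<cdot> kap n M j = s (Rn n M) \<cdot> R (kap n M j) \<cdot> kap n M i"
  using assms(2-5)
proof (induction n)
  case (Suc n)
  let ?M = "Rn n M" and ?k = "\<lambda>i. kap n M i"
  have RR: "s ?M \<cdot> R (?k i) \<in> Arr C" if "1 \<le> i" "i \<le> n" for i using that by simp
  have one: "R (d ?M) \<cdot> s ?M \<cdot> R (?k i) = s (Ro ?M) \<cdot> R (s ?M \<cdot> R (?k i)) \<cdot> d ?M" if "1 \<le> i" "i \<le> n" for i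
  proof -
    have "s (Ro ?M) \<cdot> R (s ?M \<cdot> R (?k i)) \<cdot> d ?M = s (Ro ?M) \<cdot> R (s ?M) \<cdot> R (R (?k i)) \<cdot> d ?M"
      using that by (simp add: R_comp)
    also have "... = s (Ro ?M) \<cdot> R (s ?M) \<cdot> d (Ro ?M) \<cdot> R (?k i)" using that d_nat[of "?k i"] by simp
    also have "... = (s (Ro ?M) \<cdot> R (s ?M) \<cdot> d (Ro ?M)) \<cdot> R (?k i)" using that by simp
    also have "... = R (d ?M) \<cdot> s ?M \<cdot> R (?k i)" using that by (simp only: d_s Rn_obj assms(1)) simp
    finally show ?thesis by simp
  qed
  consider "i = Suc n" "j = Suc n" | "i = Suc n" "j \<le> n" | "i \<le> n" "j = Suc n" | "i \<le> n" "j \<le> n"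
    using Suc.prems by linarith
  then show ?case
  proof cases
    case 1
    have "s (Ro ?M) \<cdot> R (d ?M) \<cdot> d ?M = (s (Ro ?M) \<cdot> d (Ro ?M)) \<cdot> d ?M" by (simp add: coassoc)
    also have "... = R (d ?M) \<cdot> d ?M" by (simp only: cocomm coassoc R_simps Rn_obj assms(1))
    finally show ?thesis using 1 by (simp add: kap_last)
  next
    case 2
    then show ?thesis using one[of j] Suc.prems by (simp add: kap_last kap_prev)
  next
    case 3
    have "s (Ro ?M) \<cdot> R (d ?M) \<cdot> s ?M \<cdot> R (?k i) = (s (Ro ?M) \<cdot> s (Ro ?M)) \<cdot> R (s ?M \<cdot> R (?k i)) \<cdot> d ?M"
      using one[of i] 3 Suc.prems by simp
    also have "... = R (s ?M \<cdot> R (?k i)) \<cdot> d ?M" using 3 Suc.prems by (simp only: s_s R_simps Rn_obj assms(1)) simp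
    finally show ?thesis using 3 Suc.prems by (simp add: kap_last kap_prev)
  next
    case 4
    have *: "R (s ?M \<cdot> R (?k a)) \<cdot> s ?M \<cdot> R (?k b) = R (s ?M) \<cdot> s (Ro ?M) \<cdot> R (R (?k a) \<cdot> ?k b)"
      if "1 \<le> a" "a \<le> n" "1 \<le> b" "b \<le> n" for a b
      using that comp_reduce[OF s_nat[of "?k a"], of "R (?k b)"] by (simp add: R_comp)
    have "R (s ?M \<cdot> R (?k i)) \<cdot> s ?M \<cdot> R (?k j) = R (s ?M) \<cdot> s (Ro ?M) \<cdot> R (s ?M \<cdot> R (?k j) \<cdot> ?k i)"
      using *[of i j] 4 Suc by simp
    also have "... = (R (s ?M) \<cdot> s (Ro ?M) \<cdot> R (s ?M)) \<cdot> R (R (?k j) \<cdot> ?k i)"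
      using 4 Suc.prems by (simp add: R_comp)
    also have "... = s (Ro ?M) \<cdot> R (s ?M) \<cdot> s (Ro ?M) \<cdot> R (R (?k j) \<cdot> ?k i)"
      using 4 Suc.prems by (simp only: yang_baxter Rn_obj assms(1)) simp
    also have "... = s (Ro ?M) \<cdot> R (s ?M \<cdot> R (?k j)) \<cdot> s ?M \<cdot> R (?k i)"
      using *[of j i] 4 Suc.prems by simp
    finally show ?thesis using 4 Suc.prems by (simp add: kap_prev)
  qed
qed simp

text \<open>
  The \<open>j\<close>-th factor of the result is a copy of factor \<open>f j\<close>: copying it afterwards is the same
  as copying \<open>f j\<close> beforehand. Functoriality follows, one copy at a time.
\<close>

lemma Fa_kap:
  assumes [simp]: "M \<in> Obj C" and f: "maps m f n" and j: "1 \<le> j" "j \<le> m"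
  shows "kap m M j \<cdot> Fa M n f m = R (Fa M n f m) \<cdot> kap n M (f j)"
  using f j
proof (induction m)
  case (Suc m)
  let ?F = "Fa M n f m" and ?b = "kap n M (f (Suc m))" and ?N = "Rn n M" and ?P = "Rn m M"
  have fm: "maps m f n" using Suc.prems by simp
  have b: "1 \<le> f (Suc m)" "f (Suc m) \<le> n" using Suc.prems by auto
  note [simp] = Fa_simps[OF assms(1) fm] kap_simps[OF assms(1) b]
  show ?case
  proof (cases "j = Suc m")
    case True
    have "d ?P \<cdot> R ?F \<cdot> ?b = R (R ?F) \<cdot> d ?N \<cdot> ?b" using comp_reduce[OF d_nat[of ?F], of ?b] by simp
    also have "... = R (R ?F) \<cdot> R ?b \<cdot> ?b" using kap_coassoc[OF assms(1) b] by simp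
    finally show ?thesis using True by (simp add: kap_last R_comp)
  next
    case False
    then have j: "1 \<le> j" "j \<le> m" using Suc.prems by auto
    have a: "1 \<le> f j" "f j \<le> n" using fm j by auto
    let ?a = "kap n M (f j)"
    note [simp] = kap_simps[OF assms(1) a] kap_simps[OF assms(1) j]
    have "(s ?P \<cdot> R (kap m M j)) \<cdot> R ?F \<cdot> ?b = s ?P \<cdot> R (kap m M j \<cdot> ?F) \<cdot> ?b" by (simp add: R_comp)
    also have "... = s ?P \<cdot> R (R ?F) \<cdot> R ?a \<cdot> ?b" using Suc.IH[OF fm j] by (simp add: R_comp)
    also have "... = R (R ?F) \<cdot> s ?N \<cdot> R ?a \<cdot> ?b" using comp_reduce[OF s_nat[of ?F], of "R ?a \<cdot> ?b"] by simp
    also have "... = R (R ?F) \<cdot> R ?b \<cdot> ?a" using kap_comm[OF assms(1) b a] by simp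
    finally show ?thesis using j by (simp add: kap_prev R_comp)
  qed
qed simp

lemma ep_Fa:
  assumes [simp]: "M \<in> Obj C" and f: "maps m f n"
  shows "ep m M \<cdot> Fa M n f m = ep n M"
  using f
proof (induction m)
  case (Suc m)
  have fm: "maps m f n" using Suc.prems by simp
  have b: "1 \<le> f (Suc m)" "f (Suc m) \<le> n" using Suc.prems by auto
  note [simp] = Fa_simps[OF assms(1) fm] kap_simps[OF assms(1) b]
  have "ep m M \<cdot> e (Rn m M) \<cdot> R (Fa M n f m) \<cdot> kap n M (f (Suc m)) = ep m M \<cdot> Fa M n f m \<cdot> e (Rn n M) \<cdot> kap n M (f (Suc m))"
    using comp_reduce[OF e_nat[of "Fa M n f m"], of "kap n M (f (Suc m))"] by simp
  then show ?case using Suc.IH[OF fm] kap_counit[OF assms(1) b] by simp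
qed simp

lemma Fa_comp:
  assumes [simp]: "M \<in> Obj C" and f: "maps m f n"
    and g: "maps l g m"
  shows "Fa M n (\<lambda>i. f (g i)) l = Fa M m g l \<cdot> Fa M n f m"
  using g
proof (induction l)
  case 0 then show ?case using ep_Fa[OF assms(1) f] by simp
next
  case (Suc l)
  have gl: "maps l g m" using Suc.prems by simp
  have b: "1 \<le> g (Suc l)" "g (Suc l) \<le> m" using Suc.prems by auto
  have fb: "1 \<le> f (g (Suc l))" "f (g (Suc l)) \<le> n" using b f by auto
  note [simp] = Fa_simps[OF assms(1) gl] kap_simps[OF assms(1) b] Fa_simps[OF assms(1) f] kap_simps[OF assms(1) fb]
  show ?case using Suc.IH[OF gl] Fa_kap[OF assms(1) f b] by (simp add: R_comp)
qed

lemma R_e_s: assumes [simp]: "M \<in> Obj C" shows "R (e M) \<cdot> s M = e (Ro M)"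
proof -
  have "R (e M) \<cdot> s M = e (Ro M) \<cdot> s M \<cdot> s M" using comp_reduce[OF e_s[OF assms], of "s M"] by simp
  then show ?thesis by (simp add: s_s)
qed

lemma Fa_incl:
  assumes [simp]: "M \<in> Obj C" and f: "maps m f n"
  shows "Fa M (Suc n) f m = Fa M n f m \<cdot> e (Rn n M)"
  using f
proof (induction m)
  case (Suc m)
  have fm: "maps m f n" using Suc.prems by simp
  have b: "1 \<le> f (Suc m)" "f (Suc m) \<le> n" using Suc.prems by auto
  let ?k = "kap n M (f (Suc m))"
  note [simp] = Fa_simps[OF assms(1) fm] kap_simps[OF assms(1) b]
  have "R (Fa M n f m \<cdot> e (Rn n M)) \<cdot> s (Rn n M) \<cdot> R ?k = R (Fa M n f m) \<cdot> e (Ro (Rn n M)) \<cdot> R ?k"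
    using comp_reduce[OF R_e_s[of "Rn n M"], of "R ?k"] by (simp add: R_comp)
  also have "... = R (Fa M n f m) \<cdot> ?k \<cdot> e (Rn n M)" using e_nat[of ?k] by simp
  finally show ?case using Suc.IH[OF fm] b by (simp add: kap_prev)
qed simp

lemma Fa_id: assumes [simp]: "M \<in> Obj C" shows "Fa M n (\<lambda>i. i) n = Id C (Rn n M)"
proof (induction n)
  case (Suc n)
  then show ?case using Fa_incl[of M n "\<lambda>i. i" n] by (simp add: kap_last counit2)
qed simp

text \<open>Since \<open>R\<^sup>m\<^sup>+\<^sup>k M = R\<^sup>k (R\<^sup>m M)\<close>, the map \<open>f \<squnion> 1\<close> acts inside \<open>R\<^sup>k\<close>, and \<open>1 \<squnion> f\<close> as \<open>f\<close> with \<open>R\<^sup>m M\<close> for \<open>M\<close>.\<close>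

lemma Fa_sum_right:
  assumes [simp]: "M \<in> Obj C" and f: "maps m f n"
  shows "Fa M (n + k) (\<lambda>i. if i \<le> m then f i else n + (i - m)) (m + k) = Ran k (Fa M n f m)"
proof (induction k)
  case 0 show ?case by (simp, rule Fa_cong) simp
next
  case (Suc k)
  let ?f = "\<lambda>i. if i \<le> m then f i else n + (i - m)"
  have ff: "maps (m + k) ?f (n + k)" using f by (auto simp: le_diff_conv trans_le_add1)
  have "Fa M (n + Suc k) ?f (m + Suc k) = R (Fa M (n + k) ?f (m + k) \<cdot> e (Rn (n + k) M)) \<cdot> d (Rn (n + k) M)"
    using Fa_incl[OF assms(1) ff] by (simp add: kap_last)
  also have "... = R (Fa M (n + k) ?f (m + k))"
    using Fa_simps[OF assms(1) ff] by (simp add: R_comp counit2)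
  finally show ?case using Suc by simp
qed

lemma kap_left: "1 \<le> i ==> i \<le> n ==> kap (p + n) M (p + i) = kap n (Rn p M) i"
proof (induction n)
  case (Suc n)
  then show ?case by (cases "i = Suc n") (auto simp: kap_last kap_prev Rn_add)
qed simp

lemma Fa_sum_left:
  assumes [simp]: "M \<in> Obj C" and f: "maps m f n"
  shows "Fa M (p + n) (\<lambda>i. if i \<le> p then i else p + f (i - p)) (p + m) = Fa (Rn p M) n f m"
  using f
proof (induction m)
  case 0
  have "Fa M (p + n) (\<lambda>i. i) p = ep n (Rn p M)"
  proof (induction n)
    case 0 show ?case by (simp add: Fa_id)
  next
    case (Suc n) then show ?case using Fa_incl[of M p "\<lambda>i. i" "p + n"] by (simp add: Rn_add)
  qed
  moreover have "Fa M (p + n) (\<lambda>i. if i \<le> p then i else p + f (i - p)) p = Fa M (p + n) (\<lambda>i. i) p"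
    by (rule Fa_cong) simp
  ultimately show ?case by simp
next
  case (Suc m)
  then have "Fa M (p + n) (\<lambda>i. if i \<le> p then i else p + f (i - p)) (p + m) = Fa (Rn p M) n f m" by simp
  moreover have "kap (p + n) M (p + f (Suc m)) = kap n (Rn p M) (f (Suc m))"
    using Suc.prems by (intro kap_left) auto
  ultimately show ?case by simp
qed

lemma N_fun: "\<phi> \<in> Arr NCat ==> maps (fst \<phi>) (nv \<phi>) (tgt \<phi>)"
  using nv_range by blast

definition power_functor :: "'o \<Rightarrow> (nat, fin_map, 'o, 'a) cfun" where
  "power_functor M = \<lparr>FO = (\<lambda>n\<in>Obj NCat. Rn n M), FA = (\<lambda>\<phi>\<in>Arr NCat. Fa M (tgt \<phi>) (nv \<phi>) (fst \<phi>))\<rparr>"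

lemma power_functor_simps [simp]: "FO (power_functor M) n = Rn n M"
  "\<phi> \<in> Arr NCat ==> FA (power_functor M) \<phi> = Fa M (tgt \<phi>) (nv \<phi>) (fst \<phi>)"
  by (simp_all add: power_functor_def)

lemma power_functor: assumes [simp]: "M \<in> Obj C" shows "cfunctor (op NCat) C (power_functor M)"
proof (rule cfunctorI[OF category_op[OF category_N] category_axioms])
  fix \<psi> \<phi> assume a: "\<psi> \<in> Arr (op NCat)" "\<phi> \<in> Arr (op NCat)" "Dom (op NCat) \<phi> = Cod (op NCat) \<psi>"
  then have a': "\<psi> \<in> Arr NCat" "\<phi> \<in> Arr NCat" "fst \<psi> = tgt \<phi>" by auto
  have "Fa M (tgt \<psi>) (nv (Comp NCat \<psi> \<phi>)) (fst \<phi>) = Fa M (tgt \<psi>) (\<lambda>i. nv \<psi> (nv \<phi> i)) (fst \<phi>)"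
    using a' by (intro Fa_cong) simp
  then show "FA (power_functor M) (Comp (op NCat) \<phi> \<psi>) = FA (power_functor M) \<phi> \<cdot> FA (power_functor M) \<psi>"
    using a' Fa_comp[OF assms, of "fst \<psi>" "nv \<psi>" "tgt \<psi>" "fst \<phi>" "nv \<phi>"] N_fun[of \<psi>] N_fun[of \<phi>] by simp
next
  fix n
  have "Fa M n (nv (Id NCat n)) n = Fa M n (\<lambda>i. i) n" by (rule Fa_cong) simp
  then show "FA (power_functor M) (Id (op NCat) n) = Id C (FO (power_functor M) n)" by (simp add: Fa_id)
next
  fix \<phi> assume "\<phi> \<in> Arr (op NCat)"
  then show "FA (power_functor M) \<phi> \<in> Hom C (FO (power_functor M) (Dom (op NCat) \<phi>)) (FO (power_functor M) (Cod (op NCat) \<phi>))"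
    using Fa_simps[OF assms N_fun[of \<phi>]] by (simp add: Hom_iff)
qed (auto simp: power_functor_def)

end

section \<open>The monoidal functor of a cocommutative coalgebra\<close>

context sym_mon_cat begin

lemma pentagon_inv:
  assumes [simp]: "W \<in> Obj C" "X \<in> Obj C" "Y \<in> Obj C" "Z \<in> Obj C"
  shows "(\<a>' W X Y \<otimes> \<one> Z) \<cdot> \<a>' W (X \<boxtimes> Y) Z \<cdot> (\<one> W \<otimes> \<a>' X Y Z) = \<a>' (W \<boxtimes> X) Y Z \<cdot> \<a>' W X (Y \<boxtimes> Z)"
proof -
  have "inv_arr C ((\<one> W \<otimes> \<a> X Y Z) \<cdot> \<a> W (X \<boxtimes> Y) Z \<cdot> (\<a> W X Y \<otimes> \<one> Z)) =
    inv_arr C (\<a> W X (Y \<boxtimes> Z) \<cdot> \<a> (W \<boxtimes> X) Y Z)" by (simp add: pentagon)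
  then show ?thesis by (simp add: inv_comp inv_tensor)
qed

end

locale coalgebra_object = sym_mon_cat C T for C :: "('o, 'a) cat" and T +
  fixes X :: 'o and \<Delta> \<eta> :: 'a
  assumes coalgebra: "cocomm_coalgebra C T (X, \<Delta>, \<eta>)"
begin

lemma coalg_simps [simp]: "X \<in> Obj C" "\<Delta> \<in> Arr C" "Dom C \<Delta> = X" "Cod C \<Delta> = X \<boxtimes> X"
  "\<eta> \<in> Arr C" "Dom C \<eta> = X" "Cod C \<eta> = \<I>"
  using coalgebra by (auto simp: cocomm_coalgebra_iff Hom_iff)

lemma coalg_laws: "\<a> X X X \<cdot> (\<Delta> \<otimes> \<one> X) \<cdot> \<Delta> = (\<one> X \<otimes> \<Delta>) \<cdot> \<Delta>"
  "\<l> X \<cdot> (\<eta> \<otimes> \<one> X) \<cdot> \<Delta> = \<one> X" "\<r> X \<cdot> (\<one> X \<otimes> \<eta>) \<cdot> \<Delta> = \<one> X" "\<c> X X \<cdot> \<Delta> = \<Delta>"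
  using coalgebra by (auto simp: cocomm_coalgebra_iff)

definition Ro :: "'o \<Rightarrow> 'o" where "Ro M = M \<boxtimes> X"
definition R :: "'a \<Rightarrow> 'a" where "R f = f \<otimes> \<one> X"
definition dl :: "'o \<Rightarrow> 'a" where "dl M = \<a>' M X X \<cdot> (\<one> M \<otimes> \<Delta>)"
definition el :: "'o \<Rightarrow> 'a" where "el M = \<r> M \<cdot> (\<one> M \<otimes> \<eta>)"
definition sl :: "'o \<Rightarrow> 'a" where "sl M = \<a>' M X X \<cdot> (\<one> M \<otimes> \<c> X X) \<cdot> \<a> M X X"

lemmas R_defs = Ro_def R_def dl_def el_def sl_def

text \<open>
  Reassociating \<open>((M \<otimes> X) \<otimes> X) \<otimes> X\<close> to \<open>M \<otimes> (X \<otimes> (X \<otimes> X))\<close> turns the structure maps of \<open>R\<close> into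
  maps of the form \<open>1 \<otimes> g\<close>, so that the laws follow from those of \<open>X\<close>.
  The maps \<open>sp\<close> and \<open>sq\<close> are the transpositions of \<open>X \<otimes> (X \<otimes> X)\<close>.
\<close>

definition B :: "'o \<Rightarrow> 'a" where "B M = \<a> M X (X \<boxtimes> X) \<cdot> \<a> (M \<boxtimes> X) X X"
definition sp :: 'a where "sp = \<a> X X X \<cdot> (\<c> X X \<otimes> \<one> X) \<cdot> \<a>' X X X"
definition sq :: 'a where "sq = \<one> X \<otimes> \<c> X X"

lemma B_alt: "M \<in> Obj C ==> B M = (\<one> M \<otimes> \<a> X X X) \<cdot> \<a> M (X \<boxtimes> X) X \<cdot> (\<a> M X X \<otimes> \<one> X)"
  by (simp add: B_def pentagon)

lemma B_simps [simp]: "M \<in> Obj C ==> iso_arr C (B M)" "M \<in> Obj C ==> Dom C (B M) = ((M \<boxtimes> X) \<boxtimes> X) \<boxtimes> X"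
  "M \<in> Obj C ==> Cod C (B M) = M \<boxtimes> X \<boxtimes> X \<boxtimes> X"
  by (simp_all add: B_def)

lemma sp_simps [simp]: "sp \<in> Arr C" "Dom C sp = X \<boxtimes> X \<boxtimes> X" "Cod C sp = X \<boxtimes> X \<boxtimes> X"
  "sq \<in> Arr C" "Dom C sq = X \<boxtimes> X \<boxtimes> X" "Cod C sq = X \<boxtimes> X \<boxtimes> X"
  by (simp_all add: sp_def sq_def)

lemma dl_simps [simp]: "M \<in> Obj C ==> dl M \<in> Arr C" "M \<in> Obj C ==> Dom C (dl M) = M \<boxtimes> X"
  "M \<in> Obj C ==> Cod C (dl M) = (M \<boxtimes> X) \<boxtimes> X" "M \<in> Obj C ==> el M \<in> Arr C" "M \<in> Obj C ==> Dom C (el M) = M \<boxtimes> X"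
  "M \<in> Obj C ==> Cod C (el M) = M" "M \<in> Obj C ==> sl M \<in> Arr C" "M \<in> Obj C ==> Dom C (sl M) = (M \<boxtimes> X) \<boxtimes> X"
  "M \<in> Obj C ==> Cod C (sl M) = (M \<boxtimes> X) \<boxtimes> X"
  by (simp_all add: R_defs)

lemma sq_sp: "sq \<cdot> sp = \<a> X X X \<cdot> \<c> X (X \<boxtimes> X)"
proof -
  have "sq \<cdot> sp = (sq \<cdot> \<a> X X X \<cdot> (\<c> X X \<otimes> \<one> X)) \<cdot> \<a>' X X X" by (simp add: sp_def)
  also have "... = (\<a> X X X \<cdot> \<c> X (X \<boxtimes> X) \<cdot> \<a> X X X) \<cdot> \<a>' X X X" by (simp add: sq_def hexagon)
  finally show ?thesis by simp
qed

lemma sp_sp: "sp \<cdot> sp = \<one> (X \<boxtimes> X \<boxtimes> X)"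
  by (simp add: sp_def interchange_re braid_sym)

lemma sq_sq: "sq \<cdot> sq = \<one> (X \<boxtimes> X \<boxtimes> X)"
  by (simp add: sq_def interchange braid_sym)

lemma sp_sq: "sp \<cdot> sq = \<c> (X \<boxtimes> X) X \<cdot> \<a>' X X X"
proof (rule iso_cancel_right[of "\<a> X X X \<cdot> \<c> X (X \<boxtimes> X)"])
  have "(sp \<cdot> sq) \<cdot> sq \<cdot> sp = sp \<cdot> (sq \<cdot> sq) \<cdot> sp" by simp
  also have "... = \<one> (X \<boxtimes> X \<boxtimes> X)" by (simp only: sq_sq) (simp add: sp_sp)
  finally show "(sp \<cdot> sq) \<cdot> \<a> X X X \<cdot> \<c> X (X \<boxtimes> X) = (\<c> (X \<boxtimes> X) X \<cdot> \<a>' X X X) \<cdot> \<a> X X X \<cdot> \<c> X (X \<boxtimes> X)"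
    by (simp add: sq_sp braid_sym)
qed auto

lemma sq_sp_sq: "sq \<cdot> sp \<cdot> sq = sp \<cdot> sq \<cdot> sp"
proof -
  have "sq \<cdot> sp \<cdot> sq = \<a> X X X \<cdot> \<c> X (X \<boxtimes> X) \<cdot> (\<one> X \<otimes> \<c> X X)"
    using comp_reduce[OF sq_sp, of sq] by (simp add: sq_def)
  also have "... = \<a> X X X \<cdot> (\<c> X X \<otimes> \<one> X) \<cdot> \<c> X (X \<boxtimes> X)" by (simp add: braid_nat)
  also have "... = sp \<cdot> \<a> X X X \<cdot> \<c> X (X \<boxtimes> X)" by (simp add: sp_def)
  finally show ?thesis by (simp add: sq_sp)
qed

context
  fixes M assumes M [simp]: "M \<in> Obj C"
begin

lemma B_R_dl: "B M \<cdot> (dl M \<otimes> \<one> X) = (\<one> M \<otimes> (\<a> X X X \<cdot> (\<Delta> \<otimes> \<one> X))) \<cdot> \<a> M X X"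
proof -
  have "B M \<cdot> (dl M \<otimes> \<one> X) = (\<one> M \<otimes> \<a> X X X) \<cdot> \<a> M (X \<boxtimes> X) X \<cdot> ((\<one> M \<otimes> \<Delta>) \<otimes> \<one> X)"
    by (simp add: B_alt dl_def interchange)
  also have "... = (\<one> M \<otimes> \<a> X X X) \<cdot> (\<one> M \<otimes> \<Delta> \<otimes> \<one> X) \<cdot> \<a> M X X" by (simp add: assoc_nat)
  finally show ?thesis by (simp add: left_comp)
qed

lemma B_dl: "B M \<cdot> dl (M \<boxtimes> X) = (\<one> M \<otimes> \<one> X \<otimes> \<Delta>) \<cdot> \<a> M X X"
  using assoc_nat[of "\<one> M" "\<one> X" \<Delta> M X "X \<boxtimes> X"] by (simp add: B_def dl_def)

lemma B_R_sl: "B M \<cdot> (sl M \<otimes> \<one> X) = (\<one> M \<otimes> sp) \<cdot> B M"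
proof -
  have "B M \<cdot> (sl M \<otimes> \<one> X) = (\<one> M \<otimes> \<a> X X X) \<cdot> \<a> M (X \<boxtimes> X) X \<cdot> ((\<one> M \<otimes> \<c> X X) \<otimes> \<one> X) \<cdot> (\<a> M X X \<otimes> \<one> X)"
    by (simp add: B_alt sl_def interchange)
  also have "... = (\<one> M \<otimes> \<a> X X X) \<cdot> (\<one> M \<otimes> \<c> X X \<otimes> \<one> X) \<cdot> \<a> M (X \<boxtimes> X) X \<cdot> (\<a> M X X \<otimes> \<one> X)"
    by (subst comp_reduce[OF assoc_nat]) simp_all
  also have "... = (\<one> M \<otimes> sp) \<cdot> (\<one> M \<otimes> \<a> X X X) \<cdot> \<a> M (X \<boxtimes> X) X \<cdot> (\<a> M X X \<otimes> \<one> X)"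
    by (simp add: sp_def interchange_re)
  finally show ?thesis by (simp add: B_alt)
qed

lemma B_sl: "B M \<cdot> sl (M \<boxtimes> X) = (\<one> M \<otimes> sq) \<cdot> B M"
  using comp_reduce[OF assoc_nat[of "\<one> M" "\<one> X" "\<c> X X" M X "X \<boxtimes> X"], of "\<a> (M \<boxtimes> X) X X"]
  by (simp add: B_def sl_def sq_def)

lemma A_dl: "\<a> M X X \<cdot> dl M = \<one> M \<otimes> \<Delta>"
  by (simp add: dl_def)

lemma A_sl: "\<a> M X X \<cdot> sl M = (\<one> M \<otimes> \<c> X X) \<cdot> \<a> M X X"
  by (simp add: sl_def)

lemma R_coassoc: "(dl M \<otimes> \<one> X) \<cdot> dl M = dl (M \<boxtimes> X) \<cdot> dl M"
proof (rule iso_cancel_left[of "B M"])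
  have "B M \<cdot> (dl M \<otimes> \<one> X) \<cdot> dl M = (\<one> M \<otimes> (\<a> X X X \<cdot> (\<Delta> \<otimes> \<one> X))) \<cdot> (\<one> M \<otimes> \<Delta>)"
    using comp_reduce[OF B_R_dl, of "dl M"] by (simp add: A_dl)
  also have "... = \<one> M \<otimes> ((\<one> X \<otimes> \<Delta>) \<cdot> \<Delta>)" by (simp add: interchange coalg_laws)
  also have "... = B M \<cdot> dl (M \<boxtimes> X) \<cdot> dl M"
    using comp_reduce[OF B_dl, of "dl M"] by (simp add: A_dl interchange)
  finally show "B M \<cdot> (dl M \<otimes> \<one> X) \<cdot> dl M = B M \<cdot> dl (M \<boxtimes> X) \<cdot> dl M" .
qed auto

lemma runit_inv: "N \<in> Obj C ==> \<r> (M \<boxtimes> N) \<cdot> \<a>' M N \<I> = \<one> M \<otimes> \<r> N"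
  using iso_move_right[OF _ _ _ runit_tensor[of M N]] by simp

lemma triangle_inv: "N \<in> Obj C ==> (\<r> M \<otimes> \<one> N) \<cdot> \<a>' M \<I> N = \<one> M \<otimes> \<l> N"
  using iso_move_right[OF _ _ _ triangle[of M N]] by simp

lemma el_lin: "N \<in> Obj C ==> el (M \<boxtimes> N) \<cdot> \<a>' M N X = \<one> M \<otimes> el N"
  using assoc_inv_nat[of "\<one> M" "\<one> N" \<eta> M N \<I>] comp_reduce[OF runit_inv[of N], of "\<one> M \<otimes> \<one> N \<otimes> \<eta>"]
  by (simp add: el_def left_comp)

lemma R_counit1: "el (M \<boxtimes> X) \<cdot> dl M = \<one> (M \<boxtimes> X)"
proof -
  have "el (M \<boxtimes> X) \<cdot> dl M = (\<one> M \<otimes> el X) \<cdot> (\<one> M \<otimes> \<Delta>)"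
    using comp_reduce[OF el_lin[of X], of "\<one> M \<otimes> \<Delta>"] by (simp add: dl_def)
  then show ?thesis by (simp add: interchange el_def coalg_laws)
qed

lemma R_el: "el M \<otimes> \<one> X = (\<one> M \<otimes> (\<l> X \<cdot> (\<eta> \<otimes> \<one> X))) \<cdot> \<a> M X X"
proof -
  have "el M \<otimes> \<one> X = (\<r> M \<otimes> \<one> X) \<cdot> ((\<one> M \<otimes> \<eta>) \<otimes> \<one> X)" by (simp add: el_def right_comp)
  also have "... = (\<one> M \<otimes> \<l> X) \<cdot> \<a> M \<I> X \<cdot> ((\<one> M \<otimes> \<eta>) \<otimes> \<one> X)" by (simp add: triangle[symmetric])
  also have "... = (\<one> M \<otimes> \<l> X) \<cdot> (\<one> M \<otimes> \<eta> \<otimes> \<one> X) \<cdot> \<a> M X X" by (simp add: assoc_nat)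
  finally show ?thesis by (simp add: left_comp)
qed

lemma R_counit2: "(el M \<otimes> \<one> X) \<cdot> dl M = \<one> (M \<boxtimes> X)"
  by (simp add: R_el A_dl interchange coalg_laws)

lemma R_e_s: "el (M \<boxtimes> X) \<cdot> sl M = el M \<otimes> \<one> X"
proof -
  have "el (M \<boxtimes> X) \<cdot> sl M = (\<one> M \<otimes> el X) \<cdot> (\<one> M \<otimes> \<c> X X) \<cdot> \<a> M X X"
    using comp_reduce[OF el_lin[of X], of "(\<one> M \<otimes> \<c> X X) \<cdot> \<a> M X X"] by (simp add: sl_def)
  also have "... = (\<one> M \<otimes> (\<r> X \<cdot> (\<one> X \<otimes> \<eta>) \<cdot> \<c> X X)) \<cdot> \<a> M X X"
    by (simp add: interchange_re el_def)
  also have "(\<one> X \<otimes> \<eta>) \<cdot> \<c> X X = \<c> \<I> X \<cdot> (\<eta> \<otimes> \<one> X)" by (simp add: braid_nat)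
  also have "\<r> X \<cdot> \<c> \<I> X \<cdot> (\<eta> \<otimes> \<one> X) = \<l> X \<cdot> (\<eta> \<otimes> \<one> X)" by (simp add: comp_reduce[OF runit_braid])
  finally show ?thesis by (simp add: R_el)
qed

lemma R_s_d: "(sl M \<otimes> \<one> X) \<cdot> sl (M \<boxtimes> X) \<cdot> (dl M \<otimes> \<one> X) = dl (M \<boxtimes> X) \<cdot> sl M"
proof (rule iso_cancel_left[of "B M"])
  have "B M \<cdot> (sl M \<otimes> \<one> X) \<cdot> sl (M \<boxtimes> X) \<cdot> (dl M \<otimes> \<one> X) = (\<one> M \<otimes> sp) \<cdot> B M \<cdot> sl (M \<boxtimes> X) \<cdot> (dl M \<otimes> \<one> X)"
    using comp_reduce[OF B_R_sl, of "sl (M \<boxtimes> X) \<cdot> (dl M \<otimes> \<one> X)"] by simp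
  also have "... = (\<one> M \<otimes> sp) \<cdot> (\<one> M \<otimes> sq) \<cdot> B M \<cdot> (dl M \<otimes> \<one> X)"
    using comp_reduce[OF B_sl, of "dl M \<otimes> \<one> X"] by simp
  also have "... = (\<one> M \<otimes> ((sp \<cdot> sq) \<cdot> \<a> X X X \<cdot> (\<Delta> \<otimes> \<one> X))) \<cdot> \<a> M X X"
    by (simp add: B_R_dl interchange_re)
  also have "(sp \<cdot> sq) \<cdot> \<a> X X X \<cdot> (\<Delta> \<otimes> \<one> X) = \<c> (X \<boxtimes> X) X \<cdot> (\<Delta> \<otimes> \<one> X)" by (simp only: sp_sq) simp
  also have "... = (\<one> X \<otimes> \<Delta>) \<cdot> \<c> X X" by (simp add: braid_nat)
  also have "(\<one> M \<otimes> ((\<one> X \<otimes> \<Delta>) \<cdot> \<c> X X)) \<cdot> \<a> M X X = B M \<cdot> dl (M \<boxtimes> X) \<cdot> sl M"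
    using comp_reduce[OF B_dl, of "sl M"] by (simp add: A_sl left_comp)
  finally show "B M \<cdot> (sl M \<otimes> \<one> X) \<cdot> sl (M \<boxtimes> X) \<cdot> (dl M \<otimes> \<one> X) = B M \<cdot> dl (M \<boxtimes> X) \<cdot> sl M" .
qed auto

lemma R_yang_baxter: "(sl M \<otimes> \<one> X) \<cdot> sl (M \<boxtimes> X) \<cdot> (sl M \<otimes> \<one> X) = sl (M \<boxtimes> X) \<cdot> (sl M \<otimes> \<one> X) \<cdot> sl (M \<boxtimes> X)"
proof (rule iso_cancel_left[of "B M"])
  have 1: "B M \<cdot> (sl M \<otimes> \<one> X) \<cdot> k = (\<one> M \<otimes> sp) \<cdot> B M \<cdot> k"
    and 2: "B M \<cdot> sl (M \<boxtimes> X) \<cdot> k = (\<one> M \<otimes> sq) \<cdot> B M \<cdot> k"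
    if "k \<in> Arr C" "Cod C k = ((M \<boxtimes> X) \<boxtimes> X) \<boxtimes> X" for k
    using comp_reduce[OF B_R_sl, of k] comp_reduce[OF B_sl, of k] that by auto
  have "B M \<cdot> (sl M \<otimes> \<one> X) \<cdot> sl (M \<boxtimes> X) \<cdot> (sl M \<otimes> \<one> X) = (\<one> M \<otimes> (sp \<cdot> sq \<cdot> sp)) \<cdot> B M"
    by (simp add: 1 2 B_R_sl interchange_re)
  also have "... = B M \<cdot> sl (M \<boxtimes> X) \<cdot> (sl M \<otimes> \<one> X) \<cdot> sl (M \<boxtimes> X)"
    by (simp add: 1 2 B_sl interchange_re sq_sp_sq)
  finally show "B M \<cdot> (sl M \<otimes> \<one> X) \<cdot> sl (M \<boxtimes> X) \<cdot> (sl M \<otimes> \<one> X) = B M \<cdot> sl (M \<boxtimes> X) \<cdot> (sl M \<otimes> \<one> X) \<cdot> sl (M \<boxtimes> X)" .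
qed auto

end

sublocale P: sym_comonad C Ro R dl el sl
proof
  fix f assume [simp]: "f \<in> Arr C"
  show "dl (Cod C f) \<cdot> R f = R (R f) \<cdot> dl (Dom C f)"
    using comp_reduce[OF assoc_inv_nat[of f "\<one> X" "\<one> X" "Cod C f" X X], of "\<one> (Dom C f) \<otimes> \<Delta>"]
    by (simp add: R_defs interchange)
  show "el (Cod C f) \<cdot> R f = f \<cdot> el (Dom C f)"
    using comp_reduce[OF runit_nat[of f], of "\<one> (Dom C f) \<otimes> \<eta>"] by (simp add: R_defs interchange)
  have "sl (Cod C f) \<cdot> R (R f) = \<a>' (Cod C f) X X \<cdot> (f \<otimes> \<one> X \<otimes> \<one> X) \<cdot> (\<one> (Dom C f) \<otimes> \<c> X X) \<cdot> \<a> (Dom C f) X X"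
    by (simp add: R_defs assoc_nat interchange_re del: tensor_simps(6)) (simp add: interchange_re)
  then show "sl (Cod C f) \<cdot> R (R f) = R (R f) \<cdot> sl (Dom C f)"
    using comp_reduce[OF assoc_inv_nat[of f "\<one> X" "\<one> X" "Cod C f" X X], of "(\<one> (Dom C f) \<otimes> \<c> X X) \<cdot> \<a> (Dom C f) X X"]
    by (simp add: R_defs)
next
  fix M assume [simp]: "M \<in> Obj C"
  show "R (dl M) \<cdot> dl M = dl (Ro M) \<cdot> dl M" unfolding R_def Ro_def by (rule R_coassoc) simp
  show "el (Ro M) \<cdot> dl M = \<one> (Ro M)" unfolding Ro_def by (rule R_counit1) simp
  show "R (el M) \<cdot> dl M = \<one> (Ro M)" unfolding R_def Ro_def by (rule R_counit2) simp
  show "sl M \<cdot> dl M = dl M" by (simp add: dl_def sl_def interchange coalg_laws)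
  show "sl M \<cdot> sl M = \<one> (Ro (Ro M))" by (simp add: sl_def Ro_def interchange_re braid_sym)
  show "el (Ro M) \<cdot> sl M = R (el M)" unfolding R_def Ro_def by (rule R_e_s) simp
  show "R (sl M) \<cdot> sl (Ro M) \<cdot> R (dl M) = dl (Ro M) \<cdot> sl M" unfolding R_def Ro_def by (rule R_s_d) simp
  show "R (sl M) \<cdot> sl (Ro M) \<cdot> R (sl M) = sl (Ro M) \<cdot> R (sl M) \<cdot> sl (Ro M)"
    unfolding R_def Ro_def by (rule R_yang_baxter) simp
qed (simp_all add: Ro_def R_def right_comp)

subsection \<open>Linearity\<close>

text \<open>
  The structure maps of \<open>R = - \<otimes> X\<close> commute with tensoring on the left, hence so does the
  action of finite maps. This compares \<open>R\<^sup>n M\<close> with \<open>M \<otimes> X\<^sup>n\<close>.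
\<close>

lemma dl_lin:
  assumes [simp]: "M \<in> Obj C" "N \<in> Obj C"
  shows "dl (M \<boxtimes> N) \<cdot> \<a>' M N X = R (\<a>' M N X) \<cdot> \<a>' M (N \<boxtimes> X) X \<cdot> (\<one> M \<otimes> dl N)"
proof -
  have "R (\<a>' M N X) \<cdot> \<a>' M (N \<boxtimes> X) X \<cdot> (\<one> M \<otimes> dl N) =
    ((\<a>' M N X \<otimes> \<one> X) \<cdot> \<a>' M (N \<boxtimes> X) X \<cdot> (\<one> M \<otimes> \<a>' N X X)) \<cdot> (\<one> M \<otimes> \<one> N \<otimes> \<Delta>)"
    by (simp add: R_def dl_def left_comp)
  also have "... = \<a>' (M \<boxtimes> N) X X \<cdot> \<a>' M N (X \<boxtimes> X) \<cdot> (\<one> M \<otimes> \<one> N \<otimes> \<Delta>)"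
    by (simp only: pentagon_inv assms coalg_simps) simp
  also have "... = dl (M \<boxtimes> N) \<cdot> \<a>' M N X"
    using assoc_inv_nat[of "\<one> M" "\<one> N" \<Delta> M N "X \<boxtimes> X"] by (simp add: dl_def)
  finally show ?thesis by simp
qed

lemma sl_lin:
  assumes [simp]: "M \<in> Obj C" "N \<in> Obj C"
  shows "sl (M \<boxtimes> N) \<cdot> R (\<a>' M N X) \<cdot> \<a>' M (N \<boxtimes> X) X = R (\<a>' M N X) \<cdot> \<a>' M (N \<boxtimes> X) X \<cdot> (\<one> M \<otimes> sl N)"
proof (rule iso_cancel_right[of "\<one> M \<otimes> \<a>' N X X"])
  let ?G = "(\<a>' M N X \<otimes> \<one> X) \<cdot> \<a>' M (N \<boxtimes> X) X \<cdot> (\<one> M \<otimes> \<a>' N X X)"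
  have G: "?G = \<a>' (M \<boxtimes> N) X X \<cdot> \<a>' M N (X \<boxtimes> X)" by (simp add: pentagon_inv)
  have "(R (\<a>' M N X) \<cdot> \<a>' M (N \<boxtimes> X) X \<cdot> (\<one> M \<otimes> sl N)) \<cdot> (\<one> M \<otimes> \<a>' N X X) = ?G \<cdot> (\<one> M \<otimes> \<one> N \<otimes> \<c> X X)"
    by (simp add: R_def sl_def interchange)
  also have "... = \<a>' (M \<boxtimes> N) X X \<cdot> (\<one> (M \<boxtimes> N) \<otimes> \<c> X X) \<cdot> \<a>' M N (X \<boxtimes> X)"
    unfolding G using assoc_inv_nat[of "\<one> M" "\<one> N" "\<c> X X" M N "X \<boxtimes> X"] by simp
  also have "... = sl (M \<boxtimes> N) \<cdot> \<a>' (M \<boxtimes> N) X X \<cdot> \<a>' M N (X \<boxtimes> X)" by (simp add: sl_def)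
  also have "... = (sl (M \<boxtimes> N) \<cdot> R (\<a>' M N X) \<cdot> \<a>' M (N \<boxtimes> X) X) \<cdot> (\<one> M \<otimes> \<a>' N X X)"
    unfolding G[symmetric] by (simp add: R_def)
  finally show "(sl (M \<boxtimes> N) \<cdot> R (\<a>' M N X) \<cdot> \<a>' M (N \<boxtimes> X) X) \<cdot> (\<one> M \<otimes> \<a>' N X X) =
    (R (\<a>' M N X) \<cdot> \<a>' M (N \<boxtimes> X) X \<cdot> (\<one> M \<otimes> sl N)) \<cdot> (\<one> M \<otimes> \<a>' N X X)" by simp
qed (auto simp: R_def)

abbreviation Xn ("X\<^sup>_" [1000] 1000) where "Xn n \<equiv> P.Rn n \<I>"

text \<open>The identification of \<open>M \<otimes> X\<^sup>n\<close> with \<open>R\<^sup>n M\<close>.\<close>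

primrec an :: "nat \<Rightarrow> 'o \<Rightarrow> 'a" where
  "an 0 M = \<r> M" | "an (Suc n) M = R (an n M) \<cdot> \<a>' M (Xn n) X"

lemma Ro_simp [simp]: "M \<in> Obj C ==> Ro M = M \<boxtimes> X"
  by (simp add: Ro_def)

lemma R_iso [simp]: "iso_arr C f ==> iso_arr C (R f)"
  by (simp add: R_def)

lemma R_arr [simp]: "f \<in> Arr C ==> R f \<in> Arr C" "f \<in> Arr C ==> Dom C (R f) = Dom C f \<boxtimes> X" "f \<in> Arr C ==> Cod C (R f) = Cod C f \<boxtimes> X"
  by (simp_all add: R_def)

lemma an_simps [simp]: assumes "M \<in> Obj C"
  shows "iso_arr C (an n M)" "Dom C (an n M) = M \<boxtimes> Xn n" "Cod C (an n M) = P.Rn n M"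
proof -
  have "iso_arr C (an n M) \<and> Dom C (an n M) = M \<boxtimes> Xn n \<and> Cod C (an n M) = P.Rn n M"
    by (induction n) (use assms in auto)
  then show "iso_arr C (an n M)" "Dom C (an n M) = M \<boxtimes> Xn n" "Cod C (an n M) = P.Rn n M" by auto
qed

lemma an_arr [simp]: "M \<in> Obj C ==> an n M \<in> Arr C"
  using an_simps(1) by simp

lemma an_nat_left: "f \<in> Arr C ==> P.Ran n f \<cdot> an n (Dom C f) = an n (Cod C f) \<cdot> (f \<otimes> \<one> (Xn n))"
proof (induction n)
  case 0 then show ?case by (simp add: runit_nat)
next
  case (Suc n)
  let ?M = "Dom C f" and ?N = "Cod C f"
  have "P.Ran (Suc n) f \<cdot> an (Suc n) ?M = R (P.Ran n f \<cdot> an n ?M) \<cdot> \<a>' ?M (Xn n) X"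
    using Suc.prems by (simp add: P.R_comp)
  also have "... = R (an n ?N \<cdot> (f \<otimes> \<one> (Xn n))) \<cdot> \<a>' ?M (Xn n) X"
    by (simp only: Suc.IH[OF Suc.prems])
  also have "... = R (an n ?N) \<cdot> ((f \<otimes> \<one> (Xn n)) \<otimes> \<one> X) \<cdot> \<a>' ?M (Xn n) X"
    using Suc.prems by (simp add: P.R_comp) (simp add: R_def)
  also have "... = R (an n ?N) \<cdot> \<a>' ?N (Xn n) X \<cdot> (f \<otimes> \<one> (Xn n \<boxtimes> X))"
    using Suc assoc_inv_nat[of f "\<one> (Xn n)" "\<one> X" ?N "Xn n" X] by simp
  finally show ?case using Suc by simp
qed

lemma kap_lin:
  assumes [simp]: "M \<in> Obj C" and "1 \<le> i" "i \<le> n"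
  shows "P.kap n M i \<cdot> an n M = an (Suc n) M \<cdot> (\<one> M \<otimes> P.kap n \<I> i)"
  using assms(2,3)
proof (induction n)
  case (Suc n)
  let ?N = "Xn n" and ?A = "an n M"
  show ?case
  proof (cases "i = Suc n")
    case True
    have "dl (P.Rn n M) \<cdot> R ?A \<cdot> \<a>' M ?N X = R (R ?A) \<cdot> dl (M \<boxtimes> ?N) \<cdot> \<a>' M ?N X"
      using comp_reduce[OF P.d_nat[of ?A], of "\<a>' M ?N X"] by simp
    also have "... = R (R ?A) \<cdot> R (\<a>' M ?N X) \<cdot> \<a>' M (?N \<boxtimes> X) X \<cdot> (\<one> M \<otimes> dl ?N)"
      by (simp add: dl_lin)
    finally show ?thesis using True by (simp add: P.kap_last P.R_comp)
  next
    case False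
    then have i: "1 \<le> i" "i \<le> n" using Suc.prems by auto
    let ?k = "P.kap n \<I> i"
    note [simp] = P.kap_simps[OF assms(1) i, simplified] P.kap_simps[OF tensor_simps(2) i, simplified]
    have "(sl (P.Rn n M) \<cdot> R (P.kap n M i)) \<cdot> R ?A \<cdot> \<a>' M ?N X = sl (P.Rn n M) \<cdot> R (P.kap n M i \<cdot> ?A) \<cdot> \<a>' M ?N X"
      by (simp add: P.R_comp)
    also have "... = sl (P.Rn n M) \<cdot> R (R ?A) \<cdot> R (\<a>' M ?N X) \<cdot> ((\<one> M \<otimes> ?k) \<otimes> \<one> X) \<cdot> \<a>' M ?N X"
      using Suc.IH[OF i] by (simp add: P.R_comp) (simp add: R_def)
    also have "... = sl (P.Rn n M) \<cdot> R (R ?A) \<cdot> R (\<a>' M ?N X) \<cdot> \<a>' M (?N \<boxtimes> X) X \<cdot> (\<one> M \<otimes> R ?k)"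
      using assoc_inv_nat[of "\<one> M" ?k "\<one> X" M "?N \<boxtimes> X" X] by (simp add: R_def)
    also have "... = R (R ?A) \<cdot> (sl (M \<boxtimes> ?N) \<cdot> R (\<a>' M ?N X) \<cdot> \<a>' M (?N \<boxtimes> X) X) \<cdot> (\<one> M \<otimes> R ?k)"
      using comp_reduce[OF P.s_nat[of ?A], of "R (\<a>' M ?N X) \<cdot> \<a>' M (?N \<boxtimes> X) X \<cdot> (\<one> M \<otimes> R ?k)"] by simp
    also have "... = R (R ?A) \<cdot> R (\<a>' M ?N X) \<cdot> \<a>' M (?N \<boxtimes> X) X \<cdot> (\<one> M \<otimes> sl ?N) \<cdot> (\<one> M \<otimes> R ?k)"
      by (simp add: sl_lin)
    finally show ?thesis using i by (simp add: P.kap_prev P.R_comp left_comp)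
  qed
qed simp

lemma ep_lin: assumes [simp]: "M \<in> Obj C"
  shows "P.ep n M \<cdot> an n M = \<r> M \<cdot> (\<one> M \<otimes> P.ep n \<I>)"
proof (induction n)
  case (Suc n)
  have "P.ep n M \<cdot> el (P.Rn n M) \<cdot> R (an n M) \<cdot> \<a>' M (Xn n) X = P.ep n M \<cdot> an n M \<cdot> el (M \<boxtimes> Xn n) \<cdot> \<a>' M (Xn n) X"
    using comp_reduce[OF P.e_nat[of "an n M"], of "\<a>' M (Xn n) X"] by simp
  also have "... = (P.ep n M \<cdot> an n M) \<cdot> (\<one> M \<otimes> el (Xn n))" by (simp add: el_lin)
  also have "... = \<r> M \<cdot> (\<one> M \<otimes> P.ep n \<I>) \<cdot> (\<one> M \<otimes> el (Xn n))" by (simp add: Suc)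
  finally show ?case by (simp add: left_comp)
qed simp

lemma Fa_lin:
  assumes [simp]: "M \<in> Obj C" and f: "maps m f n"
  shows "P.Fa M n f m \<cdot> an n M = an m M \<cdot> (\<one> M \<otimes> P.Fa \<I> n f m)"
  using f
proof (induction m)
  case 0 then show ?case by (simp add: ep_lin)
next
  case (Suc m)
  have fm: "maps m f n" using Suc.prems by simp
  have b: "1 \<le> f (Suc m)" "f (Suc m) \<le> n" using Suc.prems by auto
  let ?F = "P.Fa M n f m" and ?G = "P.Fa \<I> n f m" and ?k = "P.kap n \<I> (f (Suc m))"
  note [simp] = P.Fa_simps[OF assms(1) fm] P.kap_simps[OF assms(1) b, simplified]
    P.Fa_simps[OF tensor_simps(2) fm] P.kap_simps[OF tensor_simps(2) b, simplified]
  have "(R ?F \<cdot> P.kap n M (f (Suc m))) \<cdot> an n M = R (?F \<cdot> an n M) \<cdot> \<a>' M (Xn n) X \<cdot> (\<one> M \<otimes> ?k)"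
    using kap_lin[OF assms(1) b] by (simp add: P.R_comp)
  also have "... = R (an m M) \<cdot> ((\<one> M \<otimes> ?G) \<otimes> \<one> X) \<cdot> \<a>' M (Xn n) X \<cdot> (\<one> M \<otimes> ?k)"
    using Suc.IH[OF fm] by (simp add: P.R_comp) (simp add: R_def)
  also have "... = R (an m M) \<cdot> \<a>' M (Xn m) X \<cdot> (\<one> M \<otimes> R ?G) \<cdot> (\<one> M \<otimes> ?k)"
    using comp_reduce[OF assoc_inv_nat[of "\<one> M" ?G "\<one> X" M "Xn m" X], of "\<one> M \<otimes> ?k"] by (simp add: R_def)
  finally show ?case by (simp add: left_comp)
qed

lemma an_assoc:
  assumes [simp]: "M \<in> Obj C"
  shows "an k (P.Rn n M) \<cdot> (an n M \<otimes> \<one> (Xn k)) = an (n + k) M \<cdot> (\<one> M \<otimes> an k (Xn n)) \<cdot> \<a> M (Xn n) (Xn k)"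
proof (induction k)
  case 0
  have "\<r> (P.Rn n M) \<cdot> (an n M \<otimes> \<one> \<I>) = an n M \<cdot> \<r> (M \<boxtimes> Xn n)" using runit_nat[of "an n M"] by simp
  then show ?case by (simp add: runit_tensor)
next
  case (Suc k)
  let ?N = "Xn n" and ?K = "Xn k"
  have [simp]: "P.Rn k (P.Rn n M) = P.Rn (n + k) M" "P.Rn k ?N = Xn (n + k)" by (simp_all add: P.Rn_add)
  have "R (an k (P.Rn n M)) \<cdot> \<a>' (P.Rn n M) ?K X \<cdot> (an n M \<otimes> \<one> (?K \<boxtimes> X)) =
    R (an k (P.Rn n M)) \<cdot> ((an n M \<otimes> \<one> ?K) \<otimes> \<one> X) \<cdot> \<a>' (M \<boxtimes> ?N) ?K X"
    using assoc_inv_nat[of "an n M" "\<one> ?K" "\<one> X" "P.Rn n M" ?K X] by simp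
  also have "... = R (an k (P.Rn n M) \<cdot> (an n M \<otimes> \<one> ?K)) \<cdot> \<a>' (M \<boxtimes> ?N) ?K X"
    by (simp add: P.R_comp) (simp add: R_def)
  also have "... = R (an (n + k) M) \<cdot> ((\<one> M \<otimes> an k ?N) \<otimes> \<one> X) \<cdot> (\<a> M ?N ?K \<otimes> \<one> X) \<cdot> \<a>' (M \<boxtimes> ?N) ?K X"
    unfolding Suc by (simp add: P.R_comp) (simp add: R_def)
  also have "(\<a> M ?N ?K \<otimes> \<one> X) \<cdot> \<a>' (M \<boxtimes> ?N) ?K X = \<a>' M (?N \<boxtimes> ?K) X \<cdot> (\<one> M \<otimes> \<a>' ?N ?K X) \<cdot> \<a> M ?N (?K \<boxtimes> X)"
  proof (rule iso_cancel_left[of "\<a>' M ?N ?K \<otimes> \<one> X"])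
    have "((\<a>' M ?N ?K \<otimes> \<one> X) \<cdot> \<a>' M (?N \<boxtimes> ?K) X \<cdot> (\<one> M \<otimes> \<a>' ?N ?K X)) \<cdot> \<a> M ?N (?K \<boxtimes> X) = \<a>' (M \<boxtimes> ?N) ?K X"
      by (subst pentagon_inv) simp_all
    then show "(\<a>' M ?N ?K \<otimes> \<one> X) \<cdot> (\<a> M ?N ?K \<otimes> \<one> X) \<cdot> \<a>' (M \<boxtimes> ?N) ?K X =
      (\<a>' M ?N ?K \<otimes> \<one> X) \<cdot> \<a>' M (?N \<boxtimes> ?K) X \<cdot> (\<one> M \<otimes> \<a>' ?N ?K X) \<cdot> \<a> M ?N (?K \<boxtimes> X)"
      by (simp add: interchange_re)
  qed auto
  also have "R (an (n + k) M) \<cdot> ((\<one> M \<otimes> an k ?N) \<otimes> \<one> X) \<cdot> \<a>' M (?N \<boxtimes> ?K) X \<cdot> (\<one> M \<otimes> \<a>' ?N ?K X) \<cdot> \<a> M ?N (?K \<boxtimes> X) =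
    R (an (n + k) M) \<cdot> \<a>' M (Xn (n + k)) X \<cdot> (\<one> M \<otimes> R (an k ?N)) \<cdot> (\<one> M \<otimes> \<a>' ?N ?K X) \<cdot> \<a> M ?N (?K \<boxtimes> X)"
    using comp_reduce[OF assoc_inv_nat[of "\<one> M" "an k ?N" "\<one> X" M "Xn (n + k)" X],
        of "(\<one> M \<otimes> \<a>' ?N ?K X) \<cdot> \<a> M ?N (?K \<boxtimes> X)"] by (simp add: R_def)
  finally show ?case by (simp add: left_comp)
qed

lemma an_unit: "an n \<I> = \<l> (Xn n)"
proof (induction n)
  case (Suc n)
  have "R (\<l> (Xn n)) \<cdot> \<a>' \<I> (Xn n) X = \<l> (Xn n \<boxtimes> X)"
    using iso_move_right[OF _ _ _ lunit_tensor[of "Xn n" X]] by (simp add: R_def)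
  then show ?case by (simp add: Suc)
qed (simp add: lunit_unit)

subsection \<open>The strong monoidal functor\<close>

abbreviation Fn :: "fin_map \<Rightarrow> 'a" where "Fn \<equiv> FA (P.power_functor \<I>)"

lemma Fn_simps [simp]: "\<phi> \<in> Arr NCat ==> Fn \<phi> \<in> Arr C" "\<phi> \<in> Arr NCat ==> Dom C (Fn \<phi>) = Xn (tgt \<phi>)"
  "\<phi> \<in> Arr NCat ==> Cod C (Fn \<phi>) = Xn (fst \<phi>)" "Fn (Id NCat n) = \<one> (Xn n)"
  "[|\<phi> \<in> Arr NCat; \<psi> \<in> Arr NCat; fst \<psi> = tgt \<phi>|] ==> Fn (Comp NCat \<psi> \<phi>) = Fn \<phi> \<cdot> Fn \<psi>"
proof -
  interpret F: cfunctor "op NCat" C "P.power_functor \<I>" by (rule P.power_functor) simp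
  note f = F.functor_simps[simplified op_simps N_simps P.power_functor_simps(1)]
  show "\<phi> \<in> Arr NCat ==> Fn \<phi> \<in> Arr C" "\<phi> \<in> Arr NCat ==> Dom C (Fn \<phi>) = Xn (tgt \<phi>)"
    "\<phi> \<in> Arr NCat ==> Cod C (Fn \<phi>) = Xn (fst \<phi>)" "Fn (Id NCat n) = \<one> (Xn n)"
    using f by auto
  show "[|\<phi> \<in> Arr NCat; \<psi> \<in> Arr NCat; fst \<psi> = tgt \<phi>|] ==> Fn (Comp NCat \<psi> \<phi>) = Fn \<phi> \<cdot> Fn \<psi>"
    using F.FA_comp_simp[of \<psi> \<phi>] by simp
qed

declare P.power_functor_simps(2) [simp del]

lemma mu_nat_N:
  assumes [simp]: "\<phi> \<in> Arr NCat" "\<psi> \<in> Arr NCat"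
  shows "an (fst \<psi>) (Xn (fst \<phi>)) \<cdot> (Fn \<phi> \<otimes> Fn \<psi>) = Fn (nsum \<phi> \<psi>) \<cdot> an (tgt \<psi>) (Xn (tgt \<phi>))"
proof -
  let ?m = "fst \<phi>" and ?n = "tgt \<phi>" and ?k = "fst \<psi>" and ?l = "tgt \<psi>"
  let ?f = "\<lambda>i. if i \<le> ?m then nv \<phi> i else ?n + (i - ?m)" and ?g = "\<lambda>i. if i \<le> ?m then i else ?m + nv \<psi> (i - ?m)"
  have f: "maps (?m + ?l) ?f (?n + ?l)"
    using nv_range[of \<phi>] by (auto simp: trans_le_add1)
  have g: "maps (?m + ?k) ?g (?m + ?l)"
  proof (intro allI impI)
    fix i assume "1 \<le> i \<and> i \<le> ?m + ?k"
    then show "1 \<le> ?g i \<and> ?g i \<le> ?m + ?l" using nv_range_shift[OF assms(2), of i ?m] by auto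
  qed
  have "Fn (nsum \<phi> \<psi>) = P.Fa \<I> (?n + ?l) (\<lambda>i. ?f (?g i)) (?m + ?k)"
  proof -
    have "nv (nsum \<phi> \<psi>) i = ?f (?g i)" if "1 \<le> i" "i \<le> ?m + ?k" for i
      using nv_range_shift[of \<psi> i ?m] that by (cases "i \<le> ?m") auto
    then have "P.Fa \<I> (?n + ?l) (nv (nsum \<phi> \<psi>)) (?m + ?k) = P.Fa \<I> (?n + ?l) (\<lambda>i. ?f (?g i)) (?m + ?k)"
      by (rule P.Fa_cong)
    then show ?thesis by (simp add: P.power_functor_simps(2))
  qed
  also have "... = P.Fa \<I> (?m + ?l) ?g (?m + ?k) \<cdot> P.Fa \<I> (?n + ?l) ?f (?m + ?l)"
    using P.Fa_comp[OF tensor_simps(2) f g] .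
  also have "P.Fa \<I> (?m + ?l) ?g (?m + ?k) = P.Fa (Xn ?m) ?l (nv \<psi>) ?k"
    using P.Fa_sum_left[OF tensor_simps(2) P.N_fun[OF assms(2)]] .
  also have "P.Fa \<I> (?n + ?l) ?f (?m + ?l) = P.Ran ?l (Fn \<phi>)"
    using P.Fa_sum_right[OF tensor_simps(2) P.N_fun[OF assms(1)], of ?l] by (simp add: P.power_functor_simps(2))
  finally have s: "Fn (nsum \<phi> \<psi>) = P.Fa (Xn ?m) ?l (nv \<psi>) ?k \<cdot> P.Ran ?l (Fn \<phi>)" .
  note [simp] = P.Fa_simps[of "Xn ?m", OF _ P.N_fun[OF assms(2)], simplified]
  have "Fn (nsum \<phi> \<psi>) \<cdot> an ?l (Xn ?n) = P.Fa (Xn ?m) ?l (nv \<psi>) ?k \<cdot> an ?l (Xn ?m) \<cdot> (Fn \<phi> \<otimes> \<one> (Xn ?l))"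
    unfolding s using an_nat_left[of "Fn \<phi>" ?l] by simp
  also have "... = an ?k (Xn ?m) \<cdot> (\<one> (Xn ?m) \<otimes> Fn \<psi>) \<cdot> (Fn \<phi> \<otimes> \<one> (Xn ?l))"
  proof -
    have "P.Fa (Xn ?m) ?l (nv \<psi>) ?k \<cdot> an ?l (Xn ?m) = an ?k (Xn ?m) \<cdot> (\<one> (Xn ?m) \<otimes> Fn \<psi>)"
      using Fa_lin[OF _ P.N_fun[OF assms(2)], of "Xn ?m"] by (simp add: P.power_functor_simps(2))
    from comp_reduce[OF this, of "Fn \<phi> \<otimes> \<one> (Xn ?l)"] show ?thesis by simp
  qed
  finally show ?thesis by (simp add: interchange)
qed

text \<open>
  By the hexagon, compatibility with the braiding is additive in \<open>n\<close>, which reduces it to \<open>m =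
  n = 1\<close>.
\<close>

lemma braid_sum:
  assumes n: "Fn (swp n m) \<cdot> an n (Xn m) = an m (Xn n) \<cdot> \<c> (Xn m) (Xn n)"
    and k: "Fn (swp k m) \<cdot> an k (Xn m) = an m (Xn k) \<cdot> \<c> (Xn m) (Xn k)"
  shows "Fn (swp (n + k) m) \<cdot> an (n + k) (Xn m) = an m (Xn (n + k)) \<cdot> \<c> (Xn m) (Xn (n + k))"
proof (rule iso_cancel_right[of "(\<one> (Xn m) \<otimes> an k (Xn n)) \<cdot> \<a> (Xn m) (Xn n) (Xn k)"])
  let ?M = "Xn m" and ?N = "Xn n" and ?K = "Xn k"
  note [simp] = P.Rn_add add.assoc
  have sw: "swp (n + k) m = Comp NCat (nsum (swp n m) (Id NCat k)) (nsum (Id NCat n) (swp k m))"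
    by (rule N_ext) auto
  have "(Fn (swp (n + k) m) \<cdot> an (n + k) ?M) \<cdot> (\<one> ?M \<otimes> an k ?N) \<cdot> \<a> ?M ?N ?K =
    Fn (swp (n + k) m) \<cdot> an k (Xn (m + n)) \<cdot> (an n ?M \<otimes> \<one> ?K)"
    using an_assoc[of ?M k n] by simp
  also have "... = Fn (nsum (Id NCat n) (swp k m)) \<cdot> (Fn (nsum (swp n m) (Id NCat k)) \<cdot> an k (Xn (m + n))) \<cdot> (an n ?M \<otimes> \<one> ?K)"
    by (simp add: sw)
  also have "Fn (nsum (swp n m) (Id NCat k)) \<cdot> an k (Xn (m + n)) = an k (Xn (n + m)) \<cdot> (Fn (swp n m) \<otimes> \<one> ?K)"
    using mu_nat_N[of "swp n m" "Id NCat k"] by simp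
  also have "Fn (nsum (Id NCat n) (swp k m)) \<cdot> (an k (Xn (n + m)) \<cdot> (Fn (swp n m) \<otimes> \<one> ?K)) \<cdot> (an n ?M \<otimes> \<one> ?K) =
    Fn (nsum (Id NCat n) (swp k m)) \<cdot> an k (Xn (n + m)) \<cdot> ((Fn (swp n m) \<cdot> an n ?M) \<otimes> \<one> ?K)"
    by (simp add: right_comp)
  also have "... = Fn (nsum (Id NCat n) (swp k m)) \<cdot> (an k (Xn (n + m)) \<cdot> (an m ?N \<otimes> \<one> ?K)) \<cdot> (\<c> ?M ?N \<otimes> \<one> ?K)"
    unfolding n by (simp add: right_comp)
  also have "an k (Xn (n + m)) \<cdot> (an m ?N \<otimes> \<one> ?K) = an (m + k) ?N \<cdot> (\<one> ?N \<otimes> an k ?M) \<cdot> \<a> ?N ?M ?K"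
    using an_assoc[of ?N k m] by simp
  also have "Fn (nsum (Id NCat n) (swp k m)) \<cdot> (an (m + k) ?N \<cdot> (\<one> ?N \<otimes> an k ?M) \<cdot> \<a> ?N ?M ?K) \<cdot> (\<c> ?M ?N \<otimes> \<one> ?K) =
    (Fn (nsum (Id NCat n) (swp k m)) \<cdot> an (m + k) ?N) \<cdot> (\<one> ?N \<otimes> an k ?M) \<cdot> \<a> ?N ?M ?K \<cdot> (\<c> ?M ?N \<otimes> \<one> ?K)"
    by simp
  also have "Fn (nsum (Id NCat n) (swp k m)) \<cdot> an (m + k) ?N = an (k + m) ?N \<cdot> (\<one> ?N \<otimes> Fn (swp k m))"
    using mu_nat_N[of "Id NCat n" "swp k m"] by simp
  also have "(an (k + m) ?N \<cdot> (\<one> ?N \<otimes> Fn (swp k m))) \<cdot> (\<one> ?N \<otimes> an k ?M) \<cdot> \<a> ?N ?M ?K \<cdot> (\<c> ?M ?N \<otimes> \<one> ?K) =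
    an (k + m) ?N \<cdot> (\<one> ?N \<otimes> (Fn (swp k m) \<cdot> an k ?M)) \<cdot> \<a> ?N ?M ?K \<cdot> (\<c> ?M ?N \<otimes> \<one> ?K)"
    by (simp add: left_comp)
  also have "... = an (k + m) ?N \<cdot> (\<one> ?N \<otimes> an m ?K) \<cdot> (\<one> ?N \<otimes> \<c> ?M ?K) \<cdot> \<a> ?N ?M ?K \<cdot> (\<c> ?M ?N \<otimes> \<one> ?K)"
    unfolding k by (simp add: left_comp)
  also have "... = (an (k + m) ?N \<cdot> (\<one> ?N \<otimes> an m ?K) \<cdot> \<a> ?N ?K ?M) \<cdot> \<c> ?M (?N \<boxtimes> ?K) \<cdot> \<a> ?M ?N ?K"
    using hexagon[of ?M ?N ?K] by simp
  also have "... = (an m (Xn (n + k)) \<cdot> (an k ?N \<otimes> \<one> ?M)) \<cdot> \<c> ?M (?N \<boxtimes> ?K) \<cdot> \<a> ?M ?N ?K"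
    using an_assoc[of ?N m k] by simp
  also have "... = an m (Xn (n + k)) \<cdot> (\<c> ?M (Xn (n + k)) \<cdot> (\<one> ?M \<otimes> an k ?N)) \<cdot> \<a> ?M ?N ?K"
    using braid_nat[of "\<one> ?M" "an k ?N" ?M "Xn (n + k)"] by simp
  finally show "(Fn (swp (n + k) m) \<cdot> an (n + k) ?M) \<cdot> (\<one> ?M \<otimes> an k ?N) \<cdot> \<a> ?M ?N ?K =
    (an m (Xn (n + k)) \<cdot> \<c> ?M (Xn (n + k))) \<cdot> (\<one> ?M \<otimes> an k ?N) \<cdot> \<a> ?M ?N ?K" by simp
qed (auto simp: P.Rn_add add_ac)

lemma mu_11: "an 1 (Xn 1) = \<one> (\<I> \<boxtimes> X) \<otimes> \<l> X"
  using triangle_inv[of "\<I> \<boxtimes> X" X] by (simp add: R_def)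

lemma kap_1: "P.kap (Suc 0) \<I> (Suc 0) = dl \<I>"
  using P.kap_last[of 0 \<I>] by simp

lemma R_el_dl: "R (el M) \<cdot> dl M = \<one> (M \<boxtimes> X)" if "M \<in> Obj C"
  using P.counit2[OF that] that by simp

lemma Fn_swp_11: "Fn (swp 1 1) = sl \<I>"
proof -
  have "Fn (swp 1 1) = P.Fa \<I> 2 (\<lambda>i. if i \<le> 1 then 2 else 1) 2"
    by (auto simp: P.power_functor_simps(2) numeral_2_eq_2 intro!: P.Fa_cong)
  also have "... = R (R (el \<I> \<cdot> el (\<I> \<boxtimes> X)) \<cdot> dl (\<I> \<boxtimes> X)) \<cdot> sl (\<I> \<boxtimes> X) \<cdot> R (dl \<I>)"
    using P.kap_last[of "Suc 0" \<I>] P.kap_prev[of "Suc 0" "Suc 0" \<I>] by (simp add: numeral_2_eq_2 kap_1)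
  also have "R (el \<I> \<cdot> el (\<I> \<boxtimes> X)) \<cdot> dl (\<I> \<boxtimes> X) = R (el \<I>)"
    by (simp add: P.R_comp R_el_dl)
  also have "R (R (el \<I>)) \<cdot> sl (\<I> \<boxtimes> X) \<cdot> R (dl \<I>) = sl \<I> \<cdot> R (R (el \<I>) \<cdot> dl \<I>)"
    using comp_reduce[OF P.s_nat[of "el \<I>"], of "R (dl \<I>)"] by (simp add: P.R_comp)
  finally show ?thesis by (simp add: R_el_dl)
qed

lemma braid_11: "Fn (swp 1 1) \<cdot> an 1 (Xn 1) = an 1 (Xn 1) \<cdot> \<c> (Xn 1) (Xn 1)"
proof (rule iso_cancel_left[of "\<l> X \<otimes> \<one> X"])
  let ?Y = "\<I> \<boxtimes> X"
  have "(\<l> X \<otimes> \<one> X) \<cdot> sl \<I> = \<l> (X \<boxtimes> X) \<cdot> (\<one> \<I> \<otimes> \<c> X X) \<cdot> \<a> \<I> X X"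
    using iso_move_right[OF _ _ _ lunit_tensor[of X X]] by (simp add: sl_def lunit_tensor[symmetric])
  also have "... = \<c> X X \<cdot> (\<l> X \<otimes> \<one> X)"
    using comp_reduce[OF lunit_nat[of "\<c> X X"], of "\<a> \<I> X X"] by (simp add: lunit_tensor)
  finally have 1: "(\<l> X \<otimes> \<one> X) \<cdot> sl \<I> = \<c> X X \<cdot> (\<l> X \<otimes> \<one> X)" .
  have "(\<l> X \<otimes> \<one> X) \<cdot> sl \<I> \<cdot> (\<one> ?Y \<otimes> \<l> X) = \<c> X X \<cdot> (\<l> X \<otimes> \<l> X)"
    using comp_reduce[OF 1, of "\<one> ?Y \<otimes> \<l> X"] by (simp add: interchange del: tensor_simps(6))
  also have "... = (\<l> X \<otimes> \<l> X) \<cdot> \<c> ?Y ?Y" by (simp add: braid_nat)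
  also have "... = (\<l> X \<otimes> \<one> X) \<cdot> (\<one> ?Y \<otimes> \<l> X) \<cdot> \<c> ?Y ?Y"
    by (simp add: interchange_re del: tensor_simps(6))
  finally show "(\<l> X \<otimes> \<one> X) \<cdot> Fn (swp 1 1) \<cdot> an 1 (Xn 1) = (\<l> X \<otimes> \<one> X) \<cdot> an 1 (Xn 1) \<cdot> \<c> (Xn 1) (Xn 1)"
    unfolding Fn_swp_11 mu_11 by simp
qed (auto simp: Fn_swp_11)

lemma braid_0: "Fn (swp 0 m) \<cdot> an 0 (Xn m) = an m (Xn 0) \<cdot> \<c> (Xn m) (Xn 0)"
  by (simp add: an_unit lunit_braid)

lemma braid_sym_N:
  assumes "Fn (swp n m) \<cdot> an n (Xn m) = an m (Xn n) \<cdot> \<c> (Xn m) (Xn n)"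
  shows "Fn (swp m n) \<cdot> an m (Xn n) = an n (Xn m) \<cdot> \<c> (Xn n) (Xn m)"
proof -
  note [simp] = P.Rn_add
  have i: "Fn (swp m n) \<cdot> Fn (swp n m) = \<one> (Xn (m + n))"
  proof -
    have "Comp NCat (swp n m) (swp m n) = Id NCat (m + n)" by (rule N_ext) auto
    then show ?thesis using Fn_simps(5)[of "swp m n" "swp n m"] Fn_simps(4)[of "m + n"] by simp
  qed
  have "Fn (swp m n) \<cdot> an m (Xn n) = Fn (swp m n) \<cdot> (an m (Xn n) \<cdot> \<c> (Xn m) (Xn n)) \<cdot> \<c> (Xn n) (Xn m)"
    by (simp add: braid_sym)
  also have "... = (Fn (swp m n) \<cdot> Fn (swp n m)) \<cdot> an n (Xn m) \<cdot> \<c> (Xn n) (Xn m)"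
    unfolding assms[symmetric] by (simp add: add.commute)
  finally show ?thesis by (simp add: i add.commute)
qed

lemma braid_N: "Fn (swp n m) \<cdot> an n (Xn m) = an m (Xn n) \<cdot> \<c> (Xn m) (Xn n)"
proof -
  have one: "Fn (swp m 1) \<cdot> an m (Xn 1) = an 1 (Xn m) \<cdot> \<c> (Xn 1) (Xn m)" for m
  proof (induction m)
    case 0 show ?case by (rule braid_0)
  next
    case (Suc m) then show ?case using braid_sum[OF Suc braid_11] by simp
  qed
  show ?thesis
  proof (induction n)
    case 0 show ?case by (rule braid_0)
  next
    case (Suc n) then show ?case using braid_sum[OF Suc braid_sym_N[OF one]] by simp
  qed
qed

definition power_mu :: "nat \<times> nat \<Rightarrow> 'a" where
  "power_mu = (\<lambda>(m, n)\<in>UNIV \<times> UNIV. an n (Xn m))"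

lemma power_mu_simp [simp]: "power_mu (m, n) = an n (Xn m)"
  by (simp add: power_mu_def)

lemma power_strong:
  "strong_sym_mon_functor (op NCat) (op_tensor NCat NTensor) C T (P.power_functor \<I>) power_mu (\<one> \<I>)"
proof -
  interpret ON: sym_mon_cat "op NCat" "op_tensor NCat NTensor" by (rule sym_mon_cat_N)
  interpret F: cfunctor "op NCat" C "P.power_functor \<I>" by (rule P.power_functor) simp
  note [simp] = P.Rn_add
  show ?thesis
  proof (unfold_locales, goal_cases)
    case 1 then show ?case by (simp add: power_mu_def)
  next
    case (4 f m m' g n n') then show ?case using mu_nat_N[of f g] by (auto simp: Hom_iff)
  next
    case (7 m n k) show ?case using an_assoc[of "Xn m" k n] by (simp add: add.assoc)
  next
    case (8 n) show ?case by (simp add: an_unit)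
  next
    case (10 m n) show ?case using braid_N[of n m] by simp
  qed (auto simp: Hom_iff)
qed

text \<open>The first power is \<open>I \<otimes> X\<close>; the left unitor identifies it with \<open>X\<close> as a coalgebra.\<close>

lemma power_coalgebra:
  "\<Delta> \<cdot> \<l> X = (\<l> X \<otimes> \<l> X) \<cdot> inv_arr C (power_mu (1, 1)) \<cdot> Fn (to_one 2)"
  "\<eta> \<cdot> \<l> X = inv_arr C (\<one> \<I>) \<cdot> Fn (to_one 0)"
proof -
  let ?Y = "\<I> \<boxtimes> X"
  have "Fn (to_one 2) = P.Fa \<I> 1 (\<lambda>i. 1) 2"
    by (auto simp: P.power_functor_simps(2) intro!: P.Fa_cong)
  also have "... = R (R (el \<I>) \<cdot> dl \<I>) \<cdot> dl \<I>"
    by (simp add: numeral_2_eq_2 kap_1)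
  finally have 2: "Fn (to_one 2) = dl \<I>" by (simp add: R_el_dl)
  have "(\<l> X \<otimes> \<l> X) \<cdot> inv_arr C (power_mu (1, 1)) \<cdot> dl \<I> = (\<l> X \<otimes> \<one> X) \<cdot> dl \<I>"
    unfolding power_mu_simp mu_11 by (simp add: inv_tensor interchange_re del: tensor_simps(6))
  also have "... = \<l> (X \<boxtimes> X) \<cdot> (\<one> \<I> \<otimes> \<Delta>)"
    by (simp add: lunit_tensor[symmetric] dl_def)
  also have "... = \<Delta> \<cdot> \<l> X" using lunit_nat[of \<Delta>] by simp
  finally show "\<Delta> \<cdot> \<l> X = (\<l> X \<otimes> \<l> X) \<cdot> inv_arr C (power_mu (1, 1)) \<cdot> Fn (to_one 2)" by (simp add: 2)
  have "Fn (to_one 0) = el \<I>" by (simp add: P.power_functor_simps(2))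
  then show "\<eta> \<cdot> \<l> X = inv_arr C (\<one> \<I>) \<cdot> Fn (to_one 0)"
    using lunit_nat[of \<eta>] by (simp add: el_def lunit_unit)
qed

end

section \<open>Monoidal functors on finite sets\<close>

abbreviation TA_in ("(_ \<otimes>\<^bsub>_\<^esub> _)" [71,0,71] 70) where "f \<otimes>\<^bsub>S\<^esub> g \<equiv> TA S f g"
notation (input) TA_in ("(_ \<otimes>\<^sub>_ _)" [71,1000,71] 70)

declare Q_simps [simp del]

subsection \<open>Generators of the category of finite sets\<close>

text \<open>
  A map out of \<open>m + 1\<close> is \<open>\<psi> \<squnion> 1\<close> followed by the map \<open>k n i : n + 1 \<rightarrow> n\<close> that sends the last point to \<open>i\<close>;
  up to swaps of neighbours, the latter only multiplies two points.
\<close>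

lemma N_generators:
  assumes id: "\<And>n. P (Id NCat n)"
    and comp: "\<And>\<phi> \<psi>. [|\<phi> \<in> Arr NCat; \<psi> \<in> Arr NCat; fst \<psi> = tgt \<phi>; P \<phi>; P \<psi>|] ==> P (Comp NCat \<psi> \<phi>)"
    and sum: "\<And>\<phi> \<psi>. [|\<phi> \<in> Arr NCat; \<psi> \<in> Arr NCat; P \<phi>; P \<psi>|] ==> P (nsum \<phi> \<psi>)"
    and u: "P (to_one 2)" and v: "P (to_one 0)" and s: "P (swp 1 1)"
    and \<phi>: "\<phi> \<in> Arr NCat"
  shows "P \<phi>"
proof -
  define k where "k n i = mkn (Suc n) (\<lambda>j. if j \<le> n then j else i) n" for n i
  have ka [simp]: "k n i \<in> Arr NCat" if "1 \<le> i" "i \<le> n" for n i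
    unfolding k_def by (rule mkn_arr) (use that in auto)
  have ks [simp]: "fst (k n i) = Suc n" "tgt (k n i) = n" "1 \<le> j ==> j \<le> Suc n ==> nv (k n i) j = (if j \<le> n then j else i)" for n i j
    by (auto simp: k_def)
  have k: "P (k n i)" if "1 \<le> i" "i \<le> n" for n i
    using that
  proof (induction n)
    case (Suc n)
    show ?case
    proof (cases "i = Suc n")
      case True
      have "k (Suc n) i = nsum (Id NCat n) (to_one 2)" by (rule N_ext) (use True in auto)
      then show ?thesis using sum id u by simp
    next
      case False
      then have i: "1 \<le> i" "i \<le> n" using Suc.prems by auto
      have "k (Suc n) i = Comp NCat (nsum (k n i) (Id NCat 1)) (nsum (Id NCat n) (swp 1 1))"
        by (rule N_ext) (use i in auto)
      then show ?thesis using comp sum id s Suc.IH[OF i] i by simp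
    qed
  qed simp
  have z: "P (mkn 0 (\<lambda>i. i) n)" for n
  proof (induction n)
    case 0
    have "mkn 0 (\<lambda>i. i) 0 = Id NCat 0" by (rule N_ext) (auto simp: mkn_0)
    then show ?case using id by simp
  next
    case (Suc n)
    have "mkn 0 (\<lambda>i. i) (Suc n) = nsum (mkn 0 (\<lambda>i. i) n) (to_one 0)" by (rule N_ext) (auto simp: mkn_0)
    then show ?case using sum Suc v by (simp add: mkn_0)
  qed
  have "\<phi> \<in> Arr NCat ==> fst \<phi> = m ==> P \<phi>" for m \<phi>
  proof (induction m arbitrary: \<phi>)
    case 0
    then show ?case using z N_from_0 by metis
  next
    case (Suc m)
    let ?n = "tgt \<phi>" and ?i = "nv \<phi> (Suc m)" and ?\<psi> = "mkn m (nv \<phi>) (tgt \<phi>)"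
    have i: "1 \<le> ?i" "?i \<le> ?n" using nv_range[OF Suc.prems(1), of "Suc m"] Suc.prems by auto
    have \<psi>: "?\<psi> \<in> Arr NCat" using nv_range[OF Suc.prems(1)] Suc.prems by (intro mkn_arr) auto
    have "\<phi> = Comp NCat (k ?n ?i) (nsum ?\<psi> (Id NCat 1))"
    proof (rule N_ext)
      fix j assume j: "1 \<le> j" "j \<le> fst \<phi>"
      show "nv \<phi> j = nv (Comp NCat (k ?n ?i) (nsum ?\<psi> (Id NCat 1))) j"
      proof (cases "j \<le> m")
        case True then show ?thesis using j \<psi> nv_range[OF Suc.prems(1) j] Suc.prems by simp
      next
        case False
        then have "j = Suc m" using j Suc.prems by simp
        then show ?thesis using \<psi> by simp
      qed
    qed (use Suc.prems \<psi> i in auto)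
    moreover have "P (nsum ?\<psi> (Id NCat 1))" by (rule sum) (use Suc.IH[OF \<psi>] id \<psi> in auto)
    ultimately show ?case using comp[of "nsum ?\<psi> (Id NCat 1)" "k ?n ?i"] k[OF i] i \<psi> by simp
  qed
  then show ?thesis using \<phi> by blast
qed

subsection \<open>Monoidal transformations on finite sets\<close>

text \<open>
  The transformation is \<open>h \<otimes> \<dots> \<otimes> h\<close>. Naturality is stable under composition and disjoint
  union; for \<open>2 \<rightarrow> 1\<close> and \<open>0 \<rightarrow> 1\<close> it says that \<open>h\<close> is a map of coalgebras, for the swap it is
  the symmetry.
\<close>

lemma monoidal_transformation_exists:
  assumes K: "strong_sym_mon_functor (op NCat) (op_tensor NCat NTensor) A S K \<mu> \<epsilon>"
    and K': "strong_sym_mon_functor (op NCat) (op_tensor NCat NTensor) A S K' \<mu>' \<epsilon>'"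
    and h: "h \<in> Hom A (FO K 1) (FO K' 1)"
    and hu: "(inv_arr A (\<mu>' (1, 1)) \<cdot>\<^sub>A FA K' (to_one 2)) \<cdot>\<^sub>A h = (h \<otimes>\<^sub>S h) \<cdot>\<^sub>A inv_arr A (\<mu> (1, 1)) \<cdot>\<^sub>A FA K (to_one 2)"
    and hv: "(inv_arr A \<epsilon>' \<cdot>\<^sub>A FA K' (to_one 0)) \<cdot>\<^sub>A h = inv_arr A \<epsilon> \<cdot>\<^sub>A FA K (to_one 0)"
  shows "\<exists>\<alpha>. (\<forall>n. \<alpha> n \<in> Hom A (FO K n) (FO K' n)) \<and> \<alpha> 1 = h \<and>
    (\<forall>\<phi>\<in>Arr NCat. \<alpha> (fst \<phi>) \<cdot>\<^sub>A FA K \<phi> = FA K' \<phi> \<cdot>\<^sub>A \<alpha> (tgt \<phi>)) \<and>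
    (\<forall>m n. \<alpha> (m + n) \<cdot>\<^sub>A \<mu> (m, n) = \<mu>' (m, n) \<cdot>\<^sub>A (\<alpha> m \<otimes>\<^sub>S \<alpha> n)) \<and> \<alpha> 0 \<cdot>\<^sub>A \<epsilon> = \<epsilon>'"
proof -
  interpret K: strong_sym_mon_functor "op NCat" "op_tensor NCat NTensor" A S K \<mu> \<epsilon> by fact
  interpret K': strong_sym_mon_functor "op NCat" "op_tensor NCat NTensor" A S K' \<mu>' \<epsilon>' by fact
  define \<alpha> where "\<alpha> = rec_nat (\<epsilon>' \<cdot>\<^sub>A inv_arr A \<epsilon>) (\<lambda>n a. \<mu>' (n, 1) \<cdot>\<^sub>A (a \<otimes>\<^sub>S h) \<cdot>\<^sub>A inv_arr A (\<mu> (n, 1)))"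
  have \<alpha>0: "\<alpha> 0 = \<epsilon>' \<cdot>\<^sub>A inv_arr A \<epsilon>" and \<alpha>S: "\<alpha> (Suc n) = \<mu>' (n, 1) \<cdot>\<^sub>A (\<alpha> n \<otimes>\<^sub>S h) \<cdot>\<^sub>A inv_arr A (\<mu> (n, 1))" for n
    by (simp_all add: \<alpha>_def)
  note Kid = K.FA_id[simplified] and K'id = K'.FA_id[simplified]
  have [simp]: "h \<in> Arr A" "Dom A h = FO K 1" "Cod A h = FO K' 1" using h by (auto simp: Hom_iff)
  have "\<alpha> n \<in> Arr A \<and> Dom A (\<alpha> n) = FO K n \<and> Cod A (\<alpha> n) = FO K' n" for n
    by (induction n) (auto simp: \<alpha>0 \<alpha>S)
  then have [simp]: "\<alpha> n \<in> Arr A" "Dom A (\<alpha> n) = FO K n" "Cod A (\<alpha> n) = FO K' n" for n by auto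
  have lu: "\<mu> (0, n) \<cdot>\<^sub>A (\<epsilon> \<otimes>\<^sub>S Id A (FO K n)) = LUnit S (FO K n)" for n
    using K.mu_lunit[of n] by (simp add: Kid)
  have lu': "\<mu>' (0, n) \<cdot>\<^sub>A (\<epsilon>' \<otimes>\<^sub>S Id A (FO K' n)) = LUnit S (FO K' n)" for n
    using K'.mu_lunit[of n] by (simp add: K'id)
  have ru: "\<mu> (n, 0) \<cdot>\<^sub>A (Id A (FO K n) \<otimes>\<^sub>S \<epsilon>) = RUnit S (FO K n)" for n
    using K.mu_runit[of n] by (simp add: Kid)
  have ru': "\<mu>' (n, 0) \<cdot>\<^sub>A (Id A (FO K' n) \<otimes>\<^sub>S \<epsilon>') = RUnit S (FO K' n)" for n
    using K'.mu_runit[of n] by (simp add: K'id)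
  have as: "\<mu> (m + n, k) \<cdot>\<^sub>A (\<mu> (m, n) \<otimes>\<^sub>S Id A (FO K k)) =
     \<mu> (m, n + k) \<cdot>\<^sub>A (Id A (FO K m) \<otimes>\<^sub>S \<mu> (n, k)) \<cdot>\<^sub>A Assoc S (FO K m) (FO K n) (FO K k)" for m n k
    using K.mu_assoc[of m n k] by (simp add: Kid)
  have as': "\<mu>' (m + n, k) \<cdot>\<^sub>A (\<mu>' (m, n) \<otimes>\<^sub>S Id A (FO K' k)) =
     \<mu>' (m, n + k) \<cdot>\<^sub>A (Id A (FO K' m) \<otimes>\<^sub>S \<mu>' (n, k)) \<cdot>\<^sub>A Assoc S (FO K' m) (FO K' n) (FO K' k)" for m n k
    using K'.mu_assoc[of m n k] by (simp add: K'id)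
  have \<alpha>\<mu>1: "\<alpha> (Suc n) \<cdot>\<^sub>A \<mu> (n, 1) = \<mu>' (n, 1) \<cdot>\<^sub>A (\<alpha> n \<otimes>\<^sub>S h)" for n
    by (simp add: \<alpha>S)
  have \<alpha>1: "\<alpha> 1 = h"
  proof (rule K.T.iso_cancel_right[of "LUnit S (FO K 1)"])
    have "\<alpha> 1 \<cdot>\<^sub>A LUnit S (FO K 1) = (\<alpha> 1 \<cdot>\<^sub>A \<mu> (0, 1)) \<cdot>\<^sub>A (\<epsilon> \<otimes>\<^sub>S Id A (FO K 1))"
      by (simp add: lu)
    also have "... = \<mu>' (0, 1) \<cdot>\<^sub>A ((\<alpha> 0 \<cdot>\<^sub>A \<epsilon>) \<otimes>\<^sub>S h)"
      using \<alpha>\<mu>1[of 0] by (simp add: K.T.interchange)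
    also have "... = (\<mu>' (0, 1) \<cdot>\<^sub>A (\<epsilon>' \<otimes>\<^sub>S Id A (FO K' 1))) \<cdot>\<^sub>A (Id A (TI S) \<otimes>\<^sub>S h)"
      by (simp add: \<alpha>0 K.T.interchange)
    also have "... = h \<cdot>\<^sub>A LUnit S (FO K 1)"
      using K.T.lunit_nat[of h] by (simp add: lu')
    finally show "\<alpha> 1 \<cdot>\<^sub>A LUnit S (FO K 1) = h \<cdot>\<^sub>A LUnit S (FO K 1)" .
  qed auto
  have mon: "\<alpha> (m + n) \<cdot>\<^sub>A \<mu> (m, n) = \<mu>' (m, n) \<cdot>\<^sub>A (\<alpha> m \<otimes>\<^sub>S \<alpha> n)" for m n
  proof (induction n)
    case 0
    show ?case
    proof (rule K.T.iso_cancel_right[of "Id A (FO K m) \<otimes>\<^sub>S \<epsilon>"])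
      have "(\<mu>' (m, 0) \<cdot>\<^sub>A (\<alpha> m \<otimes>\<^sub>S \<alpha> 0)) \<cdot>\<^sub>A (Id A (FO K m) \<otimes>\<^sub>S \<epsilon>) = (\<mu>' (m, 0) \<cdot>\<^sub>A (Id A (FO K' m) \<otimes>\<^sub>S \<epsilon>')) \<cdot>\<^sub>A (\<alpha> m \<otimes>\<^sub>S Id A (TI S))"
        by (simp add: \<alpha>0 K.T.interchange)
      also have "... = \<alpha> m \<cdot>\<^sub>A RUnit S (FO K m)" using K.T.runit_nat[of "\<alpha> m"] by (simp add: ru')
      finally show "(\<alpha> (m + 0) \<cdot>\<^sub>A \<mu> (m, 0)) \<cdot>\<^sub>A (Id A (FO K m) \<otimes>\<^sub>S \<epsilon>) = (\<mu>' (m, 0) \<cdot>\<^sub>A (\<alpha> m \<otimes>\<^sub>S \<alpha> 0)) \<cdot>\<^sub>A (Id A (FO K m) \<otimes>\<^sub>S \<epsilon>)"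
        by (simp add: ru)
    qed auto
  next
    case (Suc n)
    let ?M = "FO K m" and ?N = "FO K n" and ?O = "FO K 1" and ?M' = "FO K' m" and ?N' = "FO K' n" and ?O' = "FO K' 1"
    let ?E = "(Id A ?M \<otimes>\<^sub>S \<mu> (n, 1)) \<cdot>\<^sub>A Assoc S ?M ?N ?O"
    show ?case
    proof (rule K.T.iso_cancel_right[of ?E])
      have "(\<alpha> (m + Suc n) \<cdot>\<^sub>A \<mu> (m, Suc n)) \<cdot>\<^sub>A ?E = \<alpha> (Suc (m + n)) \<cdot>\<^sub>A \<mu> (m + n, 1) \<cdot>\<^sub>A (\<mu> (m, n) \<otimes>\<^sub>S Id A ?O)"
        using as[of m n 1] by simp
      also have "... = \<mu>' (m + n, 1) \<cdot>\<^sub>A (\<alpha> (m + n) \<otimes>\<^sub>S h) \<cdot>\<^sub>A (\<mu> (m, n) \<otimes>\<^sub>S Id A ?O)"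
        using K.T.comp_reduce[OF \<alpha>\<mu>1[of "m + n"], of "\<mu> (m, n) \<otimes>\<^sub>S Id A ?O"] by simp
      also have "... = \<mu>' (m + n, 1) \<cdot>\<^sub>A ((\<alpha> (m + n) \<cdot>\<^sub>A \<mu> (m, n)) \<otimes>\<^sub>S h)"
        by (simp add: K.T.interchange)
      also have "... = (\<mu>' (m + n, 1) \<cdot>\<^sub>A (\<mu>' (m, n) \<otimes>\<^sub>S Id A ?O')) \<cdot>\<^sub>A ((\<alpha> m \<otimes>\<^sub>S \<alpha> n) \<otimes>\<^sub>S h)"
        unfolding Suc by (simp add: K.T.interchange)
      also have "... = \<mu>' (m, Suc n) \<cdot>\<^sub>A (Id A ?M' \<otimes>\<^sub>S \<mu>' (n, 1)) \<cdot>\<^sub>A (Assoc S ?M' ?N' ?O' \<cdot>\<^sub>A ((\<alpha> m \<otimes>\<^sub>S \<alpha> n) \<otimes>\<^sub>S h))"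
        unfolding as' by simp
      also have "... = \<mu>' (m, Suc n) \<cdot>\<^sub>A (\<alpha> m \<otimes>\<^sub>S (\<mu>' (n, 1) \<cdot>\<^sub>A (\<alpha> n \<otimes>\<^sub>S h))) \<cdot>\<^sub>A Assoc S ?M ?N ?O"
        by (simp add: K.T.assoc_nat K.T.interchange_re)
      also have "... = (\<mu>' (m, Suc n) \<cdot>\<^sub>A (\<alpha> m \<otimes>\<^sub>S \<alpha> (Suc n))) \<cdot>\<^sub>A ?E"
        unfolding \<alpha>\<mu>1[symmetric] by (simp add: K.T.interchange_re)
      finally show "(\<alpha> (m + Suc n) \<cdot>\<^sub>A \<mu> (m, Suc n)) \<cdot>\<^sub>A ?E = (\<mu>' (m, Suc n) \<cdot>\<^sub>A (\<alpha> m \<otimes>\<^sub>S \<alpha> (Suc n))) \<cdot>\<^sub>A ?E" .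
    qed auto
  qed
  have \<alpha>2: "\<alpha> 2 \<cdot>\<^sub>A \<mu> (1, 1) = \<mu>' (1, 1) \<cdot>\<^sub>A (h \<otimes>\<^sub>S h)"
    using mon[of 1 1] \<alpha>1 by (simp add: numeral_2_eq_2)
  have nat: "\<alpha> (fst \<phi>) \<cdot>\<^sub>A FA K \<phi> = FA K' \<phi> \<cdot>\<^sub>A \<alpha> (tgt \<phi>)" if "\<phi> \<in> Arr NCat" for \<phi>
  proof (rule N_generators[OF _ _ _ _ _ _ that])
    show "\<alpha> (fst (Id NCat n)) \<cdot>\<^sub>A FA K (Id NCat n) = FA K' (Id NCat n) \<cdot>\<^sub>A \<alpha> (tgt (Id NCat n))" for n
      by (simp add: Kid K'id)
  next
    fix \<phi> \<psi> assume a [simp]: "\<phi> \<in> Arr NCat" "\<psi> \<in> Arr NCat" "fst \<psi> = tgt \<phi>"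
      and p: "\<alpha> (fst \<phi>) \<cdot>\<^sub>A FA K \<phi> = FA K' \<phi> \<cdot>\<^sub>A \<alpha> (tgt \<phi>)"
        "\<alpha> (fst \<psi>) \<cdot>\<^sub>A FA K \<psi> = FA K' \<psi> \<cdot>\<^sub>A \<alpha> (tgt \<psi>)"
    have "FA K (Comp NCat \<psi> \<phi>) = FA K \<phi> \<cdot>\<^sub>A FA K \<psi>" "FA K' (Comp NCat \<psi> \<phi>) = FA K' \<phi> \<cdot>\<^sub>A FA K' \<psi>"
      using K.FA_comp_simp[of \<psi> \<phi>] K'.FA_comp_simp[of \<psi> \<phi>] by auto
    then show "\<alpha> (fst (Comp NCat \<psi> \<phi>)) \<cdot>\<^sub>A FA K (Comp NCat \<psi> \<phi>) = FA K' (Comp NCat \<psi> \<phi>) \<cdot>\<^sub>A \<alpha> (tgt (Comp NCat \<psi> \<phi>))"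
      using K.T.comp_reduce[OF p(1), of "FA K \<psi>"] p(2) by simp
  next
    fix \<phi> \<psi> assume a [simp]: "\<phi> \<in> Arr NCat" "\<psi> \<in> Arr NCat"
      and p: "\<alpha> (fst \<phi>) \<cdot>\<^sub>A FA K \<phi> = FA K' \<phi> \<cdot>\<^sub>A \<alpha> (tgt \<phi>)"
        "\<alpha> (fst \<psi>) \<cdot>\<^sub>A FA K \<psi> = FA K' \<psi> \<cdot>\<^sub>A \<alpha> (tgt \<psi>)"
    let ?m = "fst \<phi>" and ?n = "fst \<psi>" and ?m' = "tgt \<phi>" and ?n' = "tgt \<psi>"
    have n: "FA K (nsum \<phi> \<psi>) \<cdot>\<^sub>A \<mu> (?m', ?n') = \<mu> (?m, ?n) \<cdot>\<^sub>A (FA K \<phi> \<otimes>\<^sub>S FA K \<psi>)"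
      using K.mu_nat[of \<phi> \<psi> ?m ?n] by simp
    have n': "FA K' (nsum \<phi> \<psi>) \<cdot>\<^sub>A \<mu>' (?m', ?n') = \<mu>' (?m, ?n) \<cdot>\<^sub>A (FA K' \<phi> \<otimes>\<^sub>S FA K' \<psi>)"
      using K'.mu_nat[of \<phi> \<psi> ?m ?n] by simp
    have "\<alpha> (?m + ?n) \<cdot>\<^sub>A FA K (nsum \<phi> \<psi>) = FA K' (nsum \<phi> \<psi>) \<cdot>\<^sub>A \<alpha> (?m' + ?n')"
    proof (rule K.T.iso_cancel_right[of "\<mu> (?m', ?n')"])
      have "(\<alpha> (?m + ?n) \<cdot>\<^sub>A FA K (nsum \<phi> \<psi>)) \<cdot>\<^sub>A \<mu> (?m', ?n') = \<mu>' (?m, ?n) \<cdot>\<^sub>A (\<alpha> ?m \<otimes>\<^sub>S \<alpha> ?n) \<cdot>\<^sub>A (FA K \<phi> \<otimes>\<^sub>S FA K \<psi>)"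
        using K.T.comp_reduce[OF mon[of ?m ?n], of "FA K \<phi> \<otimes>\<^sub>S FA K \<psi>"] by (simp add: n)
      also have "... = (\<mu>' (?m, ?n) \<cdot>\<^sub>A (FA K' \<phi> \<otimes>\<^sub>S FA K' \<psi>)) \<cdot>\<^sub>A (\<alpha> ?m' \<otimes>\<^sub>S \<alpha> ?n')"
        by (simp add: K.T.interchange p)
      also have "... = (FA K' (nsum \<phi> \<psi>) \<cdot>\<^sub>A \<alpha> (?m' + ?n')) \<cdot>\<^sub>A \<mu> (?m', ?n')"
        unfolding n'[symmetric] by (simp add: mon)
      finally show "(\<alpha> (?m + ?n) \<cdot>\<^sub>A FA K (nsum \<phi> \<psi>)) \<cdot>\<^sub>A \<mu> (?m', ?n') = (FA K' (nsum \<phi> \<psi>) \<cdot>\<^sub>A \<alpha> (?m' + ?n')) \<cdot>\<^sub>A \<mu> (?m', ?n')" .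
    qed auto
    then show "\<alpha> (fst (nsum \<phi> \<psi>)) \<cdot>\<^sub>A FA K (nsum \<phi> \<psi>) = FA K' (nsum \<phi> \<psi>) \<cdot>\<^sub>A \<alpha> (tgt (nsum \<phi> \<psi>))" by simp
  next
    have t [simp]: "FO K' (Suc (Suc 0)) = FO K' 2" "FO K (Suc (Suc 0)) = FO K 2" by (simp_all add: numeral_2_eq_2)
    have "\<alpha> 2 \<cdot>\<^sub>A FA K (to_one 2) = (\<alpha> 2 \<cdot>\<^sub>A \<mu> (1, 1)) \<cdot>\<^sub>A inv_arr A (\<mu> (1, 1)) \<cdot>\<^sub>A FA K (to_one 2)"
      by simp
    also have "... = \<mu>' (1, 1) \<cdot>\<^sub>A (h \<otimes>\<^sub>S h) \<cdot>\<^sub>A inv_arr A (\<mu> (1, 1)) \<cdot>\<^sub>A FA K (to_one 2)"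
      unfolding \<alpha>2 by simp
    also have "... = FA K' (to_one 2) \<cdot>\<^sub>A h" unfolding hu[symmetric] by simp
    finally show "\<alpha> (fst (to_one 2)) \<cdot>\<^sub>A FA K (to_one 2) = FA K' (to_one 2) \<cdot>\<^sub>A \<alpha> (tgt (to_one 2))"
      using \<alpha>1 by simp
    have "\<alpha> 2 \<cdot>\<^sub>A FA K (swp 1 1) = FA K' (swp 1 1) \<cdot>\<^sub>A \<alpha> 2"
    proof (rule K.T.iso_cancel_right[of "\<mu> (1, 1)"])
      have b: "FA K (swp 1 1) \<cdot>\<^sub>A \<mu> (1, 1) = \<mu> (1, 1) \<cdot>\<^sub>A Braid S (FO K 1) (FO K 1)"
        and b': "FA K' (swp 1 1) \<cdot>\<^sub>A \<mu>' (1, 1) = \<mu>' (1, 1) \<cdot>\<^sub>A Braid S (FO K' 1) (FO K' 1)"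
        using K.mu_braid[of 1 1] K'.mu_braid[of 1 1] by auto
      have "(\<alpha> 2 \<cdot>\<^sub>A FA K (swp 1 1)) \<cdot>\<^sub>A \<mu> (1, 1) = (\<alpha> 2 \<cdot>\<^sub>A \<mu> (1, 1)) \<cdot>\<^sub>A Braid S (FO K 1) (FO K 1)"
        using b by simp
      also have "... = (\<mu>' (1, 1) \<cdot>\<^sub>A Braid S (FO K' 1) (FO K' 1)) \<cdot>\<^sub>A (h \<otimes>\<^sub>S h)"
        unfolding \<alpha>2 by (simp add: K.T.braid_nat)
      also have "... = (FA K' (swp 1 1) \<cdot>\<^sub>A \<alpha> 2) \<cdot>\<^sub>A \<mu> (1, 1)"
        unfolding b'[symmetric] using \<alpha>2 by simp
      finally show "(\<alpha> 2 \<cdot>\<^sub>A FA K (swp 1 1)) \<cdot>\<^sub>A \<mu> (1, 1) = (FA K' (swp 1 1) \<cdot>\<^sub>A \<alpha> 2) \<cdot>\<^sub>A \<mu> (1, 1)" .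
    qed auto
    then show "\<alpha> (fst (swp 1 1)) \<cdot>\<^sub>A FA K (swp 1 1) = FA K' (swp 1 1) \<cdot>\<^sub>A \<alpha> (tgt (swp 1 1))"
      by (simp add: numeral_2_eq_2)
    have "\<alpha> 0 \<cdot>\<^sub>A FA K (to_one 0) = \<epsilon>' \<cdot>\<^sub>A inv_arr A \<epsilon> \<cdot>\<^sub>A FA K (to_one 0)" by (simp add: \<alpha>0)
    also have "... = FA K' (to_one 0) \<cdot>\<^sub>A h" unfolding hv[symmetric] by simp
    finally show "\<alpha> (fst (to_one 0)) \<cdot>\<^sub>A FA K (to_one 0) = FA K' (to_one 0) \<cdot>\<^sub>A \<alpha> (tgt (to_one 0))"
      using \<alpha>1 by simp
  qed
  show ?thesis
    by (rule exI[of _ \<alpha>]) (use \<alpha>1 mon nat in "auto simp: Hom_iff \<alpha>0")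
qed

lemma monoidal_transformation_unique:
  assumes K: "strong_sym_mon_functor (op NCat) (op_tensor NCat NTensor) A S K \<mu> \<epsilon>"
    and K': "strong_sym_mon_functor (op NCat) (op_tensor NCat NTensor) A S K' \<mu>' \<epsilon>'"
    and \<alpha>: "\<And>n. \<alpha> n \<in> Hom A (FO K n) (FO K' n)" and \<beta>: "\<And>n. \<beta> n \<in> Hom A (FO K n) (FO K' n)"
    and "\<And>m n. \<alpha> (m + n) \<cdot>\<^sub>A \<mu> (m, n) = \<mu>' (m, n) \<cdot>\<^sub>A (\<alpha> m \<otimes>\<^sub>S \<alpha> n)" "\<alpha> 0 \<cdot>\<^sub>A \<epsilon> = \<epsilon>'"
    and "\<And>m n. \<beta> (m + n) \<cdot>\<^sub>A \<mu> (m, n) = \<mu>' (m, n) \<cdot>\<^sub>A (\<beta> m \<otimes>\<^sub>S \<beta> n)" "\<beta> 0 \<cdot>\<^sub>A \<epsilon> = \<epsilon>'"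
    and 1: "\<alpha> 1 = \<beta> 1"
  shows "\<alpha> n = \<beta> n"
proof -
  interpret K: strong_sym_mon_functor "op NCat" "op_tensor NCat NTensor" A S K \<mu> \<epsilon> by fact
  interpret K': strong_sym_mon_functor "op NCat" "op_tensor NCat NTensor" A S K' \<mu>' \<epsilon>' by fact
  show ?thesis
  proof (induction n)
    case 0
    show ?case by (rule K.T.iso_cancel_right[of \<epsilon>]) (use \<alpha>[of 0] \<beta>[of 0] assms(6,8) in "auto simp: Hom_iff")
  next
    case (Suc n)
    have e: "\<alpha> (n + 1) \<cdot>\<^sub>A \<mu> (n, 1) = \<beta> (n + 1) \<cdot>\<^sub>A \<mu> (n, 1)"
      unfolding assms(5,7) Suc 1 ..
    have s: "\<alpha> (n + 1) \<in> Arr A" "\<beta> (n + 1) \<in> Arr A" "Dom A (\<alpha> (n + 1)) = FO K (n + 1)" "Dom A (\<beta> (n + 1)) = FO K (n + 1)"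
      using \<alpha>[of "n + 1"] \<beta>[of "n + 1"] unfolding Hom_iff by blast+
    have "\<alpha> (n + 1) = \<beta> (n + 1)"
      by (rule K.T.iso_cancel_right[OF _ s(1,2) _ _ e]) (simp_all only: s K.mu_simps N_simps op_simps UNIV_I op_N_simps)
    then show ?case by simp
  qed
qed

section \<open>Monoidal functors along a dense functor\<close>

lemma preserves_compf:
  fixes U :: "'u itself"
  assumes F: "cfunctor C D F" "preserves_small_colimits U C D F" and G: "cfunctor D E G" "preserves_small_colimits U D E G"
  shows "preserves_small_colimits U C E (compf C F G)"
  unfolding preserves_small_colimits_def
proof (intro allI impI)
  fix J :: "('u, 'u) cat" and H L \<iota> assume a: "small_category J \<and> cfunctor J C H \<and> is_colimit J C H L \<iota>"
  interpret H: cfunctor J C H using a by simp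
  have L: "L \<in> Obj C" "\<And>j. j \<in> Obj J ==> \<iota> j \<in> Hom C (FO H j) L"
    using a by (auto simp: is_colimit_def is_cocone_def)
  then have i: "\<And>j. j \<in> Obj J ==> \<iota> j \<in> Arr C" by (simp add: Hom_iff)
  have "is_colimit J D (compf J H F) (FO F L) (\<lambda>j. FA F (\<iota> j))"
    using F(2)[unfolded preserves_small_colimits_def, rule_format, OF a] .
  then have "is_colimit J E (compf J (compf J H F) G) (FO G (FO F L)) (\<lambda>j. FA G (FA F (\<iota> j)))"
    using G(2)[unfolded preserves_small_colimits_def, rule_format, of J "compf J H F" "FO F L" "\<lambda>j. FA F (\<iota> j)"]
      a cfunctor_compf[OF _ F(1), of J H] by simp
  moreover have "compf J (compf J H F) G = compf J H (compf C F G)"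
    by (auto simp: compf_def restrict_def fun_eq_iff)
  ultimately show "is_colimit J E (compf J H (compf C F G)) (FO (compf C F G) L) (\<lambda>j. FA (compf C F G) (\<iota> j))"
    using L(1) i by (simp add: is_colimit_def is_cocone_def)
qed

text \<open>
  \<open>Y\<close> is the Yoneda embedding in the application. The density assumption says that \<open>P\<close> is the
  colimit of the arrows \<open>a : Y n \<rightarrow> P\<close> and that cocontinuous functors \<open>G\<close> preserve this
  colimit.
\<close>

locale dense_monoidal =
  Y: strong_sym_mon_functor N TN B T Y \<mu> \<epsilon> + A: sym_mon_cat A S
  for U :: "'u itself" and N :: "('n, 'm) cat" and TN and B :: "('p, 'b) cat" and T and Y and \<mu> and \<epsilon>
    and A :: "('o, 'a) cat" and S +
  assumes dense: "\<And>G P Z d. [|cfunctor B A G; preserves_small_colimits U B A G; P \<in> Obj B; Z \<in> Obj A;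
      \<And>n a. n \<in> Obj N ==> a \<in> Hom B (FO Y n) P ==> d n a \<in> Hom A (FO G (FO Y n)) Z;
      \<And>\<phi> a. \<phi> \<in> Arr N ==> a \<in> Hom B (FO Y (Cod N \<phi>)) P ==>
        d (Dom N \<phi>) (a \<cdot>\<^sub>B FA Y \<phi>) = d (Cod N \<phi>) a \<cdot>\<^sub>A FA G (FA Y \<phi>)|] ==>
      \<exists>!h. h \<in> Hom A (FO G P) Z \<and> (\<forall>n\<in>Obj N. \<forall>a\<in>Hom B (FO Y n) P. h \<cdot>\<^sub>A FA G a = d n a)"
    and cocontinuous_source: "tensor_cocontinuous U B T"
    and cocontinuous_target: "tensor_cocontinuous U A S"
begin

definition cocont :: "('p, 'b, 'o, 'a) cfun \<Rightarrow> bool" where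
  "cocont G \<longleftrightarrow> cfunctor B A G \<and> preserves_small_colimits U B A G"

lemma cocont_tensor:
  assumes H: "cocont H"
  shows "X \<in> Obj A ==> cocont (compf B H (tensor_left A S X))"
    "X \<in> Obj A ==> cocont (compf B H (tensor_right A S X))"
    "P \<in> Obj B ==> cocont (compf B (tensor_left B T P) H)"
    "P \<in> Obj B ==> cocont (compf B (tensor_right B T P) H)"
  using H cocontinuous_source cocontinuous_target
  unfolding cocont_def tensor_cocontinuous_def
  by (auto intro!: cfunctor_compf preserves_compf
      intro: A.tensor_left_functor A.tensor_right_functor Y.T.tensor_left_functor Y.T.tensor_right_functor)

lemma dense_eq:
  assumes G: "cocont G" and P: "P \<in> Obj B" and fg: "f \<in> Hom A (FO G P) Z" "g \<in> Hom A (FO G P) Z"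
    and eq: "\<And>n a. n \<in> Obj N ==> a \<in> Hom B (FO Y n) P ==> f \<cdot>\<^sub>A FA G a = g \<cdot>\<^sub>A FA G a"
  shows "f = g"
proof -
  interpret G: cfunctor B A G using G by (simp add: cocont_def)
  have Z: "Z \<in> Obj A" using A.hom_objs[OF fg(1)] by simp
  have "\<exists>!h. h \<in> Hom A (FO G P) Z \<and> (\<forall>n\<in>Obj N. \<forall>a\<in>Hom B (FO Y n) P. h \<cdot>\<^sub>A FA G a = g \<cdot>\<^sub>A FA G a)"
  proof (rule dense[OF _ _ P Z])
    show "g \<cdot>\<^sub>A FA G a \<in> Hom A (FO G (FO Y n)) Z" if "a \<in> Hom B (FO Y n) P" for n a
      using that fg(2) by (auto simp: Hom_iff)
    show "g \<cdot>\<^sub>A FA G (a \<cdot>\<^sub>B FA Y \<phi>) = (g \<cdot>\<^sub>A FA G a) \<cdot>\<^sub>A FA G (FA Y \<phi>)"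
      if "\<phi> \<in> Arr N" "a \<in> Hom B (FO Y (Cod N \<phi>)) P" for \<phi> a
      using that fg(2) by (auto simp: Hom_iff G.FA_comp_simp)
  qed (use G in "simp_all add: cocont_def")
  from ex1E[OF this] show ?thesis using fg eq by metis
qed

lemma dense_lift:
  assumes G: "cocont G" and P: "P \<in> Obj B" and Z: "Z \<in> Obj A"
    and d: "\<And>n a. n \<in> Obj N ==> a \<in> Hom B (FO Y n) P ==> d n a \<in> Hom A (FO G (FO Y n)) Z"
      "\<And>\<phi> a. \<phi> \<in> Arr N ==> a \<in> Hom B (FO Y (Cod N \<phi>)) P ==>
        d (Dom N \<phi>) (a \<cdot>\<^sub>B FA Y \<phi>) = d (Cod N \<phi>) a \<cdot>\<^sub>A FA G (FA Y \<phi>)"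
  shows "\<exists>h\<in>Hom A (FO G P) Z. \<forall>n\<in>Obj N. \<forall>a\<in>Hom B (FO Y n) P. h \<cdot>\<^sub>A FA G a = d n a"
  using dense[OF _ _ P Z d] G by (auto simp: cocont_def)

text \<open>
  At \<open>P\<close> the extension is the map of colimits induced by \<open>\<alpha>0\<close>.
\<close>

lemma extend_nat:
  assumes F: "cocont F" and G: "cocont G"
    and \<alpha>: "\<And>n. n \<in> Obj N ==> \<alpha>0 n \<in> Hom A (FO F (FO Y n)) (FO G (FO Y n))"
      "\<And>\<phi>. \<phi> \<in> Arr N ==> \<alpha>0 (Cod N \<phi>) \<cdot>\<^sub>A FA F (FA Y \<phi>) = FA G (FA Y \<phi>) \<cdot>\<^sub>A \<alpha>0 (Dom N \<phi>)"
  shows "\<exists>\<alpha>. nat_trans B A F G \<alpha> \<and> (\<forall>n\<in>Obj N. \<alpha> (FO Y n) = \<alpha>0 n)"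
proof -
  interpret F: cfunctor B A F using F by (simp add: cocont_def)
  interpret G: cfunctor B A G using G by (simp add: cocont_def)
  note [simp] = \<alpha>(1)[unfolded Hom_iff, THEN conjunct1] \<alpha>(1)[unfolded Hom_iff, THEN conjunct2, THEN conjunct1]
    \<alpha>(1)[unfolded Hom_iff, THEN conjunct2, THEN conjunct2]
  have "\<exists>h\<in>Hom A (FO F P) (FO G P). \<forall>n\<in>Obj N. \<forall>a\<in>Hom B (FO Y n) P. h \<cdot>\<^sub>A FA F a = FA G a \<cdot>\<^sub>A \<alpha>0 n"
    if P: "P \<in> Obj B" for P
  proof (rule dense_lift[OF F P])
    fix \<phi> a assume \<phi>: "\<phi> \<in> Arr N" and a: "a \<in> Hom B (FO Y (Cod N \<phi>)) P"
    then show "FA G (a \<cdot>\<^sub>B FA Y \<phi>) \<cdot>\<^sub>A \<alpha>0 (Dom N \<phi>) = (FA G a \<cdot>\<^sub>A \<alpha>0 (Cod N \<phi>)) \<cdot>\<^sub>A FA F (FA Y \<phi>)"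
      by (simp add: Hom_iff G.FA_comp_simp \<alpha>(2))
  qed (use P in "auto simp: Hom_iff")
  then obtain h where h: "\<And>P. P \<in> Obj B ==> h P \<in> Hom A (FO F P) (FO G P)"
    "\<And>P n a. [|P \<in> Obj B; n \<in> Obj N; a \<in> Hom B (FO Y n) P|] ==> h P \<cdot>\<^sub>A FA F a = FA G a \<cdot>\<^sub>A \<alpha>0 n"
    by metis
  note [simp] = h(1)[unfolded Hom_iff, THEN conjunct1] h(1)[unfolded Hom_iff, THEN conjunct2, THEN conjunct1]
    h(1)[unfolded Hom_iff, THEN conjunct2, THEN conjunct2]
  have nat: "h (Cod B f) \<cdot>\<^sub>A FA F f = FA G f \<cdot>\<^sub>A h (Dom B f)" if f [simp]: "f \<in> Arr B" for f
  proof (rule dense_eq[OF F])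
    fix n a assume n: "n \<in> Obj N" and a: "a \<in> Hom B (FO Y n) (Dom B f)"
    then have [simp]: "a \<in> Arr B" "Dom B a = FO Y n" "Cod B a = Dom B f" by (auto simp: Hom_iff)
    have "(h (Cod B f) \<cdot>\<^sub>A FA F f) \<cdot>\<^sub>A FA F a = FA G (f \<cdot>\<^sub>B a) \<cdot>\<^sub>A \<alpha>0 n"
      using h(2)[of "Cod B f" n "f \<cdot>\<^sub>B a"] n by (simp add: Hom_iff F.FA_comp_simp)
    also have "... = (FA G f \<cdot>\<^sub>A h (Dom B f)) \<cdot>\<^sub>A FA F a"
      using h(2)[OF _ n a] n by (simp add: G.FA_comp_simp)
    finally show "(h (Cod B f) \<cdot>\<^sub>A FA F f) \<cdot>\<^sub>A FA F a = (FA G f \<cdot>\<^sub>A h (Dom B f)) \<cdot>\<^sub>A FA F a" .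
  qed (auto simp: Hom_iff)
  have Yn: "h (FO Y n) = \<alpha>0 n" if "n \<in> Obj N" for n
    using h(2)[of "FO Y n" n "Id B (FO Y n)"] that by (simp add: Hom_iff)
  show ?thesis
    by (rule exI[of _ "restrict h (Obj B)"])
      (use h(1) nat Yn in "auto intro!: nat_transI simp: F.cfunctor_axioms G.cfunctor_axioms")
qed

lemma nat_unique:
  assumes F: "cocont F" and n1: "nat_trans B A F G \<alpha>" and n2: "nat_trans B A F G \<beta>"
    and eq: "\<And>n. n \<in> Obj N ==> \<alpha> (FO Y n) = \<beta> (FO Y n)"
  shows "\<alpha> = \<beta>"
proof -
  interpret a: nat_trans B A F G \<alpha> by fact
  interpret b: nat_trans B A F G \<beta> by fact
  have "\<alpha> P = \<beta> P" if P: "P \<in> Obj B" for P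
  proof (rule dense_eq[OF F P a.hom[OF P] b.hom[OF P]])
    fix n a assume "n \<in> Obj N" "a \<in> Hom B (FO Y n) P"
    then show "\<alpha> P \<cdot>\<^sub>A FA F a = \<beta> P \<cdot>\<^sub>A FA F a"
      using a.naturality[of a] b.naturality[of a] eq[of n] by (simp add: Hom_iff)
  qed
  then show ?thesis using a.ext b.ext by (auto intro: extensionalityI)
qed

lemma extend_nat_iso:
  assumes F: "cocont F" and G: "cocont G" and \<alpha>: "nat_trans B A F G \<alpha>"
    and iso: "\<And>n. n \<in> Obj N ==> iso_arr A (\<alpha> (FO Y n))" and P: "P \<in> Obj B"
  shows "iso_arr A (\<alpha> P)"
proof -
  interpret F: cfunctor B A F using F by (simp add: cocont_def)
  interpret G: cfunctor B A G using G by (simp add: cocont_def)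
  interpret a: nat_trans B A F G \<alpha> by fact
  have "\<exists>\<beta>. nat_trans B A G F \<beta> \<and> (\<forall>n\<in>Obj N. \<beta> (FO Y n) = inv_arr A (\<alpha> (FO Y n)))"
  proof (rule extend_nat[OF G F])
    fix \<phi> assume \<phi>: "\<phi> \<in> Arr N"
    show "inv_arr A (\<alpha> (FO Y (Cod N \<phi>))) \<cdot>\<^sub>A FA G (FA Y \<phi>) = FA F (FA Y \<phi>) \<cdot>\<^sub>A inv_arr A (\<alpha> (FO Y (Dom N \<phi>)))"
      by (rule A.iso_cancel_right[of "\<alpha> (FO Y (Dom N \<phi>))"])
        (use \<phi> a.naturality[of "FA Y \<phi>", symmetric] iso in simp_all)
  qed (use iso in "auto simp: Hom_iff")
  then obtain \<beta> where b: "nat_trans B A G F \<beta>" and \<beta>: "\<And>n. n \<in> Obj N ==> \<beta> (FO Y n) = inv_arr A (\<alpha> (FO Y n))"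
    by blast
  interpret b: nat_trans B A G F \<beta> by fact
  have "(\<lambda>X\<in>Obj B. \<beta> X \<cdot>\<^sub>A \<alpha> X) = (\<lambda>X\<in>Obj B. Id A (FO F X))"
    by (rule nat_unique[OF F nat_trans_comp[OF \<alpha> b] nat_trans_id[OF F.cfunctor_axioms]]) (simp add: \<beta> iso)
  from fun_cong[OF this, of P] have 1: "\<beta> P \<cdot>\<^sub>A \<alpha> P = Id A (FO F P)" using P by simp
  have "(\<lambda>X\<in>Obj B. \<alpha> X \<cdot>\<^sub>A \<beta> X) = (\<lambda>X\<in>Obj B. Id A (FO G X))"
    by (rule nat_unique[OF G nat_trans_comp[OF b \<alpha>] nat_trans_id[OF G.cfunctor_axioms]]) (simp add: \<beta> iso)
  from fun_cong[OF this, of P] have 2: "\<alpha> P \<cdot>\<^sub>A \<beta> P = Id A (FO G P)" using P by simp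
  show ?thesis by (rule A.isoI[OF a.hom[OF P] b.hom[OF P] 1 2])
qed

text \<open>
  Tensoring is cocontinuous in each variable, so density applies to one factor after the
  other.
\<close>

lemma dense_eq2:
  assumes F: "cocont F" and G: "cocont G" and P: "P \<in> Obj B" "Q \<in> Obj B"
    and fg: "f \<in> Hom A (TO S (FO F P) (FO G Q)) Z" "g \<in> Hom A (TO S (FO F P) (FO G Q)) Z"
    and eq: "\<And>m n a b. [|m \<in> Obj N; n \<in> Obj N; a \<in> Hom B (FO Y m) P; b \<in> Hom B (FO Y n) Q|] ==>
      f \<cdot>\<^sub>A (FA F a \<otimes>\<^sub>S FA G b) = g \<cdot>\<^sub>A (FA F a \<otimes>\<^sub>S FA G b)"
  shows "f = g"
proof -
  interpret F: cfunctor B A F using F by (simp add: cocont_def)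
  interpret G: cfunctor B A G using G by (simp add: cocont_def)
  have [simp]: "f \<in> Arr A" "Dom A f = TO S (FO F P) (FO G Q)" "Cod A f = Z"
    "g \<in> Arr A" "Dom A g = TO S (FO F P) (FO G Q)" "Cod A g = Z" using fg by (auto simp: Hom_iff)
  show ?thesis
  proof (rule dense_eq[OF cocont_tensor(2)[OF F] P(1)])
    fix m a assume m: "m \<in> Obj N" and a: "a \<in> Hom B (FO Y m) P"
    then have [simp]: "a \<in> Arr B" "Dom B a = FO Y m" "Cod B a = P" by (auto simp: Hom_iff)
    have "f \<cdot>\<^sub>A (FA F a \<otimes>\<^sub>S Id A (FO G Q)) = g \<cdot>\<^sub>A (FA F a \<otimes>\<^sub>S Id A (FO G Q))"
    proof (rule dense_eq[OF cocont_tensor(1)[OF G] P(2)])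
      fix n b assume n: "n \<in> Obj N" and b: "b \<in> Hom B (FO Y n) Q"
      then have [simp]: "b \<in> Arr B" "Dom B b = FO Y n" "Cod B b = Q" by (auto simp: Hom_iff)
      show "(f \<cdot>\<^sub>A (FA F a \<otimes>\<^sub>S Id A (FO G Q))) \<cdot>\<^sub>A FA (compf B G (tensor_left A S (FO F (FO Y m)))) b =
        (g \<cdot>\<^sub>A (FA F a \<otimes>\<^sub>S Id A (FO G Q))) \<cdot>\<^sub>A FA (compf B G (tensor_left A S (FO F (FO Y m)))) b"
        using eq[OF m n a b] m n P by (simp add: A.interchange)
    qed (use m P in "auto simp: Hom_iff")
    then show "f \<cdot>\<^sub>A FA (compf B F (tensor_right A S (FO G Q))) a = g \<cdot>\<^sub>A FA (compf B F (tensor_right A S (FO G Q))) a"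
      using P by simp
  qed (use P in "auto simp: Hom_iff")
qed

lemma dense_eq3:
  assumes F: "cocont F" and P: "P \<in> Obj B" "Q \<in> Obj B" "R \<in> Obj B"
    and fg: "f \<in> Hom A (TO S (TO S (FO F P) (FO F Q)) (FO F R)) Z" "g \<in> Hom A (TO S (TO S (FO F P) (FO F Q)) (FO F R)) Z"
    and eq: "\<And>m n k a b c. [|m \<in> Obj N; n \<in> Obj N; k \<in> Obj N; a \<in> Hom B (FO Y m) P; b \<in> Hom B (FO Y n) Q; c \<in> Hom B (FO Y k) R|] ==>
      f \<cdot>\<^sub>A ((FA F a \<otimes>\<^sub>S FA F b) \<otimes>\<^sub>S FA F c) = g \<cdot>\<^sub>A ((FA F a \<otimes>\<^sub>S FA F b) \<otimes>\<^sub>S FA F c)"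
  shows "f = g"
proof -
  interpret F: cfunctor B A F using F by (simp add: cocont_def)
  let ?G = "compf B F (tensor_right A S (FO F Q))"
  have [simp]: "f \<in> Arr A" "Dom A f = TO S (TO S (FO F P) (FO F Q)) (FO F R)" "Cod A f = Z"
    "g \<in> Arr A" "Dom A g = TO S (TO S (FO F P) (FO F Q)) (FO F R)" "Cod A g = Z" using fg by (auto simp: Hom_iff)
  show ?thesis
  proof (rule dense_eq2[OF cocont_tensor(2)[OF F] F P(1,3)])
    fix m k a c assume m: "m \<in> Obj N" and k: "k \<in> Obj N" and a: "a \<in> Hom B (FO Y m) P" and c: "c \<in> Hom B (FO Y k) R"
    then have [simp]: "a \<in> Arr B" "Dom B a = FO Y m" "Cod B a = P" "c \<in> Arr B" "Dom B c = FO Y k" "Cod B c = R"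
      by (auto simp: Hom_iff)
    let ?x = "(FA F a \<otimes>\<^sub>S Id A (FO F Q)) \<otimes>\<^sub>S FA F c"
    have "f \<cdot>\<^sub>A ?x = g \<cdot>\<^sub>A ?x"
    proof (rule dense_eq[OF cocont_tensor(2)[OF cocont_tensor(1)[OF F]] P(2)])
      fix n b assume n: "n \<in> Obj N" and b: "b \<in> Hom B (FO Y n) Q"
      then have [simp]: "b \<in> Arr B" "Dom B b = FO Y n" "Cod B b = Q" by (auto simp: Hom_iff)
      let ?H = "compf B (compf B F (tensor_left A S (FO F (FO Y m)))) (tensor_right A S (FO F (FO Y k)))"
      have e: "?x \<cdot>\<^sub>A FA ?H b = (FA F a \<otimes>\<^sub>S FA F b) \<otimes>\<^sub>S FA F c"
        using m n k P by (simp add: A.interchange)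
      show "(f \<cdot>\<^sub>A ?x) \<cdot>\<^sub>A FA ?H b = (g \<cdot>\<^sub>A ?x) \<cdot>\<^sub>A FA ?H b"
        using eq[OF m n k a b c] m n k P by (simp add: A.interchange)
    qed (use m k P in "auto simp: Hom_iff")
    then show "f \<cdot>\<^sub>A (FA ?G a \<otimes>\<^sub>S FA F c) = g \<cdot>\<^sub>A (FA ?G a \<otimes>\<^sub>S FA F c)" using P by simp
  qed (use P in "auto simp: Hom_iff")
qed

lemma monoidal_extend:
  assumes F: "strong_sym_mon_functor B T A S F M E" "cocont F" and G: "strong_sym_mon_functor B T A S G M' E'"
    and \<alpha>: "nat_trans B A F G \<alpha>"
    and mon: "\<And>m n. m \<in> Obj N ==> n \<in> Obj N ==>
      \<alpha> (FO Y (TO TN m n)) \<cdot>\<^sub>A FA F (\<mu> (m, n)) \<cdot>\<^sub>A M (FO Y m, FO Y n) =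
      (FA G (\<mu> (m, n)) \<cdot>\<^sub>A M' (FO Y m, FO Y n)) \<cdot>\<^sub>A (\<alpha> (FO Y m) \<otimes>\<^sub>S \<alpha> (FO Y n))"
    and unit: "\<alpha> (FO Y (TI TN)) \<cdot>\<^sub>A FA F \<epsilon> \<cdot>\<^sub>A E = FA G \<epsilon> \<cdot>\<^sub>A E'"
  shows "\<forall>P\<in>Obj B. \<forall>Q\<in>Obj B. \<alpha> (TO T P Q) \<cdot>\<^sub>A M (P, Q) = M' (P, Q) \<cdot>\<^sub>A (\<alpha> P \<otimes>\<^sub>S \<alpha> Q)"
    "\<alpha> (TI T) \<cdot>\<^sub>A E = E'"
proof -
  interpret F: strong_sym_mon_functor B T A S F M E by fact
  interpret G: strong_sym_mon_functor B T A S G M' E' by fact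
  interpret a: nat_trans B A F G \<alpha> by fact
  have 0: "\<alpha> (TO T (FO Y m) (FO Y n)) \<cdot>\<^sub>A M (FO Y m, FO Y n) = M' (FO Y m, FO Y n) \<cdot>\<^sub>A (\<alpha> (FO Y m) \<otimes>\<^sub>S \<alpha> (FO Y n))"
    if mn: "m \<in> Obj N" "n \<in> Obj N" for m n
  proof (rule A.iso_cancel_left[of "FA G (\<mu> (m, n))"])
    show "FA G (\<mu> (m, n)) \<cdot>\<^sub>A \<alpha> (TO T (FO Y m) (FO Y n)) \<cdot>\<^sub>A M (FO Y m, FO Y n) =
      FA G (\<mu> (m, n)) \<cdot>\<^sub>A M' (FO Y m, FO Y n) \<cdot>\<^sub>A (\<alpha> (FO Y m) \<otimes>\<^sub>S \<alpha> (FO Y n))"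
      using mon[OF mn] A.comp_reduce[OF a.naturality[of "\<mu> (m, n)", symmetric], of "M (FO Y m, FO Y n)"] mn by simp
  qed (use mn in auto)
  show "\<alpha> (TI T) \<cdot>\<^sub>A E = E'"
  proof (rule A.iso_cancel_left[of "FA G \<epsilon>"])
    show "FA G \<epsilon> \<cdot>\<^sub>A \<alpha> (TI T) \<cdot>\<^sub>A E = FA G \<epsilon> \<cdot>\<^sub>A E'"
      using unit A.comp_reduce[OF a.naturality[of \<epsilon>, symmetric], of E] by simp
  qed auto
  show "\<forall>P\<in>Obj B. \<forall>Q\<in>Obj B. \<alpha> (TO T P Q) \<cdot>\<^sub>A M (P, Q) = M' (P, Q) \<cdot>\<^sub>A (\<alpha> P \<otimes>\<^sub>S \<alpha> Q)"
  proof (intro ballI)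
    fix P Q assume [simp]: "P \<in> Obj B" "Q \<in> Obj B"
    show "\<alpha> (TO T P Q) \<cdot>\<^sub>A M (P, Q) = M' (P, Q) \<cdot>\<^sub>A (\<alpha> P \<otimes>\<^sub>S \<alpha> Q)"
    proof (rule dense_eq2[OF F(2) F(2), of P Q _ "FO G (TO T P Q)"])
    fix m n a b assume mn: "m \<in> Obj N" "n \<in> Obj N" and "a \<in> Hom B (FO Y m) P" "b \<in> Hom B (FO Y n) Q"
    then have [simp]: "a \<in> Arr B" "Dom B a = FO Y m" "Cod B a = P" "b \<in> Arr B" "Dom B b = FO Y n" "Cod B b = Q"
      by (auto simp: Hom_iff)
    have "(\<alpha> (TO T P Q) \<cdot>\<^sub>A M (P, Q)) \<cdot>\<^sub>A (FA F a \<otimes>\<^sub>S FA F b) =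
      (\<alpha> (TO T P Q) \<cdot>\<^sub>A FA F (a \<otimes>\<^sub>T b)) \<cdot>\<^sub>A M (FO Y m, FO Y n)"
      using mn F.mu_nat[of a b P Q] by simp
    also have "\<alpha> (TO T P Q) \<cdot>\<^sub>A FA F (a \<otimes>\<^sub>T b) = FA G (a \<otimes>\<^sub>T b) \<cdot>\<^sub>A \<alpha> (TO T (FO Y m) (FO Y n))"
      using a.naturality[of "a \<otimes>\<^sub>T b"] by simp
    also have "(FA G (a \<otimes>\<^sub>T b) \<cdot>\<^sub>A \<alpha> (TO T (FO Y m) (FO Y n))) \<cdot>\<^sub>A M (FO Y m, FO Y n) =
      (FA G (a \<otimes>\<^sub>T b) \<cdot>\<^sub>A M' (FO Y m, FO Y n)) \<cdot>\<^sub>A (\<alpha> (FO Y m) \<otimes>\<^sub>S \<alpha> (FO Y n))"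
      using mn 0[OF mn] by simp
    also have "FA G (a \<otimes>\<^sub>T b) \<cdot>\<^sub>A M' (FO Y m, FO Y n) = M' (P, Q) \<cdot>\<^sub>A (FA G a \<otimes>\<^sub>S FA G b)"
      using mn G.mu_nat[of a b P Q] by simp
    also have "(M' (P, Q) \<cdot>\<^sub>A (FA G a \<otimes>\<^sub>S FA G b)) \<cdot>\<^sub>A (\<alpha> (FO Y m) \<otimes>\<^sub>S \<alpha> (FO Y n)) =
      (M' (P, Q) \<cdot>\<^sub>A (\<alpha> P \<otimes>\<^sub>S \<alpha> Q)) \<cdot>\<^sub>A (FA F a \<otimes>\<^sub>S FA F b)"
      using mn a.naturality[of a] a.naturality[of b] by (simp add: A.interchange)
    finally show "(\<alpha> (TO T P Q) \<cdot>\<^sub>A M (P, Q)) \<cdot>\<^sub>A (FA F a \<otimes>\<^sub>S FA F b) =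
      (M' (P, Q) \<cdot>\<^sub>A (\<alpha> P \<otimes>\<^sub>S \<alpha> Q)) \<cdot>\<^sub>A (FA F a \<otimes>\<^sub>S FA F b)" .
  qed (auto simp: Hom_iff)
  qed
qed

end

context dense_monoidal begin

context
  fixes H :: "('p, 'b, 'o, 'a) cfun" and \<nu> \<zeta>
  assumes H: "cocont H"
    and K: "strong_sym_mon_functor N TN A S (compf N Y H) \<nu> \<zeta>"
begin

interpretation H: cfunctor B A H using H by (simp add: cocont_def)
interpretation K: strong_sym_mon_functor N TN A S "compf N Y H" \<nu> \<zeta> by (rule K)

text \<open>
  The structure map at \<open>(Y m, Y n)\<close>, which the one of \<open>H \<circ> Y\<close> forces.
\<close>

definition w :: "'n \<Rightarrow> 'n \<Rightarrow> 'a" where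
  "w m n = FA H (inv_arr B (\<mu> (m, n))) \<cdot>\<^sub>A \<nu> (m, n)"

lemma nu_simps [simp]:
  "[|m \<in> Obj N; n \<in> Obj N|] ==> \<nu> (m, n) \<in> Arr A"
  "[|m \<in> Obj N; n \<in> Obj N|] ==> Dom A (\<nu> (m, n)) = TO S (FO H (FO Y m)) (FO H (FO Y n))"
  "[|m \<in> Obj N; n \<in> Obj N|] ==> Cod A (\<nu> (m, n)) = FO H (FO Y (TO TN m n))"
  "\<zeta> \<in> Arr A" "Dom A \<zeta> = TI S" "Cod A \<zeta> = FO H (FO Y (TI TN))"
  by auto

lemma w_simps [simp]:
  assumes "m \<in> Obj N" "n \<in> Obj N"
  shows "w m n \<in> Arr A" "Dom A (w m n) = TO S (FO H (FO Y m)) (FO H (FO Y n))"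
    "Cod A (w m n) = FO H (TO T (FO Y m) (FO Y n))" "iso_arr A (w m n)"
  using assms by (auto simp: w_def)

lemma w_nat:
  assumes [simp]: "\<phi> \<in> Arr N" "\<psi> \<in> Arr N"
  shows "w (Cod N \<phi>) (Cod N \<psi>) \<cdot>\<^sub>A (FA H (FA Y \<phi>) \<otimes>\<^sub>S FA H (FA Y \<psi>)) =
    FA H (FA Y \<phi> \<otimes>\<^sub>T FA Y \<psi>) \<cdot>\<^sub>A w (Dom N \<phi>) (Dom N \<psi>)"
proof -
  have "w (Cod N \<phi>) (Cod N \<psi>) \<cdot>\<^sub>A (FA H (FA Y \<phi>) \<otimes>\<^sub>S FA H (FA Y \<psi>)) =
    FA H (inv_arr B (\<mu> (Cod N \<phi>, Cod N \<psi>))) \<cdot>\<^sub>A FA H (FA Y (\<phi> \<otimes>\<^bsub>TN\<^esub> \<psi>)) \<cdot>\<^sub>A \<nu> (Dom N \<phi>, Dom N \<psi>)"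
    using K.mu_nat[of \<phi> \<psi> "Cod N \<phi>" "Cod N \<psi>"] by (simp add: w_def)
  also have "... = FA H (inv_arr B (\<mu> (Cod N \<phi>, Cod N \<psi>)) \<cdot>\<^sub>B FA Y (\<phi> \<otimes>\<^bsub>TN\<^esub> \<psi>)) \<cdot>\<^sub>A \<nu> (Dom N \<phi>, Dom N \<psi>)"
    by (simp add: H.FA_comp_simp)
  also have "... = FA H ((FA Y \<phi> \<otimes>\<^sub>T FA Y \<psi>) \<cdot>\<^sub>B inv_arr B (\<mu> (Dom N \<phi>, Dom N \<psi>))) \<cdot>\<^sub>A \<nu> (Dom N \<phi>, Dom N \<psi>)"
    using Y.mu_inv_nat[of \<phi> \<psi> "Cod N \<phi>" "Cod N \<psi>"] by simp
  finally show ?thesis by (simp add: H.FA_comp_simp w_def)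
qed

lemma w_nat_left: "\<phi> \<in> Arr N ==> n \<in> Obj N ==>
   w (Cod N \<phi>) n \<cdot>\<^sub>A (FA H (FA Y \<phi>) \<otimes>\<^sub>S Id A (FO H (FO Y n))) =
   FA H (FA Y \<phi> \<otimes>\<^sub>T Id B (FO Y n)) \<cdot>\<^sub>A w (Dom N \<phi>) n"
  using w_nat[of \<phi> "Id N n"] by simp

lemma w_nat_right: "\<phi> \<in> Arr N ==> m \<in> Obj N ==>
   w m (Cod N \<phi>) \<cdot>\<^sub>A (Id A (FO H (FO Y m)) \<otimes>\<^sub>S FA H (FA Y \<phi>)) =
   FA H (Id B (FO Y m) \<otimes>\<^sub>T FA Y \<phi>) \<cdot>\<^sub>A w m (Dom N \<phi>)"
  using w_nat[of "Id N m" \<phi>] by simp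

text \<open>
  Extend \<open>w m n\<close> first in the second variable, to \<open>M1 m Q\<close>, then in the first, to \<open>M2 Q P\<close>.
\<close>

lemma structure_exists:
  "\<exists>M. M \<in> extensional (Obj B \<times> Obj B) \<and>
    (\<forall>P\<in>Obj B. \<forall>Q\<in>Obj B. M (P, Q) \<in> Hom A (TO S (FO H P) (FO H Q)) (FO H (TO T P Q)) \<and> iso_arr A (M (P, Q))) \<and>
    (\<forall>f\<in>Arr B. \<forall>g\<in>Arr B. M (Cod B f, Cod B g) \<cdot>\<^sub>A (FA H f \<otimes>\<^sub>S FA H g) = FA H (f \<otimes>\<^sub>T g) \<cdot>\<^sub>A M (Dom B f, Dom B g)) \<and>
    (\<forall>m\<in>Obj N. \<forall>n\<in>Obj N. M (FO Y m, FO Y n) = w m n)"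
proof -
  let ?L = "\<lambda>P. compf B H (tensor_left A S (FO H P))" and ?L' = "\<lambda>P. compf B (tensor_left B T P) H"
  let ?R = "\<lambda>P. compf B H (tensor_right A S (FO H P))" and ?R' = "\<lambda>P. compf B (tensor_right B T P) H"
  note cl = cocont_tensor(1)[OF H H.functor_simps(1)] cocont_tensor(3)[OF H]
  note cr = cocont_tensor(2)[OF H H.functor_simps(1)] cocont_tensor(4)[OF H]
  have "\<exists>\<alpha>. nat_trans B A (?L (FO Y m)) (?L' (FO Y m)) \<alpha> \<and> (\<forall>n\<in>Obj N. \<alpha> (FO Y n) = w m n)" if m: "m \<in> Obj N" for m
  proof (rule extend_nat[OF cl])
    fix \<phi> assume "\<phi> \<in> Arr N"
    then show "w m (Cod N \<phi>) \<cdot>\<^sub>A FA (?L (FO Y m)) (FA Y \<phi>) = FA (?L' (FO Y m)) (FA Y \<phi>) \<cdot>\<^sub>A w m (Dom N \<phi>)"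
      using w_nat_right[of \<phi> m] m by simp
  qed (use m in "auto simp: Hom_iff")
  then obtain M1 where n1: "\<And>m. m \<in> Obj N ==> nat_trans B A (?L (FO Y m)) (?L' (FO Y m)) (M1 m)"
    and M1w: "\<And>m n. m \<in> Obj N ==> n \<in> Obj N ==> M1 m (FO Y n) = w m n" by metis
  have M1iso: "iso_arr A (M1 m Q)" if m: "m \<in> Obj N" and Q: "Q \<in> Obj B" for m Q
    by (rule extend_nat_iso[OF cl n1[OF m] _ Q]) (use m in "auto simp: M1w")
  have M1 [simp]: "M1 m Q \<in> Arr A" "Dom A (M1 m Q) = TO S (FO H (FO Y m)) (FO H Q)" "Cod A (M1 m Q) = FO H (TO T (FO Y m) Q)"
    if "m \<in> Obj N" "Q \<in> Obj B" for m Q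
    using nat_trans.nat_simps[OF n1[OF that(1)] that(2)] that by auto
  have M1nat: "M1 m (Cod B g) \<cdot>\<^sub>A (Id A (FO H (FO Y m)) \<otimes>\<^sub>S FA H g) = FA H (Id B (FO Y m) \<otimes>\<^sub>T g) \<cdot>\<^sub>A M1 m (Dom B g)"
    if "m \<in> Obj N" "g \<in> Arr B" for m g
    using nat_trans.naturality[OF n1[OF that(1)] that(2)] that by simp
  have M1left: "M1 (Cod N \<phi>) Q \<cdot>\<^sub>A (FA H (FA Y \<phi>) \<otimes>\<^sub>S Id A (FO H Q)) = FA H (FA Y \<phi> \<otimes>\<^sub>T Id B Q) \<cdot>\<^sub>A M1 (Dom N \<phi>) Q"
    if \<phi> [simp]: "\<phi> \<in> Arr N" and Q [simp]: "Q \<in> Obj B" for \<phi> Q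
  proof (rule dense_eq[OF cl(1)[of "FO Y (Dom N \<phi>)"] Q])
    fix n b assume n [simp]: "n \<in> Obj N" and "b \<in> Hom B (FO Y n) Q"
    then have b [simp]: "b \<in> Arr B" "Dom B b = FO Y n" "Cod B b = Q" by (auto simp: Hom_iff)
    let ?i = "Id A (FO H (FO Y (Dom N \<phi>)))" and ?i' = "Id A (FO H (FO Y (Cod N \<phi>)))" and ?j = "Id A (FO H (FO Y n))"
    let ?f = "FA H (FA Y \<phi>)"
    have "(M1 (Cod N \<phi>) Q \<cdot>\<^sub>A (?f \<otimes>\<^sub>S Id A (FO H Q))) \<cdot>\<^sub>A (?i \<otimes>\<^sub>S FA H b) =
      (M1 (Cod N \<phi>) Q \<cdot>\<^sub>A (?i' \<otimes>\<^sub>S FA H b)) \<cdot>\<^sub>A (?f \<otimes>\<^sub>S ?j)"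
      by (simp add: A.interchange)
    also have "... = FA H (Id B (FO Y (Cod N \<phi>)) \<otimes>\<^sub>T b) \<cdot>\<^sub>A w (Cod N \<phi>) n \<cdot>\<^sub>A (?f \<otimes>\<^sub>S ?j)"
      using M1nat[of "Cod N \<phi>" b] by (simp add: M1w)
    also have "... = FA H ((Id B (FO Y (Cod N \<phi>)) \<otimes>\<^sub>T b) \<cdot>\<^sub>B (FA Y \<phi> \<otimes>\<^sub>T Id B (FO Y n))) \<cdot>\<^sub>A w (Dom N \<phi>) n"
      by (simp add: w_nat_left H.FA_comp_simp)
    also have "... = FA H ((FA Y \<phi> \<otimes>\<^sub>T Id B Q) \<cdot>\<^sub>B (Id B (FO Y (Dom N \<phi>)) \<otimes>\<^sub>T b)) \<cdot>\<^sub>A w (Dom N \<phi>) n"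
      by (simp add: Y.T.interchange)
    also have "... = FA H (FA Y \<phi> \<otimes>\<^sub>T Id B Q) \<cdot>\<^sub>A (M1 (Dom N \<phi>) Q \<cdot>\<^sub>A (?i \<otimes>\<^sub>S FA H b))"
      using M1nat[of "Dom N \<phi>" b] by (simp add: M1w H.FA_comp_simp)
    finally show "(M1 (Cod N \<phi>) Q \<cdot>\<^sub>A (?f \<otimes>\<^sub>S Id A (FO H Q))) \<cdot>\<^sub>A FA (?L (FO Y (Dom N \<phi>))) b =
      (FA H (FA Y \<phi> \<otimes>\<^sub>T Id B Q) \<cdot>\<^sub>A M1 (Dom N \<phi>) Q) \<cdot>\<^sub>A FA (?L (FO Y (Dom N \<phi>))) b" by simp
  qed (auto simp: Hom_iff)
  have "\<exists>\<alpha>. nat_trans B A (?R Q) (?R' Q) \<alpha> \<and> (\<forall>m\<in>Obj N. \<alpha> (FO Y m) = M1 m Q)" if Q: "Q \<in> Obj B" for Q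
  proof (rule extend_nat[OF cr])
    fix \<phi> assume "\<phi> \<in> Arr N"
    then show "M1 (Cod N \<phi>) Q \<cdot>\<^sub>A FA (?R Q) (FA Y \<phi>) = FA (?R' Q) (FA Y \<phi>) \<cdot>\<^sub>A M1 (Dom N \<phi>) Q"
      using M1left[of \<phi> Q] Q by simp
  qed (use Q in "auto simp: Hom_iff")
  then obtain M2 where n2: "\<And>Q. Q \<in> Obj B ==> nat_trans B A (?R Q) (?R' Q) (M2 Q)"
    and M2M1: "\<And>m Q. m \<in> Obj N ==> Q \<in> Obj B ==> M2 Q (FO Y m) = M1 m Q" by metis
  have M2iso: "iso_arr A (M2 Q P)" if Q: "Q \<in> Obj B" and P: "P \<in> Obj B" for P Q
    by (rule extend_nat_iso[OF cr n2[OF Q] _ P]) (use Q in "auto simp: M2M1 M1iso")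
  have M2 [simp]: "M2 Q P \<in> Arr A" "Dom A (M2 Q P) = TO S (FO H P) (FO H Q)" "Cod A (M2 Q P) = FO H (TO T P Q)"
    if "P \<in> Obj B" "Q \<in> Obj B" for P Q
    using nat_trans.nat_simps[OF n2[OF that(2)] that(1)] that by auto
  have M2nat: "M2 Q (Cod B f) \<cdot>\<^sub>A (FA H f \<otimes>\<^sub>S Id A (FO H Q)) = FA H (f \<otimes>\<^sub>T Id B Q) \<cdot>\<^sub>A M2 Q (Dom B f)"
    if "Q \<in> Obj B" "f \<in> Arr B" for Q f
    using nat_trans.naturality[OF n2[OF that(1)] that(2)] that by simp
  have M2right: "M2 (Cod B g) P \<cdot>\<^sub>A (Id A (FO H P) \<otimes>\<^sub>S FA H g) = FA H (Id B P \<otimes>\<^sub>T g) \<cdot>\<^sub>A M2 (Dom B g) P"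
    if P [simp]: "P \<in> Obj B" and g [simp]: "g \<in> Arr B" for P g
  proof (rule dense_eq[OF cr(1)[of "Dom B g"] P])
    fix m a assume m [simp]: "m \<in> Obj N" and "a \<in> Hom B (FO Y m) P"
    then have a [simp]: "a \<in> Arr B" "Dom B a = FO Y m" "Cod B a = P" by (auto simp: Hom_iff)
    let ?i = "Id A (FO H (Dom B g))" and ?i' = "Id A (FO H (Cod B g))" and ?j = "Id A (FO H (FO Y m))"
    have "(M2 (Cod B g) P \<cdot>\<^sub>A (Id A (FO H P) \<otimes>\<^sub>S FA H g)) \<cdot>\<^sub>A (FA H a \<otimes>\<^sub>S ?i) =
      (M2 (Cod B g) P \<cdot>\<^sub>A (FA H a \<otimes>\<^sub>S ?i')) \<cdot>\<^sub>A (?j \<otimes>\<^sub>S FA H g)"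
      by (simp add: A.interchange)
    also have "... = FA H (a \<otimes>\<^sub>T Id B (Cod B g)) \<cdot>\<^sub>A M1 m (Cod B g) \<cdot>\<^sub>A (?j \<otimes>\<^sub>S FA H g)"
      using M2nat[of "Cod B g" a] by (simp add: M2M1)
    also have "... = FA H ((a \<otimes>\<^sub>T Id B (Cod B g)) \<cdot>\<^sub>B (Id B (FO Y m) \<otimes>\<^sub>T g)) \<cdot>\<^sub>A M1 m (Dom B g)"
      by (simp add: M1nat H.FA_comp_simp)
    also have "... = FA H ((Id B P \<otimes>\<^sub>T g) \<cdot>\<^sub>B (a \<otimes>\<^sub>T Id B (Dom B g))) \<cdot>\<^sub>A M1 m (Dom B g)"
      by (simp add: Y.T.interchange)
    also have "... = FA H (Id B P \<otimes>\<^sub>T g) \<cdot>\<^sub>A (M2 (Dom B g) P \<cdot>\<^sub>A (FA H a \<otimes>\<^sub>S ?i))"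
      using M2nat[of "Dom B g" a] by (simp add: M2M1 H.FA_comp_simp)
    finally show "(M2 (Cod B g) P \<cdot>\<^sub>A (Id A (FO H P) \<otimes>\<^sub>S FA H g)) \<cdot>\<^sub>A FA (?R (Dom B g)) a =
      (FA H (Id B P \<otimes>\<^sub>T g) \<cdot>\<^sub>A M2 (Dom B g) P) \<cdot>\<^sub>A FA (?R (Dom B g)) a" by simp
  qed (auto simp: Hom_iff)
  have nat: "M2 (Cod B g) (Cod B f) \<cdot>\<^sub>A (FA H f \<otimes>\<^sub>S FA H g) = FA H (f \<otimes>\<^sub>T g) \<cdot>\<^sub>A M2 (Dom B g) (Dom B f)"
    if [simp]: "f \<in> Arr B" "g \<in> Arr B" for f g
  proof -
    have "M2 (Cod B g) (Cod B f) \<cdot>\<^sub>A (FA H f \<otimes>\<^sub>S FA H g) =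
      (M2 (Cod B g) (Cod B f) \<cdot>\<^sub>A (FA H f \<otimes>\<^sub>S Id A (FO H (Cod B g)))) \<cdot>\<^sub>A (Id A (FO H (Dom B f)) \<otimes>\<^sub>S FA H g)"
      by (simp add: A.interchange)
    also have "... = FA H ((f \<otimes>\<^sub>T Id B (Cod B g)) \<cdot>\<^sub>B (Id B (Dom B f) \<otimes>\<^sub>T g)) \<cdot>\<^sub>A M2 (Dom B g) (Dom B f)"
      by (simp add: M2nat M2right H.FA_comp_simp)
    finally show ?thesis by (simp add: Y.T.interchange)
  qed
  show ?thesis
    by (rule exI[of _ "\<lambda>(P, Q)\<in>Obj B \<times> Obj B. M2 Q P"])
      (auto simp: Hom_iff M2iso nat M2M1 M1w)
qed

text \<open>
  Each axiom compares two natural maps out of a tensor product, so by density it holds as soon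
  as it does at the objects \<open>Y n\<close>; there it combines the axioms of \<open>Y\<close> and of \<open>H \<circ> Y\<close>.
\<close>

lemma extend_strong:
  "\<exists>M E. strong_sym_mon_functor B T A S H M E \<and>
    (\<forall>m\<in>Obj N. \<forall>n\<in>Obj N. FA H (\<mu> (m, n)) \<cdot>\<^sub>A M (FO Y m, FO Y n) = \<nu> (m, n)) \<and> FA H \<epsilon> \<cdot>\<^sub>A E = \<zeta>"
proof -
  obtain M where ext: "M \<in> extensional (Obj B \<times> Obj B)"
    and M: "\<forall>P\<in>Obj B. \<forall>Q\<in>Obj B. M (P, Q) \<in> Hom A (TO S (FO H P) (FO H Q)) (FO H (TO T P Q)) \<and> iso_arr A (M (P, Q))"
    and nat: "\<forall>f\<in>Arr B. \<forall>g\<in>Arr B. M (Cod B f, Cod B g) \<cdot>\<^sub>A (FA H f \<otimes>\<^sub>S FA H g) = FA H (f \<otimes>\<^sub>T g) \<cdot>\<^sub>A M (Dom B f, Dom B g)"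
    and Mw: "\<forall>m\<in>Obj N. \<forall>n\<in>Obj N. M (FO Y m, FO Y n) = w m n"
    using structure_exists by (elim exE conjE) (rule that)
  have Ms [simp]: "M (P, Q) \<in> Arr A" "Dom A (M (P, Q)) = TO S (FO H P) (FO H Q)" "Cod A (M (P, Q)) = FO H (TO T P Q)"
    "iso_arr A (M (P, Q))" if "P \<in> Obj B" "Q \<in> Obj B" for P Q
    using M[rule_format, OF that] unfolding Hom_iff by simp_all
  have Mn: "M (P', Q') \<cdot>\<^sub>A (FA H f \<otimes>\<^sub>S FA H g) = FA H (f \<otimes>\<^sub>T g) \<cdot>\<^sub>A M (P, Q)"
    if "f \<in> Arr B" "Dom B f = P" "Cod B f = P'" "g \<in> Arr B" "Dom B g = Q" "Cod B g = Q'" for f g P Q P' Q'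
    using nat[rule_format, OF that(1,4)] unfolding that .
  have Mnl: "M (P', Q) \<cdot>\<^sub>A (FA H f \<otimes>\<^sub>S Id A (FO H Q)) = FA H (f \<otimes>\<^sub>T Id B Q) \<cdot>\<^sub>A M (P, Q)"
    if "f \<in> Arr B" "Dom B f = P" "Cod B f = P'" "Q \<in> Obj B" for f P Q P'
    using Mn[OF that(1-3), of "Id B Q" Q Q] that(4) by simp
  have Mnr: "M (P, Q') \<cdot>\<^sub>A (Id A (FO H P) \<otimes>\<^sub>S FA H f) = FA H (Id B P \<otimes>\<^sub>T f) \<cdot>\<^sub>A M (P, Q)"
    if "f \<in> Arr B" "Dom B f = Q" "Cod B f = Q'" "P \<in> Obj B" for f P Q Q'
    using Mn[of "Id B P" P P, OF _ _ _ that(1-3)] that(4) by simp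
  let ?i = "\<lambda>m n. inv_arr B (\<mu> (m, n))" and ?o = "\<lambda>m. Id A (FO H (FO Y m))" and ?I = "\<lambda>m. Id B (FO Y m)"
  define E where "E = FA H (inv_arr B \<epsilon>) \<cdot>\<^sub>A \<zeta>"
  have E [simp]: "E \<in> Arr A" "Dom A E = TI S" "Cod A E = FO H (TI T)" by (auto simp: E_def)
  have Eiso: "iso_arr A E" using K.mu_simps(4) by (simp add: E_def)
  have HE: "FA H \<epsilon> \<cdot>\<^sub>A E = \<zeta>"
    using A.comp_reduce[OF H.FA_comp_simp[symmetric], of "inv_arr B \<epsilon>" \<epsilon> \<zeta>] by (simp add: E_def)
  have HM: "FA H (\<mu> (m, n)) \<cdot>\<^sub>A M (FO Y m, FO Y n) = \<nu> (m, n)" if "m \<in> Obj N" "n \<in> Obj N" for m n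
    using A.comp_reduce[OF H.FA_comp_simp[symmetric], of "?i m n" "\<mu> (m, n)" "\<nu> (m, n)"] that by (simp add: Mw w_def)
  have assoc0: "FA H (Assoc T (FO Y m) (FO Y n) (FO Y k)) \<cdot>\<^sub>A M (TO T (FO Y m) (FO Y n), FO Y k) \<cdot>\<^sub>A (M (FO Y m, FO Y n) \<otimes>\<^sub>S ?o k) =
    M (FO Y m, TO T (FO Y n) (FO Y k)) \<cdot>\<^sub>A (?o m \<otimes>\<^sub>S M (FO Y n, FO Y k)) \<cdot>\<^sub>A Assoc S (FO H (FO Y m)) (FO H (FO Y n)) (FO H (FO Y k))"
    if [simp]: "m \<in> Obj N" "n \<in> Obj N" "k \<in> Obj N" for m n k
  proof -
    let ?a = "Assoc T (FO Y m) (FO Y n) (FO Y k)" and ?a' = "Assoc S (FO H (FO Y m)) (FO H (FO Y n)) (FO H (FO Y k))"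
    let ?mn = "TO TN m n" and ?nk = "TO TN n k"
    have ya: "?a \<cdot>\<^sub>B (?i m n \<otimes>\<^sub>T ?I k) \<cdot>\<^sub>B ?i ?mn k = (?I m \<otimes>\<^sub>T ?i n k) \<cdot>\<^sub>B ?i m ?nk \<cdot>\<^sub>B FA Y (Assoc TN m n k)"
    proof (rule Y.T.iso_cancel_right[of "\<mu> (?mn, k) \<cdot>\<^sub>B (\<mu> (m, n) \<otimes>\<^sub>T ?I k)"])
      have "(?a \<cdot>\<^sub>B (?i m n \<otimes>\<^sub>T ?I k) \<cdot>\<^sub>B ?i ?mn k) \<cdot>\<^sub>B \<mu> (?mn, k) \<cdot>\<^sub>B (\<mu> (m, n) \<otimes>\<^sub>T ?I k) = ?a"
        by (simp add: Y.T.interchange)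
      also have "... = (?I m \<otimes>\<^sub>T ?i n k) \<cdot>\<^sub>B ?i m ?nk \<cdot>\<^sub>B \<mu> (m, ?nk) \<cdot>\<^sub>B (?I m \<otimes>\<^sub>T \<mu> (n, k)) \<cdot>\<^sub>B ?a"
        by (simp add: Y.T.interchange_re)
      also have "\<mu> (m, ?nk) \<cdot>\<^sub>B (?I m \<otimes>\<^sub>T \<mu> (n, k)) \<cdot>\<^sub>B ?a = FA Y (Assoc TN m n k) \<cdot>\<^sub>B \<mu> (?mn, k) \<cdot>\<^sub>B (\<mu> (m, n) \<otimes>\<^sub>T ?I k)"
        by (rule Y.mu_assoc[symmetric]) simp_all
      finally show "(?a \<cdot>\<^sub>B (?i m n \<otimes>\<^sub>T ?I k) \<cdot>\<^sub>B ?i ?mn k) \<cdot>\<^sub>B \<mu> (?mn, k) \<cdot>\<^sub>B (\<mu> (m, n) \<otimes>\<^sub>T ?I k) =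
        ((?I m \<otimes>\<^sub>T ?i n k) \<cdot>\<^sub>B ?i m ?nk \<cdot>\<^sub>B FA Y (Assoc TN m n k)) \<cdot>\<^sub>B \<mu> (?mn, k) \<cdot>\<^sub>B (\<mu> (m, n) \<otimes>\<^sub>T ?I k)"
        by simp
    qed auto
    have "FA H ?a \<cdot>\<^sub>A M (TO T (FO Y m) (FO Y n), FO Y k) \<cdot>\<^sub>A (M (FO Y m, FO Y n) \<otimes>\<^sub>S ?o k) =
      FA H ?a \<cdot>\<^sub>A (M (TO T (FO Y m) (FO Y n), FO Y k) \<cdot>\<^sub>A (FA H (?i m n) \<otimes>\<^sub>S ?o k)) \<cdot>\<^sub>A (\<nu> (m, n) \<otimes>\<^sub>S ?o k)"
      by (simp add: Mw w_def A.right_comp)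
    also have "... = FA H (?a \<cdot>\<^sub>B (?i m n \<otimes>\<^sub>T ?I k) \<cdot>\<^sub>B ?i ?mn k) \<cdot>\<^sub>A \<nu> (?mn, k) \<cdot>\<^sub>A (\<nu> (m, n) \<otimes>\<^sub>S ?o k)"
      by (subst Mnl[of _ "FO Y ?mn"]) (simp_all add: Mw w_def H.FA_comp_simp)
    also have "... = FA H (?I m \<otimes>\<^sub>T ?i n k) \<cdot>\<^sub>A FA H (?i m ?nk) \<cdot>\<^sub>A (FA H (FA Y (Assoc TN m n k)) \<cdot>\<^sub>A \<nu> (?mn, k) \<cdot>\<^sub>A (\<nu> (m, n) \<otimes>\<^sub>S ?o k))"
      unfolding ya by (simp add: H.FA_comp_simp)
    also have "... = (FA H (?I m \<otimes>\<^sub>T ?i n k) \<cdot>\<^sub>A w m ?nk) \<cdot>\<^sub>A (?o m \<otimes>\<^sub>S \<nu> (n, k)) \<cdot>\<^sub>A ?a'"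
      using K.mu_assoc[of m n k] by (simp add: w_def)
    also have "FA H (?I m \<otimes>\<^sub>T ?i n k) \<cdot>\<^sub>A w m ?nk = M (FO Y m, TO T (FO Y n) (FO Y k)) \<cdot>\<^sub>A (?o m \<otimes>\<^sub>S FA H (?i n k))"
      by (subst Mnr[of _ "FO Y ?nk"]) (simp_all add: Mw)
    also have "(M (FO Y m, TO T (FO Y n) (FO Y k)) \<cdot>\<^sub>A (?o m \<otimes>\<^sub>S FA H (?i n k))) \<cdot>\<^sub>A (?o m \<otimes>\<^sub>S \<nu> (n, k)) \<cdot>\<^sub>A ?a' =
      M (FO Y m, TO T (FO Y n) (FO Y k)) \<cdot>\<^sub>A (?o m \<otimes>\<^sub>S M (FO Y n, FO Y k)) \<cdot>\<^sub>A ?a'"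
      by (simp add: Mw w_def A.interchange_re)
    finally show ?thesis .
  qed
  have lunit0: "FA H (LUnit T (FO Y n)) \<cdot>\<^sub>A M (TI T, FO Y n) \<cdot>\<^sub>A (E \<otimes>\<^sub>S ?o n) = LUnit S (FO H (FO Y n))"
    if [simp]: "n \<in> Obj N" for n
  proof -
    have y: "LUnit T (FO Y n) \<cdot>\<^sub>B (inv_arr B \<epsilon> \<otimes>\<^sub>T ?I n) \<cdot>\<^sub>B ?i (TI TN) n = FA Y (LUnit TN n)"
      unfolding Y.mu_lunit[OF that, symmetric] by (simp add: Y.T.interchange_re)
    have "FA H (LUnit T (FO Y n)) \<cdot>\<^sub>A M (TI T, FO Y n) \<cdot>\<^sub>A (E \<otimes>\<^sub>S ?o n) =
      FA H (LUnit T (FO Y n)) \<cdot>\<^sub>A (M (TI T, FO Y n) \<cdot>\<^sub>A (FA H (inv_arr B \<epsilon>) \<otimes>\<^sub>S ?o n)) \<cdot>\<^sub>A (\<zeta> \<otimes>\<^sub>S ?o n)"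
      by (simp add: E_def A.right_comp)
    also have "... = FA H (LUnit T (FO Y n) \<cdot>\<^sub>B (inv_arr B \<epsilon> \<otimes>\<^sub>T ?I n) \<cdot>\<^sub>B ?i (TI TN) n) \<cdot>\<^sub>A \<nu> (TI TN, n) \<cdot>\<^sub>A (\<zeta> \<otimes>\<^sub>S ?o n)"
      by (subst Mnl[of _ "FO Y (TI TN)"]) (simp_all add: Mw w_def H.FA_comp_simp)
    also have "... = LUnit S (FO H (FO Y n))" unfolding y using K.mu_lunit[of n] by simp
    finally show ?thesis .
  qed
  have braid0: "FA H (Braid T (FO Y m) (FO Y n)) \<cdot>\<^sub>A M (FO Y m, FO Y n) = M (FO Y n, FO Y m) \<cdot>\<^sub>A Braid S (FO H (FO Y m)) (FO H (FO Y n))"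
    if [simp]: "m \<in> Obj N" "n \<in> Obj N" for m n
  proof -
    have y: "Braid T (FO Y m) (FO Y n) \<cdot>\<^sub>B ?i m n = ?i n m \<cdot>\<^sub>B FA Y (Braid TN m n)"
    proof (rule Y.T.iso_cancel_right[of "\<mu> (m, n)"])
      show "(Braid T (FO Y m) (FO Y n) \<cdot>\<^sub>B ?i m n) \<cdot>\<^sub>B \<mu> (m, n) = (?i n m \<cdot>\<^sub>B FA Y (Braid TN m n)) \<cdot>\<^sub>B \<mu> (m, n)"
        by (simp add: Y.mu_braid)
    qed auto
    have "FA H (Braid T (FO Y m) (FO Y n)) \<cdot>\<^sub>A M (FO Y m, FO Y n) = FA H (Braid T (FO Y m) (FO Y n) \<cdot>\<^sub>B ?i m n) \<cdot>\<^sub>A \<nu> (m, n)"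
      by (simp add: Mw w_def H.FA_comp_simp)
    also have "... = FA H (?i n m) \<cdot>\<^sub>A FA H (FA Y (Braid TN m n)) \<cdot>\<^sub>A \<nu> (m, n)"
      unfolding y by (simp add: H.FA_comp_simp)
    also have "FA H (FA Y (Braid TN m n)) \<cdot>\<^sub>A \<nu> (m, n) = \<nu> (n, m) \<cdot>\<^sub>A Braid S (FO H (FO Y m)) (FO H (FO Y n))"
      using K.mu_braid[of m n] by simp
    finally show ?thesis by (simp add: Mw w_def)
  qed
  have "strong_sym_mon_functor B T A S H M E"
  proof (rule strong_sym_mon_functorI, goal_cases)
    case (6 f g) then show ?case by (intro Mn) auto
  next
    case (9 P Q R)
    note [simp] = 9
    show ?case
    proof (rule dense_eq3[OF H 9])
      fix m n k a b c assume [simp]: "m \<in> Obj N" "n \<in> Obj N" "k \<in> Obj N"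
        and "a \<in> Hom B (FO Y m) P" "b \<in> Hom B (FO Y n) Q" "c \<in> Hom B (FO Y k) R"
      then have [simp]: "a \<in> Arr B" "Dom B a = FO Y m" "Cod B a = P" "b \<in> Arr B" "Dom B b = FO Y n" "Cod B b = Q"
         "c \<in> Arr B" "Dom B c = FO Y k" "Cod B c = R" by (auto simp: Hom_iff)
      let ?abc = "(FA H a \<otimes>\<^sub>S FA H b) \<otimes>\<^sub>S FA H c"
      let ?l = "FA H (Assoc T P Q R) \<cdot>\<^sub>A M (TO T P Q, R) \<cdot>\<^sub>A (M (P, Q) \<otimes>\<^sub>S Id A (FO H R))"
      let ?r = "M (P, TO T Q R) \<cdot>\<^sub>A (Id A (FO H P) \<otimes>\<^sub>S M (Q, R)) \<cdot>\<^sub>A Assoc S (FO H P) (FO H Q) (FO H R)"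
      have "?l \<cdot>\<^sub>A ?abc = FA H (Assoc T P Q R) \<cdot>\<^sub>A M (TO T P Q, R) \<cdot>\<^sub>A ((M (P, Q) \<cdot>\<^sub>A (FA H a \<otimes>\<^sub>S FA H b)) \<otimes>\<^sub>S FA H c)"
        by (simp add: A.interchange)
      also have "... = FA H (Assoc T P Q R) \<cdot>\<^sub>A (M (TO T P Q, R) \<cdot>\<^sub>A (FA H (a \<otimes>\<^sub>T b) \<otimes>\<^sub>S FA H c)) \<cdot>\<^sub>A (M (FO Y m, FO Y n) \<otimes>\<^sub>S ?o k)"
        by (simp add: Mn[of a "FO Y m" P b "FO Y n" Q] A.interchange)
      also have "... = FA H (Assoc T P Q R \<cdot>\<^sub>B ((a \<otimes>\<^sub>T b) \<otimes>\<^sub>T c)) \<cdot>\<^sub>A M (TO T (FO Y m) (FO Y n), FO Y k) \<cdot>\<^sub>A (M (FO Y m, FO Y n) \<otimes>\<^sub>S ?o k)"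
        by (simp add: Mn[of "a \<otimes>\<^sub>T b" "TO T (FO Y m) (FO Y n)" "TO T P Q" c "FO Y k" R] H.FA_comp_simp)
      also have "... = FA H (a \<otimes>\<^sub>T (b \<otimes>\<^sub>T c)) \<cdot>\<^sub>A (FA H (Assoc T (FO Y m) (FO Y n) (FO Y k)) \<cdot>\<^sub>A M (TO T (FO Y m) (FO Y n), FO Y k) \<cdot>\<^sub>A (M (FO Y m, FO Y n) \<otimes>\<^sub>S ?o k))"
        by (simp add: Y.T.assoc_nat H.FA_comp_simp)
      also have "... = (FA H (a \<otimes>\<^sub>T (b \<otimes>\<^sub>T c)) \<cdot>\<^sub>A M (FO Y m, TO T (FO Y n) (FO Y k))) \<cdot>\<^sub>A (?o m \<otimes>\<^sub>S M (FO Y n, FO Y k)) \<cdot>\<^sub>A Assoc S (FO H (FO Y m)) (FO H (FO Y n)) (FO H (FO Y k))"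
        unfolding assoc0[OF \<open>m \<in> Obj N\<close> \<open>n \<in> Obj N\<close> \<open>k \<in> Obj N\<close>] by simp
      also have "FA H (a \<otimes>\<^sub>T (b \<otimes>\<^sub>T c)) \<cdot>\<^sub>A M (FO Y m, TO T (FO Y n) (FO Y k)) = M (P, TO T Q R) \<cdot>\<^sub>A (FA H a \<otimes>\<^sub>S FA H (b \<otimes>\<^sub>T c))"
        by (rule Mn[symmetric]) simp_all
      also have "(M (P, TO T Q R) \<cdot>\<^sub>A (FA H a \<otimes>\<^sub>S FA H (b \<otimes>\<^sub>T c))) \<cdot>\<^sub>A (?o m \<otimes>\<^sub>S M (FO Y n, FO Y k)) \<cdot>\<^sub>A Assoc S (FO H (FO Y m)) (FO H (FO Y n)) (FO H (FO Y k)) =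
        M (P, TO T Q R) \<cdot>\<^sub>A (FA H a \<otimes>\<^sub>S (M (Q, R) \<cdot>\<^sub>A (FA H b \<otimes>\<^sub>S FA H c))) \<cdot>\<^sub>A Assoc S (FO H (FO Y m)) (FO H (FO Y n)) (FO H (FO Y k))"
        by (simp add: Mn[of b "FO Y n" Q c "FO Y k" R] A.interchange_re)
      also have "... = ?r \<cdot>\<^sub>A ?abc"
        by (simp add: A.assoc_nat A.interchange_re)
      finally show "?l \<cdot>\<^sub>A ?abc = ?r \<cdot>\<^sub>A ?abc" .
    qed (auto simp: Hom_iff)
  next
    case (10 P)
    note [simp] = 10
    show ?case
    proof (rule dense_eq[OF cocont_tensor(1)[OF H A.tensor_simps(2)] 10])
      fix n a assume n [simp]: "n \<in> Obj N" and "a \<in> Hom B (FO Y n) P"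
      then have [simp]: "a \<in> Arr B" "Dom B a = FO Y n" "Cod B a = P" by (auto simp: Hom_iff)
      have "(FA H (LUnit T P) \<cdot>\<^sub>A M (TI T, P) \<cdot>\<^sub>A (E \<otimes>\<^sub>S Id A (FO H P))) \<cdot>\<^sub>A (Id A (TI S) \<otimes>\<^sub>S FA H a) =
        FA H (LUnit T P) \<cdot>\<^sub>A (M (TI T, P) \<cdot>\<^sub>A (Id A (FO H (TI T)) \<otimes>\<^sub>S FA H a)) \<cdot>\<^sub>A (E \<otimes>\<^sub>S ?o n)"
        by (simp add: A.interchange)
      also have "... = FA H (LUnit T P \<cdot>\<^sub>B (Id B (TI T) \<otimes>\<^sub>T a)) \<cdot>\<^sub>A M (TI T, FO Y n) \<cdot>\<^sub>A (E \<otimes>\<^sub>S ?o n)"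
        by (simp add: Mnr[of a "FO Y n" P] H.FA_comp_simp)
      also have "... = FA H a \<cdot>\<^sub>A (FA H (LUnit T (FO Y n)) \<cdot>\<^sub>A M (TI T, FO Y n) \<cdot>\<^sub>A (E \<otimes>\<^sub>S ?o n))"
        using Y.T.lunit_nat[of a] by (simp add: H.FA_comp_simp)
      also have "... = LUnit S (FO H P) \<cdot>\<^sub>A (Id A (TI S) \<otimes>\<^sub>S FA H a)"
        unfolding lunit0[OF n] using A.lunit_nat[of "FA H a"] by simp
      finally show "(FA H (LUnit T P) \<cdot>\<^sub>A M (TI T, P) \<cdot>\<^sub>A (E \<otimes>\<^sub>S Id A (FO H P))) \<cdot>\<^sub>A FA (compf B H (tensor_left A S (TI S))) a =
        LUnit S (FO H P) \<cdot>\<^sub>A FA (compf B H (tensor_left A S (TI S))) a" by simp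
    qed (auto simp: Hom_iff)
  next
    case (11 P Q)
    note [simp] = 11
    show ?case
    proof (rule dense_eq2[OF H H 11])
      fix m n a b assume mn [simp]: "m \<in> Obj N" "n \<in> Obj N" and "a \<in> Hom B (FO Y m) P" "b \<in> Hom B (FO Y n) Q"
      then have [simp]: "a \<in> Arr B" "Dom B a = FO Y m" "Cod B a = P" "b \<in> Arr B" "Dom B b = FO Y n" "Cod B b = Q"
        by (auto simp: Hom_iff)
      have "(FA H (Braid T P Q) \<cdot>\<^sub>A M (P, Q)) \<cdot>\<^sub>A (FA H a \<otimes>\<^sub>S FA H b) =
        FA H (Braid T P Q \<cdot>\<^sub>B (a \<otimes>\<^sub>T b)) \<cdot>\<^sub>A M (FO Y m, FO Y n)"
        by (simp add: Mn[of a "FO Y m" P b "FO Y n" Q] H.FA_comp_simp)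
      also have "... = FA H (b \<otimes>\<^sub>T a) \<cdot>\<^sub>A (FA H (Braid T (FO Y m) (FO Y n)) \<cdot>\<^sub>A M (FO Y m, FO Y n))"
        by (simp add: Y.T.braid_nat H.FA_comp_simp)
      also have "... = (FA H (b \<otimes>\<^sub>T a) \<cdot>\<^sub>A M (FO Y n, FO Y m)) \<cdot>\<^sub>A Braid S (FO H (FO Y m)) (FO H (FO Y n))"
        unfolding braid0[OF mn] by simp
      also have "FA H (b \<otimes>\<^sub>T a) \<cdot>\<^sub>A M (FO Y n, FO Y m) = M (Q, P) \<cdot>\<^sub>A (FA H b \<otimes>\<^sub>S FA H a)"
        by (rule Mn[symmetric]) simp_all
      also have "(M (Q, P) \<cdot>\<^sub>A (FA H b \<otimes>\<^sub>S FA H a)) \<cdot>\<^sub>A Braid S (FO H (FO Y m)) (FO H (FO Y n)) =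
        (M (Q, P) \<cdot>\<^sub>A Braid S (FO H P) (FO H Q)) \<cdot>\<^sub>A (FA H a \<otimes>\<^sub>S FA H b)"
        by (simp add: A.braid_nat)
      finally show "(FA H (Braid T P Q) \<cdot>\<^sub>A M (P, Q)) \<cdot>\<^sub>A (FA H a \<otimes>\<^sub>S FA H b) =
        (M (Q, P) \<cdot>\<^sub>A Braid S (FO H P) (FO H Q)) \<cdot>\<^sub>A (FA H a \<otimes>\<^sub>S FA H b)" .
    qed (auto simp: Hom_iff)
  qed (use ext Eiso in "auto simp: Hom_iff Y.T.sym_mon_cat_axioms A.sym_mon_cat_axioms H.cfunctor_axioms")
  then show ?thesis using HM HE by blast
qed

end

end

section \<open>Extension along the Yoneda embedding\<close>

declare Q_simps [simp]

context small_universe begin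

lemma Hom_hrep: "P \<in> Obj Qc ==> Hom Qc (hrep n) P = ya P n ` FO (P :: 'u q_obj) n"
proof (intro equalityI subsetI)
  fix a assume "a \<in> Hom Qc (hrep n) P"
  then show "a \<in> ya P n ` FO P n" using yoneda_unique[of a n P] unfolding Hom_iff Q_simps by blast
qed (auto simp: Hom_iff)

lemma hrep_inj: assumes "(hrep m :: 'u q_obj) = hrep n" shows "m = n"
proof -
  have "(enc (Id NCat n) :: 'u) \<in> FO (hrep m) n" unfolding assms by simp
  then obtain \<psi> where "\<psi> \<in> Arr NCat" "fst \<psi> = m" "(enc (Id NCat n) :: 'u) = enc \<psi>" by (rule hrepE)
  then have "fst (Id NCat n) = m" by (metis dec_enc N_comp_arr(2))
  then show ?thesis by simp
qed

lemma yoneda_dense: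
  assumes G: "cfunctor (Qc :: ('u q_obj, 'u q_arr) cat) A G" "preserves_small_colimits TYPE('u) Qc A G"
    and P: "P \<in> Obj Qc" and Z: "Z \<in> Obj A"
    and d: "\<And>n a. a \<in> Hom Qc (hrep n) P ==> d n a \<in> Hom A (FO G (hrep n)) Z"
      "\<And>\<phi> a. \<phi> \<in> Arr NCat ==> a \<in> Hom Qc (hrep (fst \<phi>)) P ==>
        d (tgt \<phi>) (a \<cdot>\<^bsub>Qc\<^esub> pre \<phi>) = d (fst \<phi>) a \<cdot>\<^sub>A FA G (pre \<phi>)"
  shows "\<exists>!h. h \<in> Hom A (FO G P) Z \<and> (\<forall>n. \<forall>a\<in>Hom Qc (hrep n) P. h \<cdot>\<^sub>A FA G a = d n a)"
proof -
  have "elcolimit A (compf (op NCat) yoneda G) P (FO G P) (\<lambda>n x. FA G (ya P n x))"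
    by (rule elcolimit_preserved[OF G(2,1) P yoneda_functor elcolimit_yoneda[OF P]])
  moreover have "elcocone A (compf (op NCat) yoneda G) P Z (\<lambda>n x. d n (ya P n x))"
    unfolding elcocone_def
  proof (intro conjI allI ballI)
    fix n x assume "x \<in> FO P n"
    then show "d n (ya P n x) \<in> Hom A (FO (compf (op NCat) yoneda G) n) Z"
      using d(1)[of "ya P n x" n] by (simp add: Hom_hrep[OF P])
  next
    fix \<phi> x assume \<phi>: "\<phi> \<in> Arr NCat" and x: "x \<in> FO P (fst \<phi>)"
    then show "d (tgt \<phi>) (ya P (tgt \<phi>) (act P \<phi> x)) =
       d (fst \<phi>) (ya P (fst \<phi>) x) \<cdot>\<^sub>A FA (compf (op NCat) yoneda G) \<phi>"
      using d(2)[OF \<phi>, of "ya P (fst \<phi>) x"] by (simp add: Hom_hrep[OF P] pre_ya[OF P])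
  qed (rule Z)
  ultimately have "\<exists>!h. h \<in> Hom A (FO G P) Z \<and> (\<forall>n. \<forall>x\<in>FO P n. h \<cdot>\<^sub>A FA G (ya P n x) = d n (ya P n x))"
    unfolding elcolimit_def by blast
  then show ?thesis by (simp only: Hom_hrep[OF P] ball_simps)
qed

lemma dense_monoidal_yoneda:
  assumes T: "extends_disjoint_union (T :: ('u q_obj, 'u q_arr) tensor) \<mu> \<epsilon>"
    and A: "sym_mon_cat A S" "tensor_cocontinuous TYPE('u) A S"
  shows "dense_monoidal TYPE('u) (op NCat) (op_tensor NCat NTensor) Qc T yoneda \<mu> \<epsilon> A S"
proof -
  have Y: "strong_sym_mon_functor (op NCat) (op_tensor NCat NTensor) Qc T yoneda \<mu> \<epsilon>" "tensor_cocontinuous TYPE('u) Qc T"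
    using T by (auto simp: extends_disjoint_union_def)
  show ?thesis
  proof (intro dense_monoidal.intro Y(1) A(1) dense_monoidal_axioms.intro Y(2) A(2))
    fix G and P :: "'u q_obj" and Z d assume "cfunctor (Qc :: ('u q_obj, 'u q_arr) cat) A G" "preserves_small_colimits TYPE('u) Qc A G" "P \<in> Obj Qc" "Z \<in> Obj A"
      and d: "\<And>n a. n \<in> Obj (op NCat) ==> a \<in> Hom Qc (FO yoneda n) P ==> d n a \<in> Hom A (FO G (FO yoneda n)) Z"
      "\<And>\<phi> a. \<phi> \<in> Arr (op NCat) ==> a \<in> Hom Qc (FO yoneda (Cod (op NCat) \<phi>)) P ==>
         d (Dom (op NCat) \<phi>) (a \<cdot>\<^bsub>Qc\<^esub> FA yoneda \<phi>) = d (Cod (op NCat) \<phi>) a \<cdot>\<^sub>A FA G (FA yoneda \<phi>)"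
    then show "\<exists>!h. h \<in> Hom A (FO G P) Z \<and> (\<forall>n\<in>Obj (op NCat). \<forall>a\<in>Hom Qc (FO yoneda n) P. h \<cdot>\<^sub>A FA G a = d n a)"
      using yoneda_dense[of A G P Z d] d by simp
  qed
qed

text \<open>
  The identity of \<open>n\<close> is a terminal object of the category of elements of \<open>h\<^sub>n\<close>.
\<close>

lemma elcolimit_hrep:
  assumes "cfunctor (op NCat) A K"
  shows "elcolimit A K (hrep n :: 'u q_obj) (FO K n) (\<lambda>k z. FA K (dec z))"
proof -
  interpret K: cfunctor "op NCat" A K by fact
  have Kc: "FA K (Comp NCat \<phi> \<psi>) = FA K \<psi> \<cdot>\<^sub>A FA K \<phi>" if "\<phi> \<in> Arr NCat" "\<psi> \<in> Arr NCat" "fst \<phi> = tgt \<psi>" for \<phi> \<psi>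
    using K.FA_comp_simp[of \<phi> \<psi>] that by simp
  have Ki: "FA K (Id NCat n) = Id A (FO K n)" for n using K.FA_id[of n] by simp
  show ?thesis unfolding elcolimit_def
  proof (intro conjI allI impI)
    show "elcocone A K (hrep n :: 'u q_obj) (FO K n) (\<lambda>k z. FA K (dec z))"
      unfolding elcocone_def by (auto elim!: hrepE simp: Hom_iff Kc)
  next
    fix Y d assume d: "elcocone A K (hrep n :: 'u q_obj) Y d"
    have d1: "d k z \<in> Hom A (FO K k) Y" if "z \<in> FO (hrep n) k" for k z using d that by (simp add: elcocone_def)
    have d2: "d (tgt \<phi>) (act (hrep n) \<phi> z) = d (fst \<phi>) z \<cdot>\<^sub>A FA K \<phi>" if "\<phi> \<in> Arr NCat" "z \<in> FO (hrep n) (fst \<phi>)" for \<phi> z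
      using d that by (simp add: elcocone_def)
    let ?h = "d n (enc (Id NCat n))"
    show "\<exists>!h. h \<in> Hom A (FO K n) Y \<and> (\<forall>k. \<forall>z\<in>FO (hrep n) k. h \<cdot>\<^sub>A FA K (dec z) = d k z)"
    proof (rule ex1I[of _ ?h], intro conjI allI ballI)
      show "?h \<in> Hom A (FO K n) Y" by (rule d1) simp
      fix k z assume "z \<in> FO (hrep n :: 'u q_obj) k"
      then obtain \<psi> where "\<psi> \<in> Arr NCat" "fst \<psi> = n" "tgt \<psi> = k" "z = enc \<psi>" by (rule hrepE)
      then show "?h \<cdot>\<^sub>A FA K (dec z) = d k z" using d2[of \<psi> "enc (Id NCat n)"] by simp
    next
      fix h assume h: "h \<in> Hom A (FO K n) Y \<and> (\<forall>k. \<forall>z\<in>FO (hrep n :: 'u q_obj) k. h \<cdot>\<^sub>A FA K (dec z) = d k z)"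
      have "h \<cdot>\<^sub>A FA K (dec (enc (Id NCat n) :: 'u)) = ?h" by (rule conjunct2[OF h, rule_format]) simp
      then show "h = ?h" using conjunct1[OF h] by (simp add: Ki Hom_iff)
    qed
  qed
qed

text \<open>
  The right adjoint sends \<open>Y\<close> to the functor \<open>n \<mapsto> Hom(K n, Y)\<close>, its values being copied into the
  universe.
\<close>

definition nerve_ob :: "('o, 'a) cat \<Rightarrow> (nat, fin_map, 'o, 'a) cfun \<Rightarrow> 'o \<Rightarrow> 'u q_obj" where
  "nerve_ob A K Y = mkob (\<lambda>n. code_of (Hom A (FO K n) Y) ` Hom A (FO K n) Y)
     (\<lambda>\<phi> z. code_of (Hom A (FO K (tgt \<phi>)) Y) (decode (Hom A (FO K (fst \<phi>)) Y) z \<cdot>\<^sub>A FA K \<phi>))"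

definition nerve_ar :: "('o, 'a) cat \<Rightarrow> (nat, fin_map, 'o, 'a) cfun \<Rightarrow> 'a \<Rightarrow> 'u q_arr" where
  "nerve_ar A K f = mkar (nerve_ob A K (Dom A f))
     (\<lambda>n z. code_of (Hom A (FO K n) (Cod A f)) (f \<cdot>\<^sub>A decode (Hom A (FO K n) (Dom A f)) z))
     (nerve_ob A K (Cod A f))"

definition nerve :: "('o, 'a) cat \<Rightarrow> (nat, fin_map, 'o, 'a) cfun \<Rightarrow> ('o, 'a, 'u q_obj, 'u q_arr) cfun" where
  "nerve A K = \<lparr>FO = (\<lambda>Y\<in>Obj A. nerve_ob A K Y), FA = (\<lambda>f\<in>Arr A. nerve_ar A K f)\<rparr>"

context
  fixes A :: "('o, 'a) cat" and K
  assumes K: "cfunctor (op NCat) A K" and ls: "locally_small TYPE('u) A"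
begin

interpretation K: cfunctor "op NCat" A K by (rule K)

abbreviation cd :: "nat \<Rightarrow> 'o \<Rightarrow> 'a \<Rightarrow> 'u" where "cd n Y \<equiv> code_of (Hom A (FO K n) Y)"

lemma Hom_small [simp]: "Y \<in> Obj A ==> small TYPE('u) (Hom A (FO K n) Y)"
  using ls by (simp add: locally_small_def)

lemma K_comp: "[|\<phi> \<in> Arr NCat; \<psi> \<in> Arr NCat; fst \<phi> = tgt \<psi>|] ==> FA K (Comp NCat \<phi> \<psi>) = FA K \<psi> \<cdot>\<^sub>A FA K \<phi>"
  using K.FA_comp_simp[of \<phi> \<psi>] by simp

lemma K_id: "FA K (Id NCat n) = Id A (FO K n)" using K.FA_id[of n] by simp

lemma nerve_FO: "FO (nerve_ob A K Y :: 'u q_obj) n = cd n Y ` Hom A (FO K n) Y"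
  by (simp add: nerve_ob_def)

lemma nerve_mem [simp]: "[|g \<in> Arr A; Dom A g = FO K n; Cod A g = Y|] ==> cd n Y g \<in> FO (nerve_ob A K Y) n"
  by (simp add: nerve_FO Hom_iff)

lemma nerveE:
  assumes "z \<in> FO (nerve_ob A K Y :: 'u q_obj) n"
  obtains g where "g \<in> Arr A" "Dom A g = FO K n" "Cod A g = Y" "z = cd n Y g"
  using assms by (auto simp: nerve_FO Hom_iff)

lemma decode_cd [simp]: "[|g \<in> Arr A; Dom A g = FO K n; Cod A g = Y|] ==> decode (Hom A (FO K n) Y) (cd n Y g) = g"
  using K.T.arr_simps(2)[of g] by (intro decode_code) (auto simp: Hom_iff)

lemma nerve_act [simp]:
  "[|\<phi> \<in> Arr NCat; g \<in> Arr A; Dom A g = FO K (fst \<phi>); Cod A g = Y|] ==>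
    act (nerve_ob A K Y) \<phi> (cd (fst \<phi>) Y g) = cd (tgt \<phi>) Y (g \<cdot>\<^sub>A FA K \<phi>)"
  unfolding nerve_ob_def by (subst mkob_simps(2)) (auto simp: Hom_iff)

lemma nerve_obj [simp]: assumes Y: "Y \<in> Obj A" shows "(nerve_ob A K Y :: 'u q_obj) \<in> Obj Qc"
  unfolding nerve_ob_def
proof (rule mkob_obj)
  show "small TYPE('u) (cd n Y ` Hom A (FO K n) Y)" for n using Y by (simp add: small_image)
qed (auto simp: Hom_iff K_id K_comp)

lemma nerve_ar_simps [simp]: "fst (nerve_ar A K f :: 'u q_arr) = nerve_ob A K (Dom A f)"
  "tgt (nerve_ar A K f :: 'u q_arr) = nerve_ob A K (Cod A f)"
  "[|g \<in> Arr A; Dom A g = FO K n; Cod A g = Dom A f|] ==>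
    ap (nerve_ar A K f) n (cd n (Dom A f) g) = cd n (Cod A f) (f \<cdot>\<^sub>A g)"
  by (simp_all add: nerve_ar_def)

lemma nerve_ar_arr [simp]: "f \<in> Arr A ==> (nerve_ar A K f :: 'u q_arr) \<in> Arr Qc"
  unfolding nerve_ar_def
proof (rule mkar_arr)
  fix \<phi> z assume f: "f \<in> Arr A" and \<phi>: "\<phi> \<in> Arr NCat" and "z \<in> FO (nerve_ob A K (Dom A f) :: 'u q_obj) (fst \<phi>)"
  then obtain g where "g \<in> Arr A" "Dom A g = FO K (fst \<phi>)" "Cod A g = Dom A f" "z = cd (fst \<phi>) (Dom A f) g" by (elim nerveE)
  then show "cd (tgt \<phi>) (Cod A f) (f \<cdot>\<^sub>A decode (Hom A (FO K (tgt \<phi>)) (Dom A f)) (act (nerve_ob A K (Dom A f)) \<phi> z)) =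
    act (nerve_ob A K (Cod A f)) \<phi> (cd (fst \<phi>) (Cod A f) (f \<cdot>\<^sub>A decode (Hom A (FO K (fst \<phi>)) (Dom A f)) z))"
    using f \<phi> by simp
qed (auto elim!: nerveE)

lemma nerve_functor: "cfunctor A Qc (nerve A K :: ('o, 'a, 'u q_obj, 'u q_arr) cfun)"
proof (rule cfunctorI[OF K.T.category_axioms category_Qc])
  show "FA (nerve A K) (Id A Y) = Id Qc (FO (nerve A K) Y :: 'u q_obj)" if Y: "Y \<in> Obj A" for Y
  proof (rule Q_ext)
    fix n z assume "z \<in> FO (fst (FA (nerve A K) (Id A Y) :: 'u q_arr)) n"
    then have z: "z \<in> FO (nerve_ob A K Y :: 'u q_obj) n" using Y by (simp add: nerve_def)
    then obtain g where g: "g \<in> Arr A" "Dom A g = FO K n" "Cod A g = Y" "z = cd n Y g" by (rule nerveE)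
    then have "ap (nerve_ar A K (Id A Y)) n (cd n (Dom A (Id A Y)) g) = cd n (Cod A (Id A Y)) (Id A Y \<cdot>\<^sub>A g)"
      using Y by (intro nerve_ar_simps) auto
    then show "ap (FA (nerve A K) (Id A Y)) n z = ap (Id Qc (FO (nerve A K) Y)) n z"
      using Y g z by (simp add: nerve_def)
  qed (use Y in "auto simp: nerve_def")
  show "FA (nerve A K) (h \<cdot>\<^sub>A f) = FA (nerve A K) h \<cdot>\<^bsub>Qc\<^esub> (FA (nerve A K) f :: 'u q_arr)"
    if f: "f \<in> Arr A" "h \<in> Arr A" "Dom A h = Cod A f" for f h
  proof (rule Q_ext)
    fix n z assume "z \<in> FO (fst (FA (nerve A K) (h \<cdot>\<^sub>A f) :: 'u q_arr)) n"
    then have z: "z \<in> FO (nerve_ob A K (Dom A f) :: 'u q_obj) n" using f by (simp add: nerve_def)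
    then obtain g where g: "g \<in> Arr A" "Dom A g = FO K n" "Cod A g = Dom A f" "z = cd n (Dom A f) g" by (rule nerveE)
    have "ap (nerve_ar A K (h \<cdot>\<^sub>A f)) n (cd n (Dom A (h \<cdot>\<^sub>A f)) g) = cd n (Cod A (h \<cdot>\<^sub>A f)) ((h \<cdot>\<^sub>A f) \<cdot>\<^sub>A g)"
      using f g by (intro nerve_ar_simps) auto
    moreover have "ap (nerve_ar A K h) n (cd n (Dom A h) (f \<cdot>\<^sub>A g)) = cd n (Cod A h) (h \<cdot>\<^sub>A (f \<cdot>\<^sub>A g))"
      using f g by (intro nerve_ar_simps) auto
    ultimately show "ap (FA (nerve A K) (h \<cdot>\<^sub>A f)) n z = ap (FA (nerve A K) h \<cdot>\<^bsub>Qc\<^esub> FA (nerve A K) f) n z"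
      using f g z by (simp add: nerve_def)
  qed (use f in "auto simp: nerve_def")
qed (auto simp: nerve_def Hom_iff)

text \<open>
  The left adjoint of the nerve sends \<open>P\<close> to the colimit of \<open>K\<close> over the elements of \<open>P\<close>. For
  \<open>P = h\<^sub>n\<close> the colimit \<open>K n\<close> is chosen, so that the restriction is equal to \<open>K\<close> and not just
  isomorphic.
\<close>

lemma kan_extension:
  assumes cc: "has_small_colimits TYPE('u) A"
  shows "\<exists>H G \<eta> \<epsilon>. adjunction (Qc :: ('u q_obj, 'u q_arr) cat) A H G \<eta> \<epsilon> \<and> compf (op NCat) yoneda H = K"
proof -
  let ?c = "\<lambda>k :: nat. \<lambda>z :: 'u. FA K (dec z)"
  have "\<exists>L c. elcolimit A K P L c \<and> (\<forall>n. P = hrep n \<longrightarrow> L = FO K n \<and> c = ?c)" if P: "P \<in> Obj Qc" for P :: "'u q_obj"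
  proof (cases "\<exists>n. P = hrep n")
    case True
    then obtain n where n: "P = hrep n" by blast
    show ?thesis
      by (rule exI[of _ "FO K n"], rule exI[of _ ?c]) (use elcolimit_hrep[OF K, of n] n hrep_inj in auto)
  next
    case False
    obtain L c where "elcolimit A K P L c" using elcolimit_exists[OF cc P K] by (elim exE)
    then show ?thesis using False by (intro exI[of _ L] exI[of _ c]) simp
  qed
  then have "\<exists>x. P \<in> Obj Qc \<longrightarrow> elcolimit A K P (fst x) (snd x) \<and> (\<forall>n. P = hrep n \<longrightarrow> fst x = FO K n \<and> snd x = ?c)"
    for P :: "'u q_obj"
    unfolding split_paired_Ex fst_conv snd_conv by (cases "P \<in> Obj Qc") simp_all
  from choice[OF allI[OF this]] obtain f where
    f: "\<forall>P :: 'u q_obj. P \<in> Obj Qc \<longrightarrow> elcolimit A K P (fst (f P)) (snd (f P)) \<and> (\<forall>n. P = hrep n \<longrightarrow> fst (f P) = FO K n \<and> snd (f P) = ?c)" ..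
  define L where "L P = fst (f P)" for P
  define c where "c P = snd (f P)" for P
  have Lc: "elcolimit A K P (L P) (c P)" if "P \<in> Obj Qc" for P
    using f[rule_format, OF that] by (simp add: L_def c_def)
  have Lh: "L (hrep n) = FO K n" "c (hrep n) = ?c" for n
    using f[rule_format, OF hrep_obj, of n] by (simp_all add: L_def c_def)
  have cocone: "elcocone A K P (L P) (c P)" if "P \<in> Obj Qc" for P using Lc[OF that] by (simp add: elcolimit_def)
  have L [simp]: "L P \<in> Obj A" if "P \<in> Obj Qc" for P using cocone[OF that] by (simp add: elcocone_def)
  have c [simp]: "c P n x \<in> Arr A" "Dom A (c P n x) = FO K n" "Cod A (c P n x) = L P" if "P \<in> Obj Qc" "x \<in> FO P n" for P n x
    using cocone[OF that(1)] that(2) by (auto simp: elcocone_def Hom_iff)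
  have cn: "c P (tgt \<phi>) (act P \<phi> x) = c P (fst \<phi>) x \<cdot>\<^sub>A FA K \<phi>" if "P \<in> Obj Qc" "\<phi> \<in> Arr NCat" "x \<in> FO P (fst \<phi>)" for P \<phi> x
    using cocone[OF that(1)] that(2,3) by (simp add: elcocone_def)
  define u where "u P = mkar P (\<lambda>n x. cd n (L P) (c P n x)) (nerve_ob A K (L P))" for P
  have us [simp]: "fst (u P) = P" "tgt (u P) = nerve_ob A K (L P)" "x \<in> FO P n ==> ap (u P) n x = cd n (L P) (c P n x)" for P n x
    by (simp_all add: u_def)
  have ua [simp]: "u P \<in> Arr Qc" if P: "P \<in> Obj Qc" for P
    unfolding u_def by (rule mkar_arr) (use P in "auto simp: cn")
  have G: "cfunctor A Qc (nerve A K :: ('o, 'a, 'u q_obj, 'u q_arr) cfun)" by (rule nerve_functor)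
  have "\<exists>H \<eta> \<epsilon>. adjunction Qc A H (nerve A K) \<eta> \<epsilon> \<and> (\<forall>P\<in>Obj (Qc :: ('u q_obj, 'u q_arr) cat). FO H P = L P \<and> \<eta> P = u P)"
  proof (rule adjunction_from_universal_arrows[OF G])
    show "L P \<in> Obj A \<and> u P \<in> Hom Qc P (FO (nerve A K) (L P))" if "P \<in> Obj Qc" for P
      using that by (simp add: Hom_iff nerve_def)
  next
    fix P :: "'u q_obj" and Y f assume P: "P \<in> Obj Qc" and Y: "Y \<in> Obj A" and f: "f \<in> Hom Qc P (FO (nerve A K) Y)"
    then have fs: "f \<in> Arr Qc" "fst f = P" "tgt f = nerve_ob A K Y" by (auto simp: Hom_iff nerve_def)
    let ?d = "\<lambda>n x. decode (Hom A (FO K n) Y) (ap f n x)"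
    have ap: "ap f n x \<in> FO (nerve_ob A K Y) n" if "x \<in> FO P n" for n x
      using Q_ap_mem[OF fs(1), of x n] that fs by simp
    have d: "?d n x \<in> Hom A (FO K n) Y" "cd n Y (?d n x) = ap f n x" if x: "x \<in> FO P n" for n x
      using ap[OF x] by (auto elim!: nerveE simp: Hom_iff)
    have "elcocone A K P Y ?d"
      unfolding elcocone_def
    proof (intro conjI allI ballI Y d)
      fix \<phi> x assume \<phi>: "\<phi> \<in> Arr NCat" and x: "x \<in> FO P (fst \<phi>)"
      have "ap f (tgt \<phi>) (act P \<phi> x) = act (nerve_ob A K Y) \<phi> (cd (fst \<phi>) Y (?d (fst \<phi>) x))"
        using Q_ap_nat[OF fs(1) \<phi>, of x] x fs d(2)[OF x] by simp
      also have "... = cd (tgt \<phi>) Y (?d (fst \<phi>) x \<cdot>\<^sub>A FA K \<phi>)"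
        by (rule nerve_act) (use \<phi> d(1)[OF x] in "auto simp: Hom_iff")
      finally show "?d (tgt \<phi>) (act P \<phi> x) = ?d (fst \<phi>) x \<cdot>\<^sub>A FA K \<phi>"
        using \<phi> d(1)[OF x] by (simp add: Hom_iff)
    qed
    then have ex: "\<exists>!h. h \<in> Hom A (L P) Y \<and> (\<forall>n. \<forall>x\<in>FO P n. h \<cdot>\<^sub>A c P n x = ?d n x)"
      using Lc[OF P] unfolding elcolimit_def by blast
    have "FA (nerve A K) h \<cdot>\<^bsub>Qc\<^esub> u P = f \<longleftrightarrow> (\<forall>n. \<forall>x\<in>FO P n. h \<cdot>\<^sub>A c P n x = ?d n x)" if h: "h \<in> Hom A (L P) Y" for h
    proof -
      have hs: "h \<in> Arr A" "Dom A h = L P" "Cod A h = Y" using h by (auto simp: Hom_iff)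
      have e: "ap (FA (nerve A K) h \<cdot>\<^bsub>Qc\<^esub> u P) n x = cd n Y (h \<cdot>\<^sub>A c P n x)" if x: "x \<in> FO P n" for n x
        using nerve_ar_simps(3)[of "c P n x" n h] hs P x by (simp add: nerve_def)
      show ?thesis
      proof
        assume "FA (nerve A K) h \<cdot>\<^bsub>Qc\<^esub> u P = f"
        then have "cd n Y (h \<cdot>\<^sub>A c P n x) = ap f n x" if "x \<in> FO P n" for n x using e[OF that] by simp
        then show "\<forall>n. \<forall>x\<in>FO P n. h \<cdot>\<^sub>A c P n x = ?d n x"
          using hs P by (metis c decode_cd K.T.arr_simps(3,4,5))
      next
        assume r: "\<forall>n. \<forall>x\<in>FO P n. h \<cdot>\<^sub>A c P n x = ?d n x"
        show "FA (nerve A K) h \<cdot>\<^bsub>Qc\<^esub> u P = f"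
        proof (rule Q_ext)
          fix n x assume "x \<in> FO (fst (FA (nerve A K) h \<cdot>\<^bsub>Qc\<^esub> u P)) n"
          then have x: "x \<in> FO P n" by simp
          show "ap (FA (nerve A K) h \<cdot>\<^bsub>Qc\<^esub> u P) n x = ap f n x"
            using e[OF x] d(2)[OF x] r[rule_format, OF x] by simp
        qed (use hs P fs in "auto simp: nerve_def")
      qed
    qed
    then show "\<exists>!h. h \<in> Hom A (L P) Y \<and> FA (nerve A K) h \<cdot>\<^bsub>Qc\<^esub> u P = f"
      using ex by (simp cong: conj_cong)
  qed
  then obtain H \<eta> \<epsilon> where adj: "adjunction (Qc :: ('u q_obj, 'u q_arr) cat) A H (nerve A K) \<eta> \<epsilon>"
    and H: "\<forall>P\<in>Obj (Qc :: ('u q_obj, 'u q_arr) cat). FO H P = L P \<and> \<eta> P = u P"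
    by (elim exE conjE)
  interpret H: cfunctor Qc A H using adj by (simp add: adjunction_def)
  interpret \<eta>: nat_trans Qc Qc "idf Qc" "compf Qc H (nerve A K)" \<eta> using adj by (simp add: adjunction_def)
  have HO: "FO H (hrep n) = FO K n" for n using H Lh by simp
  have HA: "FA H (pre \<phi>) = FA K \<phi>" if \<phi>: "\<phi> \<in> Arr NCat" for \<phi>
  proof -
    let ?m = "fst \<phi>" and ?n = "tgt \<phi>"
    let ?h = "FA H (pre \<phi> :: 'u q_arr)"
    have h: "?h \<in> Arr A" "Dom A ?h = FO K ?n" "Cod A ?h = FO K ?m" using \<phi> by (simp_all add: HO)
    have "u (hrep ?m) \<cdot>\<^bsub>Qc\<^esub> pre \<phi> = nerve_ar A K ?h \<cdot>\<^bsub>Qc\<^esub> u (hrep ?n)"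
      using \<eta>.naturality[of "pre \<phi>"] \<phi> H by (simp add: nerve_def)
    then have "ap (u (hrep ?m) \<cdot>\<^bsub>Qc\<^esub> pre \<phi>) ?n (enc (Id NCat ?n)) = ap (nerve_ar A K ?h \<cdot>\<^bsub>Qc\<^esub> u (hrep ?n)) ?n (enc (Id NCat ?n))"
      by simp
    moreover have "ap (u (hrep ?m) \<cdot>\<^bsub>Qc\<^esub> pre \<phi>) ?n (enc (Id NCat ?n)) = cd ?n (FO K ?m) (FA K \<phi>)"
      using \<phi> by (simp add: Lh)
    moreover have "ap (nerve_ar A K ?h \<cdot>\<^bsub>Qc\<^esub> u (hrep ?n)) ?n (enc (Id NCat ?n)) = cd ?n (FO K ?m) ?h"
      using nerve_ar_simps(3)[of "Id A (FO K ?n)" ?n ?h] h by (simp add: Lh K_id)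
    ultimately have e: "cd ?n (FO K ?m) (FA K \<phi>) = cd ?n (FO K ?m) ?h" by simp
    have "decode (Hom A (FO K ?n) (FO K ?m)) (cd ?n (FO K ?m) (FA K \<phi>)) = FA K \<phi>"
      by (rule decode_cd) (use \<phi> in simp_all)
    then show ?thesis unfolding e decode_cd[OF h] .
  qed
  have "compf (op NCat) yoneda H = K"
  proof -
    have "FO K = (\<lambda>n\<in>Obj (op NCat). FO H (FO yoneda n))" by (simp add: HO fun_eq_iff)
    moreover have "FA K = (\<lambda>\<phi>\<in>Arr (op NCat). FA H (FA yoneda \<phi>))"
      by (rule extensionalityI[OF K.FA_ext]) (auto simp: HA)
    ultimately show ?thesis by (simp add: compf_def)
  qed
  with adj show ?thesis by (intro exI conjI)
qed

end

end

declare Q_simps [simp del]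

section \<open>The category of morphisms and the category of coalgebras\<close>

lemma HomVect_simps [simp]:
  "f \<in> Obj (HomVect A S B T) \<longleftrightarrow> vectoid_morphism A S B T f"
  "(f, \<alpha>, g) \<in> Arr (HomVect A S B T) \<longleftrightarrow> vectoid_morphism A S B T f \<and> vectoid_morphism A S B T g \<and> vectoid_2morphism A S B T f g \<alpha>"
  "Dom (HomVect A S B T) (f, \<alpha>, g) = f" "Cod (HomVect A S B T) (f, \<alpha>, g) = g"
  "Id (HomVect A S B T) f = (f, (\<lambda>X\<in>Obj B. Id A (FO (Up f) X)), f)"
  "Comp (HomVect A S B T) (g, \<beta>, h) (f, \<alpha>, g') = (f, (\<lambda>X\<in>Obj B. \<beta> X \<cdot>\<^sub>A \<alpha> X), h)"
  by (simp_all add: HomVect_def)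

lemma HomVect_homE:
  assumes "a \<in> Hom (HomVect A S B T) f g"
  obtains \<alpha> where "a = (f, \<alpha>, g)" "vectoid_morphism A S B T f" "vectoid_morphism A S B T g" "vectoid_2morphism A S B T f g \<alpha>"
  using assms by (cases a) (simp add: Hom_iff)

lemma category_HomVect: "category (HomVect A S B T)" (is "category ?V")
proof unfold_locales
  show "Dom ?V a \<in> Obj ?V" "Cod ?V a \<in> Obj ?V"
    if "a \<in> Arr ?V" for a
    using that by (cases a; simp)+
  fix f assume "f \<in> Obj ?V"
  then have m: "vectoid_morphism A S B T f" by simp
  interpret F: strong_sym_mon_functor B T A S "Up f" "UpMu f" "UpEps f" using m by (simp add: vectoid_morphism_def)
  have "nat_trans B A (Up f) (Up f) (\<lambda>X\<in>Obj B. Id A (FO (Up f) X))" by (rule nat_trans_id[OF F.cfunctor_axioms])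
  then show "Id ?V f \<in> Hom ?V f f"
    using m by (simp add: Hom_iff vectoid_2morphism_def)
next
  fix a f g b h assume a: "a \<in> Hom ?V f g" and b: "b \<in> Hom ?V g h"
  obtain \<alpha> where [simp]: "a = (f, \<alpha>, g)" and m: "vectoid_morphism A S B T f" "vectoid_morphism A S B T g" and \<alpha>: "vectoid_2morphism A S B T f g \<alpha>"
    using a by (rule HomVect_homE)
  obtain \<beta> where [simp]: "b = (g, \<beta>, h)" and m': "vectoid_morphism A S B T h" and \<beta>: "vectoid_2morphism A S B T g h \<beta>"
    using b by (rule HomVect_homE)
  interpret F: strong_sym_mon_functor B T A S "Up f" "UpMu f" "UpEps f" using m by (simp add: vectoid_morphism_def)
  interpret G: strong_sym_mon_functor B T A S "Up g" "UpMu g" "UpEps g" using m by (simp add: vectoid_morphism_def)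
  interpret H: strong_sym_mon_functor B T A S "Up h" "UpMu h" "UpEps h" using m' by (simp add: vectoid_morphism_def)
  interpret a: nat_trans B A "Up f" "Up g" \<alpha> using \<alpha> by (simp add: vectoid_2morphism_def)
  interpret b: nat_trans B A "Up g" "Up h" \<beta> using \<beta> by (simp add: vectoid_2morphism_def)
  have a2: "\<alpha> (TO T X Y) \<cdot>\<^sub>A UpMu f (X, Y) = UpMu g (X, Y) \<cdot>\<^sub>A (\<alpha> X \<otimes>\<^sub>S \<alpha> Y)"
    and b2: "\<beta> (TO T X Y) \<cdot>\<^sub>A UpMu g (X, Y) = UpMu h (X, Y) \<cdot>\<^sub>A (\<beta> X \<otimes>\<^sub>S \<beta> Y)"
    if "X \<in> Obj B" "Y \<in> Obj B" for X Y using \<alpha> \<beta> that by (simp_all add: vectoid_2morphism_def)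
  have a3: "\<alpha> (TI T) \<cdot>\<^sub>A UpEps f = UpEps g" and b3: "\<beta> (TI T) \<cdot>\<^sub>A UpEps g = UpEps h"
    using \<alpha> \<beta> by (simp_all add: vectoid_2morphism_def)
  let ?\<gamma> = "\<lambda>X\<in>Obj B. \<beta> X \<cdot>\<^sub>A \<alpha> X"
  have "nat_trans B A (Up f) (Up h) ?\<gamma>" using nat_trans_comp[OF a.nat_trans_axioms b.nat_trans_axioms] .
  moreover have "(\<beta> (TO T X Y) \<cdot>\<^sub>A \<alpha> (TO T X Y)) \<cdot>\<^sub>A UpMu f (X, Y) = UpMu h (X, Y) \<cdot>\<^sub>A ((\<beta> X \<cdot>\<^sub>A \<alpha> X) \<otimes>\<^sub>S (\<beta> Y \<cdot>\<^sub>A \<alpha> Y))"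
    if XY: "X \<in> Obj B" "Y \<in> Obj B" for X Y
  proof -
    have "(\<beta> (TO T X Y) \<cdot>\<^sub>A \<alpha> (TO T X Y)) \<cdot>\<^sub>A UpMu f (X, Y) = (\<beta> (TO T X Y) \<cdot>\<^sub>A UpMu g (X, Y)) \<cdot>\<^sub>A (\<alpha> X \<otimes>\<^sub>S \<alpha> Y)"
      using XY by (simp add: a2)
    also have "... = UpMu h (X, Y) \<cdot>\<^sub>A (\<beta> X \<otimes>\<^sub>S \<beta> Y) \<cdot>\<^sub>A (\<alpha> X \<otimes>\<^sub>S \<alpha> Y)"
      unfolding b2[OF XY] using XY by simp
    finally show ?thesis using XY by (simp add: F.T.interchange)
  qed
  moreover have "(\<beta> (TI T) \<cdot>\<^sub>A \<alpha> (TI T)) \<cdot>\<^sub>A UpEps f = UpEps h" by (simp add: a3 b3)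
  ultimately have "vectoid_2morphism A S B T f h ?\<gamma>" by (simp add: vectoid_2morphism_def)
  then show "b \<cdot>\<^bsub>?V\<^esub> a \<in> Hom ?V f h" using m m' by (simp add: Hom_iff)
next
  fix a f g assume "a \<in> Hom ?V f g"
  then obtain \<alpha> where [simp]: "a = (f, \<alpha>, g)" and \<alpha>: "vectoid_2morphism A S B T f g \<alpha>"
    by (rule HomVect_homE)
  interpret a: nat_trans B A "Up f" "Up g" \<alpha> using \<alpha> by (simp add: vectoid_2morphism_def)
  have "(\<lambda>X\<in>Obj B. \<alpha> X) = \<alpha>" by (rule extensional_restrict[OF a.ext])
  then show "a \<cdot>\<^bsub>?V\<^esub> Id ?V f = a" "Id ?V g \<cdot>\<^bsub>?V\<^esub> a = a"
    by (simp_all cong: restrict_cong)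
next
  fix a b c f g h k assume "a \<in> Hom ?V f g" "b \<in> Hom ?V g h" "c \<in> Hom ?V h k"
  then obtain \<alpha> \<beta> \<gamma> where [simp]: "a = (f, \<alpha>, g)" "b = (g, \<beta>, h)" "c = (h, \<gamma>, k)"
    and \<alpha>: "vectoid_2morphism A S B T f g \<alpha>" "vectoid_2morphism A S B T g h \<beta>" "vectoid_2morphism A S B T h k \<gamma>"
    by (elim HomVect_homE) simp
  interpret a: nat_trans B A "Up f" "Up g" \<alpha> using \<alpha> by (simp add: vectoid_2morphism_def)
  interpret b: nat_trans B A "Up g" "Up h" \<beta> using \<alpha> by (simp add: vectoid_2morphism_def)
  interpret c: nat_trans B A "Up h" "Up k" \<gamma> using \<alpha> by (simp add: vectoid_2morphism_def)
  show "c \<cdot>\<^bsub>?V\<^esub> b \<cdot>\<^bsub>?V\<^esub> a = (c \<cdot>\<^bsub>?V\<^esub> b) \<cdot>\<^bsub>?V\<^esub> a"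
    by (simp cong: restrict_cong)
qed

lemma CocommCoalg_simps [simp]:
  "c \<in> Obj (CocommCoalg C T) \<longleftrightarrow> cocomm_coalgebra C T c"
  "((X, \<Delta>, \<eta>), h, (X', \<Delta>', \<eta>')) \<in> Arr (CocommCoalg C T) \<longleftrightarrow>
     cocomm_coalgebra C T (X, \<Delta>, \<eta>) \<and> cocomm_coalgebra C T (X', \<Delta>', \<eta>') \<and>
     h \<in> Hom C X X' \<and> \<Delta>' \<cdot>\<^sub>C h = (h \<otimes>\<^sub>T h) \<cdot>\<^sub>C \<Delta> \<and> \<eta>' \<cdot>\<^sub>C h = \<eta>"
  "Dom (CocommCoalg C T) (c, h, d) = c" "Cod (CocommCoalg C T) (c, h, d) = d"
  "Id (CocommCoalg C T) c = (c, Id C (fst c), c)"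
  "Comp (CocommCoalg C T) (d, k, e) (c, h, d') = (c, k \<cdot>\<^sub>C h, e)"
  by (auto simp: CocommCoalg_def)

lemma CocommCoalg_homE:
  assumes "a \<in> Hom (CocommCoalg C T) (X, \<Delta>, \<eta>) (X', \<Delta>', \<eta>')"
  obtains h where "a = ((X, \<Delta>, \<eta>), h, (X', \<Delta>', \<eta>'))" "h \<in> Arr C" "Dom C h = X" "Cod C h = X'"
    "\<Delta>' \<cdot>\<^sub>C h = (h \<otimes>\<^sub>T h) \<cdot>\<^sub>C \<Delta>" "\<eta>' \<cdot>\<^sub>C h = \<eta>"
    "cocomm_coalgebra C T (X, \<Delta>, \<eta>)" "cocomm_coalgebra C T (X', \<Delta>', \<eta>')"
proof -
  obtain c h d where a: "a = (c, h, d)" by (cases a)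
  then have "c = (X, \<Delta>, \<eta>)" "d = (X', \<Delta>', \<eta>')" using assms by (auto simp: Hom_iff)
  then show thesis using assms a by (intro that[of h]) (auto simp: Hom_iff)
qed

lemma (in sym_mon_cat) coalgebra_arrs:
  assumes "cocomm_coalgebra C T (X, \<Delta>, \<eta>)"
  shows "X \<in> Obj C" "\<Delta> \<in> Arr C" "Dom C \<Delta> = X" "Cod C \<Delta> = TO T X X" "\<eta> \<in> Arr C" "Dom C \<eta> = X" "Cod C \<eta> = TI T"
  using assms by (auto simp: cocomm_coalgebra_iff Hom_iff)

context sym_mon_cat begin

lemma category_CocommCoalg: "category (CocommCoalg C T)" (is "category ?V")
proof unfold_locales
  show "Dom ?V a \<in> Obj ?V" "Cod ?V a \<in> Obj ?V"
    if "a \<in> Arr ?V" for a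
    using that by (cases a; force simp: CocommCoalg_def)+
  show "Id ?V c \<in> Hom ?V c c" if "c \<in> Obj ?V" for c
  proof -
    obtain X \<Delta> \<eta> where c: "c = (X, \<Delta>, \<eta>)" by (cases c)
    then have "cocomm_coalgebra C T (X, \<Delta>, \<eta>)" using that by simp
    then show ?thesis using coalgebra_arrs[of X \<Delta> \<eta>] by (simp add: c Hom_iff)
  qed
next
  fix a b c d e assume a: "a \<in> Hom ?V c d" and b: "b \<in> Hom ?V d e"
  obtain X \<Delta> \<eta> where c: "c = (X, \<Delta>, \<eta>)" by (cases c)
  obtain X' \<Delta>' \<eta>' where d: "d = (X', \<Delta>', \<eta>')" by (cases d)
  obtain X'' \<Delta>'' \<eta>'' where e: "e = (X'', \<Delta>'', \<eta>'')" by (cases e)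
  obtain h where h: "a = (c, h, d)" "h \<in> Arr C" "Dom C h = X" "Cod C h = X'"
    "\<Delta>' \<cdot> h = (h \<otimes> h) \<cdot> \<Delta>" "\<eta>' \<cdot> h = \<eta>" and cc: "cocomm_coalgebra C T c" and dd: "cocomm_coalgebra C T d"
    using a unfolding c d by (rule CocommCoalg_homE)
  obtain k where k: "b = (d, k, e)" "k \<in> Arr C" "Dom C k = X'" "Cod C k = X''"
    "\<Delta>'' \<cdot> k = (k \<otimes> k) \<cdot> \<Delta>'" "\<eta>'' \<cdot> k = \<eta>'" and ee: "cocomm_coalgebra C T e"
    using b unfolding d e by (rule CocommCoalg_homE)
  note [simp] = coalgebra_arrs[OF cc[unfolded c]] coalgebra_arrs[OF dd[unfolded d]] coalgebra_arrs[OF ee[unfolded e]] h(2-4) k(2-4)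
  have "\<Delta>'' \<cdot> k \<cdot> h = ((k \<cdot> h) \<otimes> (k \<cdot> h)) \<cdot> \<Delta>"
    using comp_reduce[OF k(5), of h] by (simp add: h(5) interchange_re)
  moreover have "\<eta>'' \<cdot> k \<cdot> h = \<eta>" using comp_reduce[OF k(6), of h] by (simp add: h(6))
  ultimately show "b \<cdot>\<^bsub>?V\<^esub> a \<in> Hom ?V c e"
    using cc ee unfolding Hom_iff h(1) k(1) by (simp add: c e Hom_iff)
next
  fix a c d assume a: "a \<in> Hom ?V c d"
  obtain X \<Delta> \<eta> where c: "c = (X, \<Delta>, \<eta>)" by (cases c)
  obtain X' \<Delta>' \<eta>' where d: "d = (X', \<Delta>', \<eta>')" by (cases d)
  obtain h where h: "a = (c, h, d)" "h \<in> Arr C" "Dom C h = X" "Cod C h = X'"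
    using a unfolding c d by (rule CocommCoalg_homE)
  show "a \<cdot>\<^bsub>?V\<^esub> Id ?V c = a" "Id ?V d \<cdot>\<^bsub>?V\<^esub> a = a"
    using h by (simp_all add: c d)
next
  fix f g k c d e r assume a: "f \<in> Hom ?V c d" "g \<in> Hom ?V d e" "k \<in> Hom ?V e r"
  have *: "\<exists>h. a = (c, h, d) \<and> h \<in> Arr C \<and> Dom C h = fst c \<and> Cod C h = fst d" if a: "a \<in> Hom ?V c d" for a c d
  proof -
    obtain X \<Delta> \<eta> where c: "c = (X, \<Delta>, \<eta>)" by (cases c)
    obtain X' \<Delta>' \<eta>' where d: "d = (X', \<Delta>', \<eta>')" by (cases d)
    show ?thesis using a unfolding c d by (rule CocommCoalg_homE) auto
  qed
  show "k \<cdot>\<^bsub>?V\<^esub> g \<cdot>\<^bsub>?V\<^esub> f = (k \<cdot>\<^bsub>?V\<^esub> g) \<cdot>\<^bsub>?V\<^esub> f"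
    using *[OF a(1)] *[OF a(2)] *[OF a(3)] by (elim exE conjE) simp
qed

lemma iso_CocommCoalg:
  assumes a: "((X, \<Delta>, \<eta>), h, (X', \<Delta>', \<eta>')) \<in> Arr (CocommCoalg C T)" and h: "iso_arr C h"
  shows "iso_arr (CocommCoalg C T) ((X, \<Delta>, \<eta>), h, (X', \<Delta>', \<eta>'))"
proof -
  interpret CC: category "CocommCoalg C T" by (rule category_CocommCoalg)
  have c: "cocomm_coalgebra C T (X, \<Delta>, \<eta>)" and d: "cocomm_coalgebra C T (X', \<Delta>', \<eta>')" and
    e: "\<Delta>' \<cdot> h = (h \<otimes> h) \<cdot> \<Delta>" "\<eta>' \<cdot> h = \<eta>" and hs [simp]: "h \<in> Arr C" "Dom C h = X" "Cod C h = X'"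
    using a by (auto simp: Hom_iff)
  note [simp] = h coalgebra_arrs[OF c] coalgebra_arrs[OF d]
  have "\<Delta> \<cdot> inv_arr C h = (inv_arr C h \<otimes> inv_arr C h) \<cdot> \<Delta>'"
  proof (rule iso_cancel_right[of h])
    show "(\<Delta> \<cdot> inv_arr C h) \<cdot> h = ((inv_arr C h \<otimes> inv_arr C h) \<cdot> \<Delta>') \<cdot> h"
      by (simp add: e interchange_re)
  qed simp_all
  moreover have "\<eta> \<cdot> inv_arr C h = \<eta>'"
    by (rule iso_cancel_right[of h]) (simp_all add: e)
  ultimately have b: "((X', \<Delta>', \<eta>'), inv_arr C h, (X, \<Delta>, \<eta>)) \<in> Arr (CocommCoalg C T)"
    using c d by (simp add: Hom_iff)
  show ?thesis
    by (rule CC.isoI[of _ "(X, \<Delta>, \<eta>)" "(X', \<Delta>', \<eta>')" "((X', \<Delta>', \<eta>'), inv_arr C h, (X, \<Delta>, \<eta>))"])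
      (use a b in "simp_all only: Hom_iff CocommCoalg_simps(3-) iso_simps[OF h] hs fst_conv simp_thms")
qed

end

lemma coalg_eval_functor:
  assumes c: "cocomm_coalgebra B T (X, \<Delta>, \<eta>)" and B: "sym_mon_cat B T" and A: "sym_mon_cat A S"
  shows "cfunctor (HomVect A S B T) (CocommCoalg A S) (coalg_eval A S B T (X, \<Delta>, \<eta>))"
    (is "cfunctor ?V ?W ?E")
proof -
  interpret A: sym_mon_cat A S by fact
  interpret B: sym_mon_cat B T by fact
  note [simp] = B.coalgebra_arrs[OF c]
  have img: "cocomm_coalgebra A S (pull_coalg A f (X, \<Delta>, \<eta>))" if "vectoid_morphism A S B T f" for f
  proof -
    interpret F: strong_sym_mon_functor B T A S "Up f" "UpMu f" "UpEps f" using that by (simp add: vectoid_morphism_def)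
    show ?thesis using F.image_coalgebra[OF c] by (simp add: pull_coalg_def)
  qed
  have ar: "(pull_coalg A f (X, \<Delta>, \<eta>), \<alpha> X, pull_coalg A g (X, \<Delta>, \<eta>)) \<in> Arr ?W"
    if m: "vectoid_morphism A S B T f" "vectoid_morphism A S B T g" and \<alpha>: "vectoid_2morphism A S B T f g \<alpha>" for f g \<alpha>
  proof -
    interpret F: strong_sym_mon_functor B T A S "Up f" "UpMu f" "UpEps f" using m by (simp add: vectoid_morphism_def)
    interpret G: strong_sym_mon_functor B T A S "Up g" "UpMu g" "UpEps g" using m by (simp add: vectoid_morphism_def)
    interpret a: nat_trans B A "Up f" "Up g" \<alpha> using \<alpha> by (simp add: vectoid_2morphism_def)
    have a2: "\<alpha> (TO T X X) \<cdot>\<^sub>A UpMu f (X, X) = UpMu g (X, X) \<cdot>\<^sub>A (\<alpha> X \<otimes>\<^sub>S \<alpha> X)"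
      and a3: "\<alpha> (TI T) \<cdot>\<^sub>A UpEps f = UpEps g" using \<alpha> by (simp_all add: vectoid_2morphism_def)
    have "(inv_arr A (UpMu g (X, X)) \<cdot>\<^sub>A FA (Up g) \<Delta>) \<cdot>\<^sub>A \<alpha> X = (\<alpha> X \<otimes>\<^sub>S \<alpha> X) \<cdot>\<^sub>A inv_arr A (UpMu f (X, X)) \<cdot>\<^sub>A FA (Up f) \<Delta>"
    proof (rule A.iso_cancel_left[of "UpMu g (X, X)"])
      have "UpMu g (X, X) \<cdot>\<^sub>A (inv_arr A (UpMu g (X, X)) \<cdot>\<^sub>A FA (Up g) \<Delta>) \<cdot>\<^sub>A \<alpha> X = \<alpha> (TO T X X) \<cdot>\<^sub>A FA (Up f) \<Delta>"
        using a.naturality[of \<Delta>] by simp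
      also have "... = (\<alpha> (TO T X X) \<cdot>\<^sub>A UpMu f (X, X)) \<cdot>\<^sub>A inv_arr A (UpMu f (X, X)) \<cdot>\<^sub>A FA (Up f) \<Delta>" by simp
      finally show "UpMu g (X, X) \<cdot>\<^sub>A (inv_arr A (UpMu g (X, X)) \<cdot>\<^sub>A FA (Up g) \<Delta>) \<cdot>\<^sub>A \<alpha> X =
        UpMu g (X, X) \<cdot>\<^sub>A (\<alpha> X \<otimes>\<^sub>S \<alpha> X) \<cdot>\<^sub>A inv_arr A (UpMu f (X, X)) \<cdot>\<^sub>A FA (Up f) \<Delta>"
        unfolding a2 by simp
    qed simp_all
    moreover have "(inv_arr A (UpEps g) \<cdot>\<^sub>A FA (Up g) \<eta>) \<cdot>\<^sub>A \<alpha> X = inv_arr A (UpEps f) \<cdot>\<^sub>A FA (Up f) \<eta>"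
    proof (rule A.iso_cancel_left[of "UpEps g"])
      have "UpEps g \<cdot>\<^sub>A (inv_arr A (UpEps g) \<cdot>\<^sub>A FA (Up g) \<eta>) \<cdot>\<^sub>A \<alpha> X = \<alpha> (TI T) \<cdot>\<^sub>A FA (Up f) \<eta>"
        using a.naturality[of \<eta>] by simp
      also have "... = (\<alpha> (TI T) \<cdot>\<^sub>A UpEps f) \<cdot>\<^sub>A inv_arr A (UpEps f) \<cdot>\<^sub>A FA (Up f) \<eta>" by simp
      finally show "UpEps g \<cdot>\<^sub>A (inv_arr A (UpEps g) \<cdot>\<^sub>A FA (Up g) \<eta>) \<cdot>\<^sub>A \<alpha> X = UpEps g \<cdot>\<^sub>A inv_arr A (UpEps f) \<cdot>\<^sub>A FA (Up f) \<eta>"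
        unfolding a3 by simp
    qed simp_all
    ultimately show ?thesis using img[OF m(1)] img[OF m(2)] by (simp add: pull_coalg_def Hom_iff)
  qed
  show ?thesis
  proof (rule cfunctorI[OF category_HomVect A.category_CocommCoalg])
    fix a assume "a \<in> Arr ?V"
    then show "FA ?E a \<in> Hom ?W (FO ?E (Dom ?V a)) (FO ?E (Cod ?V a))"
      using ar by (cases a) (simp add: coalg_eval_def Hom_iff)
  next
    fix f assume f: "f \<in> Obj ?V"
    interpret HV: category "?V" by (rule category_HomVect)
    have "Id ?V f \<in> Arr ?V" using f by (rule HV.arr_simps)
    then show "FA ?E (Id ?V f) = Id ?W (FO ?E f)"
      using f by (simp add: coalg_eval_def pull_coalg_def)
  next
    fix a b assume ab: "a \<in> Arr ?V" "b \<in> Arr ?V" "Dom ?V b = Cod ?V a"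
    interpret HV: category "?V" by (rule category_HomVect)
    have "b \<cdot>\<^bsub>?V\<^esub> a \<in> Arr ?V" using ab by (rule HV.arr_simps)
    then show "FA ?E (b \<cdot>\<^bsub>?V\<^esub> a) = FA ?E b \<cdot>\<^bsub>?W\<^esub> FA ?E a"
      using ab by (cases a, cases b) (simp add: coalg_eval_def)
  qed (use img in "auto simp: coalg_eval_def")
qed

section \<open>The classifying property\<close>

text \<open>All the diagrams commute because \<open>1\<close> is terminal among finite sets.\<close>

lemma one_coalgebra: "cocomm_coalgebra (op NCat) (op_tensor NCat NTensor) (1, to_one 2, to_one 0)"
proof -
  have to1: "\<phi> = to_one n" if "\<phi> \<in> Arr NCat" "fst \<phi> = n" "tgt \<phi> = 1" for \<phi> n
    by (rule N_ext) (use that nv_range[of \<phi>] in "auto simp: le_antisym")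
  have eq: "\<phi> = \<psi>" if "\<phi> \<in> Arr NCat" "\<psi> \<in> Arr NCat" "fst \<phi> = fst \<psi>" "tgt \<phi> = 1" "tgt \<psi> = 1" for \<phi> \<psi>
    using to1[OF that(1) _ that(4)] to1[OF that(2) _ that(5)] that(3) by metis
  show ?thesis
    unfolding cocomm_coalgebra_iff op_simps op_N_simps
    by (intro conjI eq) (simp_all add: Hom_iff)
qed

context small_universe begin

lemma pre_ends [simp]:
  "\<phi> \<in> Arr NCat ==> Dom Qc (pre \<phi> :: 'u q_arr) = hrep (tgt \<phi>)"
  "\<phi> \<in> Arr NCat ==> Cod Qc (pre \<phi> :: 'u q_arr) = hrep (fst \<phi>)"
  by (simp_all add: Q_simps)

lemma Xc_coalgebra:
  assumes "extends_disjoint_union (T :: ('u q_obj, 'u q_arr) tensor) \<mu> \<epsilon>"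
  shows "cocomm_coalgebra Qc T (Xc \<mu> \<epsilon>)"
proof -
  interpret Y: strong_sym_mon_functor "op NCat" "op_tensor NCat NTensor" Qc T yoneda \<mu> \<epsilon>
    using assms by (simp add: extends_disjoint_union_def)
  show ?thesis using Y.image_coalgebra[OF one_coalgebra] by (simp add: Xc_def)
qed

end

locale classifying = small_universe U for U :: "'u itself" +
  fixes T :: "('u q_obj, 'u q_arr) tensor" and \<mu> \<epsilon> and A :: "('o, 'a) cat" and S
  assumes T: "extends_disjoint_union T \<mu> \<epsilon>" and A: "vectoid TYPE('u) A S"
begin

sublocale D: dense_monoidal "TYPE('u)" "op NCat" "op_tensor NCat NTensor" Qc T yoneda \<mu> \<epsilon> A S
  by (rule dense_monoidal_yoneda[OF T]) (use A in "simp_all add: vectoid_def")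

abbreviation E where "E \<equiv> coalg_eval A S Qc T (Xc \<mu> \<epsilon>)"

text \<open>
  With \<open>rmu f\<close> and \<open>reps f\<close> as structure maps, the restriction \<open>rst f\<close> of \<open>f\<^sup>*\<close> to finite sets
  is strong monoidal.
\<close>

definition rmu :: "('o, 'a, 'u q_obj, 'u q_arr) vmor \<Rightarrow> nat \<times> nat \<Rightarrow> 'a" where
  "rmu f = (\<lambda>(m, n)\<in>UNIV \<times> UNIV. FA (Up f) (\<mu> (m, n)) \<cdot>\<^sub>A UpMu f (hrep m, hrep n))"

definition reps :: "('o, 'a, 'u q_obj, 'u q_arr) vmor \<Rightarrow> 'a" where
  "reps f = FA (Up f) \<epsilon> \<cdot>\<^sub>A UpEps f"

abbreviation rst :: "('o, 'a, 'u q_obj, 'u q_arr) vmor \<Rightarrow> (nat, fin_map, 'o, 'a) cfun" where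
  "rst f \<equiv> compf (op NCat) yoneda (Up f)"

lemma rmu_simp [simp]: "rmu f (m, n) = FA (Up f) (\<mu> (m, n)) \<cdot>\<^sub>A UpMu f (hrep m, hrep n)"
  by (simp add: rmu_def)

lemma left_adjoint_cocont:
  assumes "adjunction Qc A H G \<eta> \<zeta>" shows "D.cocont H"
  using left_adjoint_preserves_colimit[OF assms] assms
  unfolding D.cocont_def preserves_small_colimits_def adjunction_def by blast

lemma morphism:
  assumes "vectoid_morphism A S Qc T f"
  shows "strong_sym_mon_functor Qc T A S (Up f) (UpMu f) (UpEps f)" "D.cocont (Up f)"
    "strong_sym_mon_functor (op NCat) (op_tensor NCat NTensor) A S (rst f) (rmu f) (reps f)"
proof -
  show 1: "strong_sym_mon_functor Qc T A S (Up f) (UpMu f) (UpEps f)" using assms by (simp add: vectoid_morphism_def)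
  show "D.cocont (Up f)" using assms left_adjoint_cocont by (auto simp: vectoid_morphism_def)
  show "strong_sym_mon_functor (op NCat) (op_tensor NCat NTensor) A S (rst f) (rmu f) (reps f)"
    using strong_sym_mon_functor_comp[OF D.Y.strong_sym_mon_functor_axioms 1]
    by (simp add: rmu_def reps_def)
qed

lemma pull_Xc:
  assumes "vectoid_morphism A S Qc T f"
  shows "pull_coalg A f (Xc \<mu> \<epsilon>) = (FO (rst f) 1,
    inv_arr A (rmu f (1, 1)) \<cdot>\<^sub>A FA (rst f) (to_one 2), inv_arr A (reps f) \<cdot>\<^sub>A FA (rst f) (to_one 0))"
proof -
  interpret F: strong_sym_mon_functor Qc T A S "Up f" "UpMu f" "UpEps f" by (rule morphism(1)[OF assms])
  have [simp]: "hrep (Suc (Suc 0)) = (hrep 2 :: 'u q_obj)" by (simp add: numeral_2_eq_2)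
  show ?thesis
    by (simp add: pull_coalg_def Xc_def reps_def F.FA_comp_simp F.FA_inv D.A.inv_comp)
qed

lemma two_morphism_restrict:
  assumes f: "vectoid_morphism A S Qc T f" and g: "vectoid_morphism A S Qc T g"
    and \<alpha>: "vectoid_2morphism A S Qc T f g \<alpha>"
  shows "\<alpha> (hrep n) \<in> Hom A (FO (rst f) n) (FO (rst g) n)"
    "\<alpha> (hrep (m + n)) \<cdot>\<^sub>A rmu f (m, n) = rmu g (m, n) \<cdot>\<^sub>A (\<alpha> (hrep m) \<otimes>\<^sub>S \<alpha> (hrep n))"
    "\<alpha> (hrep 0) \<cdot>\<^sub>A reps f = reps g"
proof -
  interpret F: strong_sym_mon_functor Qc T A S "Up f" "UpMu f" "UpEps f" by (rule morphism(1)[OF f])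
  interpret G: strong_sym_mon_functor Qc T A S "Up g" "UpMu g" "UpEps g" by (rule morphism(1)[OF g])
  interpret a: nat_trans Qc A "Up f" "Up g" \<alpha> using \<alpha> by (simp add: vectoid_2morphism_def)
  have a2: "\<alpha> (TO T X Y) \<cdot>\<^sub>A UpMu f (X, Y) = UpMu g (X, Y) \<cdot>\<^sub>A (\<alpha> X \<otimes>\<^sub>S \<alpha> Y)" if "X \<in> Obj Qc" "Y \<in> Obj Qc" for X Y
    using \<alpha> that by (simp add: vectoid_2morphism_def)
  have a3: "\<alpha> (TI T) \<cdot>\<^sub>A UpEps f = UpEps g" using \<alpha> by (simp add: vectoid_2morphism_def)
  have ms: "\<mu> (m, n) \<in> Arr Qc" "Dom Qc (\<mu> (m, n)) = TO T (hrep m) (hrep n)" "Cod Qc (\<mu> (m, n)) = hrep (m + n)"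
    "\<epsilon> \<in> Arr Qc" "Dom Qc \<epsilon> = TI T" "Cod Qc \<epsilon> = hrep 0" for m n
    using D.Y.mu_arr(1)[of m n] D.Y.mu_arr(2) D.Y.mu_simps(2,3)[of m n] D.Y.mu_simps(5,6) by simp_all
  show "\<alpha> (hrep n) \<in> Hom A (FO (rst f) n) (FO (rst g) n)" by (simp add: Hom_iff)
  have "\<alpha> (hrep (m + n)) \<cdot>\<^sub>A rmu f (m, n) = (FA (Up g) (\<mu> (m, n)) \<cdot>\<^sub>A \<alpha> (TO T (hrep m) (hrep n))) \<cdot>\<^sub>A UpMu f (hrep m, hrep n)"
    using a.naturality[OF ms(1)[of m n], symmetric] by (simp add: ms)
  also have "... = FA (Up g) (\<mu> (m, n)) \<cdot>\<^sub>A \<alpha> (TO T (hrep m) (hrep n)) \<cdot>\<^sub>A UpMu f (hrep m, hrep n)"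
    by (simp add: ms)
  finally show "\<alpha> (hrep (m + n)) \<cdot>\<^sub>A rmu f (m, n) = rmu g (m, n) \<cdot>\<^sub>A (\<alpha> (hrep m) \<otimes>\<^sub>S \<alpha> (hrep n))"
    by (simp add: a2 ms)
  have "\<alpha> (hrep 0) \<cdot>\<^sub>A reps f = (FA (Up g) \<epsilon> \<cdot>\<^sub>A \<alpha> (TI T)) \<cdot>\<^sub>A UpEps f"
    using a.naturality[OF ms(4), symmetric] by (simp add: ms reps_def)
  then show "\<alpha> (hrep 0) \<cdot>\<^sub>A reps f = reps g" by (simp add: a3 reps_def ms)
qed

lemma two_morphism_exists:
  assumes f: "vectoid_morphism A S Qc T f" and g: "vectoid_morphism A S Qc T g"
    and h: "(pull_coalg A f (Xc \<mu> \<epsilon>), h, pull_coalg A g (Xc \<mu> \<epsilon>)) \<in> Arr (CocommCoalg A S)"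
  shows "\<exists>\<alpha>. vectoid_2morphism A S Qc T f g \<alpha> \<and> \<alpha> (hrep 1) = h"
proof -
  interpret F: strong_sym_mon_functor Qc T A S "Up f" "UpMu f" "UpEps f" by (rule morphism(1)[OF f])
  interpret G: strong_sym_mon_functor Qc T A S "Up g" "UpMu g" "UpEps g" by (rule morphism(1)[OF g])
  note c = h[unfolded pull_Xc[OF f] pull_Xc[OF g] CocommCoalg_simps]
  from monoidal_transformation_exists[OF morphism(3)[OF f] morphism(3)[OF g],
      OF c[THEN conjunct2, THEN conjunct2, THEN conjunct1] c[THEN conjunct2, THEN conjunct2, THEN conjunct2, THEN conjunct1]
        c[THEN conjunct2, THEN conjunct2, THEN conjunct2, THEN conjunct2]]
  obtain \<alpha>0 where a0: "\<forall>n. \<alpha>0 n \<in> Hom A (FO (rst f) n) (FO (rst g) n)" and a1: "\<alpha>0 1 = h"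
    and a2: "\<forall>\<phi>\<in>Arr NCat. \<alpha>0 (fst \<phi>) \<cdot>\<^sub>A FA (rst f) \<phi> = FA (rst g) \<phi> \<cdot>\<^sub>A \<alpha>0 (tgt \<phi>)"
    and a3: "\<forall>m n. \<alpha>0 (m + n) \<cdot>\<^sub>A rmu f (m, n) = rmu g (m, n) \<cdot>\<^sub>A (\<alpha>0 m \<otimes>\<^sub>S \<alpha>0 n)"
    and a4: "\<alpha>0 0 \<cdot>\<^sub>A reps f = reps g"
    by (elim exE conjE) (rule that)
  have "\<exists>\<alpha>. nat_trans Qc A (Up f) (Up g) \<alpha> \<and> (\<forall>n\<in>Obj (op NCat). \<alpha> (FO yoneda n) = \<alpha>0 n)"
  proof (rule D.extend_nat[OF morphism(2)[OF f] morphism(2)[OF g]])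
    show "\<alpha>0 n \<in> Hom A (FO (Up f) (FO yoneda n)) (FO (Up g) (FO yoneda n))" for n using a0[rule_format, of n] by simp
    show "\<alpha>0 (Cod (op NCat) \<phi>) \<cdot>\<^sub>A FA (Up f) (FA yoneda \<phi>) = FA (Up g) (FA yoneda \<phi>) \<cdot>\<^sub>A \<alpha>0 (Dom (op NCat) \<phi>)"
      if "\<phi> \<in> Arr (op NCat)" for \<phi> using a2[rule_format, of \<phi>] that by simp
  qed
  then obtain \<alpha> where \<alpha>: "nat_trans Qc A (Up f) (Up g) \<alpha>" and \<alpha>h: "\<And>n. \<alpha> (hrep n) = \<alpha>0 n" by auto
  have m: "\<alpha> (FO yoneda (TO (op_tensor NCat NTensor) m n)) \<cdot>\<^sub>A FA (Up f) (\<mu> (m, n)) \<cdot>\<^sub>A UpMu f (FO yoneda m, FO yoneda n) =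
    (FA (Up g) (\<mu> (m, n)) \<cdot>\<^sub>A UpMu g (FO yoneda m, FO yoneda n)) \<cdot>\<^sub>A (\<alpha> (FO yoneda m) \<otimes>\<^sub>S \<alpha> (FO yoneda n))" for m n
    using a3[rule_format, of m n] by (simp only: \<alpha>h yoneda_simps op_N_simps rmu_simp)
  have e: "\<alpha> (FO yoneda (TI (op_tensor NCat NTensor))) \<cdot>\<^sub>A FA (Up f) \<epsilon> \<cdot>\<^sub>A UpEps f = FA (Up g) \<epsilon> \<cdot>\<^sub>A UpEps g"
    using a4 by (simp only: \<alpha>h yoneda_simps op_N_simps reps_def)
  note D.monoidal_extend[OF morphism(1)[OF f] morphism(2)[OF f] morphism(1)[OF g] \<alpha> m e]
  then have "vectoid_2morphism A S Qc T f g \<alpha>" using \<alpha> unfolding vectoid_2morphism_def by blast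
  then show ?thesis using \<alpha>h[of 1] a1 by (intro exI[of _ \<alpha>]) simp
qed

lemma two_morphism_unique:
  assumes f: "vectoid_morphism A S Qc T f" and g: "vectoid_morphism A S Qc T g"
    and \<alpha>: "vectoid_2morphism A S Qc T f g \<alpha>" and \<beta>: "vectoid_2morphism A S Qc T f g \<beta>"
    and eq: "\<alpha> (hrep 1) = \<beta> (hrep 1)"
  shows "\<alpha> = \<beta>"
proof (rule D.nat_unique[OF morphism(2)[OF f]])
  show "nat_trans Qc A (Up f) (Up g) \<alpha>" "nat_trans Qc A (Up f) (Up g) \<beta>"
    using \<alpha> \<beta> by (simp_all add: vectoid_2morphism_def)
  show "\<alpha> (FO yoneda n) = \<beta> (FO yoneda n)" for n
    unfolding yoneda_simps
    by (rule monoidal_transformation_unique[where \<alpha>="\<lambda>n. \<alpha> (hrep n)" and \<beta>="\<lambda>n. \<beta> (hrep n)",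
        OF morphism(3)[OF f] morphism(3)[OF g]
        two_morphism_restrict(1)[OF f g \<alpha>] two_morphism_restrict(1)[OF f g \<beta>]
        two_morphism_restrict(2,3)[OF f g \<alpha>] two_morphism_restrict(2,3)[OF f g \<beta>] eq])
qed

lemma essentially_surjective:
  assumes c: "cocomm_coalgebra A S (X, \<Delta>, \<eta>)"
  shows "\<exists>f. vectoid_morphism A S Qc T f \<and>
    (\<exists>h. (pull_coalg A f (Xc \<mu> \<epsilon>), h, (X, \<Delta>, \<eta>)) \<in> Arr (CocommCoalg A S) \<and> iso_arr A h)"
proof -
  interpret C: coalgebra_object A S X \<Delta> \<eta>
    using c A by (simp add: coalgebra_object_def coalgebra_object_axioms_def vectoid_def)
  let ?K = "C.P.power_functor (TI S)"
  note K = C.power_strong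
  have Kf: "cfunctor (op NCat) A ?K" using K by (simp add: strong_sym_mon_functor_def)
  obtain H G \<iota> \<kappa> where adj: "adjunction (Qc :: ('u q_obj, 'u q_arr) cat) A H G \<iota> \<kappa>" and HK: "compf (op NCat) yoneda H = ?K"
    using kan_extension[OF Kf] A by (auto simp: vectoid_def)
  obtain M e where s: "strong_sym_mon_functor Qc T A S H M e"
    and Mm: "\<forall>m\<in>Obj (op NCat). \<forall>n\<in>Obj (op NCat). FA H (\<mu> (m, n)) \<cdot>\<^sub>A M (FO yoneda m, FO yoneda n) = C.power_mu (m, n)"
    and ee: "FA H \<epsilon> \<cdot>\<^sub>A e = Id A (TI S)"
    using D.extend_strong[OF left_adjoint_cocont[OF adj], unfolded HK, OF K] by (elim exE conjE) (rule that)
  define f where "f = \<lparr>Up = H, Low = G, AUnit = \<iota>, ACounit = \<kappa>, UpMu = M, UpEps = e\<rparr>"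
  have f: "vectoid_morphism A S Qc T f" using adj s by (simp add: vectoid_morphism_def f_def)
  have r: "rst f = ?K" "rmu f (1, 1) = C.power_mu (1, 1)" "reps f = Id A (TI S)"
    using HK Mm ee by (simp_all add: f_def reps_def)
  have p: "pull_coalg A f (Xc \<mu> \<epsilon>) = (FO ?K 1, inv_arr A (C.power_mu (1, 1)) \<cdot>\<^sub>A FA ?K (to_one 2), inv_arr A (Id A (TI S)) \<cdot>\<^sub>A FA ?K (to_one 0))"
    unfolding pull_Xc[OF f] r ..
  interpret F: strong_sym_mon_functor Qc T A S "Up f" "UpMu f" "UpEps f" by (rule morphism(1)[OF f])
  have cp: "cocomm_coalgebra A S (pull_coalg A f (Xc \<mu> \<epsilon>))"
    using F.image_coalgebra[of "hrep 1"] Xc_coalgebra[OF T] by (simp add: pull_coalg_def Xc_def)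
  have X: "X \<in> Obj A" using c by (simp add: cocomm_coalgebra_iff)
  have K1: "FO ?K 1 = TO S (TI S) X" by (simp add: C.P.power_functor_simps(1) C.R_def)
  have "(pull_coalg A f (Xc \<mu> \<epsilon>), LUnit S X, (X, \<Delta>, \<eta>)) \<in> Arr (CocommCoalg A S)"
    using cp c C.power_coalgebra X unfolding p CocommCoalg_simps K1 by (simp add: Hom_iff)
  then show ?thesis using f X D.A.tensor_simps(10)[OF X] by blast
qed

theorem classifier: "is_equivalence (HomVect A S Qc T) (CocommCoalg A S) E"
proof (rule equivalenceI)
  have AS: "sym_mon_cat A S" using A by (simp add: vectoid_def)
  have QT: "sym_mon_cat Qc T" by unfold_locales
  note X = Xc_coalgebra[OF T]
  show "cfunctor (HomVect A S Qc T) (CocommCoalg A S) E"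
    using coalg_eval_functor[OF X[unfolded Xc_def] QT AS] by (simp add: Xc_def)
next
  fix f g k assume f: "f \<in> Obj (HomVect A S Qc T)" and g: "g \<in> Obj (HomVect A S Qc T)" and k: "k \<in> Hom (CocommCoalg A S) (FO E f) (FO E g)"
  have E: "FO E f = pull_coalg A f (Xc \<mu> \<epsilon>)" if "f \<in> Obj (HomVect A S Qc T)" for f using that by (simp add: coalg_eval_def)
  have fm: "vectoid_morphism A S Qc T f" "vectoid_morphism A S Qc T g" using f g by simp_all
  obtain c h d where kk: "k = (c, h, d)" by (cases k)
  have cd: "c = pull_coalg A f (Xc \<mu> \<epsilon>)" "d = pull_coalg A g (Xc \<mu> \<epsilon>)" using k unfolding kk Hom_iff E[OF f] E[OF g] by simp_all
  have "(pull_coalg A f (Xc \<mu> \<epsilon>), h, pull_coalg A g (Xc \<mu> \<epsilon>)) \<in> Arr (CocommCoalg A S)"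
    using k unfolding kk cd Hom_iff by blast
  from two_morphism_exists[OF fm this] obtain \<alpha> where \<alpha>: "vectoid_2morphism A S Qc T f g \<alpha>" "\<alpha> (hrep 1) = h" by (elim exE conjE)
  have EA: "FA E (f, \<beta>, g) = (c, \<beta> (hrep 1), d)" if "vectoid_2morphism A S Qc T f g \<beta>" for \<beta>
    using that fm by (simp add: coalg_eval_def cd Xc_def)
  show "\<exists>!a. a \<in> Hom (HomVect A S Qc T) f g \<and> FA E a = k"
  proof (rule ex1I[of _ "(f, \<alpha>, g)"])
    show "(f, \<alpha>, g) \<in> Hom (HomVect A S Qc T) f g \<and> FA E (f, \<alpha>, g) = k"
      using fm \<alpha> EA[OF \<alpha>(1)] by (simp add: Hom_iff kk)
  next
    fix a assume a: "a \<in> Hom (HomVect A S Qc T) f g \<and> FA E a = k"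
    obtain \<beta> where ab: "a = (f, \<beta>, g)" and \<beta>: "vectoid_2morphism A S Qc T f g \<beta>" using conjunct1[OF a] by (rule HomVect_homE)
    have "\<alpha> (hrep 1) = \<beta> (hrep 1)" using conjunct2[OF a] EA[OF \<beta>] \<alpha>(2) by (simp add: ab kk)
    then show "a = (f, \<alpha>, g)" using two_morphism_unique[OF fm \<alpha>(1) \<beta>] by (simp add: ab)
  qed
next
  fix c assume c: "c \<in> Obj (CocommCoalg A S)"
  obtain X \<Delta> \<eta> where cc: "c = (X, \<Delta>, \<eta>)" by (cases c)
  have co: "cocomm_coalgebra A S (X, \<Delta>, \<eta>)" using c by (simp add: cc)
  from essentially_surjective[OF co] obtain f h where f: "vectoid_morphism A S Qc T f"
    and h: "(pull_coalg A f (Xc \<mu> \<epsilon>), h, (X, \<Delta>, \<eta>)) \<in> Arr (CocommCoalg A S)" "iso_arr A h" by (elim exE conjE)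
  obtain X' \<Delta>' \<eta>' where p: "pull_coalg A f (Xc \<mu> \<epsilon>) = (X', \<Delta>', \<eta>')" by (cases "pull_coalg A f (Xc \<mu> \<epsilon>)")
  have i: "iso_arr (CocommCoalg A S) (pull_coalg A f (Xc \<mu> \<epsilon>), h, c)"
    unfolding p cc by (rule D.A.iso_CocommCoalg[OF h(1)[unfolded p] h(2)])
  show "\<exists>f\<in>Obj (HomVect A S Qc T). \<exists>e\<in>Hom (CocommCoalg A S) (FO E f) c. iso_arr (CocommCoalg A S) e"
  proof (intro bexI)
    show "iso_arr (CocommCoalg A S) (pull_coalg A f (Xc \<mu> \<epsilon>), h, c)" by (rule i)
    show "f \<in> Obj (HomVect A S Qc T)" using f by simp
    show "(pull_coalg A f (Xc \<mu> \<epsilon>), h, c) \<in> Hom (CocommCoalg A S) (FO E f) c"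
      using h(1) f unfolding Hom_iff by (simp add: cc coalg_eval_def del: CocommCoalg_simps(2))
  qed
qed

end

theorem mainTheorem3:
  assumes "universe TYPE('u)"
  shows
    "(\<exists>(T :: ('u q_obj, 'u q_arr) tensor) \<mu> \<epsilon>. extends_disjoint_union T \<mu> \<epsilon>) \<and>
     (\<forall>(T :: ('u q_obj, 'u q_arr) tensor) \<mu> \<epsilon>. extends_disjoint_union T \<mu> \<epsilon> \<longrightarrow>
        vectoid TYPE('u) Qc T \<and>
        cocomm_coalgebra Qc T (Xc \<mu> \<epsilon>) \<and>
        (\<forall>(A :: ('o, 'a) cat) S. vectoid TYPE('u) A S \<longrightarrow>
           is_equivalence (HomVect A S Qc T) (CocommCoalg A S) (coalg_eval A S Qc T (Xc \<mu> \<epsilon>))))"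
proof -
  interpret small_universe "TYPE('u)" using assms by unfold_locales
  show ?thesis
  proof (intro conjI allI impI)
    show "\<exists>(T :: ('u q_obj, 'u q_arr) tensor) \<mu> \<epsilon>. extends_disjoint_union T \<mu> \<epsilon>"
      by (intro exI) (rule extends_tensorQ)
  next
    fix T :: "('u q_obj, 'u q_arr) tensor" and \<mu> \<epsilon> assume T: "extends_disjoint_union T \<mu> \<epsilon>"
    then have "strong_sym_mon_functor (op NCat) (op_tensor NCat NTensor) Qc T yoneda \<mu> \<epsilon>" "tensor_cocontinuous TYPE('u) Qc T"
      by (simp_all add: extends_disjoint_union_def)
    then show "vectoid TYPE('u) Qc T"
      by (intro vectoid_Qc) (simp_all add: strong_sym_mon_functor_def)
    show "cocomm_coalgebra Qc T (Xc \<mu> \<epsilon>)" by (rule Xc_coalgebra[OF T])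
    fix A :: "('o, 'a) cat" and S assume "vectoid TYPE('u) A S"
    then interpret classifying "TYPE('u)" T \<mu> \<epsilon> A S using T by unfold_locales
    show "is_equivalence (HomVect A S Qc T) (CocommCoalg A S) (coalg_eval A S Qc T (Xc \<mu> \<epsilon>))" by (rule classifier)
  qed
qed

end
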